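(* Let $\ell\in\mathbb{C}$. For any restricted $\tau$-module $W$ of level $\ell$, there exists a $\tilde\sigma_0$-twisted $V_{\mathcal{L}}(\ell,0)$-module structure $Y_W$ on $W$ (with respect to the period $N_0$ of $\tilde\sigma_0$), which is uniquely determined by $$Y_W(a;x_0,\mathbf{x})=a^{\tau}(x_0,\mathbf{x})\quad\text{for } a\in\mathfrak{g},$$ and which satisfies the condition that $$Y_W(\tilde\sigma_i(v);x_0,\mathbf{x})=\lim_{x_i\to\omega_{N_i}^{-1}x_i}Y_W(v;x_0,\mathbf{x})\qquad\text{for } v\in V_{\mathcal{L}}(\ell,0),\ 1\le i\le r. \qquad ( * )$$ On the other hand, for any $\tilde\sigma_0$-twisted $V_{\mathcal{L}}(\ell,0)$-module $(W,Y_W)$ which satisfies $( * )$, $W$ is a restricted $\tau$-module of level $\ell$ with $$a^{\tau}(x_0,\mathbf{x})=Y_W(a;x_0,\mathbf{x})\quad\text{for } a\in\mathfrak{g}.$$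
   Context: Conventions. All vector spaces are over $\mathbb{C}$; $\mathbb{N}$ is the set of nonnegative integers; $r$ is a fixed positive integer. $\mathbf{x}=(x_1,\dots,x_r)$ (similarly $\mathbf{y},\mathbf{z}$) are commuting formal variables, $\mathbf{x}^{\mathbf{m}}=x_1^{m_1}\cdots x_r^{m_r}$ (and $\mathbf{t}^{\mathbf{m}}$ likewise) for $\mathbf{m}\in\mathbb{Z}^r$, and $\mathbf{z}\mathbf{y}=(z_1y_1,\dots,z_ry_r)$. $\delta(z)=\sum_{n\in\mathbb{Z}}z^n$, and $(x_0\pm y_0)^{\alpha}$ ($\alpha\in\mathbb{C}$) is expanded in nonnegative integer powers of $y_0$. $\omega_N=\exp(2\pi\sqrt{-1}/N)$. $\lim_{x_i\to\omega x_i}$ means substituting $\omega x_i$ for $x_i$. For a vector space $W$ and a positive integer $N$, $$\mathcal{E}(W,r;N)=\mathrm{Hom}\big(W,W[[x_1^{\pm1},\dots,x_r^{\pm1}]]((x_0^{1/N}))\big),\qquad \mathcal{E}(W,r)=\mathcal{E}(W,r;1).$$ Toroidal vertex algebra. An $(r+1)$-toroidal vertex algebra is a vector space $V$ with a linear map $Y(\cdot;x_0,\mathbf{x}):V\to\mathcal{E}(V,r)$, $v\mapsto Y(v;x_0,\mathbf{x})=\sum_{(m_0,\mathbf{m})\in\mathbb{Z}\times\mathbb{Z}^r}v_{m_0,\mathbf{m}}x_0^{-m_0-1}\mathbf{x}^{-\mathbf{m}}$, and a distinguished vector $\mathbf{1}\in V$, such that $Y(\mathbf{1};x_0,\mathbf{x})v=v$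 and $Y(v;x_0,\mathbf{x})\mathbf{1}\in V[[x_0,x_1^{\pm1},\dots,x_r^{\pm1}]]$ for $v\in V$, and for $u,v\in V$ $$z_0^{-1}\delta\Big(\frac{x_0-y_0}{z_0}\Big)Y(u;x_0,\mathbf{z}\mathbf{y})Y(v;y_0,\mathbf{y})-z_0^{-1}\delta\Big(\frac{y_0-x_0}{-z_0}\Big)Y(v;y_0,\mathbf{y})Y(u;x_0,\mathbf{z}\mathbf{y})=y_0^{-1}\delta\Big(\frac{x_0-z_0}{y_0}\Big)Y(Y(u;z_0,\mathbf{z})v;y_0,\mathbf{y}).$$ An automorphism of $V$ is a linear bijection $\sigma$ with $\sigma(\mathbf{1})=\mathbf{1}$ and $\sigma(Y(u;x_0,\mathbf{x})v)=Y(\sigma(u);x_0,\mathbf{x})\sigma(v)$; it has period $N$ if $\sigma^N=1$. Twisted module. For an automorphism $\sigma$ of $V$ with period $N$, a $\sigma$-twisted $V$-module is a vector space $W$ with a linear map $Y_W(\cdot;x_0,\mathbf{x}):V\to\mathcal{E}(W,r;N)$ such that $Y_W(\mathbf{1};x_0,\mathbf{x})=1_W$ and for $u,v\in V$ $$z_0^{-1}\delta\Big(\frac{x_0-y_0}{z_0}\Big)Y_W(u;x_0,\mathbf{z}\mathbf{y})Y_W(v;y_0,\mathbf{y})-z_0^{-1}\delta\Big(\frac{y_0-x_0}{-z_0}\Big)Y_W(v;y_0,\mathbf{y})Y_W(u;x_0,\mathbf{z}\mathbf{y})=\frac1N\sum_{j=0}^{N-1}y_0^{-1}\delta\Big(\omega_N^j\Big(\frac{x_0-z_0}{y_0}\Big)^{1/N}\Big)Y_W(Y(\sigma^ju;z_0,\mathbf{z})v;y_0,\mathbf{y}).$$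 Lie algebras. $\mathfrak{g}$ is a finite dimensional simple Lie algebra with Killing form $\langle\cdot,\cdot\rangle$ normalized so that $\langle\alpha,\alpha\rangle=2$ for long roots $\alpha$; $\sigma_0,\sigma_1,\dots,\sigma_r$ are mutually commuting automorphisms of $\mathfrak{g}$ of finite orders $N_0,N_1,\dots,N_r$. $\Lambda(\mathbf{N})=\mathbb{Z}N_1\times\cdots\times\mathbb{Z}N_r\subset\mathbb{Z}^r$. For $(m_0,\mathbf{m})\in\mathbb{Z}\times\mathbb{Z}^r$ put $\mathfrak{g}_{m_0,\mathbf{m}}=\{a\in\mathfrak{g}:\sigma_i(a)=\omega_{N_i}^{m_i}a,\ 0\le i\le r\}$ and $\mathfrak{g}_{\mathbf{m}}=\{a\in\mathfrak{g}:\sigma_i(a)=\omega_{N_i}^{m_i}a,\ 1\le i\le r\}$. For a positive integer $M$, $\widehat{L_{r+1}}(\mathfrak{g},M)=\mathfrak{g}\otimes\mathbb{C}[t_0^{\pm1/M},t_1^{\pm1},\dots,t_r^{\pm1}]\oplus\mathbb{C}\mathfrak{c}$ with $\mathfrak{c}$ central and $$[a\otimes t_0^{m}\mathbf{t}^{\mathbf{m}},b\otimes t_0^{n}\mathbf{t}^{\mathbf{n}}]=[a,b]\otimes t_0^{m+n}\mathbf{t}^{\mathbf{m}+\mathbf{n}}+m\langle a,b\rangle\delta_{m+n,0}\delta_{\mathbf{m}+\mathbf{n},0}\mathfrak{c}\quad(m,n\in\tfrac1M\mathbb{Z}).$$ $\tau$ is the subalgebra $\big(\bigoplus_{(m_0,\mathbf{m})\in\mathbb{Z}\times\mathbb{Z}^r}\mathfrak{g}_{m_0,\mathbf{m}}\otimes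 t_0^{m_0/N_0}\mathbf{t}^{\mathbf{m}}\big)\oplus\mathbb{C}\mathfrak{c}$ of $\widehat{L_{r+1}}(\mathfrak{g},N_0)$. $\mathcal{L}$ is the subalgebra $\big(\bigoplus_{\mathbf{m}\in\mathbb{Z}^r}\mathfrak{g}_{\mathbf{m}}\otimes\mathbf{t}^{\mathbf{m}}\mathbb{C}[t_0^{\pm1}]\big)\oplus\mathbb{C}\mathfrak{c}$ of $\widehat{L_{r+1}}(\mathfrak{g},1)$, and $\mathcal{L}^{\ge0}=\big(\bigoplus_{\mathbf{m}}\mathfrak{g}_{\mathbf{m}}\otimes\mathbf{t}^{\mathbf{m}}\mathbb{C}[t_0]\big)\oplus\mathbb{C}\mathfrak{c}$. For $a\in\mathfrak{g}_{k_0,\mathbf{k}}$ put $$a^{\tau}(x_0,\mathbf{x})=\sum_{m_0\in\mathbb{Z},\ \mathbf{m}\in\mathbf{k}+\Lambda(\mathbf{N})}\big(a\otimes t_0^{k_0/N_0+m_0}\mathbf{t}^{\mathbf{m}}\big)x_0^{-k_0/N_0-m_0-1}\mathbf{x}^{-\mathbf{m}},$$ extended linearly to $a\in\mathfrak{g}$. A $\tau$-module $W$ has level $\ell$ if $\mathfrak{c}$ acts as $\ell$, and is restricted if $a^{\tau}(x_0,\mathbf{x})\in\mathcal{E}(W,r;N_0)$ for all $a\in\mathfrak{g}$. For $a\in\mathfrak{g}_{\mathbf{k}}$ put $a^{\mathcal{L}}(x_0,\mathbf{x})=\sum_{m_0\in\mathbb{Z},\ \mathbf{m}\in\mathbf{k}+\Lambda(\mathbf{N})}(a\otimes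 t_0^{m_0}\mathbf{t}^{\mathbf{m}})x_0^{-m_0-1}\mathbf{x}^{-\mathbf{m}}$, extended linearly to $a\in\mathfrak{g}$. The algebra $V_{\mathcal{L}}(\ell,0)$. $(\mathfrak{g}\oplus\mathbb{C})_\ell$ is the $\mathcal{L}^{\ge0}$-module $\mathfrak{g}\oplus\mathbb{C}$ on which $\mathfrak{c}$ acts as $\ell$ and, for $a\in\mathfrak{g}_{\mathbf{k}}$, $b\in\mathfrak{g}$, $j\in\mathbb{N}$, $\mathbf{m}\in\mathbf{k}+\Lambda(\mathbf{N})$: $(a\otimes t_0^j\mathbf{t}^{\mathbf{m}})\cdot\mathbb{C}=0$, and $(a\otimes t_0^j\mathbf{t}^{\mathbf{m}})\cdot b$ equals $[a,b]$ if $j=0$, $\langle a,b\rangle\ell$ if $j=1$, $0$ if $j\ge2$. $V_{\mathcal{L}}(\ell,0)=U(\mathcal{L})\otimes_{U(\mathcal{L}^{\ge0})}(\mathfrak{g}\oplus\mathbb{C})_\ell$, $\mathbf{1}=1\otimes1$, and $\mathfrak{g}$ is identified with $1\otimes\mathfrak{g}$. $V_{\mathcal{L}}(\ell,0)$ is equipped with its unique $(r+1)$-toroidal vertex algebra structure with vacuum vector $\mathbf{1}$ and $Y(a;x_0,\mathbf{x})=a^{\mathcal{L}}(x_0,\mathbf{x})$ for $a\in\mathfrak{g}$. For $0\le i\le r$, $\tilde\sigma_i$ denotes the unique automorphism of the $(r+1)$-toroidal vertex algebra $V_{\mathcal{L}}(\ell,0)$ extending the automorphism $\sigma_i$ of $\mathfrak{g}$;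 it satisfies $\tilde\sigma_i^{N_i}=1$. *)

theory Defs
  imports "HOL-Analysis.Analysis" "HOL-Library.Poly_Mapping"
begin

text \<open>
  Vector spaces are types of class \<open>ab_group_add\<close> with an explicit complex scalar multiplication
  (library locale \<open>vector_space\<close>). The positive integer \<open>r\<close> is the cardinality of a finite index
  type, and multi-exponents in \<open>Z^r\<close> are elements of \<open>int ^ 'r\<close>.
\<close>

definition omega :: "nat \<Rightarrow> complex" where
  "omega N = exp (2 * of_real pi * \<i> / of_nat N)"


section \<open>Formal calculus\<close>

text \<open>
  A formal series with coefficients in the endomorphisms of \<open>W\<close>: \<open>F e p\<close> is the coefficient of
  \<open>x_0^(e/N) x^p\<close>. So the same type serves every \<open>N\<close>, which is fixed by the context, and the mode
  \<open>v_{n,m}\<close> of the usual notation (\<open>N = 1\<close>) is the coefficient with \<open>e = - n - 1\<close>, \<open>p = - m\<close>.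
\<close>

type_synonym ('r, 'w) fseries = "int \<Rightarrow> int ^ 'r \<Rightarrow> 'w \<Rightarrow> 'w"

text \<open>
  \<open>Hom(W, W[[x_1^{\<plusminus>1}, ..., x_r^{\<plusminus>1}]]((x_0^{1/N})))\<close>: the exponents of \<open>x_0\<close> are bounded below for
  each vector, uniformly in the exponent of \<open>x\<close>.
\<close>

definition E_space :: "(complex \<Rightarrow> 'w::ab_group_add \<Rightarrow> 'w) \<Rightarrow> ('r::finite, 'w) fseries set" where
  "E_space scl = {F. (\<forall>e p. Vector_Spaces.linear scl scl (F e p)) \<and>
                       (\<forall>w. \<exists>K. \<forall>e<K. \<forall>p. F e p w = 0)}"

definition id_series :: "('r::finite, 'w::ab_group_add) fseries" where
  "id_series e p w = (if e = 0 \<and> p = 0 then w else 0)"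

text \<open>The substitution \<open>x_i \<mapsto> c x_i\<close>.\<close>

definition subst_var ::
  "(complex \<Rightarrow> 'w::ab_group_add \<Rightarrow> 'w) \<Rightarrow> 'r::finite \<Rightarrow> complex \<Rightarrow> ('r, 'w) fseries \<Rightarrow> ('r, 'w) fseries" where
  "subst_var scl i c F = (\<lambda>e p w. scl (c powi (p $ i)) (F e p w))"

text \<open>
  The coefficient of \<open>x^(\<alpha> - i) y^i\<close> in the expansion of \<open>(x - y)^\<alpha>\<close> in nonnegative powers of \<open>y\<close>.
\<close>

definition binom_coeff :: "complex \<Rightarrow> nat \<Rightarrow> complex" where
  "binom_coeff \<alpha> i = (- 1) ^ i * (\<alpha> gchoose i)"

text \<open>
  The three terms of the Jacobi identity. Each of the following is the coefficient of
    \<open>z_0^(- n - 1) x_0^(b/N) y_0^(c/N) z^p y^q\<close>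
  of one term, applied to the vector \<open>w\<close>. All sums over \<open>i\<close> are finite because of the truncation
  condition in \<open>E_space\<close>.

  First term: \<open>z_0^(-1) \<delta>((x_0 - y_0)/z_0) A(x_0, zy) B(y_0, y)\<close>, where
    \<open>z_0^(-1) \<delta>((x_0 - y_0)/z_0) = \<Sum>_n z_0^(-n-1) (x_0 - y_0)^n\<close>.
\<close>

definition jacobi_left1 ::
  "nat \<Rightarrow> (complex \<Rightarrow> 'w::ab_group_add \<Rightarrow> 'w) \<Rightarrow> ('r::finite, 'w) fseries \<Rightarrow> ('r, 'w) fseries \<Rightarrow>
   int \<Rightarrow> int \<Rightarrow> int \<Rightarrow> int ^ 'r \<Rightarrow> int ^ 'r \<Rightarrow> 'w \<Rightarrow> 'w" where
  "jacobi_left1 N scl A B n b c p q w =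
     Sum_any (\<lambda>i::nat. scl (binom_coeff (of_int n) i)
       (A (b - int N * (n - int i)) p (B (c - int N * int i) (q - p) w)))"

text \<open>
  Second term: \<open>z_0^(-1) \<delta>((y_0 - x_0)/(-z_0)) B(y_0, y) A(x_0, zy)\<close>, where
    \<open>z_0^(-1) \<delta>((y_0 - x_0)/(-z_0)) = \<Sum>_n (-1)^n z_0^(-n-1) (y_0 - x_0)^n\<close>.
\<close>

definition jacobi_left2 ::
  "nat \<Rightarrow> (complex \<Rightarrow> 'w::ab_group_add \<Rightarrow> 'w) \<Rightarrow> ('r::finite, 'w) fseries \<Rightarrow> ('r, 'w) fseries \<Rightarrow>
   int \<Rightarrow> int \<Rightarrow> int \<Rightarrow> int ^ 'r \<Rightarrow> int ^ 'r \<Rightarrow> 'w \<Rightarrow> 'w" where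
  "jacobi_left2 N scl A B n b c p q w =
     Sum_any (\<lambda>i::nat. scl ((- 1) powi n * binom_coeff (of_int n) i)
       (B (c - int N * (n - int i)) (q - p) (A (b - int N * int i) p w)))"

text \<open>
  Right-hand side:
    \<open>1/N \<Sum>_{j<N} y_0^(-1) \<delta>(\<omega>_N^j ((x_0 - z_0)/y_0)^(1/N)) Y_W(Y(\<sigma>^j u; z_0, z) v; y_0, y)\<close>, where
    \<open>y_0^(-1) \<delta>(\<omega>_N^j ((x_0 - z_0)/y_0)^(1/N)) = \<Sum>_k \<omega>_N^(j k) (x_0 - z_0)^(k/N) y_0^(-k/N - 1)\<close>;
  the power \<open>x_0^(b/N) z_0^i\<close> comes from \<open>k = b + N i\<close>.
\<close>

definition jacobi_right ::
  "nat \<Rightarrow> (complex \<Rightarrow> 'w::ab_group_add \<Rightarrow> 'w) \<Rightarrow> ('v \<Rightarrow> 'v) \<Rightarrow> ('v \<Rightarrow> ('r::finite, 'v) fseries) \<Rightarrow>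
   ('v \<Rightarrow> ('r, 'w) fseries) \<Rightarrow> 'v \<Rightarrow> 'v \<Rightarrow>
   int \<Rightarrow> int \<Rightarrow> int \<Rightarrow> int ^ 'r \<Rightarrow> int ^ 'r \<Rightarrow> 'w \<Rightarrow> 'w" where
  "jacobi_right N scl \<sigma> Y YW u v n b c p q w =
     scl (1 / of_nat N) (\<Sum>j<N. Sum_any (\<lambda>i::nat.
       let k = b + int N * int i in
       scl (omega N powi (int j * k) * binom_coeff (of_int k / of_nat N) i)
         (YW (Y ((\<sigma> ^^ j) u) (- n - 1 - int i) p v) (c + k + int N) q w)))"

definition twisted_jacobi ::
  "nat \<Rightarrow> (complex \<Rightarrow> 'w::ab_group_add \<Rightarrow> 'w) \<Rightarrow> ('v \<Rightarrow> 'v) \<Rightarrow> ('v \<Rightarrow> ('r::finite, 'v) fseries) \<Rightarrow>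
   ('v \<Rightarrow> ('r, 'w) fseries) \<Rightarrow> bool" where
  "twisted_jacobi N scl \<sigma> Y YW \<longleftrightarrow>
     (\<forall>u v n b c p q w.
        jacobi_left1 N scl (YW u) (YW v) n b c p q w - jacobi_left2 N scl (YW u) (YW v) n b c p q w
        = jacobi_right N scl \<sigma> Y YW u v n b c p q w)"


section \<open>Toroidal vertex algebras and twisted modules\<close>

text \<open>For \<open>N = 1\<close> and \<open>\<sigma> = id\<close> the right-hand side is \<open>y_0^(-1) \<delta>((x_0 - z_0)/y_0) Y(Y(u; z_0, z) v; y_0, y)\<close>.\<close>

locale toroidal_vertex_algebra = vector_space scaleV
  for scaleV :: "complex \<Rightarrow> 'v::ab_group_add \<Rightarrow> 'v" +
  fixes Y :: "'v \<Rightarrow> ('r::finite, 'v) fseries" and vac :: 'v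
  assumes Y_linear: "\<And>e p w. Vector_Spaces.linear scaleV scaleV (\<lambda>v. Y v e p w)"
    and Y_E: "\<And>v. Y v \<in> E_space scaleV"
    and Y_vac: "Y vac = id_series"
    and Y_creation: "\<And>v e p. e < 0 \<Longrightarrow> Y v e p vac = 0"
    and Y_jacobi: "twisted_jacobi 1 scaleV id Y Y"

definition tva_automorphism ::
  "(complex \<Rightarrow> 'v::ab_group_add \<Rightarrow> 'v) \<Rightarrow> ('v \<Rightarrow> ('r::finite, 'v) fseries) \<Rightarrow> 'v \<Rightarrow> ('v \<Rightarrow> 'v) \<Rightarrow> bool" where
  "tva_automorphism scaleV Y vac \<sigma> \<longleftrightarrow>
     Vector_Spaces.linear scaleV scaleV \<sigma> \<and> bij \<sigma> \<and> \<sigma> vac = vac \<and>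
     (\<forall>u e p v. \<sigma> (Y u e p v) = Y (\<sigma> u) e p (\<sigma> v))"

locale twisted_tva_module = toroidal_vertex_algebra scaleV Y vac + W: vector_space scaleW
  for scaleV :: "complex \<Rightarrow> 'v::ab_group_add \<Rightarrow> 'v" and Y :: "'v \<Rightarrow> ('r::finite, 'v) fseries" and vac :: 'v
    and scaleW :: "complex \<Rightarrow> 'w::ab_group_add \<Rightarrow> 'w" +
  fixes \<sigma> :: "'v \<Rightarrow> 'v" and N :: nat and YW :: "'v \<Rightarrow> ('r, 'w) fseries"
  assumes automorphism: "tva_automorphism scaleV Y vac \<sigma>"
    and period: "N > 0" "\<sigma> ^^ N = id"
    and YW_linear: "\<And>e p w. Vector_Spaces.linear scaleV scaleW (\<lambda>v. YW v e p w)"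
    and YW_E: "\<And>v. YW v \<in> E_space scaleW"
    and YW_vac: "YW vac = id_series"
    and YW_jacobi: "twisted_jacobi N scaleW \<sigma> Y YW"


section \<open>Simple Lie algebras and the normalized Killing form\<close>

locale complex_lie_algebra = vector_space scl
  for scl :: "complex \<Rightarrow> 'g::ab_group_add \<Rightarrow> 'g" +
  fixes br :: "'g \<Rightarrow> 'g \<Rightarrow> 'g"
  assumes br_linear_left: "\<And>y. Vector_Spaces.linear scl scl (\<lambda>x. br x y)"
    and br_linear_right: "\<And>x. Vector_Spaces.linear scl scl (br x)"
    and br_alternating: "\<And>x. br x x = 0"
    and br_jacobi: "\<And>x y z. br x (br y z) + br y (br z x) + br z (br x y) = 0"

definition simple_fd_lie_algebra ::
  "(complex \<Rightarrow> 'g::ab_group_add \<Rightarrow> 'g) \<Rightarrow> ('g \<Rightarrow> 'g \<Rightarrow> 'g) \<Rightarrow> bool" where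
  "simple_fd_lie_algebra scl br \<longleftrightarrow>
     complex_lie_algebra scl br \<and>
     (\<exists>B. finite B \<and> module.span scl B = UNIV) \<and>
     (\<exists>x y. br x y \<noteq> 0) \<and>
     (\<forall>I. module.subspace scl I \<and> (\<forall>x. \<forall>y\<in>I. br x y \<in> I) \<longrightarrow> I = {0} \<or> I = UNIV)"

text \<open>The trace, computed in some basis of a finite dimensional space.\<close>

definition endo_trace :: "(complex \<Rightarrow> 'g::ab_group_add \<Rightarrow> 'g) \<Rightarrow> ('g \<Rightarrow> 'g) \<Rightarrow> complex" where
  "endo_trace scl f =
     (let B = (SOME B. \<not> module.dependent scl B \<and> module.span scl B = UNIV)
      in \<Sum>b\<in>B. module.representation scl B (f b) b)"

definition killing ::
  "(complex \<Rightarrow> 'g::ab_group_add \<Rightarrow> 'g) \<Rightarrow> ('g \<Rightarrow> 'g \<Rightarrow> 'g) \<Rightarrow> 'g \<Rightarrow> 'g \<Rightarrow> complex" where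
  "killing scl br x y = endo_trace scl (br x \<circ> br y)"

text \<open>A nilpotent self-normalizing subalgebra.\<close>

definition cartan_subalgebra ::
  "(complex \<Rightarrow> 'g::ab_group_add \<Rightarrow> 'g) \<Rightarrow> ('g \<Rightarrow> 'g \<Rightarrow> 'g) \<Rightarrow> 'g set \<Rightarrow> bool" where
  "cartan_subalgebra scl br H \<longleftrightarrow>
     module.subspace scl H \<and> (\<forall>x\<in>H. \<forall>y\<in>H. br x y \<in> H) \<and>
     (\<exists>n. \<forall>xs\<in>lists H. length xs = n \<longrightarrow> (\<forall>y\<in>H. foldr br xs y = 0)) \<and>
     {x. \<forall>h\<in>H. br x h \<in> H} \<subseteq> H"

text \<open>Only the values of \<open>\<alpha>\<close> on \<open>H\<close> matter; linearity of \<open>\<alpha>\<close> on \<open>H\<close> is automatic.\<close>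

definition is_root ::
  "(complex \<Rightarrow> 'g::ab_group_add \<Rightarrow> 'g) \<Rightarrow> ('g \<Rightarrow> 'g \<Rightarrow> 'g) \<Rightarrow> 'g set \<Rightarrow> ('g \<Rightarrow> complex) \<Rightarrow> bool" where
  "is_root scl br H \<alpha> \<longleftrightarrow>
     (\<exists>h\<in>H. \<alpha> h \<noteq> 0) \<and> (\<exists>x. x \<noteq> 0 \<and> (\<forall>h\<in>H. br h x = scl (\<alpha> h) x))"

text \<open>
  \<open>\<langle>\<alpha>, \<alpha>\<rangle> = B(t_\<alpha>, t_\<alpha>)\<close>, where \<open>t_\<alpha> \<in> H\<close> represents \<open>\<alpha>\<close> with respect to a form \<open>B\<close> that is
  nondegenerate on \<open>H\<close>.
\<close>

definition root_norm :: "('g \<Rightarrow> 'g \<Rightarrow> complex) \<Rightarrow> 'g set \<Rightarrow> ('g \<Rightarrow> complex) \<Rightarrow> complex" where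
  "root_norm B H \<alpha> = (let t = (THE t. t \<in> H \<and> (\<forall>h\<in>H. B t h = \<alpha> h)) in B t t)"

text \<open>Square lengths of roots with respect to the Killing form itself are positive real numbers.\<close>

definition is_long_root ::
  "(complex \<Rightarrow> 'g::ab_group_add \<Rightarrow> 'g) \<Rightarrow> ('g \<Rightarrow> 'g \<Rightarrow> 'g) \<Rightarrow> 'g set \<Rightarrow> ('g \<Rightarrow> complex) \<Rightarrow> bool" where
  "is_long_root scl br H \<alpha> \<longleftrightarrow>
     is_root scl br H \<alpha> \<and>
     (\<forall>\<beta>. is_root scl br H \<beta> \<longrightarrow>
        Re (root_norm (killing scl br) H \<beta>) \<le> Re (root_norm (killing scl br) H \<alpha>))"

definition normalized_killing_form ::
  "(complex \<Rightarrow> 'g::ab_group_add \<Rightarrow> 'g) \<Rightarrow> ('g \<Rightarrow> 'g \<Rightarrow> 'g) \<Rightarrow> ('g \<Rightarrow> 'g \<Rightarrow> complex) \<Rightarrow> bool" where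
  "normalized_killing_form scl br form \<longleftrightarrow>
     (\<exists>c. c \<noteq> 0 \<and> form = (\<lambda>x y. c * killing scl br x y)) \<and>
     (\<forall>H \<alpha>. cartan_subalgebra scl br H \<and> is_long_root scl br H \<alpha> \<longrightarrow> root_norm form H \<alpha> = 2)"

definition lie_automorphism ::
  "(complex \<Rightarrow> 'g::ab_group_add \<Rightarrow> 'g) \<Rightarrow> ('g \<Rightarrow> 'g \<Rightarrow> 'g) \<Rightarrow> ('g \<Rightarrow> 'g) \<Rightarrow> bool" where
  "lie_automorphism scl br \<sigma> \<longleftrightarrow>
     Vector_Spaces.linear scl scl \<sigma> \<and> bij \<sigma> \<and> (\<forall>x y. \<sigma> (br x y) = br (\<sigma> x) (\<sigma> y))"

definition has_order :: "('g \<Rightarrow> 'g) \<Rightarrow> nat \<Rightarrow> bool" where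
  "has_order \<sigma> N \<longleftrightarrow> N > 0 \<and> \<sigma> ^^ N = id \<and> (\<forall>k. 0 < k \<and> k < N \<longrightarrow> \<sigma> ^^ k \<noteq> id)"

definition toroidal_lie_data ::
  "(complex \<Rightarrow> 'g::ab_group_add \<Rightarrow> 'g) \<Rightarrow> ('g \<Rightarrow> 'g \<Rightarrow> 'g) \<Rightarrow> ('g \<Rightarrow> 'g \<Rightarrow> complex) \<Rightarrow>
   ('g \<Rightarrow> 'g) \<Rightarrow> nat \<Rightarrow> ('r::finite \<Rightarrow> 'g \<Rightarrow> 'g) \<Rightarrow> ('r \<Rightarrow> nat) \<Rightarrow> bool" where
  "toroidal_lie_data scl br form \<sigma>0 N0 \<sigma> N \<longleftrightarrow>
     simple_fd_lie_algebra scl br \<and> normalized_killing_form scl br form \<and>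
     lie_automorphism scl br \<sigma>0 \<and> has_order \<sigma>0 N0 \<and>
     (\<forall>i. lie_automorphism scl br (\<sigma> i) \<and> has_order (\<sigma> i) (N i)) \<and>
     (\<forall>i. \<sigma>0 \<circ> \<sigma> i = \<sigma> i \<circ> \<sigma>0) \<and> (\<forall>i j. \<sigma> i \<circ> \<sigma> j = \<sigma> j \<circ> \<sigma> i)"


section \<open>Toroidal Lie algebras\<close>

text \<open>
  \<open>g \<otimes> C[t_0^{\<plusminus>1/M}, t_1^{\<plusminus>1}, ..., t_r^{\<plusminus>1}] \<oplus> C c\<close>: the coefficient at \<open>(n, m)\<close> belongs to
  \<open>t_0^(n/M) t^m\<close>, and the second component is the coefficient of the central element \<open>c\<close>.
\<close>

type_synonym ('g, 'r) loop = "(int \<times> (int ^ 'r) \<Rightarrow>\<^sub>0 'g) \<times> complex"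

definition loop_scale ::
  "(complex \<Rightarrow> 'g::ab_group_add \<Rightarrow> 'g) \<Rightarrow> complex \<Rightarrow> ('g, 'r::finite) loop \<Rightarrow> ('g, 'r) loop" where
  "loop_scale scl c X = (Poly_Mapping.map (scl c) (fst X), c * snd X)"

definition loop_bracket ::
  "nat \<Rightarrow> ('g \<Rightarrow> 'g \<Rightarrow> 'g) \<Rightarrow> ('g \<Rightarrow> 'g \<Rightarrow> complex) \<Rightarrow>
   ('g::ab_group_add, 'r::finite) loop \<Rightarrow> ('g, 'r) loop \<Rightarrow> ('g, 'r) loop" where
  "loop_bracket M br form X Z =
     ((\<Sum>k\<in>Poly_Mapping.keys (fst X). \<Sum>l\<in>Poly_Mapping.keys (fst Z).
         Poly_Mapping.single (k + l) (br (Poly_Mapping.lookup (fst X) k) (Poly_Mapping.lookup (fst Z) l))),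
      (\<Sum>k\<in>Poly_Mapping.keys (fst X).
         of_int (fst k) / of_nat M * form (Poly_Mapping.lookup (fst X) k) (Poly_Mapping.lookup (fst Z) (- k))))"

definition loop_monom :: "'g::ab_group_add \<Rightarrow> int \<Rightarrow> int ^ 'r::finite \<Rightarrow> ('g, 'r) loop" where
  "loop_monom a n m = (Poly_Mapping.single (n, m) a, 0)"

definition eigen_L ::
  "(complex \<Rightarrow> 'g::ab_group_add \<Rightarrow> 'g) \<Rightarrow> ('r::finite \<Rightarrow> 'g \<Rightarrow> 'g) \<Rightarrow> ('r \<Rightarrow> nat) \<Rightarrow>
   int \<times> (int ^ 'r) \<Rightarrow> 'g set" where
  "eigen_L scl \<sigma> N k = {a. \<forall>i. \<sigma> i a = scl (omega (N i) powi (snd k $ i)) a}"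

definition eigen_tau ::
  "(complex \<Rightarrow> 'g::ab_group_add \<Rightarrow> 'g) \<Rightarrow> ('g \<Rightarrow> 'g) \<Rightarrow> nat \<Rightarrow> ('r::finite \<Rightarrow> 'g \<Rightarrow> 'g) \<Rightarrow> ('r \<Rightarrow> nat) \<Rightarrow>
   int \<times> (int ^ 'r) \<Rightarrow> 'g set" where
  "eigen_tau scl \<sigma>0 N0 \<sigma> N k = {a \<in> eigen_L scl \<sigma> N k. \<sigma>0 a = scl (omega N0 powi (fst k)) a}"

definition graded_loop :: "(int \<times> (int ^ 'r) \<Rightarrow> 'g set) \<Rightarrow> ('g::ab_group_add, 'r::finite) loop set" where
  "graded_loop E = {X. \<forall>k. Poly_Mapping.lookup (fst X) k \<in> E k}"

definition nonneg_part :: "('g::ab_group_add, 'r::finite) loop set \<Rightarrow> ('g, 'r) loop set" where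
  "nonneg_part L = {X \<in> L. \<forall>k\<in>Poly_Mapping.keys (fst X). 0 \<le> fst k}"

text \<open>
  The component of \<open>a\<close> in \<open>E k\<close> with respect to the eigenspace decomposition of \<open>g\<close>. Two families of
  eigenvalues that differ have different eigenspaces unless both eigenspaces are zero, so the
  condition \<open>E l \<noteq> E k\<close> singles out all the other summands.
\<close>

definition eigen_part ::
  "(complex \<Rightarrow> 'g::ab_group_add \<Rightarrow> 'g) \<Rightarrow> ('k \<Rightarrow> 'g set) \<Rightarrow> 'k \<Rightarrow> 'g \<Rightarrow> 'g" where
  "eigen_part scl E k a =
     (THE b. b \<in> E k \<and> a - b \<in> module.span scl (\<Union>l\<in>{l. E l \<noteq> E k}. E l))"

text \<open>
  The generating series, with \<open>E\<close> the eigenspaces for \<open>\<tau>\<close> (and \<open>M = N_0\<close>) or for \<open>L\<close> (and \<open>M = 1\<close>).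
  For \<open>a\<close> in a single eigenspace, it is the sum over all \<open>(n, m)\<close> in the residue class of the degree
  of \<open>a\<close> of \<open>(a \<otimes> t_0^(n/M) t^m) x_0^(-n/M - 1) x^(-m)\<close>, since \<open>eigen_part\<close> is \<open>a\<close> on that class and
  \<open>0\<close> elsewhere. The exponents \<open>e/M = -n/M - 1\<close> and \<open>p = -m\<close> give \<open>n = -e - M\<close> and \<open>m = -p\<close>.
\<close>

definition current_series ::
  "(complex \<Rightarrow> 'g::ab_group_add \<Rightarrow> 'g) \<Rightarrow> nat \<Rightarrow> (int \<times> (int ^ 'r::finite) \<Rightarrow> 'g set) \<Rightarrow>
   (('g, 'r) loop \<Rightarrow> 'w \<Rightarrow> 'w) \<Rightarrow> 'g \<Rightarrow> ('r, 'w) fseries" where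
  "current_series scl M E act a =
     (\<lambda>e p. act (loop_monom (eigen_part scl E (- e - int M, - p) a) (- e - int M) (- p)))"

text \<open>
  A module for a Lie subalgebra \<open>L\<close> of the type \<open>'l\<close>; only the values of \<open>act\<close> on \<open>L\<close> matter.
\<close>

definition lie_module ::
  "(complex \<Rightarrow> 'l::ab_group_add \<Rightarrow> 'l) \<Rightarrow> ('l \<Rightarrow> 'l \<Rightarrow> 'l) \<Rightarrow> 'l set \<Rightarrow>
   (complex \<Rightarrow> 'w::ab_group_add \<Rightarrow> 'w) \<Rightarrow> ('l \<Rightarrow> 'w \<Rightarrow> 'w) \<Rightarrow> bool" where
  "lie_module scaleL brL L scaleW act \<longleftrightarrow>
     vector_space scaleW \<and>
     (\<forall>x\<in>L. Vector_Spaces.linear scaleW scaleW (act x)) \<and>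
     (\<forall>x\<in>L. \<forall>y\<in>L. \<forall>w. act (x + y) w = act x w + act y w) \<and>
     (\<forall>c. \<forall>x\<in>L. \<forall>w. act (scaleL c x) w = scaleW c (act x w)) \<and>
     (\<forall>x\<in>L. \<forall>y\<in>L. \<forall>w. act (brL x y) w = act x (act y w) - act y (act x w))"

definition restricted_tau_module ::
  "(complex \<Rightarrow> 'g::ab_group_add \<Rightarrow> 'g) \<Rightarrow> ('g \<Rightarrow> 'g \<Rightarrow> 'g) \<Rightarrow> ('g \<Rightarrow> 'g \<Rightarrow> complex) \<Rightarrow>
   ('g \<Rightarrow> 'g) \<Rightarrow> nat \<Rightarrow> ('r::finite \<Rightarrow> 'g \<Rightarrow> 'g) \<Rightarrow> ('r \<Rightarrow> nat) \<Rightarrow> complex \<Rightarrow>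
   (complex \<Rightarrow> 'w::ab_group_add \<Rightarrow> 'w) \<Rightarrow> (('g, 'r) loop \<Rightarrow> 'w \<Rightarrow> 'w) \<Rightarrow> bool" where
  "restricted_tau_module scl br form \<sigma>0 N0 \<sigma> N level scaleW act \<longleftrightarrow>
     lie_module (loop_scale scl) (loop_bracket N0 br form) (graded_loop (eigen_tau scl \<sigma>0 N0 \<sigma> N))
       scaleW act \<and>
     (\<forall>w. act (0, 1) w = scaleW level w) \<and>
     (\<forall>a. current_series scl N0 (eigen_tau scl \<sigma>0 N0 \<sigma> N) act a \<in> E_space scaleW)"


section \<open>Induced modules and the space of the algebra $V_L(l,0)$\<close>

text \<open>
  \<open>U(L) \<otimes>_{U(P)} M\<close> as a quotient of the free vector space on pairs \<open>(u, m)\<close>, where the word \<open>u\<close> in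
  letters from \<open>L\<close> stands for the product of its letters: the first two families of relations turn
  words into the tensor algebra of \<open>L\<close>, the third one imposes \<open>x y - y x = [x, y]\<close>, and the others
  are those of the tensor product over \<open>U(P)\<close>.
\<close>

inductive_set induced_relations ::
  "(complex \<Rightarrow> 'l::ab_group_add \<Rightarrow> 'l) \<Rightarrow> ('l \<Rightarrow> 'l \<Rightarrow> 'l) \<Rightarrow> 'l set \<Rightarrow> 'l set \<Rightarrow>
   (complex \<Rightarrow> 'm::ab_group_add \<Rightarrow> 'm) \<Rightarrow> ('l \<Rightarrow> 'm \<Rightarrow> 'm) \<Rightarrow> ('l list \<times> 'm \<Rightarrow>\<^sub>0 complex) set"
  for scaleL brL L P scaleM actM where
  add_letter: "\<lbrakk>u \<in> lists L; v \<in> lists L; x \<in> L; y \<in> L\<rbrakk> \<Longrightarrow>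
     Poly_Mapping.single (u @ [x + y] @ v, m) 1 - Poly_Mapping.single (u @ [x] @ v, m) 1
       - Poly_Mapping.single (u @ [y] @ v, m) 1 \<in> induced_relations scaleL brL L P scaleM actM"
| scale_letter: "\<lbrakk>u \<in> lists L; v \<in> lists L; x \<in> L\<rbrakk> \<Longrightarrow>
     Poly_Mapping.single (u @ [scaleL c x] @ v, m) 1 - Poly_Mapping.single (u @ [x] @ v, m) c
       \<in> induced_relations scaleL brL L P scaleM actM"
| bracket: "\<lbrakk>u \<in> lists L; v \<in> lists L; x \<in> L; y \<in> L\<rbrakk> \<Longrightarrow>
     Poly_Mapping.single (u @ [x, y] @ v, m) 1 - Poly_Mapping.single (u @ [y, x] @ v, m) 1
       - Poly_Mapping.single (u @ [brL x y] @ v, m) 1 \<in> induced_relations scaleL brL L P scaleM actM"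
| add_right: "u \<in> lists L \<Longrightarrow>
     Poly_Mapping.single (u, m + m') 1 - Poly_Mapping.single (u, m) 1
       - Poly_Mapping.single (u, m') 1 \<in> induced_relations scaleL brL L P scaleM actM"
| scale_right: "u \<in> lists L \<Longrightarrow>
     Poly_Mapping.single (u, scaleM c m) 1 - Poly_Mapping.single (u, m) c
       \<in> induced_relations scaleL brL L P scaleM actM"
| balanced: "\<lbrakk>u \<in> lists L; v \<in> lists P\<rbrakk> \<Longrightarrow>
     Poly_Mapping.single (u @ v, m) 1 - Poly_Mapping.single (u, foldr actM v m) 1
       \<in> induced_relations scaleL brL L P scaleM actM"

text \<open>
  The vector space \<open>V\<close>, with \<open>tens u m\<close> in the role of \<open>u \<otimes> m\<close>, is the quotient of the free vector
  space on \<open>lists L \<times> UNIV\<close> by the span of the relations: the linear extension of \<open>tens\<close> is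
  surjective and its kernel is exactly that span. \<open>L\<close> acts by left multiplication.
\<close>

definition is_induced_module ::
  "(complex \<Rightarrow> 'l::ab_group_add \<Rightarrow> 'l) \<Rightarrow> ('l \<Rightarrow> 'l \<Rightarrow> 'l) \<Rightarrow> 'l set \<Rightarrow> 'l set \<Rightarrow>
   (complex \<Rightarrow> 'm::ab_group_add \<Rightarrow> 'm) \<Rightarrow> ('l \<Rightarrow> 'm \<Rightarrow> 'm) \<Rightarrow>
   (complex \<Rightarrow> 'v::ab_group_add \<Rightarrow> 'v) \<Rightarrow> ('l list \<Rightarrow> 'm \<Rightarrow> 'v) \<Rightarrow> ('l \<Rightarrow> 'v \<Rightarrow> 'v) \<Rightarrow> bool" where
  "is_induced_module scaleL brL L P scaleM actM scaleV tens actV \<longleftrightarrow>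
     vector_space scaleV \<and>
     (let Free = {f :: 'l list \<times> 'm \<Rightarrow>\<^sub>0 complex. Poly_Mapping.keys f \<subseteq> lists L \<times> UNIV};
          ext = (\<lambda>f. \<Sum>k\<in>Poly_Mapping.keys f. scaleV (Poly_Mapping.lookup f k) (tens (fst k) (snd k)))
      in ext ` Free = UNIV \<and>
         (\<forall>f\<in>Free. ext f = 0 \<longleftrightarrow>
            f \<in> module.span (\<lambda>c. Poly_Mapping.map ((*) c))
                  (induced_relations scaleL brL L P scaleM actM))) \<and>
     (\<forall>x\<in>L. Vector_Spaces.linear scaleV scaleV (actV x) \<and>
            (\<forall>u\<in>lists L. \<forall>m. actV x (tens u m) = tens (x # u) m))"

text \<open>
  The module \<open>(g \<oplus> C)_l\<close> of the nonnegative part: \<open>a \<otimes> t_0^j t^m\<close> maps \<open>(b, y)\<close> to \<open>([a, b], 0)\<close> if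
  \<open>j = 0\<close>, to \<open>(0, l \<langle>a, b\<rangle>)\<close> if \<open>j = 1\<close> and to \<open>0\<close> if \<open>j \<ge> 2\<close>; the central element acts as \<open>l\<close>.
\<close>

definition vac_scale ::
  "(complex \<Rightarrow> 'g::ab_group_add \<Rightarrow> 'g) \<Rightarrow> complex \<Rightarrow> 'g \<times> complex \<Rightarrow> 'g \<times> complex" where
  "vac_scale scl c b = (scl c (fst b), c * snd b)"

definition vac_act ::
  "(complex \<Rightarrow> 'g::ab_group_add \<Rightarrow> 'g) \<Rightarrow> ('g \<Rightarrow> 'g \<Rightarrow> 'g) \<Rightarrow> ('g \<Rightarrow> 'g \<Rightarrow> complex) \<Rightarrow> complex \<Rightarrow>
   ('g, 'r::finite) loop \<Rightarrow> 'g \<times> complex \<Rightarrow> 'g \<times> complex" where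
  "vac_act scl br form level X b =
     (let f = Poly_Mapping.lookup (fst X); K = Poly_Mapping.keys (fst X)
      in ((\<Sum>k\<in>{k \<in> K. fst k = 0}. br (f k) (fst b)) + scl (level * snd X) (fst b),
          (\<Sum>k\<in>{k \<in> K. fst k = 1}. form (f k) (fst b) * level) + level * snd X * snd b))"

definition is_V_L ::
  "(complex \<Rightarrow> 'g::ab_group_add \<Rightarrow> 'g) \<Rightarrow> ('g \<Rightarrow> 'g \<Rightarrow> 'g) \<Rightarrow> ('g \<Rightarrow> 'g \<Rightarrow> complex) \<Rightarrow>
   ('r::finite \<Rightarrow> 'g \<Rightarrow> 'g) \<Rightarrow> ('r \<Rightarrow> nat) \<Rightarrow> complex \<Rightarrow>
   (complex \<Rightarrow> 'v::ab_group_add \<Rightarrow> 'v) \<Rightarrow> (('g, 'r) loop list \<Rightarrow> 'g \<times> complex \<Rightarrow> 'v) \<Rightarrow>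
   (('g, 'r) loop \<Rightarrow> 'v \<Rightarrow> 'v) \<Rightarrow> bool" where
  "is_V_L scl br form \<sigma> N level scaleV tens actV \<longleftrightarrow>
     (let L = graded_loop (eigen_L scl \<sigma> N)
      in is_induced_module (loop_scale scl) (loop_bracket 1 br form) L (nonneg_part L)
           (vac_scale scl) (vac_act scl br form level) scaleV tens actV)"

definition V_vac :: "(('g, 'r) loop list \<Rightarrow> 'g::ab_group_add \<times> complex \<Rightarrow> 'v) \<Rightarrow> 'v" where
  "V_vac tens = tens [] (0, 1)"

definition V_gen :: "(('g, 'r) loop list \<Rightarrow> 'g::ab_group_add \<times> complex \<Rightarrow> 'v) \<Rightarrow> 'g \<Rightarrow> 'v" where
  "V_gen tens a = tens [] (a, 0)"

end

theory Submission
  imports Defs "HOL-Library.Function_Algebras"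
begin

text \<open>
  Write a field as \<open>\<Sum>_m A_m x^(-m/N-1)\<close>. If \<open>A\<close> has only modes in the class \<open>s\<close> modulo \<open>N\<close>, the Jacobi
  identity for \<open>A\<close> and \<open>B\<close> is a triangular system for the products \<open>C_n = A_n B\<close>: it determines them,
  and it can be solved exactly when \<open>A\<close> and \<open>B\<close> are mutually local. Hence every current \<open>a^\<tau>\<close> has
  products with all the fields on \<open>W\<close> that are local with the currents; by Dong's lemma these
  products are again local with the currents, and the commutator formula for them makes the space
  of such fields a module for \<open>L\<close> of level \<open>l\<close>. The universal property of the induced module
  \<open>V_L(l,0)\<close> sends \<open>V_L(l,0)\<close> into this space, which is \<open>Y_W\<close>. The Jacobi identity then holds for \<open>u \<in> g\<close> and all
  \<open>v\<close> by construction. If it holds for \<open>a\<close> and \<open>u\<close>, it holds for every \<open>a_k u\<close>, so it holds on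
  the algebra generated by \<open>g\<close>. Uniqueness and equivariance under the \<open>\<sigma>_i\<close> propagate from \<open>g\<close> in the same way, because
  products are determined by their factors. Conversely, equivariance and the Jacobi identity with the
  vacuum confine the modes of \<open>a \<in> g\<close> to the exponents of \<open>\<tau>\<close>, and the part of the Jacobi
  identity with \<open>z_0^(-1)\<close> is the bracket of \<open>\<tau>\<close>.
\<close>

text \<open>The torus variables are passive. Replacing \<open>x\<close> by \<open>zy\<close> puts
  the exponent \<open>p\<close> of the first factor into both \<open>z\<close> and \<open>y\<close>,
  so for fixed \<open>p\<close> and \<open>q\<close> the Jacobi identity relates two sequences of
  operators. The whole calculus is done for such sequences; the only trace of the torus is that
  every bound must hold for all its exponents at once. The average over the powers of the
  automorphism disappears on eigenvectors, where it selects a residue class of modes; only binomial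
  coefficients of \<open>s/N\<close> are left. Multiplication by \<open>x_0 - y_0\<close> acts on
  both sides through one difference recursion, which is why the equations with the single value
  \<open>m = s\<close> suffice. It is L, with integral powers of \<open>t_0\<close>, and not tau
  that acts on fields: \<open>a t_0^n t^m\<close> acts as the n-th product with the component of the
  current of torus exponent \<open>-m\<close>. The action that defines \<open>(g + C)_l\<close>
  coincides with the products of nonnegative index of a current with a current or with the identity,
  and this is what the universal property asks for.\<close>

section \<open>Finitely supported sums over one and two indices\<close>

abbreviation fsum :: "(nat \<Rightarrow> 'a::comm_monoid_add) \<Rightarrow> 'a" where
  "fsum \<equiv> Sum_any"

text \<open>\<open>Sum_any\<close> is 0 by convention when the support is infinite, so every
  rearrangement needs finiteness; an explicit bound is easier to carry through shifts than a finite
  support set.\<close>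

definition fin1 :: "(nat \<Rightarrow> 'a::zero) \<Rightarrow> bool" where
  "fin1 f \<longleftrightarrow> (\<exists>K. \<forall>i\<ge>K. f i = 0)"

text \<open>Support inside a square. Finiteness of each row and each column separately would not
  justify an exchange of the order of summation.\<close>

definition fin2 :: "(nat \<Rightarrow> nat \<Rightarrow> 'a::zero) \<Rightarrow> bool" where
  "fin2 h \<longleftrightarrow> (\<exists>K. \<forall>i j. K \<le> i \<or> K \<le> j \<longrightarrow> h i j = 0)"

lemma fsum_eq:
  fixes f :: "nat \<Rightarrow> 'a::comm_monoid_add"
  assumes "\<And>i. K \<le> i \<Longrightarrow> f i = 0"
  shows "fsum f = (\<Sum>i<K. f i)"
  by (rule Sum_any.expand_superset) (use assms linorder_not_le in auto)

lemma fin1I: "(\<And>i. K \<le> i \<Longrightarrow> f i = 0) \<Longrightarrow> fin1 f"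
  unfolding fin1_def by blast

lemma fin1_finite: "fin1 f \<Longrightarrow> finite {i. f i \<noteq> 0}"
  unfolding fin1_def by (metis (mono_tags, lifting) finite_nat_set_iff_bounded_le linorder_le_cases mem_Collect_eq)

lemma fin1_0: "fin1 (\<lambda>i. 0)"
  by (simp add: fin1_def)

lemma fin1_add:
  fixes f g :: "nat \<Rightarrow> 'a::monoid_add"
  assumes "fin1 f" "fin1 g" shows "fin1 (\<lambda>i. f i + g i)"
proof -
  from assms obtain K L where "\<forall>i\<ge>K. f i = 0" "\<forall>i\<ge>L. g i = 0" unfolding fin1_def by blast
  then show ?thesis by (intro fin1I[of "max K L"]) auto
qed

lemma fin1_diff:
  fixes f g :: "nat \<Rightarrow> 'a::group_add"
  assumes "fin1 f" "fin1 g" shows "fin1 (\<lambda>i. f i - g i)"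
proof -
  from assms obtain K L where "\<forall>i\<ge>K. f i = 0" "\<forall>i\<ge>L. g i = 0" unfolding fin1_def by blast
  then show ?thesis by (intro fin1I[of "max K L"]) auto
qed

lemma fin1_map: "fin1 f \<Longrightarrow> (\<And>i. T i 0 = 0) \<Longrightarrow> fin1 (\<lambda>i. T i (f i))"
  unfolding fin1_def by metis

lemma fin1_shift: "fin1 f \<Longrightarrow> fin1 (\<lambda>i. f (i + k))"
  unfolding fin1_def by (metis trans_le_add1)

lemma fsum_add:
  fixes f g :: "nat \<Rightarrow> 'a::comm_monoid_add"
  assumes "fin1 f" "fin1 g" shows "fsum (\<lambda>i. f i + g i) = fsum f + fsum g"
  by (rule Sum_any.distrib) (use assms fin1_finite in auto)

lemma fsum_hom:
  fixes f :: "nat \<Rightarrow> 'a::comm_monoid_add" and T :: "'a \<Rightarrow> 'b::comm_monoid_add"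
  assumes "fin1 f" "\<And>x y. T (x + y) = T x + T y" "T 0 = 0"
  shows "T (fsum f) = fsum (\<lambda>i. T (f i))"
proof -
  from assms(1) obtain K where K: "\<forall>i\<ge>K. f i = 0" unfolding fin1_def by blast
  have "T (sum f A) = (\<Sum>i\<in>A. T (f i))" if "finite A" for A
    using that by (induction A) (simp_all add: assms)
  then show ?thesis using K by (simp add: fsum_eq[of K] assms)
qed

lemma fsum_uminus:
  fixes f :: "nat \<Rightarrow> 'a::ab_group_add"
  shows "fin1 f \<Longrightarrow> fsum (\<lambda>i. - f i) = - fsum f"
  by (rule fsum_hom[symmetric]) auto

lemma fsum_diff:
  fixes f g :: "nat \<Rightarrow> 'a::ab_group_add"
  assumes "fin1 f" "fin1 g" shows "fsum (\<lambda>i. f i - g i) = fsum f - fsum g"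
proof -
  have "fin1 (\<lambda>i. - g i)" using assms(2) by (rule fin1_map) simp
  from fsum_add[OF assms(1) this] show ?thesis using assms(2) by (simp add: fsum_uminus)
qed

lemma fsum_zero: "(\<And>i. f i = 0) \<Longrightarrow> fsum f = 0"
  by (simp add: fsum_eq[of 0])

lemma fsum_single:
  fixes f :: "nat \<Rightarrow> 'a::comm_monoid_add"
  assumes "\<And>i. i \<noteq> k \<Longrightarrow> f i = 0" shows "fsum f = f k"
proof -
  have "fsum f = (\<Sum>i<Suc k. f i)" by (rule fsum_eq) (use assms in auto)
  also have "\<dots> = f k" using assms by simp
  finally show ?thesis .
qed

lemma fsum_Suc:
  fixes f :: "nat \<Rightarrow> 'a::comm_monoid_add"
  assumes "fin1 f" shows "fsum f = f 0 + fsum (\<lambda>i. f (Suc i))"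
proof -
  from assms obtain K where K: "\<forall>i\<ge>K. f i = 0" unfolding fin1_def by blast
  have "fsum f = (\<Sum>i<Suc K. f i)" by (rule fsum_eq) (use K in auto)
  moreover have "fsum (\<lambda>i. f (Suc i)) = (\<Sum>i<K. f (Suc i))" by (rule fsum_eq) (use K in auto)
  ultimately show ?thesis by (simp only: sum.lessThan_Suc_shift)
qed

text \<open>Only the \<open>j\<close> below \<open>J\<close> matter, and their finitely many bounds
  have a common one; the sum of the bounds dominates each of them.\<close>

lemma fin2I1:
  assumes J: "\<And>i j. J \<le> j \<Longrightarrow> h i j = 0" and I: "\<And>j. fin1 (\<lambda>i. h i j)"
  shows "fin2 h"
proof -
  obtain f where f: "\<And>j i. f j \<le> i \<Longrightarrow> h i j = 0" using I unfolding fin1_def by metis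
  let ?K = "J + (\<Sum>j<J. f j)"
  have "h i j = 0" if "?K \<le> i \<or> ?K \<le> j" for i j
  proof (cases "j < J")
    case True
    then have "f j \<le> (\<Sum>j<J. f j)" by (intro member_le_sum) auto
    then show ?thesis using that True f[of j i] by auto
  qed (use J in auto)
  then show ?thesis unfolding fin2_def by blast
qed

lemma fin2_swap: "fin2 h \<Longrightarrow> fin2 (\<lambda>i j. h j i)"
  unfolding fin2_def by meson

lemma fin2I2:
  assumes "\<And>i j. I \<le> i \<Longrightarrow> h i j = 0" "\<And>i. fin1 (\<lambda>j. h i j)"
  shows "fin2 h"
  by (rule fin2_swap, rule fin2I1[of I]) (use assms in auto)

lemma fin2_diagI: "(\<And>i j. K \<le> i + j \<Longrightarrow> h i j = 0) \<Longrightarrow> fin2 h"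
  unfolding fin2_def by (meson le_add1 le_add2 le_trans)

lemma fin2_inner: "fin2 h \<Longrightarrow> fin1 (h i)"
  unfolding fin2_def fin1_def by blast

lemma fin2_inner': "fin2 h \<Longrightarrow> fin1 (\<lambda>i. h i j)"
  unfolding fin2_def fin1_def by blast

lemma fin2_map: "fin2 h \<Longrightarrow> (\<And>i j. T i j 0 = 0) \<Longrightarrow> fin2 (\<lambda>i j. T i j (h i j))"
  unfolding fin2_def by metis

lemma fin2_outer:
  fixes h :: "nat \<Rightarrow> nat \<Rightarrow> 'a::comm_monoid_add"
  shows "fin2 h \<Longrightarrow> fin1 (\<lambda>i. fsum (h i))"
  unfolding fin2_def fin1_def by (metis fsum_zero)

lemma fsum2_eq:
  fixes h :: "nat \<Rightarrow> nat \<Rightarrow> 'a::comm_monoid_add"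
  assumes "\<And>i j. K \<le> i \<or> K \<le> j \<Longrightarrow> h i j = 0"
  shows "fsum (\<lambda>i. fsum (h i)) = (\<Sum>i<K. \<Sum>j<K. h i j)"
proof -
  have "fsum (h i) = (\<Sum>j<K. h i j)" for i by (rule fsum_eq) (use assms in auto)
  moreover have "fsum (\<lambda>i. fsum (h i)) = (\<Sum>i<K. fsum (h i))"
    by (rule fsum_eq, rule fsum_zero) (use assms in auto)
  ultimately show ?thesis by simp
qed

lemma fsum_swap:
  fixes h :: "nat \<Rightarrow> nat \<Rightarrow> 'a::comm_monoid_add"
  assumes "fin2 h"
  shows "fsum (\<lambda>i. fsum (\<lambda>j. h i j)) = fsum (\<lambda>j. fsum (\<lambda>i. h i j))"
proof -
  from assms obtain K where K: "\<And>i j. K \<le> i \<or> K \<le> j \<Longrightarrow> h i j = 0" unfolding fin2_def by blast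
  show ?thesis
    by (subst fsum2_eq[of K], use K in auto, subst fsum2_eq[of K], use K in auto) (rule sum.swap)
qed

lemma fsum2_add:
  fixes h k :: "nat \<Rightarrow> nat \<Rightarrow> 'a::comm_monoid_add"
  assumes "fin2 h" "fin2 k"
  shows "fsum (\<lambda>i. fsum (\<lambda>j. h i j + k i j)) = fsum (\<lambda>i. fsum (h i)) + fsum (\<lambda>i. fsum (k i))"
  by (simp add: fsum_add assms fin2_inner fin2_outer)

lemma fsum2_diff:
  fixes h k :: "nat \<Rightarrow> nat \<Rightarrow> 'a::ab_group_add"
  assumes "fin2 h" "fin2 k"
  shows "fsum (\<lambda>i. fsum (\<lambda>j. h i j - k i j)) = fsum (\<lambda>i. fsum (h i)) - fsum (\<lambda>i. fsum (k i))"
  by (simp add: fsum_diff assms fin2_inner fin2_outer)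

lemma fin2_add:
  fixes h k :: "nat \<Rightarrow> nat \<Rightarrow> 'a::comm_monoid_add"
  assumes "fin2 h" "fin2 k" shows "fin2 (\<lambda>i j. h i j + k i j)"
proof -
  from assms obtain K L where "\<forall>i j. K \<le> i \<or> K \<le> j \<longrightarrow> h i j = 0" "\<forall>i j. L \<le> i \<or> L \<le> j \<longrightarrow> k i j = 0"
    unfolding fin2_def by blast
  then show ?thesis unfolding fin2_def by (intro exI[of _ "max K L"]) auto
qed

lemma fin2_diff:
  fixes h k :: "nat \<Rightarrow> nat \<Rightarrow> 'a::ab_group_add"
  assumes "fin2 h" "fin2 k" shows "fin2 (\<lambda>i j. h i j - k i j)"
  using fin2_add[OF assms(1) fin2_map[OF assms(2), of "\<lambda>i j x. - x"]] by simp

lemma fsum_diag: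
  fixes h :: "nat \<Rightarrow> nat \<Rightarrow> 'a::comm_monoid_add"
  assumes "fin2 h"
  shows "fsum (\<lambda>i. fsum (\<lambda>j. h i j)) = fsum (\<lambda>s. \<Sum>i\<le>s. h i (s - i))"
proof -
  from assms obtain K where K: "\<And>i j. K \<le> i \<or> K \<le> j \<Longrightarrow> h i j = 0" unfolding fin2_def by blast
  have "fsum (\<lambda>i. fsum (\<lambda>j. h i j)) = (\<Sum>(i,j)\<in>{..<K}\<times>{..<K}. h i j)"
    by (subst fsum2_eq[of K], use K in auto) (simp add: sum.cartesian_product)
  \<comment> \<open>The triangle of side \<open>2 * K\<close> contains the square of side
    \<open>K\<close> that carries the support.\<close>
  also have "\<dots> = (\<Sum>(i,j)\<in>{(i,j). i + j < 2 * K}. h i j)"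
  proof (rule sum.mono_neutral_cong_left)
    show "finite {(i, j). i + j < 2 * K}"
      by (rule finite_subset[of _ "{..<2*K} \<times> {..<2*K}"]) auto
  qed (use K linorder_not_le in \<open>auto\<close>)
  also have "\<dots> = (\<Sum>s<2*K. \<Sum>i\<le>s. h i (s - i))"
    by (rule sum.triangle_reindex)
  also have "\<dots> = fsum (\<lambda>s. \<Sum>i\<le>s. h i (s - i))"
  proof (rule fsum_eq[symmetric], rule sum.neutral, rule ballI)
    fix s i assume "2 * K \<le> s" "i \<in> {..s}"
    then show "h i (s - i) = 0" by (intro K) auto
  qed
  finally show ?thesis .
qed

text \<open>The form used for convolutions: the vector depends on \<open>i + j\<close> only, so the
  scalars along an antidiagonal can be added up.\<close>

lemma fsum_diag':
  fixes g :: "nat \<Rightarrow> 'a::comm_monoid_add"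
  assumes "fin1 g" "\<And>i j. h i j 0 = 0"
  shows "fsum (\<lambda>i. fsum (\<lambda>j. h i j (g (i + j)))) = fsum (\<lambda>s. \<Sum>i\<le>s. h i (s - i) (g s))"
proof -
  from assms(1) obtain K where K: "\<forall>i\<ge>K. g i = 0" unfolding fin1_def by blast
  have "fin2 (\<lambda>i j. h i j (g (i + j)))"
    by (rule fin2_diagI[of K]) (simp add: K assms)
  from fsum_diag[OF this] show ?thesis by simp
qed

lemma fin1_diag:
  fixes h :: "nat \<Rightarrow> nat \<Rightarrow> 'a::comm_monoid_add"
  assumes "fin2 h" shows "fin1 (\<lambda>s. \<Sum>i\<le>s. h i (s - i))"
proof -
  from assms obtain K where K: "\<And>i j. K \<le> i \<or> K \<le> j \<Longrightarrow> h i j = 0" unfolding fin2_def by blast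
  show ?thesis
  proof (rule fin1I[of "2*K"], rule sum.neutral, rule ballI)
    fix s i assume "2 * K \<le> s" "i \<in> {..s}"
    then show "h i (s - i) = 0" by (intro K) auto
  qed
qed

section \<open>Binomial coefficients and signs of the expansions\<close>

lemma gbinomial_trinomial:
  "((a::complex) gchoose (i + j)) * of_nat ((i + j) choose i) = (a gchoose i) * (a - of_nat i gchoose j)"
  using gbinomial_trinomial_revision[of i "i + j" a] by (simp add: binomial_gbinomial)

lemma gbinomial_trinomial':
  "(a gchoose i) * (a - of_nat i gchoose j) = (a gchoose j) * ((a::complex) - of_nat j gchoose i)"
proof -
  have "of_nat ((i + j) choose i) = (of_nat ((j + i) choose j) :: complex)"
    using binomial_symmetric[of i "i + j"] by (simp add: add.commute)
  then show ?thesis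
    by (metis gbinomial_trinomial add.commute)
qed

lemma gbinomial_vandermonde_complex:
  "(\<Sum>i\<le>n. (a gchoose i) * (b gchoose (n - i))) = ((a::complex) + b) gchoose n"
  using gbinomial_Vandermonde[of a b n] by (simp add: atLeast0AtMost)

abbreviation be :: "int \<Rightarrow> nat \<Rightarrow> complex" where
  "be n i \<equiv> binom_coeff (of_int n) i"

lemma minus_one_split: "i \<le> s \<Longrightarrow> (-1::complex) ^ i * (-1) ^ (s - i) = (-1) ^ s"
  by (simp flip: power_add)

text \<open>Coefficients of \<open>(x - y)^n (x - y)^m = (x - y)^(n + m)\<close>.\<close>

lemma be_vandermonde: "(\<Sum>i\<le>s. be n i * be m (s - i)) = be (n + m) s"
proof -
  have "be n i * be m (s - i) = (-1)^s * ((of_int n gchoose i) * (of_int m gchoose (s - i)))" if "i \<le> s" for i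
    using minus_one_split[OF that] by (simp add: binom_coeff_def mult_ac)
  then have "(\<Sum>i\<le>s. be n i * be m (s - i)) = (\<Sum>i\<le>s. (-1)^s * ((of_int n gchoose i) * (of_int m gchoose (s - i))))"
    by (intro sum.cong) auto
  also have "\<dots> = be (n + m) s"
    by (simp add: binom_coeff_def gbinomial_vandermonde_complex flip: sum_distrib_left)
  finally show ?thesis .
qed

lemma be_trinomial: "be k i * be (k - int i) j = be k (i + j) * of_nat ((i + j) choose i)"
  using gbinomial_trinomial[of "of_int k" i j] by (simp add: binom_coeff_def power_add mult_ac)

lemma be_trinomial': "be k i * be (k - int i) j = be k j * be (k - int j) i"
  using gbinomial_trinomial'[of "of_int k" i j] by (simp add: binom_coeff_def mult_ac)

lemma be_0 [simp]: "be n 0 = 1" by (simp add: binom_coeff_def)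

lemma be_nat: "be (int n) i = (-1) ^ i * of_nat (n choose i)"
  by (simp add: binom_coeff_def binomial_gbinomial)

lemma be_zero: "binom_coeff 0 i = (if i = 0 then 1 else 0)"
  by (cases i) (simp_all add: binom_coeff_def)

lemma be_Suc: "be (n + 1) (Suc i) = be n (Suc i) - be n i"
  using gbinomial_Suc_Suc[of "of_int n :: complex" i] by (simp add: binom_coeff_def algebra_simps)

lemma be_absorb: "of_nat (Suc i) * be n (Suc i) = - of_int n * be (n - 1) i"
  using gbinomial_absorption[of i "of_int n"] by (simp add: binom_coeff_def mult_ac)

lemma be_absorb': "(of_int n - of_nat i) * be n i = of_int n * be (n - 1) i"
  using gbinomial_absorb_comp[of "of_int n" i] by (simp add: binom_coeff_def mult_ac)

text \<open>The sign \<open>(-1)^n\<close> for integral \<open>n\<close>, in a form that simplifies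
  without inverse powers.\<close>

definition sg :: "int \<Rightarrow> complex" where
  "sg n = (if even n then 1 else - 1)"

lemma sg_add: "sg (n + m) = sg n * sg m"
  by (simp add: sg_def)

lemma sg_0 [simp]: "sg 0 = 1" by (simp add: sg_def)

lemma sg_sq [simp]: "sg n * sg n = 1" "sg n * (sg n * x) = x"
  by (simp_all add: sg_def)

lemma sg_Suc: "sg (n + 1) = - sg n" "sg (1 + n) = - sg n"
  by (simp_all add: sg_def)

lemma sg_minus_nat: "sg (n - int i) = sg n * (-1) ^ i"
  by (simp add: sg_def uminus_power_if)

lemma powi_minus_one: "(-1) powi n = sg n"
  by (cases n rule: int_cases2) (simp_all add: sg_def uminus_power_if power_int_minus)

text \<open>Products vanish for large index, so systems that are triangular in the index are solved
  from above; this is the matching induction.\<close>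

lemma int_descend:
  fixes n K :: int
  assumes "\<And>n. K \<le> n \<Longrightarrow> Q n" "\<And>n. (\<And>k. n < k \<Longrightarrow> Q k) \<Longrightarrow> Q n"
  shows "Q n"
proof (induction "nat (K - n)" arbitrary: n rule: less_induct)
  case less
  show ?case
  proof (cases "K \<le> n")
    case False
    have "Q k" if "n < k" for k using less[of k] that False by simp
    then show ?thesis by (rule assms(2))
  qed (rule assms(1))
qed

section \<open>Linear operators and fields in a single variable\<close>

locale mode_calculus = vector_space scl
  for scl :: "complex \<Rightarrow> 'w::ab_group_add \<Rightarrow> 'w" (infixr \<open>\<odot>\<close> 75) +
  fixes N :: nat
  assumes N_pos: "N > 0"
begin

abbreviation lin :: "('w \<Rightarrow> 'w) \<Rightarrow> bool" where
  "lin \<equiv> Vector_Spaces.linear scl scl"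

lemma linI: "(\<And>x y. T (x + y) = T x + T y) \<Longrightarrow> (\<And>c x. T (c \<odot> x) = c \<odot> T x) \<Longrightarrow> lin T"
  by (simp add: Vector_Spaces.linear_def module_hom_def module_hom_axioms_def vector_space_axioms module_axioms)

lemma lin_add: "lin T \<Longrightarrow> T (x + y) = T x + T y"
  by (simp add: Vector_Spaces.linear_def module_hom_def module_hom_axioms_def)

lemma lin_scale: "lin T \<Longrightarrow> T (c \<odot> x) = c \<odot> T x"
  by (simp add: Vector_Spaces.linear_def module_hom_def module_hom_axioms_def)

lemma lin_0: "lin T \<Longrightarrow> T 0 = 0"
  using lin_scale[of T 0 0] by simp

lemma lin_diff: "lin T \<Longrightarrow> T (x - y) = T x - T y"
  using lin_add[of T "x - y" y] by (simp add: algebra_simps)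

lemma lin_fsum: "lin T \<Longrightarrow> fin1 f \<Longrightarrow> T (fsum f) = fsum (\<lambda>i. T (f i))"
  by (rule fsum_hom) (auto simp: lin_add lin_0)

lemma lin_sum: "lin T \<Longrightarrow> T (sum f A) = (\<Sum>i\<in>A. T (f i))"
  by (induction A rule: infinite_finite_induct) (auto simp: lin_add lin_0)

lemma scl_fsum: "fin1 f \<Longrightarrow> c \<odot> fsum f = fsum (\<lambda>i. c \<odot> f i)"
  by (rule fsum_hom) (auto simp: scale_right_distrib)

lemma fin1_scl: "fin1 f \<Longrightarrow> fin1 (\<lambda>i. c i \<odot> f i)"
  by (erule fin1_map) simp

lemma fin1_lin: "fin1 f \<Longrightarrow> (\<And>i. lin (T i)) \<Longrightarrow> fin1 (\<lambda>i. T i (f i))"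
  by (erule fin1_map) (simp add: lin_0)

lemma fsum_lin:
  assumes "\<And>i. lin (T i)" "\<And>w. fin1 (\<lambda>i. T i w)"
  shows "lin (\<lambda>w. fsum (\<lambda>i. T i w))"
  by (rule linI) (simp_all add: lin_add lin_scale assms fsum_add scl_fsum)

lemma lin_comp: "lin S \<Longrightarrow> lin T \<Longrightarrow> lin (\<lambda>w. S (T w))"
  by (rule linI) (simp_all add: lin_add lin_scale)

lemma lin_scl: "lin T \<Longrightarrow> lin (\<lambda>w. c \<odot> T w)"
  by (rule linI) (simp_all add: lin_add lin_scale scale_right_distrib mult.commute)

lemma lin_minus: "lin S \<Longrightarrow> lin T \<Longrightarrow> lin (\<lambda>w. S w - T w)"
  by (rule linI) (simp_all add: lin_add lin_scale scale_right_diff_distrib)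

lemma lin_plus: "lin S \<Longrightarrow> lin T \<Longrightarrow> lin (\<lambda>w. S w + T w)"
  by (rule linI) (simp_all add: lin_add lin_scale scale_right_distrib)

lemma lin_zero: "lin (\<lambda>w. 0)"
  by (rule linI) simp_all

subsection \<open>Truncated fields\<close>

text \<open>\<open>A m\<close> is the coefficient of \<open>x^(-m/N - 1)\<close>, hence the lower
  bound on the exponents becomes vanishing for large \<open>m\<close>.\<close>

definition fieldp :: "(int \<Rightarrow> 'w \<Rightarrow> 'w) \<Rightarrow> bool" where
  "fieldp A \<longleftrightarrow> (\<forall>m. lin (A m)) \<and> (\<forall>w. \<exists>K. \<forall>m\<ge>K. A m w = 0)"

lemma field_lin: "fieldp A \<Longrightarrow> lin (A m)"
  by (simp add: fieldp_def)

lemma fin1_arith: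
  assumes "\<forall>m\<ge>K. f m = (0::'a::zero)"
  shows "fin1 (\<lambda>i. f (l + int N * int i))"
proof (rule fin1I[of "nat (K - l)"])
  fix i assume "nat (K - l) \<le> i"
  then have "K \<le> l + int i" by linarith
  also have "\<dots> \<le> l + int N * int i" using N_pos by (simp add: mult_le_cancel_right1)
  finally show "f (l + int N * int i) = 0" using assms by blast
qed

lemma field_fin: "fieldp A \<Longrightarrow> fin1 (\<lambda>i. A (l + int N * int i) w)"
  unfolding fieldp_def using fin1_arith[of _ "\<lambda>m. A m w"] by blast

lemma fieldI: "(\<And>m. lin (A m)) \<Longrightarrow> (\<And>w. \<exists>K. \<forall>m\<ge>K. A m w = 0) \<Longrightarrow> fieldp A"
  by (simp add: fieldp_def)

lemma field_trunc: "fieldp A \<Longrightarrow> \<exists>K. \<forall>m\<ge>K. A m w = 0"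
  by (simp add: fieldp_def)

lemma field_plus:
  assumes "fieldp A" "fieldp B" shows "fieldp (\<lambda>m w. A m w + B m w)"
proof (rule fieldI)
  fix w
  obtain K L where "\<forall>m\<ge>K. A m w = 0" "\<forall>m\<ge>L. B m w = 0"
    using assms[THEN field_trunc] by meson
  then show "\<exists>K. \<forall>m\<ge>K. A m w + B m w = 0" by (intro exI[of _ "max K L"]) auto
qed (use assms in \<open>auto intro: lin_plus field_lin\<close>)

lemma field_scl:
  assumes "fieldp A" shows "fieldp (\<lambda>m w. c \<odot> A m w)"
proof (rule fieldI)
  fix w
  obtain K where "\<forall>m\<ge>K. A m w = 0" using field_trunc[OF assms] by meson
  then show "\<exists>K. \<forall>m\<ge>K. c \<odot> A m w = 0" by (intro exI[of _ K]) auto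
qed (use assms in \<open>auto intro: lin_scl field_lin\<close>)

lemma field_minus: "fieldp A \<Longrightarrow> fieldp B \<Longrightarrow> fieldp (\<lambda>m w. A m w - B m w)"
  using field_plus[OF _ field_scl[of B "-1"], of A] by simp

lemma field_zero: "fieldp (\<lambda>m w. 0)"
  unfolding fieldp_def by (auto intro: lin_zero)

lemma field_shift:
  assumes "fieldp A" shows "fieldp (\<lambda>m. A (m + k))"
proof (rule fieldI)
  fix w
  obtain K where "\<forall>m\<ge>K. A m w = 0" using field_trunc[OF assms] by meson
  then show "\<exists>K. \<forall>m\<ge>K. A (m + k) w = 0" by (intro exI[of _ "K - k"]) auto
qed (use assms in \<open>auto intro: field_lin\<close>)

subsection \<open>The two sides of the Jacobi identity in terms of modes\<close>

text \<open>
  The coefficients of \<open>z_0^(-n-1) x_0^(-m/N-1) y_0^(-l/N-1)\<close> in the first term and in the left-hand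
  side of the Jacobi identity.
\<close>

definition L1 where
  "L1 A B n m l w = fsum (\<lambda>i. be n i \<odot> A (m + int N * (n - int i)) (B (l + int N * int i) w))"

definition P where
  "P A B n m l w = L1 A B n m l w - sg n \<odot> L1 B A n l m w"

lemma fin_L1:
  assumes "fieldp A" "fieldp B"
  shows "fin1 (\<lambda>i. be n i \<odot> A (m + int N * (n - int i)) (B (l + int N * int i) w))"
  by (rule fin1_scl, rule fin1_lin[OF field_fin[OF assms(2)]], rule field_lin[OF assms(1)])

lemma L1_0: "L1 A B 0 m l w = A m (B l w)"
proof -
  let ?f = "\<lambda>i. be 0 i \<odot> A (m + int N * (0 - int i)) (B (l + int N * int i) w)"
  have "fsum ?f = ?f 0" by (rule fsum_single) (simp add: be_zero)
  then show ?thesis unfolding L1_def by (simp add: be_zero)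
qed

lemma P_0: "P A B 0 m l w = A m (B l w) - B l (A m w)"
  by (simp add: P_def L1_0)

text \<open>Pascal's rule, that is \<open>(x_0 - y_0)^(n+1) = (x_0 - y_0)^n (x_0 - y_0)\<close>. A
  factor \<open>x_0\<close> or \<open>y_0\<close> raises the mode number by \<open>N\<close> because
  the mode \<open>m\<close> belongs to the exponent \<open>-m/N - 1\<close>.\<close>

lemma L1_rec:
  assumes "fieldp A" "fieldp B"
  shows "L1 A B (n + 1) m l w = L1 A B n (m + int N) l w - L1 A B n m (l + int N) w"
proof -
  let ?f = "\<lambda>n m l i. be n i \<odot> A (m + int N * (n - int i)) (B (l + int N * int i) w)"
  have a: "?f (n + 1) m l (Suc i) = ?f n (m + int N) l (Suc i) - ?f n m (l + int N) i" for i
    unfolding be_Suc scale_left_diff_distrib by (simp add: algebra_simps)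
  have b: "?f (n + 1) m l 0 = ?f n (m + int N) l 0"
    unfolding be_0 by (simp add: algebra_simps)
  have f: "fin1 (?f n m l)" for n m l by (rule fin_L1[OF assms])
  have f': "fin1 (\<lambda>i. ?f n (m + int N) l (Suc i))"
    using fin1_shift[OF f, of n 1 "m + int N" l] unfolding Suc_eq_plus1 .
  have "L1 A B (n + 1) m l w = ?f (n+1) m l 0 + fsum (\<lambda>i. ?f (n+1) m l (Suc i))"
    unfolding L1_def by (rule fsum_Suc[OF f])
  also have "\<dots> = ?f n (m + int N) l 0 + (fsum (\<lambda>i. ?f n (m + int N) l (Suc i)) - fsum (?f n m (l + int N)))"
    unfolding a b by (simp only: fsum_diff[OF f' f])
  also have "\<dots> = fsum (?f n (m + int N) l) - fsum (?f n m (l + int N))"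
    unfolding fsum_Suc[OF f, of n "m + int N" l] by (rule add_diff_eq)
  finally show ?thesis unfolding L1_def .
qed

text \<open>The second term expands \<open>(y_0 - x_0)^n\<close>; the change of sign of
  \<open>sg\<close> turns its recursion into that of the first term. The value at
  \<open>n = 0\<close> is the commutator, so for \<open>n \<ge> 0\<close> these are the coefficients
  of \<open>(x_0 - y_0)^n [A, B]\<close>.\<close>

lemma P_rec:
  assumes "fieldp A" "fieldp B"
  shows "P A B (n + 1) m l w = P A B n (m + int N) l w - P A B n m (l + int N) w"
  unfolding P_def L1_rec[OF assms] L1_rec[OF assms(2,1)] sg_Suc
  by (simp add: scale_right_diff_distrib)

lemma P_zero_up:
  assumes "fieldp A" "fieldp B" "\<And>m l. P A B K m l w = 0" "K \<le> n"
  shows "P A B n m l w = 0"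
  using assms(4)
proof (induction n arbitrary: m l rule: int_ge_induct)
  case (step i) then show ?case unfolding P_rec[OF assms(1,2)] by simp
qed (rule assms)

lemma lin_AB: "fieldp A \<Longrightarrow> fieldp B \<Longrightarrow> lin (\<lambda>w. A m (B l w))"
  using lin_comp[OF field_lin field_lin] .

lemma lin_L1:
  assumes "fieldp A" "fieldp B" shows "lin (L1 A B n m l)"
  unfolding L1_def[abs_def]
  by (rule fsum_lin, rule lin_scl, rule lin_AB[OF assms], rule fin_L1[OF assms])

lemma lin_P: "fieldp A \<Longrightarrow> fieldp B \<Longrightarrow> lin (P A B n m l)"
  unfolding P_def[abs_def] by (rule lin_minus, erule (1) lin_L1, rule lin_scl, erule (1) lin_L1)

text \<open>Uniformity in \<open>q\<close> is what keeps products inside \<open>E_space\<close>.\<close>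

lemma P_trunc:
  assumes A: "fieldp A" and B: "\<And>w. \<exists>K. \<forall>q. \<forall>l\<ge>K. B q l w = 0" and B0: "\<And>q l. B q l 0 = 0"
  shows "\<exists>K. \<forall>q. \<forall>l\<ge>K. P A (B q) n m l w = 0"
proof -
  obtain K where K: "\<And>q l. l \<ge> K \<Longrightarrow> B q l w = 0"
    using B[of w] by metis
  obtain I where I: "\<And>i. i \<ge> I \<Longrightarrow> A (m + int N * int i) w = 0"
    using field_fin[OF A, of m w] unfolding fin1_def by blast
  have "\<forall>i. \<exists>L. \<forall>q. \<forall>l\<ge>L. B q l (A (m + int N * int i) w) = 0"
    using B by (rule allI)
  from choice[OF this] obtain f
    where f: "\<And>i q l. l \<ge> f i \<Longrightarrow> B q l (A (m + int N * int i) w) = 0" by blast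
  \<comment> \<open>\<open>K\<close> takes care of the terms in which \<open>B q\<close> acts first,
    the \<open>f i\<close> with \<open>i < I\<close> of those in which it acts last, and the summand
    with \<open>N\<close> absorbs the shifts \<open>N * (n - i)\<close>. Only finitely many
    \<open>f i\<close> occur, and none depends on \<open>q\<close>.\<close>
  let ?L = "\<bar>K\<bar> + (\<Sum>i<I. \<bar>f i\<bar>) + int N * (\<bar>n\<bar> + int I)"
  have "P A (B q) n m l w = 0" if l: "?L \<le> l" for q l
  proof -
    have nn: "0 \<le> (\<Sum>i<I. \<bar>f i\<bar>)" "0 \<le> int N * (\<bar>n\<bar> + int I)" by (auto intro: sum_nonneg)
    have "K \<le> l + int N * int i" for i
    proof -
      have "0 \<le> int N * int i" by simp
      then show ?thesis using l nn by linarith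
    qed
    then have "L1 A (B q) n m l w = 0"
      unfolding L1_def by (intro fsum_zero) (simp add: K lin_0[OF field_lin[OF A]])
    moreover have "B q (l + int N * (n - int i)) (A (m + int N * int i) w) = 0" for i
    proof (cases "i < I")
      case True
      have "f i \<le> \<bar>f i\<bar>" by simp
      also have "\<bar>f i\<bar> \<le> (\<Sum>i<I. \<bar>f i\<bar>)" using True by (intro member_le_sum) auto
      finally have 1: "f i \<le> (\<Sum>i<I. \<bar>f i\<bar>)" .
      have 2: "int N * (n - int i) \<ge> int N * (- (\<bar>n\<bar> + int I))"
        using True by (intro mult_left_mono) auto
      have 3: "int N * (- (\<bar>n\<bar> + int I)) = - (int N * (\<bar>n\<bar> + int I))" by (rule mult_minus_right)
      have "f i \<le> l + int N * (n - int i)" using l nn 1 2 unfolding 3 by linarith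
      then show ?thesis by (rule f)
    next
      case False
      then show ?thesis by (simp add: I B0)
    qed
    then have "L1 (B q) A n l m w = 0" unfolding L1_def by (intro fsum_zero) simp
    ultimately show ?thesis by (simp add: P_def)
  qed
  then show ?thesis by blast
qed

end

section \<open>Coefficients of the right-hand side and the triangular system for the
  products\<close>

context mode_calculus
begin

text \<open>The coefficient that the delta function of the right-hand side contributes to
  \<open>x_0^(-m/N - 1) z_0^i\<close>; \<open>binom_gb\<close> converts it from
  \<open>binom_coeff\<close>.\<close>

definition gb :: "int \<Rightarrow> nat \<Rightarrow> complex" where
  "gb m i = (of_int m / of_nat N) gchoose i"

lemma gb_0 [simp]: "gb m 0 = 1"
  by (simp add: gb_def)

lemma gb_zero: "gb 0 i = (if i = 0 then 1 else 0)"
  by (cases i) (simp_all add: gb_def)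

lemma gb_mult: "gb (int N * d) i = of_int d gchoose i"
  using N_pos by (simp add: gb_def)

lemma gb_shift: "of_int (m + int N * d) / of_nat N = of_int m / of_nat N + (of_int d :: complex)"
  using N_pos by (simp add: field_simps)

lemma gb_Suc: "gb (m + int N) (Suc i) = gb m (Suc i) + gb m i"
  using gb_shift[of m 1] gbinomial_Suc_Suc[of "of_int m / of_nat N :: complex" i]
  by (simp add: gb_def add.commute)

lemma gb_vandermonde: "(\<Sum>i\<le>s. gb m i * gb l (s - i)) = gb (m + l) s"
  unfolding gb_def gbinomial_vandermonde_complex by (simp add: add_divide_distrib)

lemma gb_trinomial: "gb m i * gb (m - int N * int i) j = gb m (i + j) * of_nat ((i + j) choose i)"
  using gbinomial_trinomial[of "of_int m / of_nat N" i j] gb_shift[of m "- int i"]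
  by (simp add: gb_def)

text \<open>
  The same coefficient of the right-hand side, \<open>C n e\<close> being the mode \<open>e\<close> of the \<open>n\<close>-th product. The
  restriction to one residue class in \<open>jac\<close> reflects that an eigenvector of eigenvalue \<open>\<omega>_N^s\<close> has
  modes in the class of \<open>s\<close> only.
\<close>

definition R :: "(int \<Rightarrow> int \<Rightarrow> 'w \<Rightarrow> 'w) \<Rightarrow> int \<Rightarrow> int \<Rightarrow> int \<Rightarrow> 'w \<Rightarrow> 'w" where
  "R C n m l w = fsum (\<lambda>i. gb m i \<odot> C (n + int i) (m + l - int N * int i) w)"

definition jac :: "int \<Rightarrow> (int \<Rightarrow> 'w \<Rightarrow> 'w) \<Rightarrow> (int \<Rightarrow> 'w \<Rightarrow> 'w) \<Rightarrow> (int \<Rightarrow> int \<Rightarrow> 'w \<Rightarrow> 'w) \<Rightarrow> bool" where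
  "jac s A B C \<longleftrightarrow> (\<exists>K. \<forall>n\<ge>K. C n = (\<lambda>e w. 0)) \<and>
     (\<forall>n m l w. m mod int N = s mod int N \<longrightarrow> P A B n m l w = R C n m l w)"

abbreviation vanishing :: "(int \<Rightarrow> int \<Rightarrow> 'w \<Rightarrow> 'w) \<Rightarrow> bool" where
  "vanishing C \<equiv> (\<exists>K. \<forall>n\<ge>K. C n = (\<lambda>e w. 0))"

lemma jac_vanishing: "jac s A B C \<Longrightarrow> vanishing C"
  by (simp add: jac_def)

lemma jac_eq: "jac s A B C \<Longrightarrow> m mod int N = s mod int N \<Longrightarrow> P A B n m l w = R C n m l w"
  by (simp add: jac_def)

lemma vanishing_fin: "vanishing C \<Longrightarrow> fin1 (\<lambda>i. C (n + int i) (g i) w)"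
proof -
  assume "vanishing C"
  then obtain K where "\<And>n. n \<ge> K \<Longrightarrow> C n = (\<lambda>e w. 0)" by blast
  then show ?thesis by (intro fin1I[of "nat (K - n)"]) (simp add: nat_le_iff)
qed

lemma fin_R: "vanishing C \<Longrightarrow> fin1 (\<lambda>i. gb m i \<odot> C (n + int i) (m + l - int N * int i) w)"
  by (rule fin1_scl, rule vanishing_fin)

lemma R_zero: "(\<And>i. C (n + int i) = (\<lambda>e w. 0)) \<Longrightarrow> R C n m l w = 0"
  unfolding R_def by (rule fsum_zero) simp

text \<open>Pascal's rule for \<open>gb\<close> yields the recursion of \<open>P_rec\<close>: on the
  right-hand side \<open>x_0 - y_0\<close> acts as \<open>z_0\<close>, which raises the index of the
  product.\<close>

lemma R_rec:
  assumes "vanishing C"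
  shows "R C (n + 1) m l w = R C n (m + int N) l w - R C n m (l + int N) w"
proof -
  let ?f = "\<lambda>n m l i. gb m i \<odot> C (n + int i) (m + l - int N * int i) w"
  have f: "fin1 (?f n m l)" for n m l by (rule fin_R[OF assms])
  have f': "fin1 (\<lambda>i. ?f n m l (Suc i))" for n m l
    using fin1_shift[OF f, of m 1 n l] unfolding Suc_eq_plus1 .
  have a: "?f n (m + int N) l (Suc i) = ?f n m (l + int N) (Suc i) + ?f (n + 1) m l i" for i
    unfolding gb_Suc scale_left_distrib by (simp add: algebra_simps)
  have b: "?f n (m + int N) l 0 = ?f n m (l + int N) 0"
    unfolding gb_0 by (simp add: algebra_simps)
  have "R C n (m + int N) l w = ?f n (m + int N) l 0 + fsum (\<lambda>i. ?f n (m + int N) l (Suc i))"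
    unfolding R_def by (rule fsum_Suc[OF f])
  also have "\<dots> = ?f n m (l + int N) 0 + (fsum (\<lambda>i. ?f n m (l + int N) (Suc i)) + fsum (?f (n + 1) m l))"
    unfolding a b by (simp only: fsum_add[OF f' f])
  also have "\<dots> = fsum (?f n m (l + int N)) + fsum (?f (n + 1) m l)"
    unfolding fsum_Suc[OF f, of m n "l + int N"] by (rule add.assoc[symmetric])
  finally show ?thesis unfolding R_def by simp
qed

text \<open>From \<open>m\<close> to \<open>m + N\<close> the recursion is explicit. From
  \<open>m + N\<close> to \<open>m\<close> it expresses a value through another one with larger
  \<open>n\<close>, and the vanishing for large \<open>n\<close> starts the descent.\<close>

lemma rec_vanish:
  fixes E :: "int \<Rightarrow> int \<Rightarrow> int \<Rightarrow> 'w"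
  assumes rec: "\<And>n m l. E (n + 1) m l = E n (m + int N) l - E n m (l + int N)"
    and K: "\<And>n m l. K \<le> n \<Longrightarrow> E n m l = 0"
    and s: "\<And>n l. E n s l = 0"
    and m: "m mod int N = s mod int N"
  shows "E n m l = 0"
proof -
  have up: "E n (s + int N * int d) l = 0" for d n l
  proof (induction d arbitrary: n l)
    case (Suc d)
    have "E n (s + int N * int d + int N) l = E (n + 1) (s + int N * int d) l + E n (s + int N * int d) (l + int N)"
      using rec[of n "s + int N * int d" l] by simp
    then show ?case using Suc by (simp add: algebra_simps)
  qed (simp add: s)
  have down: "E n (s - int N * int d) l = 0" for d n l
  proof (induction d arbitrary: n l)
    case (Suc d)
    let ?m = "s - int N * int (Suc d)"
    have m: "?m + int N = s - int N * int d" by (simp add: algebra_simps)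
    have "\<forall>l. E n ?m l = 0"
    proof (induction n rule: int_descend[of K])
      case (2 n)
      show ?case
      proof
        fix l
        have "E n ?m l = E n (s - int N * int d) (l - int N) - E (n + 1) ?m (l - int N)"
          using rec[of n ?m "l - int N"] unfolding m by simp
        then show "E n ?m l = 0" using Suc.IH 2[of "n + 1"] by simp
      qed
    qed (simp add: K)
    then show ?case by blast
  qed (simp add: s)
  from m obtain d where d: "m = s + int N * d"
    by (metis mod_eqE add.commute add_diff_cancel_left' diff_add_cancel mod_eq_dvd_iff dvd_def)
  show ?thesis
  proof (cases "0 \<le> d")
    case True then show ?thesis using up[of n "nat d" l] d by simp
  next
    case False then show ?thesis using down[of n "nat (- d)" l] d by simp
  qed
qed

text \<open>The system is triangular with diagonal coefficient \<open>gb s 0 = 1\<close>: once all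
  products of larger index vanish, only \<open>i = 0\<close> is left.\<close>

lemma R_inj:
  assumes "vanishing D" "\<And>n l w. R D n s l w = 0"
  shows "D n = (\<lambda>e w. 0)"
proof -
  from assms(1) obtain K where K: "\<And>n. n \<ge> K \<Longrightarrow> D n = (\<lambda>e w. 0)" by blast
  show ?thesis
  proof (induction n rule: int_descend[of K])
    case (2 n)
    show ?case
    proof (intro ext)
      fix e w
      have "R D n s (e - s) w = gb s 0 \<odot> D (n + int 0) (s + (e - s) - int N * int 0) w"
        unfolding R_def by (rule fsum_single) (simp add: 2)
      then show "D n e w = 0" using assms(2) by simp
    qed
  qed (rule K)
qed

lemma vanishing_diff: "vanishing C \<Longrightarrow> vanishing D \<Longrightarrow> vanishing (\<lambda>n e w. C n e w - D n e w)"
proof -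
  assume "vanishing C" "vanishing D"
  then obtain K L where "\<forall>n\<ge>K. C n = (\<lambda>e w. 0)" "\<forall>n\<ge>L. D n = (\<lambda>e w. 0)" by blast
  then show ?thesis by (intro exI[of _ "max K L"]) auto
qed

lemma R_diff:
  assumes "vanishing C" "vanishing D"
  shows "R (\<lambda>n e w. C n e w - D n e w) n m l w = R C n m l w - R D n m l w"
  unfolding R_def scale_right_diff_distrib by (rule fsum_diff[OF fin_R[OF assms(1)] fin_R[OF assms(2)]])

lemma jac_unique:
  assumes "jac s A B C" "jac s A B D"
  shows "C = D"
proof -
  note v = assms[THEN jac_vanishing]
  have "(\<lambda>e w. C n e w - D n e w) = (\<lambda>e w. 0)" for n
    by (rule R_inj[OF vanishing_diff[OF v], where s = s])
       (simp add: R_diff[OF v] jac_eq[OF assms(1), symmetric] jac_eq[OF assms(2), symmetric])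
  then show ?thesis by (simp add: fun_eq_iff)
qed

text \<open>Both sides obey one recursion and vanish for large \<open>n\<close>, so
  \<open>rec_vanish\<close> extends the equations with \<open>m = s\<close> to the whole residue
  class of \<open>s\<close>.\<close>

lemma jac_one:
  assumes A: "fieldp A" and B: "fieldp B" and C: "vanishing C"
    and K: "\<And>n m l w. K \<le> n \<Longrightarrow> P A B n m l w = 0"
    and s: "\<And>n l w. P A B n s l w = R C n s l w"
  shows "jac s A B C"
  unfolding jac_def
proof (intro conjI allI impI C)
  fix n m l w assume m: "m mod int N = s mod int N"
  from C obtain L where L: "\<And>n. n \<ge> L \<Longrightarrow> C n = (\<lambda>e w. 0)" by blast
  have "P A B n m l w - R C n m l w = 0"
    by (rule rec_vanish[where K = "max K L" and s = s, OF _ _ _ m])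
       (simp_all add: P_rec[OF A B] R_rec[OF C] K s R_zero L)
  then show "P A B n m l w = R C n m l w" by simp
qed

text \<open>
  The solution of the system \<open>jac\<close>, found from the equations with \<open>m = s\<close>: the convolution inverse of
  \<open>i \<mapsto> C(s/N, i)\<close> is \<open>i \<mapsto> C(-s/N, i)\<close> by Vandermonde.
\<close>

definition tprod :: "int \<Rightarrow> (int \<Rightarrow> 'w \<Rightarrow> 'w) \<Rightarrow> (int \<Rightarrow> 'w \<Rightarrow> 'w) \<Rightarrow> int \<Rightarrow> int \<Rightarrow> 'w \<Rightarrow> 'w" where
  "tprod s A B n e w = fsum (\<lambda>i. gb (- s) i \<odot> P A B (n + int i) s (e - s - int N * int i) w)"

lemma tprod_zero:
  assumes "\<And>n m l w. K \<le> n \<Longrightarrow> P A B n m l w = 0" "K \<le> n"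
  shows "tprod s A B n = (\<lambda>e w. 0)"
  unfolding tprod_def[abs_def] using assms by (simp add: fsum_zero)

lemma jac_tprod:
  assumes A: "fieldp A" and B: "fieldp B"
    and K: "\<And>n m l w. K \<le> n \<Longrightarrow> P A B n m l w = 0"
  shows "jac s A B (tprod s A B)"
proof (rule jac_one[OF A B _ K])
  show "vanishing (tprod s A B)" using tprod_zero[OF K] by blast
  fix n l w
  let ?g = "\<lambda>i. P A B (n + int i) s (l - int N * int i) w"
  have g: "fin1 ?g" by (rule fin1I[of "nat (K - n)"]) (simp add: K nat_le_iff)
  have "R (tprod s A B) n s l w = fsum (\<lambda>i. fsum (\<lambda>j. gb s i \<odot> gb (- s) j \<odot> ?g (i + j)))"
    unfolding R_def tprod_def
  proof (rule arg_cong[of _ _ fsum], rule ext)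
    fix i
    have e: "P A B (n + int i + int j) s (s + l - int N * int i - s - int N * int j) w = ?g (i + j)" for j
      by (simp add: algebra_simps)
    have "fin1 (\<lambda>j. ?g (i + j))" using fin1_shift[OF g, of i] by (simp only: add.commute)
    then show "gb s i \<odot> fsum (\<lambda>j. gb (- s) j \<odot> P A B (n + int i + int j) s (s + l - int N * int i - s - int N * int j) w)
       = fsum (\<lambda>j. gb s i \<odot> gb (- s) j \<odot> ?g (i + j))"
      unfolding e by (intro scl_fsum fin1_scl)
  qed
  also have "\<dots> = fsum (\<lambda>t. \<Sum>i\<le>t. gb s i \<odot> gb (- s) (t - i) \<odot> ?g t)"
    by (rule fsum_diag'[OF g]) simp
  also have "\<dots> = fsum (\<lambda>t. gb 0 t \<odot> ?g t)"
    using gb_vandermonde[of s "- s"] by (simp flip: scale_sum_left)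
  also have "\<dots> = gb 0 0 \<odot> ?g 0" by (rule fsum_single) (simp add: gb_zero)
  finally show "P A B n s l w = R (tprod s A B) n s l w" by simp
qed

lemma lin_tprod:
  assumes "fieldp A" "fieldp B" "\<And>n m l w. K \<le> n \<Longrightarrow> P A B n m l w = 0"
  shows "lin (tprod s A B n e)"
  unfolding tprod_def[abs_def]
proof (rule fsum_lin)
  show "lin (\<lambda>w. gb (- s) i \<odot> P A B (n + int i) s (e - s - int N * int i) w)" for i
    by (rule lin_scl) (rule lin_P[OF assms(1,2)])
  show "fin1 (\<lambda>i. gb (- s) i \<odot> P A B (n + int i) s (e - s - int N * int i) w)" for w
    by (rule fin1I[of "nat (K - n)"]) (simp add: assms(3) nat_le_iff)
qed

text \<open>By locality only the indices below \<open>?I\<close> contribute, so finitely many of the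
  bounds from \<open>P_trunc\<close> suffice, and each of them is independent of
  \<open>q\<close>.\<close>

lemma tprod_trunc:
  assumes A: "fieldp A" and B: "\<And>w. \<exists>K. \<forall>q. \<forall>l\<ge>K. B q l w = 0" and B0: "\<And>q l. B q l 0 = 0"
    and K: "\<And>q n m l w. K \<le> n \<Longrightarrow> P A (B q) n m l w = 0"
  shows "\<exists>L. \<forall>q. \<forall>e\<ge>L. tprod s A (B q) n e w = 0"
proof -
  have "\<forall>i. \<exists>L. \<forall>q. \<forall>l\<ge>L. P A (B q) (n + int i) s l w = 0"
    using P_trunc[of A B, OF A B B0] by (intro allI)
  from choice[OF this] obtain f
    where f: "\<And>i q l. l \<ge> f i \<Longrightarrow> P A (B q) (n + int i) s l w = 0" by blast
  let ?I = "nat (K - n)"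
  have z: "P A (B q) (n + int i) s (e - s - int N * int i) w = 0"
    if e: "(\<Sum>i<?I. \<bar>f i\<bar>) + s + int N * int ?I \<le> e" for q e i
  proof (cases "i < ?I")
    case True
    have "f i \<le> \<bar>f i\<bar>" by simp
    also have "\<bar>f i\<bar> \<le> (\<Sum>i<?I. \<bar>f i\<bar>)" using True by (intro member_le_sum) auto
    moreover have "int N * int i \<le> int N * int ?I" using True by (intro mult_left_mono) auto
    ultimately show ?thesis using e by (intro f) linarith
  next
    case False
    then show ?thesis by (intro K) simp
  qed
  have "tprod s A (B q) n e w = 0" if e: "(\<Sum>i<?I. \<bar>f i\<bar>) + s + int N * int ?I \<le> e" for q e
    unfolding tprod_def by (rule fsum_zero) (simp only: z[OF e] scale_zero_right)
  then show ?thesis by blast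
qed

lemma field_P:
  assumes A: "fieldp A" and B: "fieldp B" shows "fieldp (P A B n m)"
proof (rule fieldI)
  fix w
  have "\<exists>L. \<forall>q::unit. \<forall>e\<ge>L. P A B n m e w = 0"
    by (rule P_trunc[OF A, of "\<lambda>q. B"]) (use field_trunc[OF B] lin_0[OF field_lin[OF B]] in auto)
  then show "\<exists>L. \<forall>e\<ge>L. P A B n m e w = 0" by simp
qed (rule lin_P[OF assms])

subsection \<open>Linearity of the left-hand side in the fields\<close>

lemma L1_left_add:
  assumes "fieldp A" "fieldp A'" "fieldp B"
  shows "L1 (\<lambda>m w. A m w + A' m w) B n m l w = L1 A B n m l w + L1 A' B n m l w"
  unfolding L1_def scale_right_distrib by (rule fsum_add[OF fin_L1[OF assms(1,3)] fin_L1[OF assms(2,3)]])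

lemma L1_right_add:
  assumes "fieldp A" "fieldp B" "fieldp B'"
  shows "L1 A (\<lambda>m w. B m w + B' m w) n m l w = L1 A B n m l w + L1 A B' n m l w"
  unfolding L1_def lin_add[OF field_lin[OF assms(1)]] scale_right_distrib
  by (rule fsum_add[OF fin_L1[OF assms(1,2)] fin_L1[OF assms(1,3)]])

lemma L1_left_scl:
  assumes "fieldp A" "fieldp B"
  shows "L1 (\<lambda>m w. c \<odot> A m w) B n m l w = c \<odot> L1 A B n m l w"
  unfolding L1_def scl_fsum[OF fin_L1[OF assms]] by (simp add: mult.commute)

lemma L1_right_scl:
  assumes "fieldp A" "fieldp B"
  shows "L1 A (\<lambda>m w. c \<odot> B m w) n m l w = c \<odot> L1 A B n m l w"
  unfolding L1_def scl_fsum[OF fin_L1[OF assms]] lin_scale[OF field_lin[OF assms(1)]]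
  by (simp add: mult.commute)

lemma P_left_add:
  assumes "fieldp A" "fieldp A'" "fieldp B"
  shows "P (\<lambda>m w. A m w + A' m w) B n m l w = P A B n m l w + P A' B n m l w"
  unfolding P_def L1_left_add[OF assms] L1_right_add[OF assms(3,1,2)] by (simp add: scale_right_distrib)

lemma P_right_add:
  assumes "fieldp A" "fieldp B" "fieldp B'"
  shows "P A (\<lambda>m w. B m w + B' m w) n m l w = P A B n m l w + P A B' n m l w"
  unfolding P_def L1_right_add[OF assms] L1_left_add[OF assms(2,3,1)] by (simp add: scale_right_distrib)

lemma P_left_scl:
  assumes "fieldp A" "fieldp B"
  shows "P (\<lambda>m w. c \<odot> A m w) B n m l w = c \<odot> P A B n m l w"
  unfolding P_def L1_left_scl[OF assms] L1_right_scl[OF assms(2,1)] by (simp add: scale_right_diff_distrib mult.commute)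

lemma P_right_scl:
  assumes "fieldp A" "fieldp B"
  shows "P A (\<lambda>m w. c \<odot> B m w) n m l w = c \<odot> P A B n m l w"
  unfolding P_def L1_right_scl[OF assms] L1_left_scl[OF assms(2,1)] by (simp add: scale_right_diff_distrib mult.commute)

lemma P_left_zero: "P (\<lambda>m w. 0) B n m l w = 0" if "fieldp B"
  using P_left_scl[OF field_zero that, of 0] by simp

lemma P_right_zero: "P A (\<lambda>m w. 0) n m l w = 0" if "fieldp A"
  using P_right_scl[OF that field_zero, of 0] by simp

lemma P_left_diff:
  assumes "fieldp A" "fieldp A'" "fieldp B"
  shows "P (\<lambda>m w. A m w - A' m w) B n m l w = P A B n m l w - P A' B n m l w"
  using P_left_add[OF assms(1) field_scl[OF assms(2)] assms(3), of "-1"] P_left_scl[OF assms(2,3), of "-1"] by simp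

lemma P_right_diff:
  assumes "fieldp A" "fieldp B" "fieldp B'"
  shows "P A (\<lambda>m w. B m w - B' m w) n m l w = P A B n m l w - P A B' n m l w"
  using P_right_add[OF assms(1,2) field_scl[OF assms(3)], of "-1"] P_right_scl[OF assms(1,3), of "-1"] by simp

lemma field_sum: "(\<And>i. i \<in> S \<Longrightarrow> fieldp (A i)) \<Longrightarrow> fieldp (\<lambda>m w. \<Sum>i\<in>S. A i m w)"
  by (induction S rule: infinite_finite_induct) (simp_all add: field_zero field_plus)

lemma P_left_sum:
  assumes "\<And>i. i \<in> S \<Longrightarrow> fieldp (A i)" "fieldp B"
  shows "P (\<lambda>m w. \<Sum>i\<in>S. A i m w) B n m l w = (\<Sum>i\<in>S. P (A i) B n m l w)"
  using assms(1)
  by (induction S rule: infinite_finite_induct)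
     (simp_all add: P_left_zero[OF assms(2)] P_left_add[OF _ _ assms(2)] field_sum)

lemma P_right_sum:
  assumes "fieldp A" "\<And>i. i \<in> S \<Longrightarrow> fieldp (B i)"
  shows "P A (\<lambda>m w. \<Sum>i\<in>S. B i m w) n m l w = (\<Sum>i\<in>S. P A (B i) n m l w)"
  using assms(2)
  by (induction S rule: infinite_finite_induct)
     (simp_all add: P_right_zero[OF assms(1)] P_right_add[OF assms(1)] field_sum)

lemma P_left_fsum:
  assumes "\<And>i. fieldp (A i)" "\<And>i. K \<le> i \<Longrightarrow> A i = (\<lambda>m w. 0)" "fieldp B"
  shows "P (\<lambda>m w. fsum (\<lambda>i. A i m w)) B n m l w = fsum (\<lambda>i. P (A i) B n m l w)"
proof -
  have "fsum (\<lambda>i. A i m w) = (\<Sum>i<K. A i m w)" for m w by (rule fsum_eq) (simp add: assms)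
  moreover have "fsum (\<lambda>i. P (A i) B n m l w) = (\<Sum>i<K. P (A i) B n m l w)"
    by (rule fsum_eq) (simp add: assms P_left_zero)
  ultimately show ?thesis by (simp add: P_left_sum assms)
qed

lemma P_right_fsum:
  assumes "\<And>i. fieldp (B i)" "\<And>i. K \<le> i \<Longrightarrow> B i = (\<lambda>m w. 0)" "fieldp A"
  shows "P A (\<lambda>m w. fsum (\<lambda>i. B i m w)) n m l w = fsum (\<lambda>i. P A (B i) n m l w)"
proof -
  have "fsum (\<lambda>i. B i m w) = (\<Sum>i<K. B i m w)" for m w by (rule fsum_eq) (simp add: assms)
  moreover have "fsum (\<lambda>i. P A (B i) n m l w) = (\<Sum>i<K. P A (B i) n m l w)"
    by (rule fsum_eq) (simp add: assms P_right_zero)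
  ultimately show ?thesis by (simp add: P_right_sum assms)
qed

lemma P_shift_left: "P (\<lambda>m. A (m + k)) B n m l w = P A B n (m + k) l w"
  by (simp add: P_def L1_def algebra_simps)

lemma P_shift_right: "P A (\<lambda>l. B (l + k)) n m l w = P A B n m (l + k) w"
  by (simp add: P_def L1_def algebra_simps)

end

context mode_calculus
begin

subsection \<open>Dong's lemma\<close>

text \<open>\<open>[a, bB] = [a, b]B + b[a, B]\<close> in every summand; \<open>P\<close> with index
  0 is the commutator.\<close>

lemma L1_derivation:
  assumes a: "fieldp a" and b: "fieldp b" and B: "fieldp B"
  shows "a m (L1 b B k l c w) - L1 b B k l c (a m w) = L1 (P a b 0 m) B k l c w + L1 b (P a B 0 m) k l c w"
proof -
  note la = field_lin[OF a] and lb = field_lin[OF b]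
  have "a m (L1 b B k l c w) - L1 b B k l c (a m w) =
      fsum (\<lambda>i. be k i \<odot> a m (b (l + int N * (k - int i)) (B (c + int N * int i) w)))
      - fsum (\<lambda>i. be k i \<odot> b (l + int N * (k - int i)) (B (c + int N * int i) (a m w)))"
    unfolding L1_def lin_fsum[OF la fin_L1[OF b B]] lin_scale[OF la] ..
  also have "\<dots> = fsum (\<lambda>i. be k i \<odot> a m (b (l + int N * (k - int i)) (B (c + int N * int i) w))
      - be k i \<odot> b (l + int N * (k - int i)) (B (c + int N * int i) (a m w)))"
    by (rule fsum_diff[symmetric]) (rule fin1_scl, rule fin1_lin, rule fin1_lin[OF field_fin[OF B]], rule lb, rule la, rule fin_L1[OF b B])
  also have "\<dots> = fsum (\<lambda>i. be k i \<odot> P a b 0 m (l + int N * (k - int i)) (B (c + int N * int i) w)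
       + be k i \<odot> b (l + int N * (k - int i)) (P a B 0 m (c + int N * int i) w))"
    by (simp add: P_0 lin_diff[OF lb] scale_right_diff_distrib)
  also have "\<dots> = L1 (P a b 0 m) B k l c w + L1 b (P a B 0 m) k l c w"
    unfolding L1_def by (rule fsum_add[OF fin_L1[OF field_P[OF a b] B] fin_L1[OF b field_P[OF a B]]])
  finally show ?thesis .
qed

lemma P_derivation:
  assumes a: "fieldp a" and b: "fieldp b" and B: "fieldp B"
  shows "P a (P b B k l) 0 m c w = P (P a b 0 m) B k l c w + P b (P a B 0 m) k l c w"
proof -
  have "P a (P b B k l) 0 m c w = (a m (L1 b B k l c w) - L1 b B k l c (a m w))
      - sg k \<odot> (a m (L1 B b k c l w) - L1 B b k c l (a m w))"
    unfolding P_0 unfolding P_def lin_diff[OF field_lin[OF a]] lin_scale[OF field_lin[OF a]]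
    by (simp add: scale_right_diff_distrib)
  then show ?thesis
    unfolding L1_derivation[OF a b B] L1_derivation[OF a B b] by (simp add: P_def scale_right_distrib)
qed

text \<open>
  Multiplication by \<open>x - y\<close>, \<open>x - z\<close> and \<open>y - z\<close> on coefficients of series in three variables. Dong's
  lemma rests on \<open>(x - z) = (x - y) + (y - z)\<close>.
\<close>

definition D12 :: "(int \<Rightarrow> int \<Rightarrow> int \<Rightarrow> 'w) \<Rightarrow> int \<Rightarrow> int \<Rightarrow> int \<Rightarrow> 'w" where
  "D12 G m l c = G (m + int N) l c - G m (l + int N) c"

definition D13 :: "(int \<Rightarrow> int \<Rightarrow> int \<Rightarrow> 'w) \<Rightarrow> int \<Rightarrow> int \<Rightarrow> int \<Rightarrow> 'w" where
  "D13 G m l c = G (m + int N) l c - G m l (c + int N)"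

definition D23 :: "(int \<Rightarrow> int \<Rightarrow> int \<Rightarrow> 'w) \<Rightarrow> int \<Rightarrow> int \<Rightarrow> int \<Rightarrow> 'w" where
  "D23 G m l c = G m (l + int N) c - G m l (c + int N)"

abbreviation "Z3 \<equiv> (\<lambda>_ _ _. 0 :: 'w)"

lemma funpow_fix: "T z = z \<Longrightarrow> (T ^^ n) z = z"
  by (induction n) auto

lemma funpow_comm: "(\<And>x. S (T x) = T (S x)) \<Longrightarrow> (S ^^ n) ((T ^^ k) x) = (T ^^ k) ((S ^^ n) x)"
proof -
  assume a: "\<And>x. S (T x) = T (S x)"
  have b: "S ((T ^^ k) x) = (T ^^ k) (S x)" for x by (induction k) (simp_all add: a)
  show ?thesis by (induction n) (simp_all add: b)
qed

lemma D_zero: "D12 Z3 = Z3" "D13 Z3 = Z3" "D23 Z3 = Z3"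
  by (simp_all add: D12_def D13_def D23_def fun_eq_iff)

lemma D_comm: "D12 (D13 G) = D13 (D12 G)" "D12 (D23 G) = D23 (D12 G)" "D13 (D23 G) = D23 (D13 G)"
  by (simp_all add: D12_def D13_def D23_def fun_eq_iff algebra_simps)

lemma D13_add_pow: "(D13 ^^ n) (\<lambda>m l c. G m l c + H m l c) = (\<lambda>m l c. (D13 ^^ n) G m l c + (D13 ^^ n) H m l c)"
  by (induction n) (simp_all add: D13_def fun_eq_iff algebra_simps)

lemma D12_add_pow: "(D12 ^^ n) (\<lambda>m l c. G m l c + H m l c) = (\<lambda>m l c. (D12 ^^ n) G m l c + (D12 ^^ n) H m l c)"
  by (induction n) (simp_all add: D12_def fun_eq_iff algebra_simps)

lemma D13_split: "D13 G = (\<lambda>m l c. D12 G m l c + D23 G m l c)"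
  by (simp add: D12_def D13_def D23_def fun_eq_iff)

text \<open>In the binomial expansion of \<open>((x - y) + (y - z))^(p + q)\<close> every term
  contains \<open>(x - y)^p\<close> or \<open>(y - z)^q\<close>. The induction removes one factor at
  a time instead of expanding.\<close>

lemma D_nil:
  assumes "(D12 ^^ p) G = Z3" "(D23 ^^ q) G = Z3"
  shows "(D13 ^^ (p + q)) G = Z3"
  using assms
proof (induction "p + q" arbitrary: p q G rule: less_induct)
  case less
  show ?case
  proof (cases "p = 0 \<or> q = 0")
    case True
    then have "G = Z3" using less.prems by auto
    then show ?thesis by (simp add: funpow_fix D_zero)
  next
    case False
    then obtain p' q' where p: "p = Suc p'" and q: "q = Suc q'" by (metis not0_implies_Suc)
    have "(D13 ^^ (p' + q)) (D12 G) = Z3"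
    proof (rule less.hyps)
      show "(D12 ^^ p') (D12 G) = Z3" using less.prems(1) by (simp add: p funpow_swap1)
      show "(D23 ^^ q) (D12 G) = Z3"
        using funpow_comm[of D23 D12 q 1 G] less.prems(2) by (simp add: D_comm D_zero)
    qed (simp add: p)
    moreover have "(D13 ^^ (p + q')) (D23 G) = Z3"
    proof (rule less.hyps)
      show "(D23 ^^ q') (D23 G) = Z3" using less.prems(2) by (simp add: q funpow_swap1)
      show "(D12 ^^ p) (D23 G) = Z3"
        using funpow_comm[of D12 D23 p 1 G] less.prems(1) by (simp add: D_comm D_zero)
    qed (simp add: q)
    moreover have "(D13 ^^ (p + q)) G = (D13 ^^ (p' + q)) (D13 G)"
      unfolding p by (simp add: funpow_swap1)
    moreover have "p' + q = p + q'" by (simp add: p q)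
    ultimately show ?thesis unfolding D13_split[of G] D13_add_pow by (simp add: fun_eq_iff)
  qed
qed

text \<open>\<open>P_derivation\<close> splits the commutator of \<open>a\<close> with the
  \<open>k\<close>-th bracket of \<open>b\<close> and \<open>B\<close>. A power of
  \<open>x - y\<close> kills the part with \<open>[a, b]\<close>, a power of \<open>x - z\<close>
  the part with \<open>[a, B]\<close>, and a power of \<open>y - z\<close> raises \<open>k\<close>
  into the range where \<open>b\<close> and \<open>B\<close> are local. \<open>D_nil\<close> trades
  powers of \<open>x - y\<close> and \<open>y - z\<close> for powers of
  \<open>x - z\<close>.\<close>

lemma dong_P:
  assumes a: "fieldp a" and b: "fieldp b" and B: "fieldp B"
    and ab: "\<And>m l w. P a b (int Kab) m l w = 0"
    and aB: "\<And>m l w. P a B (int KaB) m l w = 0"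
    and bB: "\<And>n m l w. KbB \<le> n \<Longrightarrow> P b B n m l w = 0"
    and n: "int (Kab + KaB + nat (KbB - k)) \<le> n"
  shows "P a (P b B k l) n m c w = 0"
proof -
  define G where "G k = (\<lambda>m l c. P a (P b B k l) 0 m c w)" for k
  let ?G1 = "\<lambda>n m l c. P (P a b n m) B k l c w" and ?G2 = "\<lambda>n m l c. P b (P a B n m) k l c w"
  define q where "q = nat (KbB - k)"
  have d13: "(D13 ^^ n) (G k) = (\<lambda>m l c. P a (P b B k l) (int n) m c w)" for n
  proof (induction n)
    case (Suc n)
    have "(D13 ^^ Suc n) (G k) = D13 (\<lambda>m l c. P a (P b B k l) (int n) m c w)" by (simp add: Suc)
    also have "\<dots> = (\<lambda>m l c. P a (P b B k l) (int (Suc n)) m c w)"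
      by (simp add: fun_eq_iff D13_def P_rec[OF a field_P[OF b B], symmetric] add.commute[of 1])
    finally show ?case .
  qed (simp add: G_def)
  have d23: "(D23 ^^ n) (G k) = G (k + int n)" for n
  proof (induction n)
    case (Suc n)
    have "D23 (G (k + int n)) = G (k + int n + 1)"
      unfolding D23_def G_def P_0
      by (simp add: fun_eq_iff P_rec[OF b B] lin_diff[OF field_lin[OF a]])
    then show ?case by (simp add: Suc algebra_simps)
  qed simp
  have e: "G k = (\<lambda>m l c. ?G1 0 m l c + ?G2 0 m l c)"
    unfolding G_def P_derivation[OF a b B] ..
  have g1: "(D12 ^^ n) (?G1 0) = ?G1 (int n)" for n
  proof (induction n)
    case (Suc n)
    have "D12 (?G1 (int n)) m l c = P (\<lambda>l w. P a b (int n) (m + int N) l w - P a b (int n) m (l + int N) w) B k l c w" for m l c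
      unfolding D12_def P_left_diff[OF field_P[OF a b] field_shift[OF field_P[OF a b]] B] P_shift_left ..
    then have "D12 (?G1 (int n)) = ?G1 (int (Suc n))"
      unfolding P_rec[OF a b, symmetric] by (simp add: fun_eq_iff add.commute[of 1])
    then show ?case by (simp add: Suc)
  qed simp
  have g2: "(D13 ^^ n) (?G2 0) = ?G2 (int n)" for n
  proof (induction n)
    case (Suc n)
    have "D13 (?G2 (int n)) m l c = P b (\<lambda>l w. P a B (int n) (m + int N) l w - P a B (int n) m (l + int N) w) k l c w" for m l c
      unfolding D13_def P_right_diff[OF b field_P[OF a B] field_shift[OF field_P[OF a B]]] P_shift_right ..
    then have "D13 (?G2 (int n)) = ?G2 (int (Suc n))"
      unfolding P_rec[OF a B, symmetric] by (simp add: fun_eq_iff add.commute[of 1])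
    then show ?case by (simp add: Suc)
  qed simp
  \<comment> \<open>The factor \<open>(x - z)^KaB\<close> already removes the part with
    \<open>[a, B]\<close>; what is left is killed by \<open>(x - y)^Kab\<close> as well as by
    \<open>(y - z)^q\<close>, as \<open>D_nil\<close> requires.\<close>
  let ?G' = "(D13 ^^ KaB) (G k)"
  have "(D12 ^^ Kab) ?G' = (D13 ^^ KaB) ((D12 ^^ Kab) (G k))" by (rule funpow_comm[where S = D12 and T = D13], rule D_comm(1))
  also have "\<dots> = (\<lambda>m l c. (D13 ^^ KaB) ((D12 ^^ Kab) (?G1 0)) m l c + (D13 ^^ KaB) ((D12 ^^ Kab) (?G2 0)) m l c)"
    unfolding e D12_add_pow D13_add_pow ..
  also have "(D12 ^^ Kab) (?G1 0) = Z3" unfolding g1 ab[abs_def] P_left_zero[OF B] ..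
  also have "(D13 ^^ KaB) ((D12 ^^ Kab) (?G2 0)) = (D12 ^^ Kab) ((D13 ^^ KaB) (?G2 0))"
    by (rule funpow_comm[where S = D12 and T = D13, symmetric], rule D_comm(1))
  also have "(D13 ^^ KaB) (?G2 0) = Z3" unfolding g2 aB[abs_def] P_right_zero[OF b] ..
  finally have 1: "(D12 ^^ Kab) ?G' = Z3" by (simp add: funpow_fix D_zero)
  have "(D23 ^^ q) ?G' = (D13 ^^ KaB) ((D23 ^^ q) (G k))" by (rule funpow_comm[where S = D23 and T = D13], rule D_comm(3)[symmetric])
  also have "(D23 ^^ q) (G k) = Z3"
    unfolding d23 using bB by (simp add: G_def q_def P_0 lin_0[OF field_lin[OF a]])
  finally have 2: "(D23 ^^ q) ?G' = Z3" by (simp add: funpow_fix D_zero)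
  have "(D13 ^^ (Kab + q + KaB)) (G k) = Z3" using D_nil[OF 1 2] by (simp add: funpow_add)
  then have "P a (P b B k l) (int (Kab + q + KaB)) m c w = 0" for m c
    unfolding d13 by (simp add: fun_eq_iff)
  then have "\<And>m c w'. w' = w \<Longrightarrow> P a (P b B k l) (int (Kab + q + KaB)) m c w' = 0" by simp
  have "P a (P b B k l) (int (Kab + q + KaB) + int d) m c w = 0" for d m c
  proof (induction d arbitrary: m c)
    case (Suc d)
    have "P a (P b B k l) (int (Kab + q + KaB) + int d + 1) m c w = 0"
      unfolding P_rec[OF a field_P[OF b B]] Suc by simp
    then show ?case by (simp add: add_ac)
  qed (use \<open>\<And>m c. P a (P b B k l) (int (Kab + q + KaB)) m c w = 0\<close> in simp)
  from this[of "nat (n - int (Kab + q + KaB))"] show ?thesis using n by (simp add: q_def)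
qed

text \<open>A product is a finite combination of brackets \<open>P b B (k + i)\<close>, and the
  exponent that \<open>dong_P\<close> asks for does not grow with \<open>i\<close>.\<close>

lemma dong:
  assumes a: "fieldp a" and b: "fieldp b" and B: "fieldp B"
    and ab: "\<And>m l w. P a b (int Kab) m l w = 0"
    and aB: "\<And>m l w. P a B (int KaB) m l w = 0"
    and bB: "\<And>n m l w. KbB \<le> n \<Longrightarrow> P b B n m l w = 0"
    and n: "int (Kab + KaB + nat (KbB - k)) \<le> n"
  shows "P a (tprod s b B k) n m c w = 0"
proof -
  let ?B = "\<lambda>i e w. gb (- s) i \<odot> P b B (k + int i) s (e + (- s - int N * int i)) w"
  have f: "fieldp (\<lambda>e. P b B (k + int i) s (e + (- s - int N * int i)))" for i
    by (rule field_shift[OF field_P[OF b B]])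
  have "P a (\<lambda>e w. fsum (\<lambda>i. ?B i e w)) n m c w = fsum (\<lambda>i. P a (?B i) n m c w)"
  proof (rule P_right_fsum[OF _ _ a])
    show "fieldp (?B i)" for i by (rule field_scl[OF f])
    show "?B i = (\<lambda>m w. 0)" if "nat (KbB - k) \<le> i" for i
      using that bB[of "k + int i"] by simp
  qed
  also have "\<dots> = 0"
  proof (rule fsum_zero)
    fix i
    have "P a (P b B (k + int i) s) n m (c + (- s - int N * int i)) w = 0"
    proof (rule dong_P[OF a b B ab aB bB])
      have "int (nat (KbB - (k + int i))) \<le> int (nat (KbB - k))" by simp
      then show "int (Kab + KaB + nat (KbB - (k + int i))) \<le> n" using n by linarith
    qed
    then show "P a (?B i) n m c w = 0"
      unfolding P_right_scl[OF a f] P_shift_right by simp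
  qed
  finally show ?thesis by (simp add: tprod_def[abs_def] diff_diff_eq add_diff_eq)
qed

subsection \<open>Iterated products\<close>

text \<open>As a field in its last index, \<open>P b B k l\<close> is a finite combination of
  shifted products of \<open>b\<close> and \<open>B\<close>; this reduces iterated brackets to
  products.\<close>

lemma P_P_right:
  assumes a: "fieldp a" and j: "jac s b B C" and C: "\<And>k. fieldp (C k)" and l: "l mod int N = s mod int N"
  shows "P a (P b B k l) n m c w = fsum (\<lambda>r. gb l r \<odot> P a (C (k + int r)) n m (l + c - int N * int r) w)"
proof -
  obtain K where K: "\<And>n. n \<ge> K \<Longrightarrow> C n = (\<lambda>e w. 0)" using jac_vanishing[OF j] by blast
  let ?B = "\<lambda>r c w. gb l r \<odot> C (k + int r) (c + (l - int N * int r)) w"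
  have f: "fieldp (\<lambda>c. C (k + int r) (c + (l - int N * int r)))" for r by (rule field_shift[OF C])
  have "P b B k l = (\<lambda>c w. fsum (\<lambda>r. ?B r c w))"
    by (simp add: fun_eq_iff jac_eq[OF j l] R_def algebra_simps)
  then have "P a (P b B k l) n m c w = fsum (\<lambda>r. P a (?B r) n m c w)"
    using P_right_fsum[OF field_scl[OF f] _ a, of "nat (K - k)" "gb l"] by (simp add: K)
  also have "\<dots> = fsum (\<lambda>r. gb l r \<odot> P a (C (k + int r)) n m (l + c - int N * int r) w)"
    unfolding P_right_scl[OF a f] P_shift_right by (simp add: algebra_simps)
  finally show ?thesis .
qed

lemma P_P_left:
  assumes B: "fieldp B" and j: "jac s a b C" and C: "\<And>k. fieldp (C k)" and m: "m mod int N = s mod int N"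
  shows "P (P a b k m) B n l c w = fsum (\<lambda>i. gb m i \<odot> P (C (k + int i)) B n (m + l - int N * int i) c w)"
proof -
  obtain K where K: "\<And>n. n \<ge> K \<Longrightarrow> C n = (\<lambda>e w. 0)" using jac_vanishing[OF j] by blast
  let ?B = "\<lambda>r c w. gb m r \<odot> C (k + int r) (c + (m - int N * int r)) w"
  have f: "fieldp (\<lambda>c. C (k + int r) (c + (m - int N * int r)))" for r by (rule field_shift[OF C])
  have "P a b k m = (\<lambda>c w. fsum (\<lambda>r. ?B r c w))"
    by (simp add: fun_eq_iff jac_eq[OF j m] R_def algebra_simps)
  then have "P (P a b k m) B n l c w = fsum (\<lambda>r. P (?B r) B n l c w)"
    using P_left_fsum[OF field_scl[OF f] _ B, of "nat (K - k)" "gb m"] by (simp add: K)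
  also have "\<dots> = fsum (\<lambda>r. gb m r \<odot> P (C (k + int r)) B n (m + l - int N * int r) c w)"
    unfolding P_left_scl[OF f B] P_shift_left by (simp add: algebra_simps)
  finally show ?thesis .
qed

lemma field_L1:
  assumes b: "fieldp b" and B: "fieldp B" shows "fieldp (L1 b B k l)"
proof (rule fieldI[OF lin_L1[OF assms]])
  fix w
  obtain K where K: "\<forall>m\<ge>K. B m w = 0" using field_trunc[OF B] by blast
  have "L1 b B k l m w = 0" if "K \<le> m" for m
  proof -
    have "K \<le> m + int N * int i" for i
    proof -
      have "0 \<le> int N * int i" by simp
      then show ?thesis using that by linarith
    qed
    then show ?thesis unfolding L1_def using K by (simp add: lin_0[OF field_lin[OF b]])
  qed
  then show "\<exists>K. \<forall>m\<ge>K. L1 b B k l m w = 0" by blast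
qed

text \<open>Truncation for this order of the factors is inherited from \<open>P\<close>, where
  \<open>P_trunc\<close> has done the estimate.\<close>

lemma field_L1':
  assumes B: "fieldp B" and b: "fieldp b" shows "fieldp (\<lambda>c. L1 B b k c l)"
proof -
  have "(\<lambda>c. L1 B b k c l) = (\<lambda>c w. sg k \<odot> (L1 b B k l c w - P b B k l c w))"
    by (simp add: fun_eq_iff P_def)
  moreover have "fieldp (\<lambda>c w. sg k \<odot> (L1 b B k l c w - P b B k l c w))"
    by (rule field_scl[OF field_minus[OF field_L1[OF b B] field_P[OF b B]]])
  ultimately show ?thesis by simp
qed

text \<open>The joint expansion of two binomial factors with exponents \<open>n\<close> and
  \<open>k\<close>: one shape for all orders of three fields, so that they can be compared term by
  term.\<close>

definition TT :: "int \<Rightarrow> int \<Rightarrow> (nat \<Rightarrow> nat \<Rightarrow> 'w) \<Rightarrow> 'w" where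
  "TT n k f = fsum (\<lambda>i. fsum (\<lambda>j. (be n i * be k j) \<odot> f i j))"

lemma fin2_scl: "fin2 f \<Longrightarrow> fin2 (\<lambda>i j. c i j \<odot> f i j)"
  by (erule fin2_map) simp

lemma TT_diff: "fin2 f \<Longrightarrow> fin2 g \<Longrightarrow> TT n k f - TT n k g = TT n k (\<lambda>i j. f i j - g i j)"
  unfolding TT_def scale_right_diff_distrib by (rule fsum2_diff[symmetric]) (rule fin2_scl, assumption)+

lemma TT_swap: "fin2 f \<Longrightarrow> TT k n (\<lambda>j i. f i j) = TT n k f"
  unfolding TT_def by (subst fsum_swap) (auto intro: fin2_scl fin2_swap simp: mult.commute)

lemma TT_nest: "fin2 f \<Longrightarrow> TT n k f = fsum (\<lambda>i. be n i \<odot> fsum (\<lambda>j. be k j \<odot> f i j))"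
  unfolding TT_def
proof (rule arg_cong[of _ _ fsum], rule ext)
  fix i assume "fin2 f"
  then show "fsum (\<lambda>j. (be n i * be k j) \<odot> f i j) = be n i \<odot> fsum (\<lambda>j. be k j \<odot> f i j)"
    by (simp add: scl_fsum[OF fin1_scl[OF fin2_inner]])
qed

lemma TT_nest_lin:
  assumes "fin2 (\<lambda>i j. T i (f i j))" "\<And>i. lin (T i)" "\<And>i. fin1 (f i)"
  shows "TT n k (\<lambda>i j. T i (f i j)) = fsum (\<lambda>i. be n i \<odot> T i (fsum (\<lambda>j. be k j \<odot> f i j)))"
  unfolding TT_nest[OF assms(1)] lin_fsum[OF assms(2) fin1_scl[OF assms(3)]] lin_scale[OF assms(2)] ..

text \<open>The field that acts first carries both indices, so a bound on \<open>i + j\<close>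
  suffices. In \<open>fin2_2\<close> the bound for \<open>i\<close> depends on \<open>j\<close>, but
  only finitely many \<open>j\<close> occur.\<close>

lemma fin2_1:
  assumes "fieldp B" "\<And>i j. lin (T i j)"
  shows "fin2 (\<lambda>i j. T i j (B (c + int N * int i + int N * int j) w))"
proof -
  obtain K where "\<And>i. K \<le> i \<Longrightarrow> B (c + int N * int i) w = 0"
    using field_fin[OF assms(1), of c w] unfolding fin1_def by blast
  from this[of "_ + _"] show ?thesis
    by (intro fin2_diagI[of K]) (simp add: algebra_simps lin_0[OF assms(2)])
qed

lemma fin2_2:
  assumes A: "fieldp A" and B: "fieldp B" and T: "\<And>i j. lin (T i j)"
  shows "fin2 (\<lambda>i j. T i j (A (g j + int N * int i) (B (l + int N * int j) w)))"
proof -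
  obtain K where K: "\<And>i. K \<le> i \<Longrightarrow> B (l + int N * int i) w = 0"
    using field_fin[OF B, of l w] unfolding fin1_def by blast
  show ?thesis
  proof (rule fin2I1[of K])
    show "fin1 (\<lambda>i. T i j (A (g j + int N * int i) (B (l + int N * int j) w)))" for j
      by (rule fin1_lin[OF field_fin[OF A] T])
  qed (simp add: K lin_0[OF field_lin[OF A]] lin_0[OF T])
qed

text \<open>The three fields cannot be reordered, but each of the four orders is a double sum that
  is finite on a vector, since the fields that act first truncate it.\<close>

lemma P_P_expand:
  assumes a: "fieldp a" and b: "fieldp b" and B: "fieldp B"
  shows "P a (P b B k l) n m c w =
      TT n k (\<lambda>i j. a (m + int N * (n - int i)) (b (l + int N * (k - int j)) (B (c + int N * int i + int N * int j) w)))
    - sg k \<odot> TT n k (\<lambda>i j. a (m + int N * (n - int i)) (B (c + int N * (k - int j) + int N * int i) (b (l + int N * int j) w)))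
    - sg n \<odot> TT n k (\<lambda>i j. b (l + int N * (k - int j)) (B (c + int N * (n - int i) + int N * int j) (a (m + int N * int i) w)))
    + sg (n + k) \<odot> TT n k (\<lambda>i j. B (c + int N * (n - int i) + int N * (k - int j)) (b (l + int N * int j) (a (m + int N * int i) w)))"
    (is "_ = ?T1 - sg k \<odot> ?T2 - sg n \<odot> ?T3 + _ \<odot> ?T4")
proof -
  note la = field_lin[OF a] and lb = field_lin[OF b] and lB = field_lin[OF B]
  have 1: "?T1 = L1 a (L1 b B k l) n m c w"
    unfolding L1_def[of a] unfolding L1_def
    by (rule TT_nest_lin[OF fin2_1[OF B lin_comp[OF la lb]] la fin1_lin[OF field_fin[OF B] lb]])
  have 2: "?T2 = L1 a (\<lambda>c. L1 B b k c l) n m c w"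
  proof -
    have "?T2 = fsum (\<lambda>i. be n i \<odot> a (m + int N * (n - int i)) (fsum (\<lambda>j. be k j \<odot> (B (c + int N * (k - int j) + int N * int i) (b (l + int N * int j) w)))))"
      by (rule TT_nest_lin[OF fin2_2[OF B b la] la fin1_lin[OF field_fin[OF b] lB]])
    then show ?thesis unfolding L1_def[of a] unfolding L1_def by (simp add: add_ac)
  qed
  have f3: "fin2 (\<lambda>j i. b (l + int N * (k - int j)) (B (c + int N * (n - int i) + int N * int j) (a (m + int N * int i) w)))"
    by (rule fin2_2[OF B a lb])
  have f4: "fin2 (\<lambda>j i. B (c + int N * (n - int i) + int N * (k - int j)) (b (l + int N * int j) (a (m + int N * int i) w)))"
    by (rule fin2_2[OF b a lB])
  have 3: "?T3 = L1 (L1 b B k l) a n c m w"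
    unfolding L1_def[of _ a] unfolding L1_def
    by (rule TT_nest[OF fin2_swap[OF f3]])
  have 4: "?T4 = L1 (\<lambda>c. L1 B b k c l) a n c m w"
    unfolding L1_def[of _ a] unfolding L1_def
    by (rule TT_nest[OF fin2_swap[OF f4]])
  note fb = field_L1[OF b B] and fB = field_L1'[OF B b]
  have "L1 a (P b B k l) n m c w = L1 a (L1 b B k l) n m c w - sg k \<odot> L1 a (\<lambda>c. L1 B b k c l) n m c w"
    using L1_right_add[OF a fb field_scl[OF fB, of "- sg k"]] L1_right_scl[OF a fB, where c = "- sg k"]
    by (simp add: P_def[abs_def])
  moreover have "L1 (P b B k l) a n c m w = L1 (L1 b B k l) a n c m w - sg k \<odot> L1 (\<lambda>c. L1 B b k c l) a n c m w"
    using L1_left_add[OF fb field_scl[OF fB, of "- sg k"] a] L1_left_scl[OF fB a, where c = "- sg k"]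
    by (simp add: P_def[abs_def])
  ultimately show ?thesis
    unfolding 1 2 3 4 P_def[of a] by (simp add: sg_add scale_right_diff_distrib)
qed

end

context mode_calculus
begin

subsection \<open>The commutator of two products\<close>

lemma TT_conv:
  assumes "fin1 g"
  shows "TT n k (\<lambda>i j. g (i + j)) = fsum (\<lambda>s. be (n + k) s \<odot> g s)"
  unfolding TT_def using fsum_diag'[OF assms, of "\<lambda>i j x. (be n i * be k j) \<odot> x"]
  by (simp add: be_vandermonde flip: scale_sum_left)

text \<open>The weight comes from the mode number in the central term of a commutator. Absorbing it
  by \<open>(n - i) C(n,i) = n C(n-1,i)\<close> lowers the exponent by one, as differentiation of a
  power does; the Vandermonde identity then collects the sum.\<close>

lemma TT_conv_left:
  assumes "fin1 g"
  shows "TT n k (\<lambda>i j. (of_int n - of_nat i) \<odot> g (i + j)) = of_int n \<odot> fsum (\<lambda>s. be (n - 1 + k) s \<odot> g s)"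
proof -
  have "TT n k (\<lambda>i j. (of_int n - of_nat i) \<odot> g (i + j)) = TT (n - 1) k (\<lambda>i j. of_int n \<odot> g (i + j))"
    unfolding TT_def scale_scale
  proof (intro arg_cong[of _ _ fsum] ext arg_cong2[of _ _ _ _ scl] refl)
    fix i j
    show "be n i * be k j * (of_int n - of_nat i) = be (n - 1) i * be k j * of_int n"
      using be_absorb'[of n i] by (simp add: mult_ac del: of_int_diff)
  qed
  also have "\<dots> = fsum (\<lambda>s. be (n - 1 + k) s \<odot> of_int n \<odot> g s)"
    by (rule TT_conv[of "\<lambda>s. of_int n \<odot> g s", OF fin1_scl[OF assms]])
  also have "\<dots> = of_int n \<odot> fsum (\<lambda>s. be (n - 1 + k) s \<odot> g s)"
    unfolding scl_fsum[OF fin1_scl[OF assms]] by (simp add: mult.commute)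
  finally show ?thesis .
qed

lemma TT_conv_right:
  assumes "fin1 g"
  shows "TT n k (\<lambda>i j. of_nat i \<odot> g (i + j)) = - of_int n \<odot> fsum (\<lambda>s. be (n - 1 + k) s \<odot> g (Suc s))"
proof -
  have g2: "fin2 (\<lambda>i j. g (i + j))" using assms unfolding fin1_def by (meson fin2_diagI)
  have g': "fin1 (\<lambda>s. g (Suc s))" using fin1_shift[OF assms, of 1] by simp
  have f: "fin2 (\<lambda>i j. (be n i * be k j) \<odot> of_nat i \<odot> g (i + j))"
    by (rule fin2_scl[OF fin2_scl[OF g2]])
  have "TT n k (\<lambda>i j. of_nat i \<odot> g (i + j))
      = fsum (\<lambda>i. fsum (\<lambda>j. (be n (Suc i) * be k j) \<odot> of_nat (Suc i) \<odot> g (Suc i + j)))"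
    unfolding TT_def by (subst fsum_Suc[OF fin2_outer[OF f]]) simp
  also have "\<dots> = TT (n - 1) k (\<lambda>i j. (- of_int n) \<odot> g (Suc (i + j)))"
    unfolding TT_def scale_scale
  proof (intro arg_cong[of _ _ fsum] ext arg_cong2[of _ _ _ _ scl])
    fix i j
    show "be n (Suc i) * be k j * of_nat (Suc i) = be (n - 1) i * be k j * - of_int n"
      using be_absorb[of i n] by (simp add: mult_ac del: of_int_diff)
  qed simp
  also have "\<dots> = fsum (\<lambda>s. be (n - 1 + k) s \<odot> (- of_int n) \<odot> g (Suc s))"
    by (rule TT_conv[of "\<lambda>s. (- of_int n) \<odot> g (Suc s)", OF fin1_scl[OF g']])
  also have "\<dots> = - of_int n \<odot> fsum (\<lambda>s. be (n - 1 + k) s \<odot> g (Suc s))"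
    unfolding scl_fsum[OF fin1_scl[OF g']] by (simp add: mult.commute)
  finally show ?thesis .
qed

lemma TT_add: "fin2 f \<Longrightarrow> fin2 g \<Longrightarrow> TT n k (\<lambda>i j. f i j + g i j) = TT n k f + TT n k g"
  unfolding TT_def scale_right_distrib by (rule fsum2_add) (rule fin2_scl, assumption)+

lemma TT_scl: "fin2 f \<Longrightarrow> TT n k (\<lambda>i j. c \<odot> f i j) = c \<odot> TT n k f"
proof -
  assume f: "fin2 f"
  note g = fin2_scl[OF f, of "\<lambda>i j. be n i * be k j"]
  show ?thesis unfolding TT_def scl_fsum[OF fin2_outer[OF g]] scl_fsum[OF fin2_inner[OF g]]
    by (simp add: mult_ac)
qed

text \<open>Of the eight orders the four with \<open>B\<close> in the middle cancel in pairs; the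
  others combine to \<open>[a, b]\<close> applied after or before \<open>B\<close>.\<close>

lemma P_P_commutator:
  assumes a: "fieldp a" and b: "fieldp b" and B: "fieldp B"
  shows "P a (P b B k l) n m c w - P b (P a B n m) k l c w =
      TT n k (\<lambda>i j. P a b 0 (m + int N * (n - int i)) (l + int N * (k - int j)) (B (c + int N * int i + int N * int j) w))
      - sg (n + k) \<odot> TT n k (\<lambda>i j. B (c + int N * (n - int i) + int N * (k - int j)) (P a b 0 (m + int N * int i) (l + int N * int j) w))"
proof -
  note la = field_lin[OF a] and lb = field_lin[OF b] and lB = field_lin[OF B]
  let ?f1 = "\<lambda>i j. a (m + int N * (n - int i)) (b (l + int N * (k - int j)) (B (c + int N * int i + int N * int j) w))"
  let ?g1 = "\<lambda>i j. b (l + int N * (k - int j)) (a (m + int N * (n - int i)) (B (c + int N * int i + int N * int j) w))"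
  let ?f2 = "\<lambda>i j. a (m + int N * (n - int i)) (B (c + int N * (k - int j) + int N * int i) (b (l + int N * int j) w))"
  let ?f3 = "\<lambda>i j. b (l + int N * (k - int j)) (B (c + int N * (n - int i) + int N * int j) (a (m + int N * int i) w))"
  let ?f4 = "\<lambda>i j. B (c + int N * (n - int i) + int N * (k - int j)) (b (l + int N * int j) (a (m + int N * int i) w))"
  let ?g4 = "\<lambda>i j. B (c + int N * (n - int i) + int N * (k - int j)) (a (m + int N * int i) (b (l + int N * int j) w))"
  have f1: "fin2 ?f1" by (rule fin2_1[OF B lin_comp[OF la lb]])
  have g1: "fin2 ?g1" by (rule fin2_1[OF B lin_comp[OF lb la]])
  have f2: "fin2 ?f2" by (rule fin2_2[OF B b la])
  have f3': "fin2 (\<lambda>j i. ?f3 i j)" by (rule fin2_2[OF B a lb])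
  have f4': "fin2 (\<lambda>j i. ?f4 i j)" by (rule fin2_2[OF b a lB])
  note f3 = fin2_swap[OF f3'] and f4 = fin2_swap[OF f4']
  have g4: "fin2 ?g4" by (rule fin2_2[OF a b lB])
  have 1: "P b (P a B n m) k l c w = TT n k ?g1 - sg n \<odot> TT n k ?f3 - sg k \<odot> TT n k ?f2 + sg (n + k) \<odot> TT n k ?g4"
    unfolding P_P_expand[OF b a B, of n m k l c w]
    unfolding TT_swap[OF f3, symmetric] TT_swap[OF f2, symmetric] TT_swap[OF g4, symmetric] TT_swap[OF g1, symmetric]
    by (simp add: add_ac)
  have "P a (P b B k l) n m c w - P b (P a B n m) k l c w =
      (TT n k ?f1 - TT n k ?g1) - sg (n + k) \<odot> (TT n k ?g4 - TT n k ?f4)"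
    unfolding 1 P_P_expand[OF a b B, of k l n m c w] by (simp add: algebra_simps)
  also have "TT n k ?f1 - TT n k ?g1 = TT n k (\<lambda>i j. P a b 0 (m + int N * (n - int i)) (l + int N * (k - int j)) (B (c + int N * int i + int N * int j) w))"
    unfolding TT_diff[OF f1 g1] P_0 ..
  also have "TT n k ?g4 - TT n k ?f4 = TT n k (\<lambda>i j. B (c + int N * (n - int i) + int N * (k - int j)) (P a b 0 (m + int N * int i) (l + int N * int j) w))"
    unfolding TT_diff[OF g4 f4] P_0 lin_diff[OF lB] ..
  finally show ?thesis .
qed

text \<open>Since \<open>[a, b]\<close> is affine in the first mode number, \<open>m/N\<close> gives
  a fixed multiple of \<open>Z\<close>, while the summation index gives a derivative term with
  exponent \<open>n + k - 1\<close>. To the left and to the right of \<open>B\<close> its weights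
  are \<open>n - i\<close> and \<open>i\<close>; \<open>sg\<close> reconciles the signs.\<close>

lemma P_P_affine:
  assumes a: "fieldp a" and b: "fieldp b" and B: "fieldp B" and E: "fieldp E" and Z: "fieldp Z"
    and comm: "\<And>x y w. x mod int N = m mod int N \<Longrightarrow>
      P a b 0 x y w = E (x + y) w + (of_int x / of_nat N) \<odot> Z (x + y - int N) w"
  shows "P a (P b B k l) n m c w - P b (P a B n m) k l c w =
      P E B (n + k) (m + l) c w + (of_int m / of_nat N) \<odot> P Z B (n + k) (m + l - int N) c w
      + of_int n \<odot> P Z B (n + k - 1) (m + l) c w"
proof -
  note lE = field_lin[OF E] and lZ = field_lin[OF Z] and lB = field_lin[OF B]
  let ?m = "of_int m / of_nat N :: complex"
  define e1 where "e1 s = E (m + l + int N * (n + k - int s)) (B (c + int N * int s) w)" for s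
  define z1 where "z1 s = Z (m + l - int N + int N * (n + k - int s)) (B (c + int N * int s) w)" for s
  define e2 where "e2 s = B (c + int N * (n + k - int s)) (E (m + l + int N * int s) w)" for s
  define z2 where "z2 s = B (c + int N * (n + k - int s)) (Z (m + l - int N + int N * int s) w)" for s
  have fe1: "fin1 e1" unfolding e1_def by (rule fin1_lin[OF field_fin[OF B] lE])
  have fz1: "fin1 z1" unfolding z1_def by (rule fin1_lin[OF field_fin[OF B] lZ])
  have fe2: "fin1 e2" unfolding e2_def by (rule fin1_lin[OF field_fin[OF E] lB])
  have fz2: "fin1 z2" unfolding z2_def by (rule fin1_lin[OF field_fin[OF Z] lB])
  have fin2_sum: "fin2 (\<lambda>i j. g (i + j))" if "fin1 g" for g :: "nat \<Rightarrow> 'w"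
    using that unfolding fin1_def by (meson fin2_diagI)
  have N: "of_int (m + int N * x) / of_nat N = ?m + (of_int x :: complex)" for x by (rule gb_shift)
  have comm': "P a b 0 (m + int N * x) y w = E (m + int N * x + y) w
      + (?m + of_int x) \<odot> Z (m + int N * x + y - int N) w" for x y w
    unfolding N[symmetric] by (rule comm) (rule mod_mult_self2)
  have q1: "P a b 0 (m + int N * (n - int i)) (l + int N * (k - int j)) (B (c + int N * int i + int N * int j) w)
     = e1 (i + j) + (?m \<odot> z1 (i + j) + (of_int n - of_nat i) \<odot> z1 (i + j))" for i j
    unfolding comm' e1_def z1_def scale_left_distrib[symmetric] by (simp add: algebra_simps)
  have q2: "B (c + int N * (n - int i) + int N * (k - int j)) (P a b 0 (m + int N * int i) (l + int N * int j) w)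
     = e2 (i + j) + (?m \<odot> z2 (i + j) + of_nat i \<odot> z2 (i + j))" for i j
    unfolding comm' e2_def z2_def lin_add[OF lB] lin_scale[OF lB] scale_left_distrib[symmetric] by (simp add: algebra_simps)
  have r1: "TT n k (\<lambda>i j. P a b 0 (m + int N * (n - int i)) (l + int N * (k - int j)) (B (c + int N * int i + int N * int j) w))
     = L1 E B (n + k) (m + l) c w + (?m \<odot> L1 Z B (n + k) (m + l - int N) c w + of_int n \<odot> L1 Z B (n + k - 1) (m + l) c w)"
  proof -
    have "(\<lambda>s. be (n - 1 + k) s \<odot> z1 s) = (\<lambda>i. be (n + k - 1) i \<odot> Z (m + l + int N * (n + k - 1 - int i)) (B (c + int N * int i) w))"
      by (simp add: z1_def algebra_simps)
    moreover have "(\<lambda>s. be (n + k) s \<odot> e1 s) = (\<lambda>i. be (n + k) i \<odot> E (m + l + int N * (n + k - int i)) (B (c + int N * int i) w))"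
      by (simp add: e1_def)
    moreover have "(\<lambda>s. be (n + k) s \<odot> z1 s) = (\<lambda>i. be (n + k) i \<odot> Z (m + l - int N + int N * (n + k - int i)) (B (c + int N * int i) w))"
      by (simp add: z1_def)
    ultimately show ?thesis
      unfolding q1 L1_def
      by (simp only: TT_add fin2_add fin2_sum fin2_scl fe1 fz1 TT_scl TT_conv TT_conv_left)
  qed
  have r2: "TT n k (\<lambda>i j. B (c + int N * (n - int i) + int N * (k - int j)) (P a b 0 (m + int N * int i) (l + int N * int j) w))
     = L1 B E (n + k) c (m + l) w + (?m \<odot> L1 B Z (n + k) c (m + l - int N) w - of_int n \<odot> L1 B Z (n + k - 1) c (m + l) w)"
  proof -
    have "(\<lambda>s. be (n - 1 + k) s \<odot> z2 (Suc s)) = (\<lambda>i. be (n + k - 1) i \<odot> B (c + int N * (n + k - 1 - int i)) (Z (m + l + int N * int i) w))"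
      by (simp add: z2_def algebra_simps)
    moreover have "(\<lambda>s. be (n + k) s \<odot> e2 s) = (\<lambda>i. be (n + k) i \<odot> B (c + int N * (n + k - int i)) (E (m + l + int N * int i) w))"
      by (simp add: e2_def)
    moreover have "(\<lambda>s. be (n + k) s \<odot> z2 s) = (\<lambda>i. be (n + k) i \<odot> B (c + int N * (n + k - int i)) (Z (m + l - int N + int N * int i) w))"
      by (simp add: z2_def)
    ultimately show ?thesis
      unfolding q2 L1_def
      by (simp only: TT_add fin2_add fin2_sum fin2_scl fe2 fz2 TT_scl TT_conv TT_conv_right scale_minus_left) simp
  qed
  have s: "sg (n + k - 1) = - sg (n + k)" by (simp add: sg_def)
  show ?thesis
    unfolding P_P_commutator[OF a b B] r1 r2 P_def[of E B] P_def[of Z B] s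
    by (simp add: scale_right_distrib scale_right_diff_distrib mult.commute)
qed

text \<open>The modes of \<open>1_W\<close>.\<close>

definition idm :: "int \<Rightarrow> 'w \<Rightarrow> 'w" where
  "idm m w = (if m = - int N then w else 0)"

lemma field_idm: "fieldp idm"
proof (rule fieldI)
  show "lin (idm m)" for m by (rule linI) (simp_all add: idm_def)
  show "\<exists>K. \<forall>m\<ge>K. idm m w = 0" for w by (rule exI[of _ 0]) (use N_pos in \<open>auto simp: idm_def\<close>)
qed

lemma P_idm_left: "fieldp B \<Longrightarrow> 0 \<le> n \<Longrightarrow> P idm B n m l w = 0"
  by (rule P_zero_up[OF field_idm, of _ 0]) (simp_all add: P_0 idm_def lin_0[OF field_lin])

lemma P_idm_right: "fieldp B \<Longrightarrow> 0 \<le> n \<Longrightarrow> P B idm n m l w = 0"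
  by (rule P_zero_up[OF _ field_idm, of _ 0]) (simp_all add: P_0 idm_def lin_0[OF field_lin])

lemma jac_idm:
  assumes B: "fieldp B"
  shows "jac 0 idm B (\<lambda>n. if n = - 1 then B else (\<lambda>e w. 0))"
proof (rule jac_one[OF field_idm B _ P_idm_left[OF B]])
  show "vanishing (\<lambda>n. if n = - 1 then B else (\<lambda>e w. 0))" by (rule exI[of _ 0]) auto
  fix n l w
  have 1: "L1 B idm n l 0 w = 0"
  proof -
    have "0 + int N * int i \<noteq> - int N" for i
    proof -
      have "0 \<le> int N * int i" by simp
      then show ?thesis using N_pos by linarith
    qed
    then show ?thesis unfolding L1_def idm_def by (simp add: lin_0[OF field_lin[OF B]])
  qed
  have e: "0 + int N * (n - int i) = - int N \<longleftrightarrow> int i = n + 1" for i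
  proof -
    have "0 + int N * (n - int i) = - int N \<longleftrightarrow> int N * (n - int i) = int N * (- 1)" by simp
    also have "\<dots> \<longleftrightarrow> n - int i = - 1" unfolding mult_cancel_left using N_pos by simp
    finally show ?thesis by auto
  qed
  have 2: "L1 idm B n 0 l w = (if n = - 1 then B l w else 0)"
  \<comment> \<open>The only index that can contribute is \<open>n + 1\<close>. For
    \<open>n \<ge> 0\<close> its binomial coefficient is 0, for \<open>n = -1\<close> it is the
    index 0, and for smaller \<open>n\<close> there is none.\<close>
  proof (cases "n \<ge> 0")
    case True
    then obtain n' where n': "n = int n'" by (metis nonneg_int_cases)
    have z: "be n i = 0" if "int i = n + 1" for i
    proof -
      have "i = Suc n'" using that n' by simp
      then show ?thesis unfolding n' be_nat by simp
    qed
    have "L1 idm B n 0 l w = 0"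
      unfolding L1_def idm_def e by (rule fsum_zero) (simp add: z)
    then show ?thesis using True by simp
  next
    case False
    have "L1 idm B n 0 l w = be n 0 \<odot> idm (0 + int N * (n - int 0)) (B (l + int N * int 0) w)"
      unfolding L1_def by (rule fsum_single) (use False in \<open>simp add: idm_def e del: add_0\<close>)
    then show ?thesis unfolding idm_def e by auto
  qed
  have 3: "R (\<lambda>n. if n = - 1 then B else (\<lambda>e w. 0)) n 0 l w = (if n = - 1 then B l w else 0)"
  proof -
    have "R (\<lambda>n. if n = - 1 then B else (\<lambda>e w. 0)) n 0 l w =
        gb 0 0 \<odot> (if n + int 0 = - 1 then B else (\<lambda>e w. 0)) (0 + l - int N * int 0) w"
      unfolding R_def by (rule fsum_single) (simp add: gb_zero)
    then show ?thesis by auto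
  qed
  show "P idm B n 0 l w = R (\<lambda>n. if n = - 1 then B else (\<lambda>e w. 0)) n 0 l w"
    unfolding P_def 1 2 3 by simp
qed

end

section \<open>Commutators of the product operations\<close>

context mode_calculus
begin

lemma vanishing_nat: "vanishing C \<Longrightarrow> \<exists>I. \<forall>i\<ge>I. C (n + int i) = (\<lambda>e w. 0)"
proof -
  assume "vanishing C"
  then obtain K where "\<And>n. n \<ge> K \<Longrightarrow> C n = (\<lambda>e w. 0)" by blast
  then show ?thesis by (intro exI[of _ "nat (K - n)"]) (simp add: nat_le_iff)
qed

lemma jac_right_zero:
  assumes "jac s a (\<lambda>e w. 0) C" "fieldp a"
  shows "C n = (\<lambda>e w. 0)"
proof -
  have "jac s a (\<lambda>e w. 0) (\<lambda>n e w. 0)"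
    unfolding jac_def by (auto simp: P_right_zero[OF assms(2)] R_zero)
  from jac_unique[OF assms(1) this] show ?thesis by simp
qed

text \<open>\<open>[a_n, b_k] B = [a, b]_(n+k) B + n \<kappa> \<delta>_(n+k,0) B\<close>, where \<open>E\<close> is the field of \<open>[a, b]\<close>.\<close>

lemma jac_commutator:
  assumes a: "fieldp a" and b: "fieldp b" and B: "fieldp B" and E: "fieldp E"
    and Ca: "\<And>n. fieldp (Ca n)" and Cb: "\<And>k. fieldp (Cb k)"
    and Ja: "jac s a B Ca" and Jb: "jac t b B Cb" and JE: "jac (s + t) E B CE"
    and Jab: "\<And>k. jac s a (Cb k) (Cab k)" and Jba: "\<And>n. jac t b (Ca n) (Cba n)"
    and comm: "\<And>x y w. x mod int N = s mod int N \<Longrightarrow>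
      P a b 0 x y w = E (x + y) w + (of_int x / of_nat N) \<odot> \<kappa> \<odot> idm (x + y - int N) w"
    and kappa: "\<kappa> \<noteq> 0 \<Longrightarrow> (s + t) mod int N = 0"
  shows "Cab k n e w - Cba n k e w = CE (n + k) e w + (if n + k = 0 then (of_int n * \<kappa>) \<odot> B e w else 0)"
proof -
  define I where "I = (\<lambda>n::int. if n = - 1 then B else (\<lambda>e w. 0))"
  \<comment> \<open>The defect of the claim. \<open>main\<close> shows that its transform by
    \<open>gb\<close> in both indices vanishes; \<open>R_inj\<close> inverts the transform in
    \<open>k\<close> and then in \<open>n\<close>.\<close>
  define X where "X n k e w = Cab k n e w - Cba n k e w - CE (n + k) e w
     - (if n + k = 0 then (of_int n * \<kappa>) \<odot> B e w else 0)" for n k e w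
  have I: "vanishing I" unfolding I_def by (rule exI[of _ 0]) auto
  note vE = jac_vanishing[OF JE] and va = jac_vanishing[OF Ja] and vb = jac_vanishing[OF Jb]
  have vab: "Cab k = (\<lambda>n e w. 0)" if "Cb k = (\<lambda>e w. 0)" for k
    using jac_right_zero[OF _ a, of s "Cab k"] Jab[of k] that by auto
  have vba: "Cba n = (\<lambda>k e w. 0)" if "Ca n = (\<lambda>e w. 0)" for n
    using jac_right_zero[OF _ b, of t "Cba n"] Jba[of n] that by auto
  have PZ: "P (\<lambda>m w. \<kappa> \<odot> idm m w) B n m c w = \<kappa> \<odot> R I n m c w" if "m mod int N = (s + t) mod int N" for n m c w
  proof (cases "\<kappa> = 0")
    case False
    then show ?thesis
      using jac_eq[OF jac_idm[OF B], of m n c w] kappa that by (simp add: P_left_scl[OF field_idm B] I_def)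
  qed (simp add: P_left_zero[OF B])
  have main: "fsum (\<lambda>r. gb t r \<odot> fsum (\<lambda>i. gb s i \<odot> X (n + int i) (k + int r) (s + t + c - int N * int r - int N * int i) w)) = 0" for n k c w
  proof -
    define Q where "Q i r = s + t + c - int N * int r - int N * int i" for i r :: nat
    have 1: "P a (P b B k t) n s c w = fsum (\<lambda>r. fsum (\<lambda>i. (gb t r * gb s i) \<odot> Cab (k + int r) (n + int i) (Q i r) w))"
    proof -
      have "P a (P b B k t) n s c w = fsum (\<lambda>r. gb t r \<odot> P a (Cb (k + int r)) n s (t + c - int N * int r) w)"
        by (rule P_P_right[OF a Jb Cb refl])
      also have "\<dots> = fsum (\<lambda>r. fsum (\<lambda>i. (gb t r * gb s i) \<odot> Cab (k + int r) (n + int i) (Q i r) w))"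
        unfolding jac_eq[OF Jab refl] R_def scl_fsum[OF fin_R[OF jac_vanishing[OF Jab]]]
        by (simp add: Q_def algebra_simps)
      finally show ?thesis .
    qed
    have f1: "fin2 (\<lambda>r i. (gb t r * gb s i) \<odot> Cab (k + int r) (n + int i) (Q i r) w)"
    proof -
      obtain K where K: "\<And>i. i \<ge> K \<Longrightarrow> Cb (k + int i) = (\<lambda>e w. 0)" using vanishing_nat[OF vb] by blast
      show ?thesis
        by (rule fin2I2[of K]) (simp add: vab[OF K], rule fin1_scl, rule vanishing_fin[OF jac_vanishing[OF Jab]])
    qed
    have f2: "fin2 (\<lambda>i r. (gb t r * gb s i) \<odot> Cba (n + int i) (k + int r) (Q i r) w)"
    proof -
      obtain K where K: "\<And>i. i \<ge> K \<Longrightarrow> Ca (n + int i) = (\<lambda>e w. 0)" using vanishing_nat[OF va] by blast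
      show ?thesis
        by (rule fin2I2[of K]) (simp add: vba[OF K], rule fin1_scl, rule vanishing_fin[OF jac_vanishing[OF Jba]])
    qed
    have 2: "P b (P a B n s) k t c w = fsum (\<lambda>r. fsum (\<lambda>i. (gb t r * gb s i) \<odot> Cba (n + int i) (k + int r) (Q i r) w))"
    proof -
      have "P b (P a B n s) k t c w = fsum (\<lambda>i. gb s i \<odot> P b (Ca (n + int i)) k t (s + c - int N * int i) w)"
        by (rule P_P_right[OF b Ja Ca refl])
      also have "\<dots> = fsum (\<lambda>i. fsum (\<lambda>r. (gb t r * gb s i) \<odot> Cba (n + int i) (k + int r) (Q i r) w))"
        unfolding jac_eq[OF Jba refl] R_def scl_fsum[OF fin_R[OF jac_vanishing[OF Jba]]]
        by (simp add: Q_def algebra_simps)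
      also have "\<dots> = fsum (\<lambda>r. fsum (\<lambda>i. (gb t r * gb s i) \<odot> Cba (n + int i) (k + int r) (Q i r) w))"
        by (rule fsum_swap[OF f2])
      finally show ?thesis .
    qed
    define g where "g q = CE (n + k + int q) (s + t + c - int N * int q) w" for q :: nat
    have fg: "fin1 g" unfolding g_def by (rule vanishing_fin[OF vE])
    \<comment> \<open>The delta term as a sequence with at most one nonzero entry, at
      \<open>q = - n - k\<close>, so that it passes through the same sums as the products.\<close>
    define h where "h q = (if n + k + int q = 0 then \<kappa> \<odot> B (s + t + c - int N * int q) w else 0)" for q :: nat
    have fh: "fin1 h" unfolding h_def by (rule fin1I[of "nat (1 - n - k)"]) auto
    have fin2_sum: "fin2 (\<lambda>r i. x (r + i))" if "fin1 x" for x :: "nat \<Rightarrow> 'w"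
      using that unfolding fin1_def by (meson fin2_diagI)
    have gg: "(\<Sum>r\<le>q. gb t r * gb s (q - r)) = gb (s + t) q" for q
      using gb_vandermonde[of t s q] by (simp add: add.commute)
    have 3: "P E B (n + k) (s + t) c w = fsum (\<lambda>r. fsum (\<lambda>i. (gb t r * gb s i) \<odot> g (r + i)))"
      unfolding jac_eq[OF JE refl] R_def fsum_diag[OF fin2_scl[OF fin2_sum[OF fg]]]
      by (simp add: g_def gg flip: scale_sum_left)
    have 4: "(of_int s / of_nat N) \<odot> P (\<lambda>m w. \<kappa> \<odot> idm m w) B (n + k) (s + t - int N) c w
       + of_int n \<odot> P (\<lambda>m w. \<kappa> \<odot> idm m w) B (n + k - 1) (s + t) c w
       = fsum (\<lambda>r. fsum (\<lambda>i. (gb t r * gb s i) \<odot> (of_int n + of_nat i) \<odot> h (r + i)))"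
    proof -
      have fh': "fin1 (\<lambda>q. h (Suc q))" using fin1_shift[OF fh, of 1] by simp
      \<comment> \<open>The central weight \<open>n + i\<close> contains the index \<open>i\<close>
        of the expansion in \<open>a\<close>; \<open>i C(s/N,i) = (s/N) C(s/N - 1, i - 1)\<close>
        absorbs it, which is the origin of \<open>q - 1\<close>.\<close>
      have c: "(\<Sum>r\<le>q. gb t r * gb s (q - r) * of_nat (q - r)) = (if q = 0 then 0 else (of_int s / of_nat N) * gb (s + t - int N) (q - 1))" for q
      proof (cases q)
        case (Suc p)
        have "(\<Sum>r\<le>q. gb t r * gb s (q - r) * of_nat (q - r)) = (\<Sum>r\<le>p. gb t r * gb s (Suc (p - r)) * of_nat (Suc (p - r)))"
          unfolding Suc sum.atMost_Suc diff_self_eq_0 of_nat_0 mult_zero_right add_0_right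
          by (rule sum.cong) (simp_all only: Suc_diff_le atMost_iff)
        also have "\<dots> = (\<Sum>r\<le>p. (of_int s / of_nat N) * (gb t r * gb (s - int N) (p - r)))"
        proof (rule sum.cong[OF refl])
          fix r
          have "of_nat (Suc (p - r)) * gb s (Suc (p - r)) = (of_int s / of_nat N) * gb (s - int N) (p - r)"
            using gbinomial_absorption[of "p - r" "of_int s / of_nat N :: complex"] gb_shift[of s "-1"] by (simp add: gb_def del: of_nat_Suc)
          then show "gb t r * gb s (Suc (p - r)) * of_nat (Suc (p - r)) = (of_int s / of_nat N) * (gb t r * gb (s - int N) (p - r))"
            by (simp only: mult_ac)
        qed
        also have "\<dots> = (of_int s / of_nat N) * gb (s + t - int N) p"
          using gb_vandermonde[of t "s - int N" p] by (simp only: sum_distrib_left[symmetric]) (simp add: algebra_simps)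
        finally show ?thesis by (simp add: Suc)
      qed simp
      have "fsum (\<lambda>r. fsum (\<lambda>i. (gb t r * gb s i) \<odot> (of_int n + of_nat i) \<odot> h (r + i)))
         = fsum (\<lambda>q. \<Sum>r\<le>q. (gb t r * gb s (q - r)) \<odot> (of_int n + of_nat (q - r)) \<odot> h q)"
        using fsum_diag[OF fin2_scl[OF fin2_scl[OF fin2_sum[OF fh]]]] by simp
      also have "\<dots> = fsum (\<lambda>q. of_int n \<odot> gb (s + t) q \<odot> h q
           + (if q = 0 then 0 else (of_int s / of_nat N) * gb (s + t - int N) (q - 1)) \<odot> h q)"
      proof (intro arg_cong[of _ _ fsum] ext)
        fix q
        have "(\<Sum>r\<le>q. (gb t r * gb s (q - r)) \<odot> (of_int n + of_nat (q - r)) \<odot> h q)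
          = (\<Sum>r\<le>q. of_int n * (gb t r * gb s (q - r)) + gb t r * gb s (q - r) * of_nat (q - r)) \<odot> h q"
          unfolding scale_sum_left scale_scale by (simp only: distrib_left distrib_right mult.commute)
        also have "\<dots> = (of_int n * gb (s + t) q + (if q = 0 then 0 else (of_int s / of_nat N) * gb (s + t - int N) (q - 1))) \<odot> h q"
          unfolding c[symmetric] gg[symmetric] sum.distrib sum_distrib_left ..
        finally show "(\<Sum>r\<le>q. (gb t r * gb s (q - r)) \<odot> (of_int n + of_nat (q - r)) \<odot> h q)
          = of_int n \<odot> gb (s + t) q \<odot> h q
           + (if q = 0 then 0 else (of_int s / of_nat N) * gb (s + t - int N) (q - 1)) \<odot> h q"
          by (simp only: scale_left_distrib scale_scale)
      qed
      also have "\<dots> = fsum (\<lambda>q. of_int n \<odot> gb (s + t) q \<odot> h q)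
           + fsum (\<lambda>q. (if q = 0 then 0 else (of_int s / of_nat N) * gb (s + t - int N) (q - 1)) \<odot> h q)"
        by (rule fsum_add[OF fin1_scl[OF fin1_scl[OF fh]] fin1_scl[OF fh]])
      also have "fsum (\<lambda>q. (if q = 0 then 0 else (of_int s / of_nat N) * gb (s + t - int N) (q - 1)) \<odot> h q)
          = fsum (\<lambda>q. (of_int s / of_nat N) \<odot> gb (s + t - int N) q \<odot> h (Suc q))"
        by (subst fsum_Suc[OF fin1_scl[OF fh]]) simp
      also have "\<dots> = (of_int s / of_nat N) \<odot> fsum (\<lambda>q. gb (s + t - int N) q \<odot> h (Suc q))"
        by (rule scl_fsum[OF fin1_scl[OF fh'], symmetric])
      also have "fsum (\<lambda>q. of_int n \<odot> gb (s + t) q \<odot> h q) = of_int n \<odot> fsum (\<lambda>q. gb (s + t) q \<odot> h q)"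
        by (rule scl_fsum[OF fin1_scl[OF fh], symmetric])
      also have "fsum (\<lambda>q. gb (s + t) q \<odot> h q) = P (\<lambda>m w. \<kappa> \<odot> idm m w) B (n + k - 1) (s + t) c w"
        unfolding PZ[OF refl] R_def scl_fsum[OF fin_R[OF I]]
      proof (intro arg_cong[of _ _ fsum] ext)
        fix q
        show "gb (s + t) q \<odot> h q = \<kappa> \<odot> gb (s + t) q \<odot> I (n + k - 1 + int q) (s + t + c - int N * int q) w"
          by (simp add: h_def I_def mult.commute)
      qed
      also have "fsum (\<lambda>q. gb (s + t - int N) q \<odot> h (Suc q)) = P (\<lambda>m w. \<kappa> \<odot> idm m w) B (n + k) (s + t - int N) c w"
      proof -
        have m: "(s + t - int N) mod int N = (s + t) mod int N" by simp
        have e: "gb (s + t - int N) q \<odot> h (Suc q) = \<kappa> \<odot> gb (s + t - int N) q \<odot> I (n + k + int q) (s + t - int N + c - int N * int q) w" for q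
          by (auto simp: h_def I_def algebra_simps)
        show ?thesis unfolding PZ[OF m] R_def scl_fsum[OF fin_R[OF I]] e ..
      qed
      finally show ?thesis by (simp only: add.commute)
    qed
    have "P a (P b B k t) n s c w - P b (P a B n s) k t c w =
      P E B (n + k) (s + t) c w + (of_int s / of_nat N) \<odot> P (\<lambda>m w. \<kappa> \<odot> idm m w) B (n + k) (s + t - int N) c w
      + of_int n \<odot> P (\<lambda>m w. \<kappa> \<odot> idm m w) B (n + k - 1) (s + t) c w"
      by (rule P_P_affine[OF a b B E field_scl[OF field_idm]]) (rule comm)
    note this[unfolded add.assoc[of "P E B (n + k) (s + t) c w"] 4, unfolded 1 2 3]
    moreover have "fsum (\<lambda>r. fsum (\<lambda>i. (gb t r * gb s i) \<odot> Cab (k + int r) (n + int i) (Q i r) w))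
       - fsum (\<lambda>r. fsum (\<lambda>i. (gb t r * gb s i) \<odot> Cba (n + int i) (k + int r) (Q i r) w))
       - fsum (\<lambda>r. fsum (\<lambda>i. (gb t r * gb s i) \<odot> g (r + i)))
       - fsum (\<lambda>r. fsum (\<lambda>i. (gb t r * gb s i) \<odot> (of_int n + of_nat i) \<odot> h (r + i)))
       = fsum (\<lambda>r. fsum (\<lambda>i. (gb t r * gb s i) \<odot> Cab (k + int r) (n + int i) (Q i r) w
            - (gb t r * gb s i) \<odot> Cba (n + int i) (k + int r) (Q i r) w
            - (gb t r * gb s i) \<odot> g (r + i) - (gb t r * gb s i) \<odot> (of_int n + of_nat i) \<odot> h (r + i)))"
      using f1 fin2_swap[OF f2] fin2_scl[OF fin2_sum[OF fg], of "\<lambda>r i. gb t r * gb s i"]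
        fin2_scl[OF fin2_scl[OF fin2_sum[OF fh]], of "\<lambda>r i. gb t r * gb s i" "\<lambda>r i. of_int n + of_nat i"]
      by (simp only: fsum2_diff fin2_diff)
    moreover have "fsum (\<lambda>i. (gb t r * gb s i) \<odot> Cab (k + int r) (n + int i) (Q i r) w
            - (gb t r * gb s i) \<odot> Cba (n + int i) (k + int r) (Q i r) w
            - (gb t r * gb s i) \<odot> g (r + i) - (gb t r * gb s i) \<odot> (of_int n + of_nat i) \<odot> h (r + i))
        = gb t r \<odot> fsum (\<lambda>i. gb s i \<odot> X (n + int i) (k + int r) (s + t + c - int N * int r - int N * int i) w)" for r
    proof -
      have e: "(gb t r * gb s i) \<odot> Cab (k + int r) (n + int i) (Q i r) w
            - (gb t r * gb s i) \<odot> Cba (n + int i) (k + int r) (Q i r) w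
            - (gb t r * gb s i) \<odot> g (r + i) - (gb t r * gb s i) \<odot> (of_int n + of_nat i) \<odot> h (r + i)
          = gb t r \<odot> gb s i \<odot> X (n + int i) (k + int r) (s + t + c - int N * int r - int N * int i) w" for i
        by (simp add: X_def Q_def g_def h_def scale_right_diff_distrib algebra_simps)
      have "fin1 (\<lambda>i. X (n + int i) (k + int r) (s + t + c - int N * int r - int N * int i) w)"
      proof -
        let ?e = "\<lambda>i. s + t + c - int N * int r - int N * int i"
        have "fin1 (\<lambda>i. if n + int i + (k + int r) = 0 then (of_int (n + int i) * \<kappa>) \<odot> B (?e i) w else 0)"
          by (rule fin1I[of "nat (1 - n - k)"]) auto
        moreover have "fin1 (\<lambda>i. CE (n + int i + (k + int r)) (?e i) w)"
          using vanishing_fin[OF vE, of "n + (k + int r)" ?e w] by (simp add: add_ac)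
        moreover have "fin1 (\<lambda>i. Cab (k + int r) (n + int i) (?e i) w)"
          by (rule vanishing_fin[OF jac_vanishing[OF Jab]])
        moreover have "fin1 (\<lambda>i. Cba (n + int i) (k + int r) (?e i) w)"
        proof -
          obtain K where K: "\<And>i. i \<ge> K \<Longrightarrow> Ca (n + int i) = (\<lambda>e w. 0)" using vanishing_nat[OF va] by blast
          show ?thesis by (rule fin1I[of K]) (simp add: vba[OF K])
        qed
        ultimately show ?thesis unfolding X_def by (simp only: fin1_diff)
      qed
      then show ?thesis unfolding e by (rule scl_fsum[OF fin1_scl, symmetric])
    qed
    ultimately show ?thesis by (simp add: algebra_simps)
  qed
  have Xn: "vanishing (\<lambda>n. X n k)" for k
  proof -
    obtain K1 where "\<And>n. n \<ge> K1 \<Longrightarrow> Cab k n = (\<lambda>e w. 0)" using jac_vanishing[OF Jab] by blast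
    moreover obtain K2 where "\<And>n. n \<ge> K2 \<Longrightarrow> Ca n = (\<lambda>e w. 0)" using va by blast
    moreover obtain K3 where "\<And>n. n \<ge> K3 \<Longrightarrow> CE n = (\<lambda>e w. 0)" using vE by blast
    ultimately show ?thesis
      by (intro exI[of _ "max (max K1 K2) (max (K3 - k) (1 - k))"]) (auto simp: X_def fun_eq_iff vba)
  qed
  \<comment> \<open>The transform in \<open>n\<close> alone. Its vanishing for large
    \<open>k\<close> must be uniform in \<open>i\<close>: all but finitely many
    \<open>Ca (n + i)\<close> are zero, and each of the others has its own bound
    \<open>f i\<close>.\<close>
  define F where "F n k e w = fsum (\<lambda>i. gb s i \<odot> X (n + int i) k (e - int N * int i) w)" for n k e w
  have Fk: "vanishing (F n)" for n
  proof -
    obtain I where I: "\<And>i. i \<ge> I \<Longrightarrow> Ca (n + int i) = (\<lambda>e w. 0)" using vanishing_nat[OF va] by blast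
    obtain K1 where K1: "\<And>k. k \<ge> K1 \<Longrightarrow> Cb k = (\<lambda>e w. 0)" using vb by blast
    have "\<forall>i. \<exists>K. \<forall>k\<ge>K. Cba (n + int i) k = (\<lambda>e w. 0)" using jac_vanishing[OF Jba] by blast
    from choice[OF this] obtain f where f: "\<And>i k. k \<ge> f i \<Longrightarrow> Cba (n + int i) k = (\<lambda>e w. 0)" by blast
    obtain K3 where K3: "\<And>n. n \<ge> K3 \<Longrightarrow> CE n = (\<lambda>e w. 0)" using vE by blast
    have "F n k e w = 0" if k: "\<bar>K1\<bar> + (\<Sum>i<I. \<bar>f i\<bar>) + \<bar>K3 - n\<bar> + \<bar>1 - n\<bar> \<le> k" for k e w
    proof -
      have nn: "0 \<le> (\<Sum>i<I. \<bar>f i\<bar>)" by (auto intro: sum_nonneg)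
      have "X (n + int i) k e w = 0" for i e
      proof -
        have "Cba (n + int i) k = (\<lambda>e w. 0)"
        proof (cases "i < I")
          case True
          have "f i \<le> \<bar>f i\<bar>" by simp
          also have "\<bar>f i\<bar> \<le> (\<Sum>i<I. \<bar>f i\<bar>)" using True by (intro member_le_sum) auto
          finally show ?thesis using k by (intro f) linarith
        next
          case False
          then show ?thesis using vba[OF I] by simp
        qed
        moreover have "Cab k = (\<lambda>n e w. 0)" by (rule vab, rule K1) (use k nn in linarith)
        moreover have "CE (n + int i + k) = (\<lambda>e w. 0)" by (rule K3) (use k nn in linarith)
        moreover have "n + int i + k \<noteq> 0" using k nn by linarith
        ultimately show ?thesis by (simp add: X_def)
      qed
      then show ?thesis by (simp add: F_def)
    qed
    then show ?thesis
      by (intro exI[of _ "\<bar>K1\<bar> + (\<Sum>i<I. \<bar>f i\<bar>) + \<bar>K3 - n\<bar> + \<bar>1 - n\<bar>"] allI impI ext) simp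
  qed
  have F0: "F n k = (\<lambda>e w. 0)" for n k
  proof (rule R_inj[OF Fk, of n t])
    fix k l w
    show "R (F n) k t l w = 0"
      using main[of n k "l - s" w] by (simp add: R_def F_def algebra_simps)
  qed
  have "(\<lambda>n. X n k) n = (\<lambda>e w. 0)"
  proof (rule R_inj[OF Xn, of k s])
    fix n l w
    have "F n k (s + l) w = 0" by (simp add: F0)
    then show "R (\<lambda>n. X n k) n s l w = 0" by (simp add: R_def F_def)
  qed
  then have "X n k e w = 0" by simp
  then show ?thesis by (simp add: X_def algebra_simps)
qed

end

context mode_calculus
begin

subsection \<open>The associator identity\<close>

definition local_from :: "int \<Rightarrow> (int \<Rightarrow> 'w \<Rightarrow> 'w) \<Rightarrow> (int \<Rightarrow> 'w \<Rightarrow> 'w) \<Rightarrow> bool" where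
  "local_from K A B \<longleftrightarrow> (\<forall>n m l w. K \<le> n \<longrightarrow> P A B n m l w = 0)"

text \<open>\<open>x_0^d = (y_0 + (x_0 - y_0))^d\<close>, expanded in powers of
  \<open>x_0 - y_0\<close>; locality makes this finite for negative \<open>d\<close> too. In terms
  of the products it is the Vandermonde identity for \<open>gb\<close>.\<close>

lemma P_shift:
  assumes A: "fieldp A" and B: "fieldp B" and K: "local_from K A B"
  shows "P A B n (m + int N * d) l w = fsum (\<lambda>i. (of_int d gchoose i) \<odot> P A B (n + int i) m (l + int N * (d - int i)) w)"
proof -
  let ?C = "tprod m A B"
  have J: "jac m A B ?C"
    by (rule jac_tprod[OF A B, of K]) (use K in \<open>simp add: local_from_def\<close>)
  have v: "vanishing ?C" by (rule jac_vanishing[OF J])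
  let ?g = "\<lambda>i. ?C (n + int i) (m + l + int N * d - int N * int i) w"
  have g: "fin1 ?g" by (rule vanishing_fin[OF v])
  have "fsum (\<lambda>i. (of_int d gchoose i) \<odot> P A B (n + int i) m (l + int N * (d - int i)) w)
     = fsum (\<lambda>i. fsum (\<lambda>j. (of_int d gchoose i) \<odot> gb m j \<odot> ?g (i + j)))"
  proof (intro arg_cong[of _ _ fsum] ext)
    fix i
    have e: "m + (l + int N * (d - int i)) - int N * int j = m + l + int N * d - int N * int (i + j)" for j
      by (simp add: algebra_simps)
    have "P A B (n + int i) m (l + int N * (d - int i)) w = fsum (\<lambda>j. gb m j \<odot> ?g (i + j))"
      unfolding jac_eq[OF J refl] R_def e by (simp add: add.assoc)
    moreover have "fin1 (\<lambda>j. gb m j \<odot> ?g (i + j))"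
      using fin1_shift[OF g, of i] by (intro fin1_scl) (simp only: add.commute)
    ultimately show "(of_int d gchoose i) \<odot> P A B (n + int i) m (l + int N * (d - int i)) w
       = fsum (\<lambda>j. (of_int d gchoose i) \<odot> gb m j \<odot> ?g (i + j))"
      by (simp only: scl_fsum)
  qed
  also have "\<dots> = fsum (\<lambda>s. \<Sum>i\<le>s. (of_int d gchoose i) \<odot> gb m (s - i) \<odot> ?g s)"
    by (rule fsum_diag'[OF g]) simp
  also have "\<dots> = fsum (\<lambda>s. gb (m + int N * d) s \<odot> ?g s)"
    using gb_vandermonde[of "int N * d" m] by (simp add: gb_mult add.commute flip: scale_sum_left)
  also have "\<dots> = P A B n (m + int N * d) l w"
  proof -
    have "P A B n (m + int N * d) l w = R ?C n (m + int N * d) l w" by (rule jac_eq[OF J]) simp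
    then show ?thesis unfolding R_def by (simp add: algebra_simps)
  qed
  finally show ?thesis ..
qed

lemma P_shift_nat:
  assumes "fieldp A" "fieldp B" "local_from K A B"
  shows "P A B n (m + int N * int d) l w = (\<Sum>i\<le>d. of_nat (d choose i) \<odot> P A B (n + int i) m (l + int N * int (d - i)) w)"
proof -
  have "P A B n (m + int N * int d) l w = fsum (\<lambda>i. of_nat (d choose i) \<odot> P A B (n + int i) m (l + int N * (int d - int i)) w)"
    unfolding P_shift[OF assms] by (simp add: binomial_gbinomial)
  also have "\<dots> = (\<Sum>i<Suc d. of_nat (d choose i) \<odot> P A B (n + int i) m (l + int N * (int d - int i)) w)"
    by (rule fsum_eq) (simp add: binomial_eq_0)
  also have "\<dots> = (\<Sum>i\<le>d. of_nat (d choose i) \<odot> P A B (n + int i) m (l + int N * int (d - i)) w)"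
    unfolding lessThan_Suc_atMost by (rule sum.cong) (simp_all add: of_nat_diff)
  finally show ?thesis .
qed

lemma P_antisym: "P A B n m l w = - sg n \<odot> P B A n l m w"
  by (simp add: P_def scale_right_diff_distrib)

lemma P_P_expand_left:
  assumes a: "fieldp a" and u: "fieldp u" and v: "fieldp v"
  shows "P (P a u k m) v n b c w =
      TT k n (\<lambda>i j. a (m + int N * (k - int i)) (u (b + int N * int i + int N * (n - int j)) (v (c + int N * int j) w)))
    - sg k \<odot> TT k n (\<lambda>i j. u (b + int N * (k - int i) + int N * (n - int j)) (a (m + int N * int i) (v (c + int N * int j) w)))
    - sg n \<odot> TT k n (\<lambda>i j. v (c + int N * (n - int j)) (a (m + int N * (k - int i)) (u (b + int N * int i + int N * int j) w)))
    + sg (n + k) \<odot> TT k n (\<lambda>i j. v (c + int N * (n - int j)) (u (b + int N * (k - int i) + int N * int j) (a (m + int N * int i) w)))"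
proof -
  note la = field_lin[OF a] and lu = field_lin[OF u] and lv = field_lin[OF v]
  have f1: "fin2 (\<lambda>i j. v (c + int N * (n - int i)) (a (m + int N * (k - int j)) (u (b + int N * int i + int N * int j) w)))"
    by (rule fin2_1[OF u lin_comp[OF lv la]])
  have f2: "fin2 (\<lambda>i j. v (c + int N * (n - int i)) (u (b + int N * (k - int j) + int N * int i) (a (m + int N * int j) w)))"
    by (rule fin2_2[OF u a lv])
  have f3: "fin2 (\<lambda>j i. a (m + int N * (k - int j)) (u (b + int N * (n - int i) + int N * int j) (v (c + int N * int i) w)))"
    by (rule fin2_2[OF u v la])
  have f4: "fin2 (\<lambda>j i. u (b + int N * (n - int i) + int N * (k - int j)) (a (m + int N * int j) (v (c + int N * int i) w)))"
    by (rule fin2_2[OF a v lu])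
  have e: "b + int N * int j + int N * int i = b + int N * int i + int N * int j"
    "b + int N * (n - int j) + int N * (k - int i) = b + int N * (k - int i) + int N * (n - int j)"
    "b + int N * (n - int j) + int N * int i = b + int N * int i + int N * (n - int j)" for i j
    by simp_all
  have s: "sg n * (sg k * sg n) = sg k" "sg k * sg n = sg n * sg k" by (simp_all add: sg_def)
  show ?thesis
    unfolding P_antisym[of "P a u k m" v] P_P_expand[OF v a u]
    unfolding TT_swap[OF f1, symmetric] TT_swap[OF f2, symmetric] TT_swap[OF f3] TT_swap[OF f4]
    unfolding e by (simp add: scale_right_diff_distrib scale_right_distrib sg_add s)
qed

text \<open>With \<open>a\<close>, \<open>u\<close>, \<open>v\<close> at \<open>x\<close>,
  \<open>y\<close>, \<open>z\<close> this expands \<open>(x - y)^k = ((x - z) - (y - z))^k\<close>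
  in powers of \<open>y - z\<close>. \<open>P_shift_nat\<close> and \<open>P_shift\<close> resum the
  powers of \<open>y - z\<close> into shifts of the mode of \<open>u\<close>.\<close>

lemma assoc_first:
  assumes a: "fieldp a" and u: "fieldp u" and v: "fieldp v"
    and uv: "local_from K u v"
  shows "fsum (\<lambda>i. be k i \<odot> P a (P u v (n + int i) b) (k - int i) m c w) =
      TT k n (\<lambda>i j. a (m + int N * (k - int i)) (u (b + int N * int i + int N * (n - int j)) (v (c + int N * int j) w)))
    - sg n \<odot> TT k n (\<lambda>i j. a (m + int N * (k - int i)) (v (c + int N * (n - int j)) (u (b + int N * int i + int N * int j) w)))
    - sg k \<odot> TT k n (\<lambda>i j. u (b + int N * (k - int i) + int N * (n - int j)) (v (c + int N * int j) (a (m + int N * int i) w)))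
    + sg (n + k) \<odot> TT k n (\<lambda>i j. v (c + int N * (n - int j)) (u (b + int N * (k - int i) + int N * int j) (a (m + int N * int i) w)))"
    (is "_ = ?auv - sg n \<odot> ?avu - sg k \<odot> ?uva + _ \<odot> ?vua")
proof -
  note la = field_lin[OF a] and lu = field_lin[OF u] and lv = field_lin[OF v]
  define p where "p i = P u v (n + int i) b" for i :: nat
  define I where "I = nat (K - n)"
  have p0: "p i l w = 0" if "I \<le> i" for i l w using that uv by (simp add: p_def local_from_def I_def)
  have fp: "fieldp (p i)" for i unfolding p_def by (rule field_P[OF u v])
  note lp = field_lin[OF fp]
  have A: "fsum (\<lambda>i. be k i \<odot> L1 a (p i) (k - int i) m c w) = ?auv - sg n \<odot> ?avu"
  proof -
    have f: "fin2 (\<lambda>i j. (be k i * be (k - int i) j) \<odot> a (m + int N * (k - int i - int j)) (p i (c + int N * int j) w))"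
      by (rule fin2_scl, rule fin2I2[of I]) (simp add: p0 lin_0[OF la], rule fin1_lin[OF field_fin[OF fp] la])
    have "fsum (\<lambda>i. be k i \<odot> L1 a (p i) (k - int i) m c w)
       = fsum (\<lambda>i. fsum (\<lambda>j. (be k i * be (k - int i) j) \<odot> a (m + int N * (k - int i - int j)) (p i (c + int N * int j) w)))"
      unfolding L1_def scl_fsum[OF fin_L1[OF a fp]] scale_scale ..
    also have "\<dots> = fsum (\<lambda>s. \<Sum>i\<le>s. (be k i * be (k - int i) (s - i)) \<odot> a (m + int N * (k - int i - int (s - i))) (p i (c + int N * int (s - i)) w))"
      by (rule fsum_diag[OF f])
    \<comment> \<open>With \<open>s = i + j\<close> fixed, the coefficients are
      \<open>be k s\<close> times \<open>s choose i\<close>, and \<open>P_shift_nat\<close>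
      recognizes the inner sum as one bracket with mode \<open>b + N s\<close>.\<close>
    also have "\<dots> = fsum (\<lambda>s. be k s \<odot> a (m + int N * (k - int s)) (P u v n (b + int N * int s) c w))"
    proof (intro arg_cong[of _ _ fsum] ext)
      fix s
      have "(\<Sum>i\<le>s. (be k i * be (k - int i) (s - i)) \<odot> a (m + int N * (k - int i - int (s - i))) (p i (c + int N * int (s - i)) w))
         = (\<Sum>i\<le>s. be k s \<odot> a (m + int N * (k - int s)) (of_nat (s choose i) \<odot> p i (c + int N * int (s - i)) w))"
      proof (rule sum.cong[OF refl])
        fix i assume "i \<in> {..s}"
        then obtain j where s: "s = i + j" by (metis atMost_iff le_add_diff_inverse)
        show "(be k i * be (k - int i) (s - i)) \<odot> a (m + int N * (k - int i - int (s - i))) (p i (c + int N * int (s - i)) w)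
           = be k s \<odot> a (m + int N * (k - int s)) (of_nat (s choose i) \<odot> p i (c + int N * int (s - i)) w)"
          unfolding s lin_scale[OF la] be_trinomial[symmetric] scale_scale
          using be_trinomial[of k i j] by (simp add: diff_diff_eq)
      qed
      also have "\<dots> = be k s \<odot> a (m + int N * (k - int s)) (P u v n (b + int N * int s) c w)"
        unfolding P_shift_nat[OF u v uv] lin_sum[OF la] scale_sum_right p_def ..
      finally show "(\<Sum>i\<le>s. (be k i * be (k - int i) (s - i)) \<odot> a (m + int N * (k - int i - int (s - i))) (p i (c + int N * int (s - i)) w))
        = be k s \<odot> a (m + int N * (k - int s)) (P u v n (b + int N * int s) c w)" .
    qed
    also have "\<dots> = fsum (\<lambda>s. be k s \<odot> a (m + int N * (k - int s)) (L1 u v n (b + int N * int s) c w)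
        - sg n \<odot> be k s \<odot> a (m + int N * (k - int s)) (L1 v u n c (b + int N * int s) w))"
      unfolding P_def lin_diff[OF la] lin_scale[OF la] scale_right_diff_distrib by (simp add: mult.commute)
    also have "\<dots> = fsum (\<lambda>s. be k s \<odot> a (m + int N * (k - int s)) (L1 u v n (b + int N * int s) c w))
        - sg n \<odot> fsum (\<lambda>s. be k s \<odot> a (m + int N * (k - int s)) (L1 v u n c (b + int N * int s) w))"
      by (subst scl_fsum, rule fin1_scl, rule fin1_lin[OF field_fin[OF field_L1[OF v u]] la], rule fsum_diff,
          rule fin1_scl, rule fin1_lin[OF field_fin[OF field_L1'[OF u v]] la],
          rule fin1_scl, rule fin1_scl, rule fin1_lin[OF field_fin[OF field_L1[OF v u]] la])
    also have "fsum (\<lambda>s. be k s \<odot> a (m + int N * (k - int s)) (L1 u v n (b + int N * int s) c w)) = ?auv"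
    proof -
      have f: "fin2 (\<lambda>i j. a (m + int N * (k - int i)) (u (b + int N * (n - int j) + int N * int i) (v (c + int N * int j) w)))"
        by (rule fin2_2[OF u v la])
      have e: "b + int N * int i + int N * (n - int j) = b + int N * (n - int j) + int N * int i" for i j by simp
      show ?thesis unfolding L1_def e
        by (rule TT_nest_lin[OF f la fin1_lin[OF field_fin[OF v] lu], symmetric])
    qed
    also have "fsum (\<lambda>s. be k s \<odot> a (m + int N * (k - int s)) (L1 v u n c (b + int N * int s) w)) = ?avu"
    proof -
      have f: "fin2 (\<lambda>i j. a (m + int N * (k - int i)) (v (c + int N * (n - int j)) (u (b + int N * int i + int N * int j) w)))"
        by (rule fin2_1[OF u lin_comp[OF la lv]])
      show ?thesis unfolding L1_def
        by (rule TT_nest_lin[OF f la fin1_lin[OF field_fin[OF u] lv], symmetric])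
    qed
    finally show ?thesis .
  qed
  have B: "fsum (\<lambda>i. be k i \<odot> sg (k - int i) \<odot> L1 (p i) a (k - int i) c m w) = sg k \<odot> (?uva - sg n \<odot> ?vua)"
  proof -
    have f: "fin2 (\<lambda>i j. (be k i * sg (k - int i) * be (k - int i) j) \<odot> p i (c + int N * (k - int i - int j)) (a (m + int N * int j) w))"
      by (rule fin2_scl, rule fin2I2[of I]) (simp add: p0, rule fin1_lin[OF field_fin[OF a] lp])
    have "fsum (\<lambda>i. be k i \<odot> sg (k - int i) \<odot> L1 (p i) a (k - int i) c m w)
       = fsum (\<lambda>i. fsum (\<lambda>j. (be k i * sg (k - int i) * be (k - int i) j) \<odot> p i (c + int N * (k - int i - int j)) (a (m + int N * int j) w)))"
    proof (intro arg_cong[of _ _ fsum] ext)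
      fix i
      show "be k i \<odot> sg (k - int i) \<odot> L1 (p i) a (k - int i) c m w
        = fsum (\<lambda>j. (be k i * sg (k - int i) * be (k - int i) j) \<odot> p i (c + int N * (k - int i - int j)) (a (m + int N * int j) w))"
        unfolding scale_scale[of "be k i" "sg (k - int i)"] unfolding L1_def
        unfolding scl_fsum[OF fin_L1[OF fp a]] by (simp only: scale_scale)
    qed
    also have "\<dots> = fsum (\<lambda>j. fsum (\<lambda>i. (be k i * sg (k - int i) * be (k - int i) j) \<odot> p i (c + int N * (k - int i - int j)) (a (m + int N * int j) w)))"
      by (rule fsum_swap[OF f])
    \<comment> \<open>For fixed \<open>j\<close> the sum over \<open>i\<close> expands a shift by
      \<open>k - j\<close>, possibly negative; this is \<open>P_shift\<close>.\<close>
    also have "\<dots> = fsum (\<lambda>j. sg k \<odot> be k j \<odot> P u v n (b + int N * (k - int j)) c (a (m + int N * int j) w))"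
    proof (intro arg_cong[of _ _ fsum] ext)
      fix j
      have "be k i * sg (k - int i) * be (k - int i) j = sg k * be k j * (of_int (k - int j) gchoose i)" for i
      proof -
        have "be k i * sg (k - int i) * be (k - int i) j = sg k * (-1) ^ i * (be k i * be (k - int i) j)"
          by (simp only: sg_minus_nat mult_ac)
        also have "\<dots> = sg k * be k j * ((-1) ^ i * be (k - int j) i)"
          unfolding be_trinomial'[of k i j] by (simp only: mult_ac)
        finally show ?thesis by (simp add: binom_coeff_def)
      qed
      then have "fsum (\<lambda>i. (be k i * sg (k - int i) * be (k - int i) j) \<odot> p i (c + int N * (k - int i - int j)) (a (m + int N * int j) w))
        = fsum (\<lambda>i. (sg k * be k j) \<odot> (of_int (k - int j) gchoose i) \<odot> P u v (n + int i) b (c + int N * (k - int j - int i)) (a (m + int N * int j) w))"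
        by (simp add: p_def algebra_simps)
      also have "\<dots> = (sg k * be k j) \<odot> fsum (\<lambda>i. (of_int (k - int j) gchoose i) \<odot> P u v (n + int i) b (c + int N * (k - int j - int i)) (a (m + int N * int j) w))"
        by (rule scl_fsum[symmetric], rule fin1_scl, rule fin1I[of I]) (use uv in \<open>simp add: local_from_def I_def\<close>)
      also have "\<dots> = sg k \<odot> be k j \<odot> P u v n (b + int N * (k - int j)) c (a (m + int N * int j) w)"
        unfolding P_shift[OF u v uv] by simp
      finally show "fsum (\<lambda>i. (be k i * sg (k - int i) * be (k - int i) j) \<odot> p i (c + int N * (k - int i - int j)) (a (m + int N * int j) w))
         = sg k \<odot> be k j \<odot> P u v n (b + int N * (k - int j)) c (a (m + int N * int j) w)" .
    qed
    also have "\<dots> = sg k \<odot> fsum (\<lambda>j. be k j \<odot> P u v n (b + int N * (k - int j)) c (a (m + int N * int j) w))"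
      by (rule scl_fsum[symmetric], rule fin1_scl, rule fin1_lin[OF field_fin[OF a] field_lin[OF field_P[OF u v]]])
    also have "fsum (\<lambda>j. be k j \<odot> P u v n (b + int N * (k - int j)) c (a (m + int N * int j) w))
       = fsum (\<lambda>j. be k j \<odot> L1 u v n (b + int N * (k - int j)) c (a (m + int N * int j) w)
          - sg n \<odot> be k j \<odot> L1 v u n c (b + int N * (k - int j)) (a (m + int N * int j) w))"
      unfolding P_def scale_right_diff_distrib by (simp add: mult.commute)
    also have "\<dots> = fsum (\<lambda>j. be k j \<odot> L1 u v n (b + int N * (k - int j)) c (a (m + int N * int j) w))
          - sg n \<odot> fsum (\<lambda>j. be k j \<odot> L1 v u n c (b + int N * (k - int j)) (a (m + int N * int j) w))"
      by (subst scl_fsum, rule fin1_scl, rule fin1_lin[OF field_fin[OF a] lin_L1[OF v u]], rule fsum_diff,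
          rule fin1_scl, rule fin1_lin[OF field_fin[OF a] lin_L1[OF u v]],
          rule fin1_scl, rule fin1_scl, rule fin1_lin[OF field_fin[OF a] lin_L1[OF v u]])
    also have "fsum (\<lambda>j. be k j \<odot> L1 u v n (b + int N * (k - int j)) c (a (m + int N * int j) w)) = ?uva"
    proof -
      have f: "fin2 (\<lambda>j i. u (b + int N * (k - int i) + int N * (n - int j)) (v (c + int N * int j) (a (m + int N * int i) w)))"
        by (rule fin2_2[OF v a lu])
      show ?thesis unfolding L1_def by (rule TT_nest[OF fin2_swap[OF f], symmetric])
    qed
    also have "fsum (\<lambda>j. be k j \<odot> L1 v u n c (b + int N * (k - int j)) (a (m + int N * int j) w)) = ?vua"
    proof -
      have f: "fin2 (\<lambda>j i. v (c + int N * (n - int j)) (u (b + int N * (k - int i) + int N * int j) (a (m + int N * int i) w)))"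
        by (rule fin2_2[OF u a lv])
      show ?thesis unfolding L1_def by (rule TT_nest[OF fin2_swap[OF f], symmetric])
    qed
    finally show ?thesis .
  qed
  have fA: "fin1 (\<lambda>i. be k i \<odot> L1 a (p i) (k - int i) m c w)"
    by (rule fin1I[of I]) (simp add: L1_def p0 lin_0[OF la])
  have fB: "fin1 (\<lambda>i. be k i \<odot> sg (k - int i) \<odot> L1 (p i) a (k - int i) c m w)"
    by (rule fin1I[of I]) (simp add: L1_def p0)
  have "fsum (\<lambda>i. be k i \<odot> P a (P u v (n + int i) b) (k - int i) m c w)
     = fsum (\<lambda>i. be k i \<odot> L1 a (p i) (k - int i) m c w) - fsum (\<lambda>i. be k i \<odot> sg (k - int i) \<odot> L1 (p i) a (k - int i) c m w)"
    unfolding p_def[symmetric] P_def[of a] scale_right_diff_distrib by (rule fsum_diff[OF fA fB])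
  then show ?thesis unfolding A B by (simp add: scale_right_diff_distrib sg_add mult.commute)
qed

end

context mode_calculus
begin

text \<open>The trinomial identity pulls the choice of \<open>i\<close> out of the
  \<open>k\<close>-th power; the remaining factors form a Vandermonde sum.\<close>

lemma be_choose_vandermonde:
  assumes "i \<le> d"
  shows "(\<Sum>s\<le>d. be k s * of_nat (s choose i) * be n (d - s)) = be k i * be (n + k - int i) (d - i)"
proof -
  have "(\<Sum>s\<le>d. be k s * of_nat (s choose i) * be n (d - s)) = (\<Sum>s\<in>{i..d}. be k s * of_nat (s choose i) * be n (d - s))"
    by (rule sum.mono_neutral_right) (auto simp: binomial_eq_0)
  also have "\<dots> = (\<Sum>r\<in>{0..d - i}. be k (r + i) * of_nat ((r + i) choose i) * be n (d - (r + i)))"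
    using sum.shift_bounds_cl_nat_ivl[of "\<lambda>s. be k s * of_nat (s choose i) * be n (d - s)" 0 i "d - i"] assms by simp
  also have "\<dots> = (\<Sum>r\<le>d - i. be k i * (be (k - int i) r * be n (d - i - r)))"
    unfolding atLeast0AtMost
  proof (rule sum.cong[OF refl])
    fix r
    have "be k (r + i) * of_nat ((r + i) choose i) = be k i * be (k - int i) r"
      unfolding be_trinomial by (simp only: add.commute)
    then show "be k (r + i) * of_nat ((r + i) choose i) * be n (d - (r + i)) = be k i * (be (k - int i) r * be n (d - i - r))"
      by (simp only: mult.assoc diff_diff_left add.commute)
  qed
  also have "\<dots> = be k i * be (n + k - int i) (d - i)"
    using be_vandermonde[of "k - int i" n "d - i"] by (simp only: sum_distrib_left[symmetric]) (simp add: algebra_simps)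
  finally show ?thesis .
qed

lemma fin1_sum: "(\<And>s. s \<in> S \<Longrightarrow> fin1 (\<lambda>i. f i s)) \<Longrightarrow> fin1 (\<lambda>i. \<Sum>s\<in>S. f i s :: 'w)"
  by (induction S rule: infinite_finite_induct) (simp_all add: fin1_0 fin1_add)

lemma fsum_sum:
  assumes "\<And>s. s \<in> S \<Longrightarrow> fin1 (\<lambda>i. f i s)"
  shows "fsum (\<lambda>i. \<Sum>s\<in>S. f i s) = (\<Sum>s\<in>S. fsum (\<lambda>i. f i s :: 'w))"
  using assms
proof (induction S rule: infinite_finite_induct)
  case (insert x S)
  have "fin1 (\<lambda>i. \<Sum>s\<in>S. f i s)" using insert.prems by (simp add: fin1_sum)
  then show ?case using insert by (simp add: fsum_add)
qed simp_all

lemma TT_diag: "fin2 f \<Longrightarrow> TT n k f = fsum (\<lambda>s. \<Sum>i\<le>s. (be n i * be k (s - i)) \<odot> f i (s - i))"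
  unfolding TT_def by (rule fsum_diag[OF fin2_scl])

text \<open>The companion expansion of \<open>(y - x)^k = ((y - z) - (x - z))^k\<close> in powers of
  \<open>x - z\<close>; the shifts now act on the mode of \<open>a\<close> in its bracket with
  \<open>v\<close>.\<close>

lemma assoc_second:
  assumes a: "fieldp a" and u: "fieldp u" and v: "fieldp v"
    and av: "local_from K a v"
  shows "fsum (\<lambda>i. be k i \<odot> P u (P a v (int i) m) (n + k - int i) b c w) =
      TT k n (\<lambda>i j. u (b + int N * (k - int i) + int N * (n - int j)) (a (m + int N * int i) (v (c + int N * int j) w)))
    - TT k n (\<lambda>i j. u (b + int N * (k - int i) + int N * (n - int j)) (v (c + int N * int j) (a (m + int N * int i) w)))
    - sg (n + k) \<odot> TT k n (\<lambda>i j. a (m + int N * (k - int i)) (v (c + int N * (n - int j)) (u (b + int N * int i + int N * int j) w)))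
    + sg (n + k) \<odot> TT k n (\<lambda>i j. v (c + int N * (n - int j)) (a (m + int N * (k - int i)) (u (b + int N * int i + int N * int j) w)))"
    (is "_ = ?uav - ?uva - _ \<odot> ?avu + _ \<odot> ?vau")
proof -
  note la = field_lin[OF a] and lu = field_lin[OF u] and lv = field_lin[OF v]
  define p where "p i = P a v (int i) m" for i :: nat
  define I where "I = nat K"
  have p0: "p i l w = 0" if "I \<le> i" for i l w using that av by (simp add: p_def local_from_def I_def)
  have fp: "fieldp (p i)" for i unfolding p_def by (rule field_P[OF a v])
  note lp = field_lin[OF fp]
  have A: "fsum (\<lambda>i. be k i \<odot> L1 u (p i) (n + k - int i) b c w) = ?uav - ?uva"
  proof -
    have f: "fin2 (\<lambda>i j. (be k i * be (n + k - int i) j) \<odot> u (b + int N * (n + k - int i - int j)) (p i (c + int N * int j) w))"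
      by (rule fin2_scl, rule fin2I2[of I]) (simp add: p0 lin_0[OF lu], rule fin1_lin[OF field_fin[OF fp] lu])
    have "fsum (\<lambda>i. be k i \<odot> L1 u (p i) (n + k - int i) b c w)
       = fsum (\<lambda>i. fsum (\<lambda>j. (be k i * be (n + k - int i) j) \<odot> u (b + int N * (n + k - int i - int j)) (p i (c + int N * int j) w)))"
      unfolding L1_def scl_fsum[OF fin_L1[OF u fp]] scale_scale ..
    also have "\<dots> = fsum (\<lambda>d. \<Sum>i\<le>d. (be k i * be (n + k - int i) (d - i)) \<odot> u (b + int N * (n + k - int i - int (d - i))) (p i (c + int N * int (d - i)) w))"
      by (rule fsum_diag[OF f])
    \<comment> \<open>The comparison runs backwards: the shift of the mode of \<open>a\<close> by
      \<open>N s\<close> is opened up by \<open>P_shift_nat\<close>, and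
      \<open>be_choose_vandermonde\<close> matches the coefficients for fixed
      \<open>d\<close>.\<close>
    also have "\<dots> = fsum (\<lambda>d. \<Sum>s\<le>d. (be k s * be n (d - s)) \<odot> u (b + int N * (k - int s) + int N * (n - int (d - s))) (P a v 0 (m + int N * int s) (c + int N * int (d - s)) w))"
    proof (intro arg_cong[of _ _ fsum] ext)
      fix d
      define x where "x i = u (b + int N * (n + k - int d)) (p i (c + int N * int (d - i)) w)" for i
      have "(\<Sum>s\<le>d. (be k s * be n (d - s)) \<odot> u (b + int N * (k - int s) + int N * (n - int (d - s))) (P a v 0 (m + int N * int s) (c + int N * int (d - s)) w))
         = (\<Sum>s\<le>d. \<Sum>i\<le>d. (be k s * of_nat (s choose i) * be n (d - s)) \<odot> x i)"
      proof (rule sum.cong[OF refl])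
        fix s assume "s \<in> {..d}"
        then have s: "s \<le> d" by simp
        have e1: "b + int N * (k - int s) + int N * (n - int (d - s)) = b + int N * (n + k - int d)"
          using s by (simp add: of_nat_diff algebra_simps)
        have e2: "c + int N * int (d - s) + int N * int (s - i) = c + int N * int (d - i)" if "i \<le> s" for i
          using s that by (simp add: of_nat_diff algebra_simps)
        have "u (b + int N * (n + k - int d)) (P a v 0 (m + int N * int s) (c + int N * int (d - s)) w)
           = (\<Sum>i\<le>s. of_nat (s choose i) \<odot> x i)"
          unfolding P_shift_nat[OF a v av] lin_sum[OF lu] lin_scale[OF lu] x_def p_def
          by (rule sum.cong) (simp_all only: atMost_iff e2 add_0)
        also have "\<dots> = (\<Sum>i\<le>d. of_nat (s choose i) \<odot> x i)"
          by (rule sum.mono_neutral_left) (use s in \<open>auto simp: binomial_eq_0\<close>)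
        finally show "(be k s * be n (d - s)) \<odot> u (b + int N * (k - int s) + int N * (n - int (d - s))) (P a v 0 (m + int N * int s) (c + int N * int (d - s)) w)
          = (\<Sum>i\<le>d. (be k s * of_nat (s choose i) * be n (d - s)) \<odot> x i)"
          unfolding e1 by (simp only: scale_sum_right scale_scale mult_ac)
      qed
      also have "\<dots> = (\<Sum>i\<le>d. (\<Sum>s\<le>d. be k s * of_nat (s choose i) * be n (d - s)) \<odot> x i)"
        unfolding scale_sum_left by (rule sum.swap)
      also have "\<dots> = (\<Sum>i\<le>d. (be k i * be (n + k - int i) (d - i)) \<odot> u (b + int N * (n + k - int i - int (d - i))) (p i (c + int N * int (d - i)) w))"
      proof (rule sum.cong[OF refl])
        fix i assume "i \<in> {..d}"
        then have i: "i \<le> d" by simp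
        then have e: "n + k - int i - int (d - i) = n + k - int d" by (simp add: of_nat_diff)
        show "(\<Sum>s\<le>d. be k s * of_nat (s choose i) * be n (d - s)) \<odot> x i
           = (be k i * be (n + k - int i) (d - i)) \<odot> u (b + int N * (n + k - int i - int (d - i))) (p i (c + int N * int (d - i)) w)"
          unfolding be_choose_vandermonde[OF i] x_def e ..
      qed
      finally show "(\<Sum>i\<le>d. (be k i * be (n + k - int i) (d - i)) \<odot> u (b + int N * (n + k - int i - int (d - i))) (p i (c + int N * int (d - i)) w))
         = (\<Sum>s\<le>d. (be k s * be n (d - s)) \<odot> u (b + int N * (k - int s) + int N * (n - int (d - s))) (P a v 0 (m + int N * int s) (c + int N * int (d - s)) w))" by simp
    qed
    also have "\<dots> = TT k n (\<lambda>s j. u (b + int N * (k - int s) + int N * (n - int j)) (P a v 0 (m + int N * int s) (c + int N * int j) w))"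
    proof (rule TT_diag[symmetric])
      have f1: "fin2 (\<lambda>i j. u (b + int N * (k - int i) + int N * (n - int j)) (a (m + int N * int i) (v (c + int N * int j) w)))"
        by (rule fin2_2[OF a v lu])
      have f2: "fin2 (\<lambda>j i. u (b + int N * (k - int i) + int N * (n - int j)) (v (c + int N * int j) (a (m + int N * int i) w)))"
        by (rule fin2_2[OF v a lu])
      show "fin2 (\<lambda>s j. u (b + int N * (k - int s) + int N * (n - int j)) (P a v 0 (m + int N * int s) (c + int N * int j) w))"
        unfolding P_0 lin_diff[OF lu] by (rule fin2_diff[OF f1 fin2_swap[OF f2]])
    qed
    also have "\<dots> = ?uav - ?uva"
    proof -
      have f1: "fin2 (\<lambda>i j. u (b + int N * (k - int i) + int N * (n - int j)) (a (m + int N * int i) (v (c + int N * int j) w)))"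
        by (rule fin2_2[OF a v lu])
      have f2: "fin2 (\<lambda>j i. u (b + int N * (k - int i) + int N * (n - int j)) (v (c + int N * int j) (a (m + int N * int i) w)))"
        by (rule fin2_2[OF v a lu])
      show ?thesis unfolding P_0 lin_diff[OF lu] by (rule TT_diff[OF f1 fin2_swap[OF f2], symmetric])
    qed
    finally show ?thesis .
  qed
  have B: "fsum (\<lambda>i. be k i \<odot> sg (n + k - int i) \<odot> L1 (p i) u (n + k - int i) c b w) = sg (n + k) \<odot> (?avu - ?vau)"
  proof -
    define y where "y i j = p i (c + int N * (n + k - int i - int j)) (u (b + int N * int j) w)" for i j
    have fy: "fin2 y"
      unfolding y_def by (rule fin2I2[of I]) (simp add: p0, rule fin1_lin[OF field_fin[OF u] lp])
    have "fsum (\<lambda>i. be k i \<odot> sg (n + k - int i) \<odot> L1 (p i) u (n + k - int i) c b w)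
       = fsum (\<lambda>i. fsum (\<lambda>j. (be k i * sg (n + k - int i) * be (n + k - int i) j) \<odot> y i j))"
    proof (intro arg_cong[of _ _ fsum] ext)
      fix i
      show "be k i \<odot> sg (n + k - int i) \<odot> L1 (p i) u (n + k - int i) c b w
        = fsum (\<lambda>j. (be k i * sg (n + k - int i) * be (n + k - int i) j) \<odot> y i j)"
        unfolding scale_scale[of "be k i" "sg (n + k - int i)"] unfolding L1_def y_def
        unfolding scl_fsum[OF fin_L1[OF fp u]] by (simp only: scale_scale)
    qed
    also have "\<dots> = fsum (\<lambda>j. fsum (\<lambda>i. (be k i * sg (n + k - int i) * be (n + k - int i) j) \<odot> y i j))"
      by (rule fsum_swap[OF fin2_scl[OF fy]])
    also have "\<dots> = fsum (\<lambda>d. \<Sum>s\<le>d. (sg (n + k) * (be k s * be n (d - s))) \<odot> P a v 0 (m + int N * (k - int s)) (c + int N * (n - int (d - s))) (u (b + int N * int d) w))"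
    proof (intro arg_cong[of _ _ fsum] ext)
      fix d
      \<comment> \<open>\<open>be_trinomial'\<close> moves the dependence on \<open>i\<close> out of
        the sum over \<open>s\<close>; what remains is a Vandermonde sum.\<close>
      have sc: "(\<Sum>s\<le>d. sg (n + k) * (be k s * be n (d - s)) * (of_int (k - int s) gchoose i)) = be k i * sg (n + k - int i) * be (n + k - int i) d" for i
      proof -
        have "(\<Sum>s\<le>d. sg (n + k) * (be k s * be n (d - s)) * (of_int (k - int s) gchoose i))
           = (\<Sum>s\<le>d. (sg (n + k) * (-1) ^ i * be k i) * (be (k - int i) s * be n (d - s)))"
        proof (rule sum.cong[OF refl])
          fix s
          have "(of_int (k - int s) gchoose i) = (-1) ^ i * be (k - int s) i" by (simp add: binom_coeff_def)
          then have "sg (n + k) * (be k s * be n (d - s)) * (of_int (k - int s) gchoose i)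
            = sg (n + k) * (-1) ^ i * be n (d - s) * (be k s * be (k - int s) i)" by (simp only: mult_ac)
          also have "\<dots> = (sg (n + k) * (-1) ^ i * be k i) * (be (k - int i) s * be n (d - s))"
            unfolding be_trinomial'[of k s i] by (simp only: mult_ac)
          finally show "sg (n + k) * (be k s * be n (d - s)) * (of_int (k - int s) gchoose i)
            = (sg (n + k) * (-1) ^ i * be k i) * (be (k - int i) s * be n (d - s))" .
        qed
        also have "\<dots> = (sg (n + k) * (-1) ^ i * be k i) * be (n + k - int i) d"
          using be_vandermonde[of "k - int i" n d] by (simp only: sum_distrib_left[symmetric]) (simp add: algebra_simps)
        finally show ?thesis unfolding sg_minus_nat by (simp only: mult_ac)
      qed
      have t: "P a v 0 (m + int N * (k - int s)) (c + int N * (n - int (d - s))) (u (b + int N * int d) w)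
          = fsum (\<lambda>i. (of_int (k - int s) gchoose i) \<odot> y i d)" if "s \<le> d" for s
      proof -
        have e: "c + int N * (n - int (d - s)) + int N * (k - int s - int i) = c + int N * (n + k - int i - int d)" for i
          using that by (simp add: of_nat_diff algebra_simps)
        show ?thesis unfolding P_shift[OF a v av] y_def p_def e add_0 ..
      qed
      note fyd = fin2_inner'[OF fy, of d]
      have "fsum (\<lambda>i. (be k i * sg (n + k - int i) * be (n + k - int i) d) \<odot> y i d)
         = fsum (\<lambda>i. \<Sum>s\<le>d. (sg (n + k) * (be k s * be n (d - s)) * (of_int (k - int s) gchoose i)) \<odot> y i d)"
        unfolding sc[symmetric] scale_sum_left ..
      also have "\<dots> = (\<Sum>s\<le>d. fsum (\<lambda>i. (sg (n + k) * (be k s * be n (d - s)) * (of_int (k - int s) gchoose i)) \<odot> y i d))"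
        by (rule fsum_sum) (rule fin1_scl[OF fyd])
      also have "\<dots> = (\<Sum>s\<le>d. (sg (n + k) * (be k s * be n (d - s))) \<odot> P a v 0 (m + int N * (k - int s)) (c + int N * (n - int (d - s))) (u (b + int N * int d) w))"
      proof (rule sum.cong[OF refl])
        fix s assume "s \<in> {..d}"
        then have s: "s \<le> d" by simp
        show "fsum (\<lambda>i. (sg (n + k) * (be k s * be n (d - s)) * (of_int (k - int s) gchoose i)) \<odot> y i d)
          = (sg (n + k) * (be k s * be n (d - s))) \<odot> P a v 0 (m + int N * (k - int s)) (c + int N * (n - int (d - s))) (u (b + int N * int d) w)"
          unfolding t[OF s] scl_fsum[OF fin1_scl[OF fyd]] scale_scale ..
      qed
      finally show "fsum (\<lambda>i. (be k i * sg (n + k - int i) * be (n + k - int i) d) \<odot> y i d)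
        = (\<Sum>s\<le>d. (sg (n + k) * (be k s * be n (d - s))) \<odot> P a v 0 (m + int N * (k - int s)) (c + int N * (n - int (d - s))) (u (b + int N * int d) w))" .
    qed
    also have "\<dots> = sg (n + k) \<odot> TT k n (\<lambda>s j. P a v 0 (m + int N * (k - int s)) (c + int N * (n - int j)) (u (b + int N * int s + int N * int j) w))"
    proof -
      have f: "fin2 (\<lambda>s j. P a v 0 (m + int N * (k - int s)) (c + int N * (n - int j)) (u (b + int N * int s + int N * int j) w))"
        by (rule fin2_1[OF u lin_P[OF a v]])
      have f': "fin1 (\<lambda>d. \<Sum>s\<le>d. (be k s * be n (d - s)) \<odot> P a v 0 (m + int N * (k - int s)) (c + int N * (n - int (d - s))) (u (b + int N * int s + int N * int (d - s)) w))"
        by (rule fin1_diag[OF fin2_scl[OF f]])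
      have e: "b + int N * int s + int N * int (d - s) = b + int N * int d" if "s \<le> d" for s d
        using that by (simp add: of_nat_diff algebra_simps)
      show ?thesis unfolding TT_diag[OF f] scl_fsum[OF f'] scale_sum_right scale_scale
        by (intro arg_cong[of _ _ fsum] ext sum.cong refl) (simp only: atMost_iff e)
    qed
    also have "\<dots> = sg (n + k) \<odot> (?avu - ?vau)"
    proof -
      have f1: "fin2 (\<lambda>i j. a (m + int N * (k - int i)) (v (c + int N * (n - int j)) (u (b + int N * int i + int N * int j) w)))"
        by (rule fin2_1[OF u lin_comp[OF la lv]])
      have f2: "fin2 (\<lambda>i j. v (c + int N * (n - int j)) (a (m + int N * (k - int i)) (u (b + int N * int i + int N * int j) w)))"
        by (rule fin2_1[OF u lin_comp[OF lv la]])
      show ?thesis unfolding P_0 TT_diff[OF f1 f2] ..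
    qed
    finally show ?thesis .
  qed
  have fA: "fin1 (\<lambda>i. be k i \<odot> L1 u (p i) (n + k - int i) b c w)"
    by (rule fin1I[of I]) (simp add: L1_def p0 lin_0[OF lu])
  have fB: "fin1 (\<lambda>i. be k i \<odot> sg (n + k - int i) \<odot> L1 (p i) u (n + k - int i) c b w)"
    by (rule fin1I[of I]) (simp add: L1_def p0)
  have "fsum (\<lambda>i. be k i \<odot> P u (P a v (int i) m) (n + k - int i) b c w)
     = fsum (\<lambda>i. be k i \<odot> L1 u (p i) (n + k - int i) b c w) - fsum (\<lambda>i. be k i \<odot> sg (n + k - int i) \<odot> L1 (p i) u (n + k - int i) c b w)"
    unfolding p_def[symmetric] P_def[of u] scale_right_diff_distrib by (rule fsum_diff[OF fA fB])
  then show ?thesis unfolding A B by (simp add: scale_right_diff_distrib)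
qed

text \<open>The orders with \<open>v\<close> in the middle cancel between the two sums. Those with
  \<open>a\<close> and \<open>u\<close> adjacent remain, and they are the four of
  \<open>P_P_expand_left\<close>.\<close>

lemma P_P_assoc:
  assumes a: "fieldp a" and u: "fieldp u" and v: "fieldp v"
    and uv: "local_from K u v" and av: "local_from L a v"
  shows "P (P a u k m) v n b c w =
     fsum (\<lambda>i. be k i \<odot> P a (P u v (n + int i) b) (k - int i) m c w)
     - sg k \<odot> fsum (\<lambda>i. be k i \<odot> P u (P a v (int i) m) (n + k - int i) b c w)"
proof -
  have s: "sg k * sg (n + k) = sg n" by (simp add: sg_def)
  show ?thesis
    unfolding P_P_expand_left[OF a u v] assoc_first[OF a u v uv] assoc_second[OF a u v av]
    by (simp add: scale_right_diff_distrib scale_right_distrib s)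
qed

end

context mode_calculus
begin

subsection \<open>Products of fields that satisfy the Jacobi identity\<close>

text \<open>\<open>jac\<close> controls the residue class of \<open>s\<close> only; outside it
  \<open>A\<close> has no modes and both terms of \<open>P\<close> vanish.\<close>

lemma jac_local_from:
  assumes A: "fieldp A" and B: "fieldp B" and j: "jac s A B C"
    and hom: "\<And>m. m mod int N \<noteq> s mod int N \<Longrightarrow> A m = (\<lambda>w. 0)"
  shows "\<exists>K. local_from K A B"
proof -
  obtain K where K: "\<And>n. n \<ge> K \<Longrightarrow> C n = (\<lambda>e w. 0)" using jac_vanishing[OF j] by blast
  have "P A B n m l w = 0" if n: "K \<le> n" for n m l w
  proof (cases "m mod int N = s mod int N")
    case True
    show ?thesis unfolding jac_eq[OF j True] using n by (intro R_zero K) simp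
  next
    case False
    have "(m + int N * x) mod int N = m mod int N" for x by (rule mod_mult_self2)
    then have "A (m + int N * x) = (\<lambda>w. 0)" for x using False hom by simp
    then show ?thesis by (simp add: P_def L1_def lin_0[OF field_lin[OF B]])
  qed
  then show ?thesis unfolding local_from_def by blast
qed

lemma fin2_scl_nest: "fin1 f \<Longrightarrow> c \<odot> d \<odot> fsum f = fsum (\<lambda>i. (c * d) \<odot> f i)"
  by (simp only: scale_scale scl_fsum fin1_scl)

text \<open>
  Here \<open>D r = a_* (u_r v)\<close>, \<open>D' q = u_* (a_q v)\<close> and \<open>F k = (a_k u)_* v\<close>, so that \<open>jacobi\<close> is the
  Jacobi identity of the vertex algebra for \<open>a\<close>, \<open>u\<close>, \<open>v\<close>.
\<close>

lemma jac_closure: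
  assumes a: "fieldp a" and u: "fieldp u" and v: "fieldp v"
    and Cau: "\<And>k. fieldp (Cau k)" and Cuv: "\<And>k. fieldp (Cuv k)" and Cav: "\<And>k. fieldp (Cav k)"
    and Jau: "jac s a u Cau" and Juv: "jac t u v Cuv" and Jav: "jac s a v Cav"
    and Ja: "\<And>r. jac s a (Cuv r) (D r)" and Ju: "\<And>q. jac t u (Cav q) (D' q)"
    and loc_uv: "local_from K u v" and loc_av: "local_from L a v"
    and F0: "\<And>k. Kau \<le> k \<Longrightarrow> Cau k = (\<lambda>e w. 0)" "\<And>k. Kau \<le> k \<Longrightarrow> F k = (\<lambda>n e w. 0)"
    and F: "\<And>k. vanishing (F k)"
    and jacobi: "\<And>k q r e w. (\<Sum>i\<le>q. of_nat (q choose i) \<odot> F (k + int i) (int q - int i + r) e w) =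
        fsum (\<lambda>i. be k i \<odot> D (r + int i) (int q + k - int i) e w)
        - sg k \<odot> fsum (\<lambda>i. be k i \<odot> D' (int q + int i) (r + k - int i) e w)"
  shows "jac (s + t) (Cau k) v (F k)"
proof -
  note vuv = jac_vanishing[OF Juv] and vav = jac_vanishing[OF Jav]
  have D0: "D r = (\<lambda>n e w. 0)" if "Cuv r = (\<lambda>e w. 0)" for r
    using jac_right_zero[OF _ a, of s "D r"] Ja[of r] that by auto
  have D'0: "D' r = (\<lambda>n e w. 0)" if "Cav r = (\<lambda>e w. 0)" for r
    using jac_right_zero[OF _ u, of t "D' r"] Ju[of r] that by auto
  \<comment> \<open>\<open>P_P_left\<close> reaches the products \<open>Cau\<close> only in this
    combination over \<open>k + i\<close>; the descending induction on \<open>k\<close> below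
    isolates the term \<open>i = 0\<close>.\<close>
  have main: "fsum (\<lambda>i. gb s i \<odot> P (Cau (k + int i)) v n (s + b - int N * int i) c w)
     = fsum (\<lambda>i. gb s i \<odot> R (F (k + int i)) n (s + b - int N * int i) c w)"
    if b: "b mod int N = t mod int N" for k n b c w
  proof -
    define Q where "Q j = s + b + c - int N * int j" for j :: nat
    have 1: "fsum (\<lambda>i. gb s i \<odot> P (Cau (k + int i)) v n (s + b - int N * int i) c w)
      = fsum (\<lambda>i. be k i \<odot> P a (P u v (n + int i) b) (k - int i) s c w)
      - sg k \<odot> fsum (\<lambda>i. be k i \<odot> P u (P a v (int i) s) (n + k - int i) b c w)"
      using P_P_left[OF v Jau Cau refl, of k n b c w] P_P_assoc[OF a u v loc_uv loc_av] by simp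
    define x where "x i q r = (gb s q * gb b r) \<odot> be k i \<odot> D (n + int i + int r) (k - int i + int q) (Q (q + r)) w" for i q r
    define x' where "x' i q r = (gb s q * gb b r) \<odot> be k i \<odot> D' (int i + int q) (n + k - int i + int r) (Q (q + r)) w" for i q r
    obtain I where I: "\<And>i. I \<le> i \<Longrightarrow> Cuv (n + int i) = (\<lambda>e w. 0)" using vanishing_nat[OF vuv] by blast
    obtain I' where I': "\<And>i. I' \<le> i \<Longrightarrow> Cav (0 + int i) = (\<lambda>e w. 0)" using vanishing_nat[OF vav] by blast
    have x0: "x i q r = 0" if "I \<le> i + r" for i q r
      using D0[OF I[OF that]] by (simp add: x_def add.assoc)
    have xq: "fin1 (\<lambda>q. x i q r)" for i r
      unfolding x_def by (rule fin1_scl, rule fin1_scl, rule vanishing_fin[OF jac_vanishing[OF Ja]])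
    have x'0: "x' i q r = 0" if "I' \<le> i + q" for i q r
      using D'0[OF I'[OF that]] by (simp add: x'_def)
    have x'r: "fin1 (\<lambda>r. x' i q r)" for i q
      unfolding x'_def by (rule fin1_scl, rule fin1_scl, rule vanishing_fin[OF jac_vanishing[OF Ju]])
    have 2: "fsum (\<lambda>i. be k i \<odot> P a (P u v (n + int i) b) (k - int i) s c w) = fsum (\<lambda>i. fsum (\<lambda>r. fsum (\<lambda>q. x i q r)))"
    proof (intro arg_cong[of _ _ fsum] ext)
      fix i
      have "P a (P u v (n + int i) b) (k - int i) s c w
        = fsum (\<lambda>r. gb b r \<odot> P a (Cuv (n + int i + int r)) (k - int i) s (b + c - int N * int r) w)"
        by (rule P_P_right[OF a Juv Cuv b])
      moreover have "fin1 (\<lambda>r. gb b r \<odot> P a (Cuv (n + int i + int r)) (k - int i) s (b + c - int N * int r) w)"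
        by (rule fin1_scl, rule fin1I[of I]) (use I in \<open>simp add: add.assoc P_right_zero[OF a] flip: of_nat_add\<close>)
      ultimately have "be k i \<odot> P a (P u v (n + int i) b) (k - int i) s c w
        = fsum (\<lambda>r. be k i \<odot> gb b r \<odot> P a (Cuv (n + int i + int r)) (k - int i) s (b + c - int N * int r) w)"
        by (simp only: scl_fsum)
      also have "\<dots> = fsum (\<lambda>r. fsum (\<lambda>q. x i q r))"
      proof (intro arg_cong[of _ _ fsum] ext)
        fix r
        show "be k i \<odot> gb b r \<odot> P a (Cuv (n + int i + int r)) (k - int i) s (b + c - int N * int r) w = fsum (\<lambda>q. x i q r)"
          unfolding jac_eq[OF Ja refl] R_def fin2_scl_nest[OF fin_R[OF jac_vanishing[OF Ja]]]
          by (simp add: x_def Q_def algebra_simps)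
      qed
      finally show "be k i \<odot> P a (P u v (n + int i) b) (k - int i) s c w = fsum (\<lambda>r. fsum (\<lambda>q. x i q r))" .
    qed
    have 3: "fsum (\<lambda>i. be k i \<odot> P u (P a v (int i) s) (n + k - int i) b c w) = fsum (\<lambda>i. fsum (\<lambda>q. fsum (\<lambda>r. x' i q r)))"
    proof (intro arg_cong[of _ _ fsum] ext)
      fix i
      have "P u (P a v (int i) s) (n + k - int i) b c w
        = fsum (\<lambda>q. gb s q \<odot> P u (Cav (int i + int q)) (n + k - int i) b (s + c - int N * int q) w)"
        by (rule P_P_right[OF u Jav Cav refl])
      moreover have "fin1 (\<lambda>q. gb s q \<odot> P u (Cav (int i + int q)) (n + k - int i) b (s + c - int N * int q) w)"
        by (rule fin1_scl, rule fin1I[of I']) (use I' in \<open>simp add: P_right_zero[OF u] flip: of_nat_add\<close>)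
      ultimately have "be k i \<odot> P u (P a v (int i) s) (n + k - int i) b c w
        = fsum (\<lambda>q. be k i \<odot> gb s q \<odot> P u (Cav (int i + int q)) (n + k - int i) b (s + c - int N * int q) w)"
        by (simp only: scl_fsum)
      also have "\<dots> = fsum (\<lambda>q. fsum (\<lambda>r. x' i q r))"
      proof (intro arg_cong[of _ _ fsum] ext)
        fix q
        show "be k i \<odot> gb s q \<odot> P u (Cav (int i + int q)) (n + k - int i) b (s + c - int N * int q) w = fsum (\<lambda>r. x' i q r)"
          unfolding jac_eq[OF Ju b] R_def fin2_scl_nest[OF fin_R[OF jac_vanishing[OF Ju]]]
          by (simp add: x'_def Q_def algebra_simps)
      qed
      finally show "be k i \<odot> P u (P a v (int i) s) (n + k - int i) b c w = fsum (\<lambda>q. fsum (\<lambda>r. x' i q r))" .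
    qed
    define A where "A q r = fsum (\<lambda>i. x i q r)" for q r
    define A' where "A' q r = fsum (\<lambda>i. x' i q r)" for q r
    have xiq: "fin2 (\<lambda>i q. x i q r)" for r
      by (rule fin2I2[of I]) (simp add: x0, rule xq)
    have fA: "fin2 A"
      unfolding A_def
    proof (rule fin2I1[of I])
      show "fin1 (\<lambda>q. fsum (\<lambda>i. x i q r))" for r by (rule fin2_outer[OF fin2_swap[OF xiq]])
    qed (simp add: x0)
    have x'ir: "fin2 (\<lambda>i r. x' i q r)" for q
      by (rule fin2I2[of I']) (simp add: x'0, rule x'r)
    have fA': "fin2 A'"
      unfolding A'_def
    proof (rule fin2I2[of I'])
      show "fin1 (\<lambda>r. fsum (\<lambda>i. x' i q r))" for q by (rule fin2_outer[OF fin2_swap[OF x'ir]])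
    qed (simp add: x'0)
    have 4: "fsum (\<lambda>i. fsum (\<lambda>r. fsum (\<lambda>q. x i q r))) = fsum (\<lambda>q. fsum (\<lambda>r. A q r))"
    proof -
      have "fin2 (\<lambda>i r. fsum (\<lambda>q. x i q r))" by (rule fin2_diagI[of I]) (simp add: x0)
      from fsum_swap[OF this] have "fsum (\<lambda>i. fsum (\<lambda>r. fsum (\<lambda>q. x i q r))) = fsum (\<lambda>r. fsum (\<lambda>i. fsum (\<lambda>q. x i q r)))" .
      also have "\<dots> = fsum (\<lambda>r. fsum (\<lambda>q. A q r))" unfolding A_def fsum_swap[OF xiq] ..
      also have "\<dots> = fsum (\<lambda>q. fsum (\<lambda>r. A q r))" by (rule fsum_swap[OF fin2_swap[OF fA]])
      finally show ?thesis .
    qed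
    have 5: "fsum (\<lambda>i. fsum (\<lambda>q. fsum (\<lambda>r. x' i q r))) = fsum (\<lambda>q. fsum (\<lambda>r. A' q r))"
    proof -
      have "fin2 (\<lambda>i q. fsum (\<lambda>r. x' i q r))" by (rule fin2_diagI[of I']) (simp add: x'0)
      from fsum_swap[OF this] have "fsum (\<lambda>i. fsum (\<lambda>q. fsum (\<lambda>r. x' i q r))) = fsum (\<lambda>q. fsum (\<lambda>i. fsum (\<lambda>r. x' i q r)))" .
      also have "\<dots> = fsum (\<lambda>q. fsum (\<lambda>r. A' q r))" unfolding A'_def fsum_swap[OF x'ir] ..
      finally show ?thesis .
    qed
    \<comment> \<open>The Jacobi identity of the algebra with \<open>q\<close> as mode of
      \<open>a\<close> and \<open>n + r\<close> as mode of \<open>u\<close>. Both double sums carry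
      the same weight and the same shift, so it applies inside them.\<close>
    have AA: "A q r - sg k \<odot> A' q r = (gb s q * gb b r) \<odot> (\<Sum>i\<le>q. of_nat (q choose i) \<odot> F (k + int i) (int q - int i + (n + int r)) (Q (q + r)) w)" for q r
    proof -
      have f: "fin1 (\<lambda>i. be k i \<odot> D (n + int i + int r) (k - int i + int q) (Q (q + r)) w)"
        by (rule fin1I[of I]) (use D0[OF I] in \<open>simp add: add.assoc flip: of_nat_add\<close>)
      have f': "fin1 (\<lambda>i. be k i \<odot> D' (int i + int q) (n + k - int i + int r) (Q (q + r)) w)"
        by (rule fin1I[of I']) (use D'0[OF I'] in \<open>simp flip: of_nat_add\<close>)
      show ?thesis
        unfolding jacobi A_def A'_def x_def x'_def scl_fsum[OF f, symmetric] scl_fsum[OF f', symmetric]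
        by (simp add: scale_right_diff_distrib algebra_simps)
    qed
    have 6: "fsum (\<lambda>q. fsum (\<lambda>r. A q r)) - sg k \<odot> fsum (\<lambda>q. fsum (\<lambda>r. A' q r))
       = fsum (\<lambda>q. fsum (\<lambda>r. A q r - sg k \<odot> A' q r))"
      unfolding scl_fsum[OF fin2_outer[OF fA']] scl_fsum[OF fin2_inner[OF fA']]
      by (rule fsum2_diff[OF fA fin2_scl[OF fA'], symmetric])
    \<comment> \<open>This splits \<open>q = i + j\<close>: the identity
      \<open>C(s/N,i) C(s/N - i,j) = C(s/N,i+j) C(i+j,i)\<close> produces the coefficients
      \<open>q choose i\<close> of \<open>jacobi\<close>.\<close>
    define y where "y i j r = (gb s (i + j) * of_nat ((i + j) choose i) * gb b r) \<odot> F (k + int i) (n + int j + int r) (Q (i + j + r)) w" for i j r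
    define J where "J = nat (Kau - k)"
    have y0: "y i j r = 0" if "J \<le> i" for i j r
      using F0(2)[of "k + int i"] that by (simp add: y_def J_def nat_le_iff)
    have yjr: "fin2 (\<lambda>j r. y i j r)" for i
    proof -
      obtain M where M: "\<And>d. M \<le> d \<Longrightarrow> F (k + int i) (n + int d) = (\<lambda>e w. 0)" using vanishing_nat[OF F] by blast
      show ?thesis by (rule fin2_diagI[of M]) (use M in \<open>simp add: y_def add.assoc flip: of_nat_add\<close>)
    qed
    have 7: "fsum (\<lambda>i. gb s i \<odot> R (F (k + int i)) n (s + b - int N * int i) c w) = fsum (\<lambda>i. fsum (\<lambda>j. fsum (\<lambda>r. y i j r)))"
    proof (intro arg_cong[of _ _ fsum] ext)
      fix i
      have "gb s i \<odot> R (F (k + int i)) n (s + b - int N * int i) c w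
        = fsum (\<lambda>l. gb s i \<odot> gb (s + b - int N * int i) l \<odot> F (k + int i) (n + int l) (s + b - int N * int i + c - int N * int l) w)"
        unfolding R_def by (rule scl_fsum[OF fin_R[OF F]])
      also have "\<dots> = fsum (\<lambda>l. \<Sum>j\<le>l. y i j (l - j))"
      proof (intro arg_cong[of _ _ fsum] ext)
        fix l
        have "gb s i * gb (s + b - int N * int i) l = (\<Sum>j\<le>l. gb s (i + j) * of_nat ((i + j) choose i) * gb b (l - j))"
        proof -
          have "s + b - int N * int i = s - int N * int i + b" by simp
          then show ?thesis unfolding gb_trinomial[symmetric]
            by (simp only: gb_vandermonde[symmetric] sum_distrib_left mult.assoc)
        qed
        then have "gb s i \<odot> gb (s + b - int N * int i) l \<odot> F (k + int i) (n + int l) (s + b - int N * int i + c - int N * int l) w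
           = (\<Sum>j\<le>l. (gb s (i + j) * of_nat ((i + j) choose i) * gb b (l - j)) \<odot> F (k + int i) (n + int l) (s + b - int N * int i + c - int N * int l) w)"
          by (simp only: scale_scale scale_sum_left)
        also have "\<dots> = (\<Sum>j\<le>l. y i j (l - j))"
        proof (rule sum.cong[OF refl])
          fix j assume "j \<in> {..l}"
          then have "n + int j + int (l - j) = n + int l" "Q (i + j + (l - j)) = s + b - int N * int i + c - int N * int l"
            by (simp_all add: of_nat_diff Q_def algebra_simps)
          then show "(gb s (i + j) * of_nat ((i + j) choose i) * gb b (l - j)) \<odot> F (k + int i) (n + int l) (s + b - int N * int i + c - int N * int l) w
            = y i j (l - j)" unfolding y_def by simp
        qed
        finally show "gb s i \<odot> gb (s + b - int N * int i) l \<odot> F (k + int i) (n + int l) (s + b - int N * int i + c - int N * int l) w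
          = (\<Sum>j\<le>l. y i j (l - j))" .
      qed
      also have "\<dots> = fsum (\<lambda>j. fsum (\<lambda>r. y i j r))" by (rule fsum_diag[OF yjr, symmetric])
      finally show "gb s i \<odot> R (F (k + int i)) n (s + b - int N * int i) c w = fsum (\<lambda>j. fsum (\<lambda>r. y i j r))" .
    qed
    also have "\<dots> = fsum (\<lambda>q. \<Sum>i\<le>q. fsum (\<lambda>r. y i (q - i) r))"
    proof (rule fsum_diag)
      show "fin2 (\<lambda>i j. fsum (\<lambda>r. y i j r))"
        by (rule fin2I2[of J]) (simp add: y0, rule fin2_outer[OF yjr])
    qed
    also have "\<dots> = fsum (\<lambda>q. fsum (\<lambda>r. A q r - sg k \<odot> A' q r))"
    proof (intro arg_cong[of _ _ fsum] ext)
      fix q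
      have "(\<Sum>i\<le>q. fsum (\<lambda>r. y i (q - i) r)) = fsum (\<lambda>r. \<Sum>i\<le>q. y i (q - i) r)"
        by (rule fsum_sum[symmetric]) (rule fin2_inner[OF yjr])
      also have "\<dots> = fsum (\<lambda>r. A q r - sg k \<odot> A' q r)"
      proof (intro arg_cong[of _ _ fsum] ext)
        fix r
        show "(\<Sum>i\<le>q. y i (q - i) r) = A q r - sg k \<odot> A' q r"
          unfolding AA scale_sum_right
        proof (rule sum.cong[OF refl])
          fix i assume "i \<in> {..q}"
          then have i: "i \<le> q" by simp
          have e: "n + int (q - i) + int r = int q - int i + (n + int r)" "i + (q - i) = q"
            using i by (simp_all add: of_nat_diff)
          show "y i (q - i) r = (gb s q * gb b r) \<odot> of_nat (q choose i) \<odot> F (k + int i) (int q - int i + (n + int r)) (Q (q + r)) w"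
            unfolding y_def e scale_scale by (simp only: mult_ac)
        qed
      qed
      finally show "(\<Sum>i\<le>q. fsum (\<lambda>r. y i (q - i) r)) = fsum (\<lambda>r. A q r - sg k \<odot> A' q r)" .
    qed
    finally show ?thesis unfolding 1 2 3 4 5 6 by simp
  qed
  define X where "X k n m l w = P (Cau k) v n m l w - R (F k) n m l w" for k n m l w
  have X: "\<forall>n m l w. m mod int N = (s + t) mod int N \<longrightarrow> X k n m l w = 0" for k
  proof (induction k rule: int_descend[of Kau])
    case (1 k)
    then show ?case by (simp add: X_def F0 P_left_zero[OF v] R_zero)
  next
    case (2 k)
    show ?case
    proof (intro allI impI)
      fix n m l w assume m: "m mod int N = (s + t) mod int N"
      let ?b = "m - s"
      have b: "?b mod int N = t mod int N" using m by (metis add_diff_cancel_left' mod_diff_left_eq)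
      let ?f = "\<lambda>i. gb s i \<odot> P (Cau (k + int i)) v n (s + ?b - int N * int i) l w"
      let ?g = "\<lambda>i. gb s i \<odot> R (F (k + int i)) n (s + ?b - int N * int i) l w"
      have ff: "fin1 ?f" by (rule fin1I[of "nat (Kau - k)"]) (simp add: F0 nat_le_iff P_left_zero[OF v])
      have fg: "fin1 ?g" by (rule fin1I[of "nat (Kau - k)"]) (simp add: F0 nat_le_iff R_zero)
      have "fsum (\<lambda>i. ?f i - ?g i) = 0" unfolding fsum_diff[OF ff fg] main[OF b] by simp
      moreover have "fsum (\<lambda>i. ?f i - ?g i) = ?f 0 - ?g 0"
      proof (rule fsum_single)
        fix i :: nat assume i: "i \<noteq> 0"
        have "(s + ?b - int N * int i) mod int N = (s + t) mod int N"
          using m mod_mult_self2[of m "int N" "- int i"] by simp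
        then have "X (k + int i) n (s + ?b - int N * int i) l w = 0" using 2[of "k + int i"] i by simp
        then show "?f i - ?g i = 0" by (simp add: X_def)
      qed
      ultimately show "X k n m l w = 0" by (simp add: X_def)
    qed
  qed
  show ?thesis unfolding jac_def using X[of k] F[of k] by (simp add: X_def)
qed

end

subsection \<open>Roots of unity and averages\<close>

lemma omega_powi: "omega N powi k = exp (2 * of_real pi * \<i> * of_int k / of_nat N)"
proof -
  have "exp (2 * of_real pi * \<i> / of_nat N) powi k = exp (of_int k * (2 * of_real pi * \<i> / of_nat N))"
    by (rule exp_power_int)
  then show ?thesis by (simp add: omega_def mult_ac)
qed

lemma omega_nz [simp]: "omega N \<noteq> 0"
  by (simp add: omega_def)

lemma omega_add: "omega N powi (k + l) = omega N powi k * omega N powi l"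
  by (simp add: power_int_add)

lemma omega_one_iff: "N > 0 \<Longrightarrow> omega N powi k = 1 \<longleftrightarrow> int N dvd k"
proof -
  assume N: "N > 0"
  have "omega N powi k = 1 \<longleftrightarrow> (\<exists>n::int. 2 * pi * real_of_int k / real N = real_of_int (2 * n) * pi)"
    unfolding omega_powi exp_eq_1 by simp
  also have "\<dots> \<longleftrightarrow> (\<exists>n::int. real_of_int k = real_of_int (int N * n))"
    using N by (intro ex_cong1) (auto simp: field_simps)
  also have "\<dots> \<longleftrightarrow> int N dvd k" unfolding of_int_eq_iff dvd_def ..
  finally show ?thesis .
qed

lemma omega_eq_iff: "N > 0 \<Longrightarrow> omega N powi k = omega N powi l \<longleftrightarrow> k mod int N = l mod int N"
proof -
  assume N: "N > 0"
  have "omega N powi k = omega N powi l \<longleftrightarrow> omega N powi (k - l) = 1"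
    by (simp add: power_int_diff)
  also have "\<dots> \<longleftrightarrow> k mod int N = l mod int N"
    unfolding omega_one_iff[OF N] mod_eq_dvd_iff ..
  finally show ?thesis .
qed

lemma omega_sum:
  assumes N: "N > 0"
  shows "(\<Sum>j<N. omega N powi (int j * d)) = (if int N dvd d then of_nat N else 0)"
proof -
  have e: "omega N powi (int j * d) = (omega N powi d) ^ j" for j
    by (simp add: power_int_mult mult.commute flip: power_int_of_nat)
  show ?thesis
  proof (cases "int N dvd d")
    case True
    then show ?thesis unfolding e using omega_one_iff[OF N, of d] by simp
  next
    case False
    then have ne: "omega N powi d \<noteq> 1" using omega_one_iff[OF N] by simp
    have "(omega N powi d) ^ N = 1"
      using e[of N] omega_one_iff[OF N, of "int N * d"] by simp
    then show ?thesis unfolding e using geometric_sum[OF ne, of N] False by simp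
  qed
qed

section \<open>Eigenspace decompositions for commuting maps of finite order\<close>

lemma linear_iff_lin:
  assumes "vector_space s1" "vector_space s2"
  shows "Vector_Spaces.linear s1 s2 f \<longleftrightarrow> (\<forall>x y. f (x + y) = f x + f y) \<and> (\<forall>c x. f (s1 c x) = s2 c (f x))"
  using assms by (simp add: Vector_Spaces.linear_def module_hom_def module_hom_axioms_def module_iff_vector_space)

lemma linear_dest:
  assumes "Vector_Spaces.linear s1 s2 f"
  shows "f (x + y) = f x + f y" "f (s1 c x) = s2 c (f x)" "f 0 = 0" "f (x - y) = f x - f y" "f (- x) = - f x"
    "f (sum g A) = (\<Sum>i\<in>A. f (g i))"
proof -
  interpret l: Vector_Spaces.linear s1 s2 f by fact
  show "f (x + y) = f x + f y" "f (s1 c x) = s2 c (f x)" "f 0 = 0" "f (x - y) = f x - f y" "f (- x) = - f x"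
    "f (sum g A) = (\<Sum>i\<in>A. f (g i))"
    by (rule l.add l.scale l.zero l.diff l.neg l.sum)+
qed

context vector_space
begin

lemma linear_idf: "Vector_Spaces.linear scale scale id" "Vector_Spaces.linear scale scale (\<lambda>x. x)"
  by (simp_all add: Vector_Spaces.linear_def module_hom_def module_hom_axioms_def vector_space_axioms module_axioms)

lemma linear_o: "Vector_Spaces.linear scale scale f \<Longrightarrow> Vector_Spaces.linear scale scale g \<Longrightarrow> Vector_Spaces.linear scale scale (f \<circ> g)"
  by (simp add: Vector_Spaces.linear_def module_hom_def module_hom_axioms_def)

lemma linear_funpow: "Vector_Spaces.linear scale scale f \<Longrightarrow> Vector_Spaces.linear scale scale (f ^^ j)"
proof (induction j)
  case 0
  show ?case unfolding funpow.simps by (rule linear_idf)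
next
  case (Suc j)
  show ?case unfolding funpow.simps by (rule linear_o[OF Suc.prems Suc.IH[OF Suc.prems]])
qed

end

locale periodic_map = vector_space scl
  for scl :: "complex \<Rightarrow> 'g::ab_group_add \<Rightarrow> 'g" +
  fixes f :: "'g \<Rightarrow> 'g" and M :: nat
  assumes lin_f: "Vector_Spaces.linear scl scl f" and per: "f ^^ M = id" and M_pos: "M > 0"
begin

text \<open>The discrete Fourier projection onto the eigenspace for
  \<open>omega M powi k\<close>.\<close>

definition ep :: "int \<Rightarrow> 'g \<Rightarrow> 'g" where
  "ep k a = scl (1 / of_nat M) (\<Sum>j<M. scl (omega M powi (- (int j * k))) ((f ^^ j) a))"

lemma linear_ep: "Vector_Spaces.linear scl scl (ep k)"
  unfolding linear_iff_lin[OF vector_space_axioms vector_space_axioms] ep_def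
  using linear_dest(1,2)[OF linear_funpow[OF lin_f]]
  by (simp add: scale_right_distrib sum.distrib scale_sum_right mult_ac)

lemma ep_eigen: "f (ep k a) = scl (omega M powi k) (ep k a)"
proof -
  let ?g = "\<lambda>j. scl (omega M powi (k - int j * k)) ((f ^^ j) a)"
  \<comment> \<open>Applying \<open>f\<close> shifts the summation index; the sum closes up
    cyclically because \<open>f ^^ M = id\<close>.\<close>
  have g0: "?g M = ?g 0"
    using omega_eq_iff[OF M_pos, of "k - int M * k" k] mod_mult_self2[of k "int M" "- k"] by (simp add: per)
  have "f (ep k a) = scl (1 / of_nat M) (\<Sum>j<M. scl (omega M powi (- (int j * k))) ((f ^^ Suc j) a))"
    unfolding ep_def linear_dest(2,6)[OF lin_f] by simp
  also have "(\<Sum>j<M. scl (omega M powi (- (int j * k))) ((f ^^ Suc j) a)) = (\<Sum>j<M. ?g (Suc j))"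
    by (simp add: algebra_simps)
  also have "\<dots> = (\<Sum>j<M. ?g j)"
    using sum.lessThan_Suc_shift[of ?g M] g0 by simp
  also have "\<dots> = scl (omega M powi k) (\<Sum>j<M. scl (omega M powi (- (int j * k))) ((f ^^ j) a))"
    by (simp add: scale_sum_right power_int_diff power_int_minus field_simps)
  finally show ?thesis unfolding ep_def by (simp add: mult.commute)
qed

lemma funpow_eigen: "f a = scl (omega M powi l) a \<Longrightarrow> (f ^^ j) a = scl (omega M powi (int j * l)) a"
proof (induction j)
  case (Suc j)
  have "int (Suc j) * l = l + int j * l" by (simp add: algebra_simps)
  then show ?case using Suc by (simp only: funpow.simps o_apply linear_dest(2)[OF lin_f] omega_add scale_scale mult.commute)
qed simp

lemma ep_on_eigen:
  assumes "f a = scl (omega M powi l) a"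
  shows "ep k a = (if k mod int M = l mod int M then a else 0)"
proof -
  have "ep k a = scl (1 / of_nat M * (\<Sum>j<M. omega M powi (int j * (l - k)))) a"
    unfolding ep_def funpow_eigen[OF assms] scale_scale[symmetric] scale_sum_left
    by (simp add: power_int_diff power_int_minus right_diff_distrib field_simps)
  then show ?thesis
    unfolding omega_sum[OF M_pos] using M_pos mod_eq_dvd_iff[of l "int M" k] by auto
qed

lemma ep_sum: "(\<Sum>k<M. ep (int k) a) = a"
proof -
  have "(\<Sum>k<M. ep (int k) a) = scl (1 / of_nat M) (\<Sum>j<M. \<Sum>k<M. scl (omega M powi (- (int j * int k))) ((f ^^ j) a))"
    unfolding ep_def scale_sum_right[symmetric] by (subst sum.swap) simp
  also have "(\<Sum>j<M. \<Sum>k<M. scl (omega M powi (- (int j * int k))) ((f ^^ j) a)) = (\<Sum>j<M. scl (if j = 0 then of_nat M else 0) ((f ^^ j) a))"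
  proof (rule sum.cong[OF refl])
    fix j assume j: "j \<in> {..<M}"
    have "int M dvd - int j \<longleftrightarrow> j = 0" using j by (auto simp: zdvd_not_zless)
    then have "(\<Sum>k<M. omega M powi (int k * (- int j))) = (if j = 0 then of_nat M else 0)"
      unfolding omega_sum[OF M_pos] by simp
    then show "(\<Sum>k<M. scl (omega M powi (- (int j * int k))) ((f ^^ j) a)) = scl (if j = 0 then of_nat M else 0) ((f ^^ j) a)"
      by (simp add: mult.commute flip: scale_sum_left)
  qed
  also have "\<dots> = scl (of_nat M) a"
    using M_pos by (subst sum.remove[of _ 0]) auto
  finally show ?thesis using M_pos by simp
qed

lemma ep_commute:
  assumes "Vector_Spaces.linear scl scl T" "\<And>a. T (f a) = f (T a)"
  shows "T (ep k a) = ep k (T a)"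
proof -
  have "T ((f ^^ j) a) = (f ^^ j) (T a)" for j by (induction j) (simp_all add: assms(2))
  then show ?thesis unfolding ep_def linear_dest(2,6)[OF assms(1)] by simp
qed

end

locale commuting_family = vector_space scl
  for scl :: "complex \<Rightarrow> 'g::ab_group_add \<Rightarrow> 'g" +
  fixes s :: "'i::finite \<Rightarrow> 'g \<Rightarrow> 'g" and M :: "'i \<Rightarrow> nat"
  assumes periodic: "periodic_map scl (s i) (M i)" and comm: "s i (s j a) = s j (s i a)"
begin

abbreviation epi :: "'i \<Rightarrow> int \<Rightarrow> 'g \<Rightarrow> 'g" where
  "epi i \<equiv> periodic_map.ep scl (s i) (M i)"

definition jeig :: "('i \<Rightarrow> int) \<Rightarrow> 'g set" where
  "jeig k = {a. \<forall>i. s i a = scl (omega (M i) powi (k i)) a}"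

text \<open>The joint projection runs along a list, which gives the unordered finite index type an
  induction; \<open>jproj\<close> takes any enumeration.\<close>

definition pr :: "'i list \<Rightarrow> ('i \<Rightarrow> int) \<Rightarrow> 'g \<Rightarrow> 'g" where
  "pr xs k = foldr (\<lambda>i. epi i (k i)) xs"

definition jproj :: "('i \<Rightarrow> int) \<Rightarrow> 'g \<Rightarrow> 'g" where
  "jproj = pr (SOME xs. set xs = UNIV \<and> distinct xs)"

lemmas lin_s = periodic_map.lin_f[OF periodic]

lemma pr_simps: "pr [] k a = a" "pr (x # xs) k a = epi x (k x) (pr xs k a)"
  by (simp_all add: pr_def)

lemma linear_pr: "Vector_Spaces.linear scl scl (pr xs k)"
proof (induction xs)
  case Nil
  then show ?case by (simp add: pr_def linear_idf)
next
  case (Cons x xs)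
  have "pr (x # xs) k = epi x (k x) \<circ> pr xs k" by (simp add: pr_def)
  then show ?case by (simp only: linear_o[OF periodic_map.linear_ep[OF periodic] Cons.IH])
qed

lemma pr_eigen: "i \<in> set xs \<Longrightarrow> s i (pr xs k a) = scl (omega (M i) powi (k i)) (pr xs k a)"
proof (induction xs)
  case (Cons x xs)
  show ?case
  proof (cases "i = x")
    case True
    show ?thesis unfolding pr_simps True by (rule periodic_map.ep_eigen[OF periodic])
  next
    case False
    then have "i \<in> set xs" using Cons.prems by simp
    then have IH: "s i (pr xs k a) = scl (omega (M i) powi (k i)) (pr xs k a)" by (rule Cons.IH)
    have "s i (epi x (k x) (pr xs k a)) = epi x (k x) (s i (pr xs k a))"
      by (rule periodic_map.ep_commute[where scl = scl and f = "s x" and M = "M x" and T = "s i"])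
         (rule periodic, rule lin_s, rule comm)
    then show ?thesis unfolding pr_simps IH linear_dest(2)[OF periodic_map.linear_ep[OF periodic]] .
  qed
qed simp

lemma pr_on_eigen:
  assumes "\<And>i. s i a = scl (omega (M i) powi (l i)) a"
  shows "pr xs k a = (if \<forall>i\<in>set xs. k i mod int (M i) = l i mod int (M i) then a else 0)"
proof (induction xs)
  case (Cons x xs)
  have e: "epi x (k x) a = (if k x mod int (M x) = l x mod int (M x) then a else 0)"
    by (rule periodic_map.ep_on_eigen[OF periodic assms])
  have z: "epi x (k x) 0 = 0" by (rule linear_dest(3)[OF periodic_map.linear_ep[OF periodic]])
  show ?case
  proof (cases "\<forall>i\<in>set xs. k i mod int (M i) = l i mod int (M i)")
    case True
    then have p: "pr xs k a = a" unfolding Cons.IH by simp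
    show ?thesis unfolding pr_simps p e using True by simp
  next
    case False
    have p: "pr xs k a = 0" unfolding Cons.IH by (rule if_not_P[OF False])
    show ?thesis unfolding pr_simps p z using False by auto
  qed
qed (simp add: pr_simps)

lemma pr_upd: "x \<notin> set xs \<Longrightarrow> pr xs (k(x := j)) = pr xs k"
  by (induction xs) (auto simp: pr_def)

text \<open>Each further index writes every component as a sum of finer components.\<close>

lemma pr_span: "distinct xs \<Longrightarrow> a \<in> span (range (\<lambda>k. pr xs k a))"
proof (induction xs)
  case Nil
  show ?case by (rule span_base) (simp add: pr_simps)
next
  case (Cons x xs)
  then have x: "x \<notin> set xs" and IH: "a \<in> span (range (\<lambda>k. pr xs k a))" by auto
  have "range (\<lambda>k. pr xs k a) \<subseteq> span (range (\<lambda>k. pr (x # xs) k a))"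
  proof
    fix b assume "b \<in> range (\<lambda>k. pr xs k a)"
    then obtain k where b: "b = pr xs k a" by blast
    have "b = (\<Sum>j<M x. epi x (int j) b)" by (rule periodic_map.ep_sum[OF periodic, symmetric])
    also have "\<dots> = (\<Sum>j<M x. pr (x # xs) (k(x := int j)) a)"
      by (simp add: pr_simps pr_upd[OF x] b)
    also have "\<dots> \<in> span (range (\<lambda>k. pr (x # xs) k a))"
      by (rule span_sum) (auto intro: span_base)
    finally show "b \<in> span (range (\<lambda>k. pr (x # xs) k a))" .
  qed
  then have "span (range (\<lambda>k. pr xs k a)) \<subseteq> span (range (\<lambda>k. pr (x # xs) k a))"
    by (rule span_minimal) (rule subspace_span)
  then show ?case using IH by (rule subsetD)
qed

lemma enum: "set (SOME xs. set xs = (UNIV :: 'i set) \<and> distinct xs) = UNIV"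
  "distinct (SOME xs. set xs = (UNIV :: 'i set) \<and> distinct xs)"
proof -
  have "\<exists>xs. set xs = (UNIV :: 'i set) \<and> distinct xs" by (rule finite_distinct_list) simp
  from someI_ex[OF this] show "set (SOME xs. set xs = (UNIV :: 'i set) \<and> distinct xs) = UNIV"
    "distinct (SOME xs. set xs = (UNIV :: 'i set) \<and> distinct xs)" by auto
qed

lemma linear_jproj: "Vector_Spaces.linear scl scl (jproj k)"
  unfolding jproj_def by (rule linear_pr)

lemma jproj_in: "jproj k a \<in> jeig k"
  unfolding jproj_def jeig_def by (simp add: pr_eigen enum)

lemma jproj_on:
  "a \<in> jeig l \<Longrightarrow> jproj k a = (if \<forall>i. k i mod int (M i) = l i mod int (M i) then a else 0)"
  unfolding jproj_def by (subst pr_on_eigen[of a l]) (simp_all add: jeig_def enum)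

lemma jproj_id: "a \<in> jeig k \<Longrightarrow> jproj k a = a"
  by (simp add: jproj_on)

lemma jeig_span: "span (\<Union>k. jeig k) = UNIV"
proof -
  have "a \<in> span (\<Union>k. jeig k)" for a
  proof -
    have "a \<in> span (range (\<lambda>k. jproj k a))" unfolding jproj_def by (rule pr_span[OF enum(2)])
    moreover have "range (\<lambda>k. jproj k a) \<subseteq> (\<Union>k. jeig k)" using jproj_in by blast
    ultimately show ?thesis by (meson span_mono subsetD)
  qed
  then show ?thesis by auto
qed

lemma M_pos: "M i > 0"
  using periodic_map.M_pos[OF periodic] .

lemma jeig_cong: "(\<And>i. k i mod int (M i) = l i mod int (M i)) \<Longrightarrow> jeig k = jeig l"
proof -
  assume "\<And>i. k i mod int (M i) = l i mod int (M i)"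
  then have "omega (M i) powi (k i) = omega (M i) powi (l i)" for i
    unfolding omega_eq_iff[OF M_pos] .
  then show ?thesis unfolding jeig_def by simp
qed

lemma subspace_jeig: "subspace (jeig k)"
  unfolding subspace_def jeig_def
  by (simp add: linear_dest[OF lin_s] scale_right_distrib mult.commute)

text \<open>Replaces a description by unique existence with a linear projection. Existence is tested
  on joint eigenvectors, which span. Uniqueness holds because an eigenspace that differs as a set
  has some different residue, so the projection vanishes on it.\<close>

lemma eigen_part_eq:
  assumes d: "surj d"
  shows "eigen_part scl (\<lambda>k. jeig (d k)) k a = jproj (d k) a"
proof -
  let ?U = "\<Union>l\<in>{l. jeig (d l) \<noteq> jeig (d k)}. jeig (d l)"
  have dif: "a - jproj (d k) a \<in> span ?U"
  proof -
    have "subspace {a. a - jproj (d k) a \<in> span ?U}"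
    proof (rule subspaceI)
      show "0 \<in> {a. a - jproj (d k) a \<in> span ?U}" by (simp add: linear_dest[OF linear_jproj] span_zero)
    next
      fix x y assume "x \<in> {a. a - jproj (d k) a \<in> span ?U}" "y \<in> {a. a - jproj (d k) a \<in> span ?U}"
      then have "(x - jproj (d k) x) + (y - jproj (d k) y) \<in> span ?U" using span_add by blast
      then show "x + y \<in> {a. a - jproj (d k) a \<in> span ?U}" by (simp add: linear_dest[OF linear_jproj] algebra_simps)
    next
      fix c x assume "x \<in> {a. a - jproj (d k) a \<in> span ?U}"
      then have "scl c (x - jproj (d k) x) \<in> span ?U" using span_scale by blast
      then show "scl c x \<in> {a. a - jproj (d k) a \<in> span ?U}"
        by (simp add: linear_dest[OF linear_jproj] scale_right_diff_distrib)
    qed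
    moreover have "(\<Union>k. jeig k) \<subseteq> {a. a - jproj (d k) a \<in> span ?U}"
    proof
      fix b assume "b \<in> (\<Union>k. jeig k)"
      then obtain l where l: "b \<in> jeig (d l)" using surjD[OF d] by (metis UN_E)
      show "b \<in> {a. a - jproj (d k) a \<in> span ?U}"
      proof (cases "jproj (d k) b = b")
        case True
        then show ?thesis by (simp add: span_zero)
      next
        case False
        have "jproj (d k) b = b \<or> jproj (d k) b = 0" unfolding jproj_on[OF l] by simp
        then have "jproj (d k) b = 0" using False by blast
        moreover have "jeig (d l) \<noteq> jeig (d k)" using False l jproj_id by blast
        ultimately show ?thesis using l by (auto intro: span_base)
      qed
    qed
    ultimately have "span (\<Union>k. jeig k) \<subseteq> {a. a - jproj (d k) a \<in> span ?U}" by (intro span_minimal)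
    then show ?thesis unfolding jeig_span by blast
  qed
  have kill: "jproj (d k) b = 0" if "b \<in> span ?U" for b
  proof -
    have "subspace {b. jproj (d k) b = 0}"
      by (rule subspaceI) (simp_all add: linear_dest[OF linear_jproj])
    moreover have "?U \<subseteq> {b. jproj (d k) b = 0}"
    proof
      fix b assume "b \<in> ?U"
      then obtain l where l: "b \<in> jeig (d l)" "jeig (d l) \<noteq> jeig (d k)" by blast
      then have n: "\<not> (\<forall>i. d k i mod int (M i) = d l i mod int (M i))" using jeig_cong by metis
      have "jproj (d k) b = 0" unfolding jproj_on[OF l(1)] if_not_P[OF n] ..
      then show "b \<in> {b. jproj (d k) b = 0}" by simp
    qed
    ultimately have "span ?U \<subseteq> {b. jproj (d k) b = 0}" by (intro span_minimal)
    then show ?thesis using that by blast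
  qed
  show ?thesis
    unfolding eigen_part_def
  proof (rule the_equality)
    show "jproj (d k) a \<in> jeig (d k) \<and> a - jproj (d k) a \<in> span ?U" using dif jproj_in by simp
    fix b assume b: "b \<in> jeig (d k) \<and> a - b \<in> span ?U"
    then have "jproj (d k) (a - b) = 0" using kill by blast
    then show "b = jproj (d k) a" using b jproj_id by (simp add: linear_dest[OF linear_jproj])
  qed
qed

end

subsection \<open>Invariance of the Killing form\<close>

locale finite_dim_space = vector_space scl
  for scl :: "complex \<Rightarrow> 'g::ab_group_add \<Rightarrow> 'g" +
  assumes fin_span: "\<exists>B. finite B \<and> span B = UNIV"
begin

definition Bas where "Bas = (SOME B. independent B \<and> span B = UNIV)"

lemma Bas: "independent Bas" "span Bas = UNIV" "finite Bas"
proof -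
  have "\<exists>B. independent B \<and> span B = UNIV"
  proof -
    obtain B where "independent B" "UNIV \<subseteq> span B" by (rule maximal_independent_subset[of UNIV])
    then show ?thesis by (intro exI[of _ B]) auto
  qed
  then have *: "independent Bas \<and> span Bas = UNIV" unfolding Bas_def by (rule someI_ex)
  then show "independent Bas" "span Bas = UNIV" by auto
  from fin_span obtain C where "finite C" "span C = UNIV" by blast
  then show "finite Bas" using independent_span_bound[of C Bas] * by auto
qed

abbreviation rp :: "'g \<Rightarrow> 'g \<Rightarrow> complex" where "rp \<equiv> representation Bas"

lemma rp_sum: "(\<Sum>b\<in>Bas. scl (rp x b) b) = x"
  by (rule sum_representation_eq[OF Bas(1) _ Bas(3)]) (simp_all add: Bas(2))

lemma rp_add: "rp (x + y) b = rp x b + rp y b"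
  using representation_add[OF Bas(1), of y x] Bas(2) by simp

lemma rp_scale: "rp (scl c x) b = c * rp x b"
  using representation_scale[OF Bas(1), of x c] Bas(2) by simp

lemma rp_zero: "rp 0 b = 0"
  by (simp add: representation_zero)

lemma rp_sum_right: "rp (\<Sum>i\<in>A. f i) b = (\<Sum>i\<in>A. rp (f i) b)"
  by (induction A rule: infinite_finite_induct) (simp_all add: rp_zero rp_add)

lemma trace_eq: "endo_trace scl f = (\<Sum>b\<in>Bas. rp (f b) b)"
  unfolding endo_trace_def Bas_def by (simp add: Let_def)

lemma trace_add: "endo_trace scl (\<lambda>x. f x + g x) = endo_trace scl f + endo_trace scl g"
  by (simp add: trace_eq rp_add sum.distrib)

lemma trace_scale: "endo_trace scl (\<lambda>x. scl c (f x)) = c * endo_trace scl f"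
  by (simp add: trace_eq rp_scale sum_distrib_left)

lemma trace_comm:
  assumes f: "Vector_Spaces.linear scl scl f" and g: "Vector_Spaces.linear scl scl g"
  shows "endo_trace scl (f \<circ> g) = endo_trace scl (g \<circ> f)"
proof -
  have c: "rp (f (g b)) b = (\<Sum>c\<in>Bas. rp (g b) c * rp (f c) b)"
    if f: "Vector_Spaces.linear scl scl f" for f g :: "'g \<Rightarrow> 'g" and b
  proof -
    have "f (g b) = (\<Sum>c\<in>Bas. scl (rp (g b) c) (f c))"
      by (subst rp_sum[symmetric, of "g b"]) (simp add: linear_dest[OF f])
    then show ?thesis by (simp add: rp_sum_right rp_scale)
  qed
  have "endo_trace scl (f \<circ> g) = (\<Sum>b\<in>Bas. \<Sum>c\<in>Bas. rp (g b) c * rp (f c) b)"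
    by (simp add: trace_eq c[OF f])
  also have "\<dots> = (\<Sum>c\<in>Bas. \<Sum>b\<in>Bas. rp (f c) b * rp (g b) c)"
    by (subst sum.swap) (simp add: mult.commute)
  also have "\<dots> = endo_trace scl (g \<circ> f)"
    by (simp add: trace_eq c[OF g])
  finally show ?thesis .
qed

end

text \<open>\<open>ad (\<sigma> x) = \<sigma> (ad x) \<sigma>^(-1)\<close>, and the trace is
  invariant under cyclic permutation.\<close>

lemma killing_automorphism:
  assumes s: "simple_fd_lie_algebra scl br" and a: "lie_automorphism scl br \<sigma>"
  shows "killing scl br (\<sigma> x) (\<sigma> y) = killing scl br x y"
proof -
  from s interpret L: complex_lie_algebra scl br by (simp add: simple_fd_lie_algebra_def)
  interpret F: finite_dim_space scl
    by unfold_locales (use s in \<open>simp add: simple_fd_lie_algebra_def\<close>)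
  from a have l: "Vector_Spaces.linear scl scl \<sigma>" and b: "bij \<sigma>" and h: "\<And>x y. \<sigma> (br x y) = br (\<sigma> x) (\<sigma> y)"
    by (auto simp: lie_automorphism_def)
  define \<tau> where "\<tau> = inv \<sigma>"
  have st: "\<sigma> (\<tau> x) = x" and ts: "\<tau> (\<sigma> x) = x" for x
    using b by (simp_all add: \<tau>_def bij_is_surj surj_f_inv_f bij_is_inj)
  have lt: "Vector_Spaces.linear scl scl \<tau>"
    unfolding linear_iff_lin[OF L.vector_space_axioms L.vector_space_axioms]
  proof (intro conjI allI)
    fix x y c
    show "\<tau> (x + y) = \<tau> x + \<tau> y" using ts[of "\<tau> x + \<tau> y"] by (simp only: linear_dest(1)[OF l] st)
    show "\<tau> (scl c x) = scl c (\<tau> x)" using ts[of "scl c (\<tau> x)"] by (simp only: linear_dest(2)[OF l] st)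
  qed
  have lb: "Vector_Spaces.linear scl scl (br x \<circ> br y)" for x y
    by (rule L.linear_o[OF L.br_linear_right L.br_linear_right])
  have "br (\<sigma> x) \<circ> br (\<sigma> y) = \<sigma> \<circ> ((br x \<circ> br y) \<circ> \<tau>)"
    by (simp add: fun_eq_iff h st)
  then have "killing scl br (\<sigma> x) (\<sigma> y) = endo_trace scl (((br x \<circ> br y) \<circ> \<tau>) \<circ> \<sigma>)"
    unfolding killing_def using F.trace_comm[OF l L.linear_o[OF lb lt]] by simp
  also have "((br x \<circ> br y) \<circ> \<tau>) \<circ> \<sigma> = br x \<circ> br y" by (simp add: fun_eq_iff ts)
  finally show ?thesis unfolding killing_def .
qed

lemma killing_bilinear:
  assumes s: "simple_fd_lie_algebra scl br"
  shows "killing scl br (x + x') y = killing scl br x y + killing scl br x' y"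
    "killing scl br (scl c x) y = c * killing scl br x y"
    "killing scl br x (y + y') = killing scl br x y + killing scl br x y'"
    "killing scl br x (scl c y) = c * killing scl br x y"
proof -
  from s interpret L: complex_lie_algebra scl br by (simp add: simple_fd_lie_algebra_def)
  interpret F: finite_dim_space scl
    by unfold_locales (use s in \<open>simp add: simple_fd_lie_algebra_def\<close>)
  note b = linear_dest(1,2)[OF L.br_linear_left] linear_dest(1,2)[OF L.br_linear_right]
  show "killing scl br (x + x') y = killing scl br x y + killing scl br x' y"
    "killing scl br (scl c x) y = c * killing scl br x y"
    "killing scl br x (y + y') = killing scl br x y + killing scl br x y'"
    "killing scl br x (scl c y) = c * killing scl br x y"
    by (simp_all add: killing_def o_def b F.trace_add F.trace_scale)
qed

subsection \<open>Universal property of induced modules\<close>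

lemma lookup_map_mult: "Poly_Mapping.lookup (Poly_Mapping.map ((*) c) f) k = c * Poly_Mapping.lookup f k" for c :: complex
  by (simp add: Poly_Mapping.map.rep_eq when_def)

lemma vector_space_poly: "vector_space (\<lambda>c::complex. Poly_Mapping.map ((*) c) :: ('k \<Rightarrow>\<^sub>0 complex) \<Rightarrow> _)"
  by unfold_locales (rule poly_mapping_eqI; simp add: lookup_map_mult lookup_add algebra_simps)+

locale complex_space = vector_space scl for scl :: "complex \<Rightarrow> 'b::ab_group_add \<Rightarrow> 'b"
begin

definition lext :: "('k \<Rightarrow> 'b) \<Rightarrow> ('k \<Rightarrow>\<^sub>0 complex) \<Rightarrow> 'b" where
  "lext h f = (\<Sum>k\<in>Poly_Mapping.keys f. scl (Poly_Mapping.lookup f k) (h k))"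

lemma lext_superset: "finite A \<Longrightarrow> Poly_Mapping.keys f \<subseteq> A \<Longrightarrow> lext h f = (\<Sum>k\<in>A. scl (Poly_Mapping.lookup f k) (h k))"
  unfolding lext_def by (rule sum.mono_neutral_left) (auto simp: in_keys_iff)

lemma lext_add: "lext h (f + g) = lext h f + lext h g"
proof -
  let ?A = "Poly_Mapping.keys f \<union> Poly_Mapping.keys g"
  have "Poly_Mapping.keys (f + g) \<subseteq> ?A" by (rule keys_add)
  then show ?thesis
    by (simp add: lext_superset[of ?A] lookup_add scale_left_distrib sum.distrib)
qed

lemma lext_diff: "lext h (f - g) = lext h f - lext h g"
  using lext_add[of h "f - g" g] by simp

lemma lext_single: "lext h (Poly_Mapping.single k c) = scl c (h k)"
  by (simp add: lext_superset[of "{k}"])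

lemma lext_zero: "lext h 0 = 0"
  by (simp add: lext_def)

lemma lext_map:
  assumes "\<And>k. Poly_Mapping.lookup f' k = c * Poly_Mapping.lookup f k"
  shows "lext h f' = scl c (lext h f)"
proof -
  have "Poly_Mapping.keys f' \<subseteq> Poly_Mapping.keys f" using assms by (auto simp: in_keys_iff)
  from lext_superset[OF finite_keys this, of h] show ?thesis by (simp add: lext_def assms scale_sum_right)
qed

end

definition words :: "'l set \<Rightarrow> ('l list \<times> 'm \<Rightarrow>\<^sub>0 complex) set" where
  "words L = {f. Poly_Mapping.keys f \<subseteq> lists L \<times> UNIV}"

lemma words_add: "f \<in> words L \<Longrightarrow> g \<in> words L \<Longrightarrow> f + g \<in> words L"
  using keys_add[of f g] by (auto simp: words_def)

lemma words_map: "f \<in> words L \<Longrightarrow> Poly_Mapping.map ((*) c) f \<in> words L"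
  by (auto simp: words_def in_keys_iff lookup_map_mult subset_iff)

lemma words_diff: "f \<in> words L \<Longrightarrow> g \<in> words L \<Longrightarrow> f - g \<in> words L"
proof -
  assume "f \<in> words L" "g \<in> words L"
  moreover have "Poly_Mapping.keys (f - g) \<subseteq> Poly_Mapping.keys f \<union> Poly_Mapping.keys g"
    by (auto simp: in_keys_iff lookup_minus)
  ultimately show ?thesis by (auto simp: words_def)
qed

lemma words_single: "u \<in> lists L \<Longrightarrow> Poly_Mapping.single (u, m) c \<in> words L"
  by (auto simp: words_def)

locale induced_module =
  fixes scaleL :: "complex \<Rightarrow> 'l::ab_group_add \<Rightarrow> 'l" and brL :: "'l \<Rightarrow> 'l \<Rightarrow> 'l" and L Pos and scaleM :: "complex \<Rightarrow> 'm::ab_group_add \<Rightarrow> 'm"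
    and actM and scaleV :: "complex \<Rightarrow> 'v::ab_group_add \<Rightarrow> 'v" and tens actV
  assumes ind: "is_induced_module scaleL brL L Pos scaleM actM scaleV tens actV"
begin

sublocale V: complex_space scaleV
  using ind by (simp add: is_induced_module_def complex_space_def)

abbreviation ten where "ten \<equiv> (\<lambda>k. tens (fst k) (snd k))"

lemma surj_words: "\<exists>f\<in>words L. V.lext ten f = v"
proof -
  have "V.lext ten ` words L = UNIV"
    using ind unfolding is_induced_module_def Let_def words_def V.lext_def[abs_def] by blast
  then have "v \<in> V.lext ten ` words L" by simp
  then show ?thesis by blast
qed

lemma kernel: "f \<in> words L \<Longrightarrow> V.lext ten f = 0 \<longleftrightarrow>
    f \<in> module.span (\<lambda>c. Poly_Mapping.map ((*) c)) (induced_relations scaleL brL L Pos scaleM actM)"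
  using ind unfolding is_induced_module_def Let_def words_def V.lext_def by blast

lemma actV_linear: "x \<in> L \<Longrightarrow> Vector_Spaces.linear scaleV scaleV (actV x)"
  and actV_tens: "x \<in> L \<Longrightarrow> u \<in> lists L \<Longrightarrow> actV x (tens u m) = tens (x # u) m"
  using ind unfolding is_induced_module_def by blast+

lemma relation_zero: "r \<in> words L \<Longrightarrow> r \<in> induced_relations scaleL brL L Pos scaleM actM \<Longrightarrow> V.lext ten r = 0"
  using kernel module.span_base[OF vector_space_poly[folded module_iff_vector_space]] by blast

lemma tens_relations:
  assumes u: "u \<in> lists L" and v: "v \<in> lists L"
  shows "x \<in> L \<Longrightarrow> y \<in> L \<Longrightarrow> x + y \<in> L \<Longrightarrow> tens (u @ [x + y] @ v) m = tens (u @ [x] @ v) m + tens (u @ [y] @ v) m"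
    and "x \<in> L \<Longrightarrow> scaleL c x \<in> L \<Longrightarrow> tens (u @ [scaleL c x] @ v) m = scaleV c (tens (u @ [x] @ v) m)"
    and "x \<in> L \<Longrightarrow> y \<in> L \<Longrightarrow> brL x y \<in> L \<Longrightarrow> tens (u @ [x, y] @ v) m = tens (u @ [y, x] @ v) m + tens (u @ [brL x y] @ v) m"
    and "tens u (m + m') = tens u m + tens u m'"
    and "tens u (scaleM c m) = scaleV c (tens u m)"
    and "w \<in> lists Pos \<Longrightarrow> Pos \<subseteq> L \<Longrightarrow> tens (u @ w) m = tens u (foldr actM w m)"
proof -
  note e = V.lext_diff V.lext_single
  show "tens (u @ [x + y] @ v) m = tens (u @ [x] @ v) m + tens (u @ [y] @ v) m" if "x \<in> L" "y \<in> L" "x + y \<in> L"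
  proof -
    have "V.lext ten (Poly_Mapping.single (u @ [x + y] @ v, m) 1 - Poly_Mapping.single (u @ [x] @ v, m) 1 - Poly_Mapping.single (u @ [y] @ v, m) 1) = 0"
      by (rule relation_zero[OF _ induced_relations.add_letter]) (use u v that in \<open>auto intro!: words_diff words_single\<close>)
    then show ?thesis unfolding e by (simp add: algebra_simps)
  qed
  show "tens (u @ [scaleL c x] @ v) m = scaleV c (tens (u @ [x] @ v) m)" if "x \<in> L" "scaleL c x \<in> L"
  proof -
    have "V.lext ten (Poly_Mapping.single (u @ [scaleL c x] @ v, m) 1 - Poly_Mapping.single (u @ [x] @ v, m) c) = 0"
      by (rule relation_zero[OF _ induced_relations.scale_letter]) (use u v that in \<open>auto intro!: words_diff words_single\<close>)
    then show ?thesis unfolding e by (simp add: algebra_simps)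
  qed
  show "tens (u @ [x, y] @ v) m = tens (u @ [y, x] @ v) m + tens (u @ [brL x y] @ v) m" if "x \<in> L" "y \<in> L" "brL x y \<in> L"
  proof -
    have "V.lext ten (Poly_Mapping.single (u @ [x, y] @ v, m) 1 - Poly_Mapping.single (u @ [y, x] @ v, m) 1 - Poly_Mapping.single (u @ [brL x y] @ v, m) 1) = 0"
      by (rule relation_zero[OF _ induced_relations.bracket]) (use u v that in \<open>auto intro!: words_diff words_single\<close>)
    then show ?thesis unfolding e by (simp add: algebra_simps)
  qed
  show "tens u (m + m') = tens u m + tens u m'"
  proof -
    have "V.lext ten (Poly_Mapping.single (u, m + m') 1 - Poly_Mapping.single (u, m) 1 - Poly_Mapping.single (u, m') 1) = 0"
      by (rule relation_zero[OF _ induced_relations.add_right]) (use u v in \<open>auto intro!: words_diff words_single\<close>)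
    then show ?thesis unfolding e by (simp add: algebra_simps)
  qed
  show "tens u (scaleM c m) = scaleV c (tens u m)"
  proof -
    have "V.lext ten (Poly_Mapping.single (u, scaleM c m) 1 - Poly_Mapping.single (u, m) c) = 0"
      by (rule relation_zero[OF _ induced_relations.scale_right]) (use u v in \<open>auto intro!: words_diff words_single\<close>)
    then show ?thesis unfolding e by (simp add: algebra_simps)
  qed
  show "tens (u @ w) m = tens u (foldr actM w m)" if "w \<in> lists Pos" "Pos \<subseteq> L"
  proof -
    have "V.lext ten (Poly_Mapping.single (u @ w, m) 1 - Poly_Mapping.single (u, foldr actM w m) 1) = 0"
      by (rule relation_zero[OF _ induced_relations.balanced]) (use u v that in \<open>auto intro!: words_diff words_single\<close>)
    then show ?thesis unfolding e by (simp add: algebra_simps)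
  qed
qed

lemma module_generation:
  assumes S: "V.subspace S" and t: "\<And>m. tens [] m \<in> S" and a: "\<And>x v. x \<in> L \<Longrightarrow> v \<in> S \<Longrightarrow> actV x v \<in> S"
  shows "v \<in> S"
proof -
  have t': "tens u m \<in> S" if "u \<in> lists L" for u m
    using that
  proof (induction u)
    case (Cons x u)
    then show ?case using a[of x "tens u m"] actV_tens[of x u m] by simp
  qed (rule t)
  obtain f where f: "f \<in> words L" "V.lext ten f = v" using surj_words by blast
  show ?thesis unfolding f(2)[symmetric] V.lext_def
    by (intro V.subspace_sum[OF S] V.subspace_scale[OF S] t') (use f(1) in \<open>auto simp: words_def\<close>)
qed

text \<open>The target is a subspace \<open>T\<close>, and the module laws are asked for on
  \<open>T\<close> alone: products with currents are under control on local fields, not on all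
  series. Each defining relation of the induced module then holds for iterated operators applied to
  \<open>init\<close>.\<close>

lemma universal:
  fixes scaleX :: "complex \<Rightarrow> 'x::ab_group_add \<Rightarrow> 'x" and act :: "'l \<Rightarrow> 'x \<Rightarrow> 'x" and init :: "'m \<Rightarrow> 'x"
  assumes X: "vector_space scaleX" and T: "module.subspace scaleX T"
    and closed: "\<And>x t. x \<in> L \<Longrightarrow> t \<in> T \<Longrightarrow> act x t \<in> T"
    and act_add: "\<And>x t t'. x \<in> L \<Longrightarrow> t \<in> T \<Longrightarrow> t' \<in> T \<Longrightarrow> act x (t + t') = act x t + act x t'"
    and act_scale: "\<And>x c t. x \<in> L \<Longrightarrow> t \<in> T \<Longrightarrow> act x (scaleX c t) = scaleX c (act x t)"
    and add_act: "\<And>x y t. x \<in> L \<Longrightarrow> y \<in> L \<Longrightarrow> t \<in> T \<Longrightarrow> act (x + y) t = act x t + act y t"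
    and scale_act: "\<And>x c t. x \<in> L \<Longrightarrow> t \<in> T \<Longrightarrow> act (scaleL c x) t = scaleX c (act x t)"
    and bracket_act: "\<And>x y t. x \<in> L \<Longrightarrow> y \<in> L \<Longrightarrow> t \<in> T \<Longrightarrow> act (brL x y) t = act x (act y t) - act y (act x t)"
    and init_in: "\<And>m. init m \<in> T" and init_add: "\<And>m m'. init (m + m') = init m + init m'"
    and init_scale: "\<And>c m. init (scaleM c m) = scaleX c (init m)"
    and Pos: "Pos \<subseteq> L" and init_act: "\<And>x m. x \<in> Pos \<Longrightarrow> init (actM x m) = act x (init m)"
  shows "\<exists>\<phi>. Vector_Spaces.linear scaleV scaleX \<phi> \<and> (\<forall>v. \<phi> v \<in> T) \<and> (\<forall>m. \<phi> (tens [] m) = init m) \<and>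
      (\<forall>x\<in>L. \<forall>v. \<phi> (actV x v) = act x (\<phi> v))"
proof -
  interpret X: complex_space scaleX using X by (simp add: complex_space_def)
  define \<Phi> where "\<Phi> k = foldr act (fst k) (init (snd k))" for k
  have foldr_in: "foldr act u t \<in> T" if "u \<in> lists L" "t \<in> T" for u t
    using that by (induction u) (auto intro: closed)
  have foldr_add: "foldr act u (t + t') = foldr act u t + foldr act u t'" if "u \<in> lists L" "t \<in> T" "t' \<in> T" for u t t'
    using that by (induction u) (auto simp: act_add foldr_in)
  have foldr_scale: "foldr act u (scaleX c t) = scaleX c (foldr act u t)" if "u \<in> lists L" "t \<in> T" for u t c
    using that by (induction u) (auto simp: act_scale foldr_in)
  have foldr_init: "foldr act w (init m) = init (foldr actM w m)" if "w \<in> lists Pos" for w m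
    using that by (induction w) (auto simp: init_act)
  note Ti = foldr_in[OF _ init_in]
  have minus: "t - t' \<in> T" if "t \<in> T" "t' \<in> T" for t t'
    using X.subspace_diff[OF T that] .
  have rel: "X.lext \<Phi> r = 0" if "r \<in> induced_relations scaleL brL L Pos scaleM actM" for r
    using that
  proof induction
    case (add_letter u v x y m)
    show ?case using foldr_add[OF add_letter(1) closed[OF add_letter(3) Ti[OF add_letter(2)]] closed[OF add_letter(4) Ti[OF add_letter(2)]]]
      by (simp add: X.lext_diff X.lext_single \<Phi>_def add_act[OF add_letter(3,4) Ti[OF add_letter(2)]])
  next
    case (scale_letter u v x c m)
    show ?case using foldr_scale[OF scale_letter(1) closed[OF scale_letter(3) Ti[OF scale_letter(2)]]]
      by (simp add: X.lext_diff X.lext_single \<Phi>_def scale_act[OF scale_letter(3) Ti[OF scale_letter(2)]])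
  next
    case (bracket u v x y m)
    let ?t = "foldr act v (init m)"
    have t: "?t \<in> T" by (rule Ti[OF bracket(2)])
    have xy: "act x (act y ?t) \<in> T" "act y (act x ?t) \<in> T" using bracket t closed by auto
    have "act x (act y ?t) = act y (act x ?t) + (act x (act y ?t) - act y (act x ?t))" by simp
    then have "foldr act u (act x (act y ?t)) = foldr act u (act y (act x ?t)) + foldr act u (act x (act y ?t) - act y (act x ?t))"
      using foldr_add[OF bracket(1) xy(2) minus[OF xy]] by simp
    then show ?case
      by (simp add: X.lext_diff X.lext_single \<Phi>_def bracket_act[OF bracket(3,4) t])
  next
    case (add_right u m m')
    show ?case using foldr_add[OF add_right init_in init_in]
      by (simp add: X.lext_diff X.lext_single \<Phi>_def init_add)
  next
    case (scale_right u c m)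
    show ?case using foldr_scale[OF scale_right init_in]
      by (simp add: X.lext_diff X.lext_single \<Phi>_def init_scale)
  next
    case (balanced u v m)
    show ?case by (simp add: X.lext_diff X.lext_single \<Phi>_def foldr_init[OF balanced(2)])
  qed
  interpret Pm: vector_space "\<lambda>c::complex. Poly_Mapping.map ((*) c) :: ('l list \<times> 'm \<Rightarrow>\<^sub>0 complex) \<Rightarrow> _"
    by (rule vector_space_poly)
  have span0: "X.lext \<Phi> r = 0" if "r \<in> Pm.span (induced_relations scaleL brL L Pos scaleM actM)" for r
  proof -
    have "Pm.subspace {r. X.lext \<Phi> r = 0}"
      by (rule Pm.subspaceI) (auto simp: X.lext_zero X.lext_add X.lext_map[OF lookup_map_mult])
    then have "Pm.span (induced_relations scaleL brL L Pos scaleM actM) \<subseteq> {r. X.lext \<Phi> r = 0}"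
      by (rule Pm.span_minimal[rotated]) (use rel in auto)
    then show ?thesis using that by blast
  qed
  \<comment> \<open>A representing combination of words is chosen; the kernel of the quotient map is
    the span of the relations, so \<open>span0\<close> makes the value independent of the
    choice.\<close>
  define \<phi> where "\<phi> v = X.lext \<Phi> (SOME f. f \<in> words L \<and> V.lext ten f = v)" for v
  have \<phi>: "\<phi> (V.lext ten f) = X.lext \<Phi> f" if f: "f \<in> words L" for f
  proof -
    let ?g = "SOME g. g \<in> words L \<and> V.lext ten g = V.lext ten f"
    have g: "?g \<in> words L \<and> V.lext ten ?g = V.lext ten f"
      by (rule someI[where P = "\<lambda>g. g \<in> words L \<and> V.lext ten g = V.lext ten f"]) (use f in simp)
    then have "V.lext ten (?g - f) = 0" by (simp add: V.lext_diff)
    then have "X.lext \<Phi> (?g - f) = 0"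
      by (intro span0) (use kernel[OF words_diff[OF conjunct1[OF g] f]] in blast)
    then show ?thesis by (simp add: \<phi>_def X.lext_diff)
  qed
  have lin: "Vector_Spaces.linear scaleV scaleX \<phi>"
    unfolding linear_iff_lin[OF V.vector_space_axioms X]
  proof (intro conjI allI)
    fix v v' c
    obtain f g where f: "f \<in> words L" "V.lext ten f = v" and g: "g \<in> words L" "V.lext ten g = v'"
      using surj_words by meson
    show "\<phi> (v + v') = \<phi> v + \<phi> v'"
      using \<phi>[OF words_add[OF f(1) g(1)]] \<phi>[OF f(1)] \<phi>[OF g(1)] by (simp add: V.lext_add X.lext_add f g)
    show "\<phi> (scaleV c v) = scaleX c (\<phi> v)"
      using \<phi>[OF words_map[OF f(1), of c]] \<phi>[OF f(1)]
      by (simp add: V.lext_map[OF lookup_map_mult] X.lext_map[OF lookup_map_mult] f)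
  qed
  have tens: "\<phi> (tens u m) = foldr act u (init m)" if "u \<in> lists L" for u m
    using \<phi>[OF words_single[OF that, of m 1]] by (simp add: V.lext_single X.lext_single \<Phi>_def)
  have inT: "\<phi> v \<in> T" for v
  proof -
    obtain f where f: "f \<in> words L" "V.lext ten f = v" using surj_words by meson
    have "X.lext \<Phi> f \<in> T" unfolding X.lext_def \<Phi>_def
      by (intro X.subspace_sum[OF T] X.subspace_scale[OF T] Ti) (use f(1) in \<open>auto simp: words_def\<close>)
    then show ?thesis using \<phi>[OF f(1)] f(2) by simp
  qed
  have act: "\<phi> (actV x v) = act x (\<phi> v)" if x: "x \<in> L" for x v
  proof -
    let ?S = "{v. \<phi> (actV x v) = act x (\<phi> v)}"
    have act0: "act x 0 = 0" using act_scale[OF x init_in, of 0 undefined] by simp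
    have "V.subspace ?S"
      by (rule V.subspaceI)
        (simp_all add: linear_dest[OF actV_linear[OF x]] linear_dest[OF lin] act_add[OF x inT inT] act_scale[OF x inT] act0)
    obtain f where f: "f \<in> words L" "V.lext ten f = v" using surj_words by meson
    have "V.lext ten f \<in> ?S" unfolding V.lext_def
    proof (rule V.subspace_sum[OF \<open>V.subspace ?S\<close>], rule V.subspace_scale[OF \<open>V.subspace ?S\<close>])
      fix k assume "k \<in> Poly_Mapping.keys f"
      then have "fst k \<in> lists L" using f(1) by (auto simp: words_def)
      then show "tens (fst k) (snd k) \<in> ?S" using x tens by (simp add: actV_tens)
    qed
    then show ?thesis using f by simp
  qed
  show ?thesis
    using lin inT act tens[of "[]"] by (intro exI[of _ \<phi>]) auto
qed

end

subsection \<open>Passing between coefficients and modes\<close>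

text \<open>The coefficient of \<open>x_0^(-m/N - 1)\<close>, whose exponent is
  \<open>- m - N\<close> in units of \<open>1/N\<close>. The torus exponent becomes a
  parameter.\<close>

definition modes :: "nat \<Rightarrow> ('r::finite, 'w) fseries \<Rightarrow> int ^ 'r \<Rightarrow> int \<Rightarrow> 'w \<Rightarrow> 'w" where
  "modes N F p m = F (- m - int N) p"

context mode_calculus
begin

lemma field_modes: "F \<in> E_space scl \<Longrightarrow> fieldp (modes N F p)"
proof (rule fieldI)
  fix w assume "F \<in> E_space scl"
  then obtain K where K: "\<And>e p. e < K \<Longrightarrow> F e p w = 0" unfolding E_space_def by blast
  show "\<exists>K. \<forall>m\<ge>K. modes N F p m w = 0"
    by (intro exI[of _ "1 - K - int N"] allI impI) (simp add: modes_def K)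
qed (auto simp: E_space_def modes_def)

lemma left1_eq:
  "jacobi_left1 N scl A B n b c p q w = L1 (modes N A p) (modes N B (q - p)) n (- b - int N) (- c - int N) w"
  unfolding jacobi_left1_def L1_def modes_def by (simp add: algebra_simps)

lemma left2_eq:
  assumes "A \<in> E_space scl" "B \<in> E_space scl"
  shows "jacobi_left2 N scl A B n b c p q w = sg n \<odot> L1 (modes N B (q - p)) (modes N A p) n (- c - int N) (- b - int N) w"
  unfolding L1_def scl_fsum[OF fin_L1[OF field_modes[OF assms(2)] field_modes[OF assms(1)]]]
  unfolding jacobi_left2_def modes_def by (simp add: algebra_simps powi_minus_one)

lemma left_eq:
  assumes "A \<in> E_space scl" "B \<in> E_space scl"
  shows "jacobi_left1 N scl A B n b c p q w - jacobi_left2 N scl A B n b c p q w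
    = P (modes N A p) (modes N B (q - p)) n (- b - int N) (- c - int N) w"
  unfolding left1_eq left2_eq[OF assms] P_def ..

text \<open>Upper negation \<open>(-1)^i C(x,i) = C(i - x - 1,i)\<close> turns the exponent
  \<open>b + N i\<close>, which moves with \<open>i\<close>, into the fixed mode number.\<close>

lemma binom_gb: "binom_coeff (of_int (b + int N * int i) / of_nat N) i = gb (- b - int N) i"
proof -
  have "of_int (b + int N * int i) / of_nat N = of_nat i - of_int (- b - int N) / of_nat N - (1 :: complex)"
    using N_pos by (simp add: field_simps)
  then show ?thesis unfolding binom_coeff_def gb_def gbinomial_negated_upper[of "of_int (- b - int N) / of_nat N" i] by simp
qed

text \<open>Erasing the modes outside the class of \<open>s + t\<close> leaves a solution, since the
  indices in \<open>R\<close> differ by multiples of \<open>N\<close>; by uniqueness it is the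
  original one.\<close>

lemma jac_class:
  assumes "fieldp A" and j: "jac s A B C" and B: "\<And>l. l mod int N \<noteq> t mod int N \<Longrightarrow> B l = (\<lambda>w. 0)"
    and e: "e mod int N \<noteq> (s + t) mod int N"
  shows "C n e = (\<lambda>w. 0)"
proof -
  define C' where "C' n e w = (if e mod int N = (s + t) mod int N then C n e w else 0)" for n e w
  have "jac s A B C'"
    unfolding jac_def
  proof (intro conjI allI impI)
    obtain K where "\<And>n. n \<ge> K \<Longrightarrow> C n = (\<lambda>e w. 0)" using jac_vanishing[OF j] by blast
    then show "vanishing C'" by (intro exI[of _ K]) (auto simp: C'_def fun_eq_iff)
    fix n m l w assume m: "m mod int N = s mod int N"
    have k: "(m + l - int N * int i) mod int N = (m + l) mod int N" for i
      using mod_mult_self2[of "m + l" "int N" "- int i"] by simp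
    show "P A B n m l w = R C' n m l w"
    proof (cases "l mod int N = t mod int N")
      case True
      then have "(m + l) mod int N = (s + t) mod int N" using m by (metis mod_add_cong)
      then show ?thesis unfolding jac_eq[OF j m] R_def C'_def k by simp
    next
      case False
      have "B (l + int N * x) = (\<lambda>w. 0)" for x
        using B[of "l + int N * x"] False mod_mult_self2[of l "int N" x] by simp
      then have "P A B n m l w = 0"
        by (simp add: P_def L1_def lin_0[OF field_lin[OF assms(1)]])
      moreover have "(m + l) mod int N \<noteq> (s + t) mod int N"
      proof
        assume "(m + l) mod int N = (s + t) mod int N"
        then have "(m + l - m) mod int N = (s + t - s) mod int N" using m by (metis mod_diff_cong)
        then show False using False by simp
      qed
      ultimately show ?thesis unfolding R_def C'_def k by simp
    qed
  qed
  then have "C = C'" by (rule jac_unique[OF j])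
  then have "C n e w = C' n e w" for w by simp
  then show ?thesis using e by (simp add: C'_def fun_eq_iff)
qed

end

text \<open>Fields on \<open>W\<close> before any Jacobi identity for them, so that the same notions
  serve where it is derived, where it is given, and for the algebra acting on itself with
  \<open>N = 1\<close>.\<close>

locale tva_fields = toroidal_vertex_algebra scaleV Y vac + W: vector_space scaleW
  for scaleV :: "complex \<Rightarrow> 'v::ab_group_add \<Rightarrow> 'v" and Y :: "'v \<Rightarrow> ('r::finite, 'v) fseries" and vac :: 'v
    and scaleW :: "complex \<Rightarrow> 'w::ab_group_add \<Rightarrow> 'w" +
  fixes \<sigma> :: "'v \<Rightarrow> 'v" and N :: nat and YW :: "'v \<Rightarrow> ('r, 'w) fseries"
  assumes aut: "tva_automorphism scaleV Y vac \<sigma>"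
    and per: "N > 0" "\<sigma> ^^ N = id"
    and YWlin: "\<And>e p w. Vector_Spaces.linear scaleV scaleW (\<lambda>v. YW v e p w)"
    and YWE: "\<And>v. YW v \<in> E_space scaleW"
begin

sublocale M: mode_calculus scaleW N
  by unfold_locales (rule per)

sublocale S: periodic_map scaleV \<sigma> N
proof (rule periodic_map.intro[OF vector_space_axioms], rule periodic_map_axioms.intro)
  show "Vector_Spaces.linear scaleV scaleV \<sigma>" using aut unfolding tva_automorphism_def by blast
qed (use per in auto)

text \<open>The substitution \<open>zy\<close> gives the exponent \<open>p\<close> of the first
  factor to \<open>y\<close> as well, hence the total \<open>p + q\<close>; \<open>- n - 1\<close>
  is the exponent of \<open>z_0\<close> for the n-th product.\<close>

definition wprod :: "'v \<Rightarrow> int ^ 'r \<Rightarrow> 'v \<Rightarrow> int ^ 'r \<Rightarrow> int \<Rightarrow> int \<Rightarrow> 'w \<Rightarrow> 'w" where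
  "wprod u p v q n = modes N (YW (Y u (- n - 1) p v)) (p + q)"

definition wjac :: "int \<Rightarrow> 'v \<Rightarrow> 'v \<Rightarrow> bool" where
  "wjac s u v \<longleftrightarrow> (\<forall>p q. M.jac s (modes N (YW u) p) (modes N (YW v) q) (wprod u p v q))"

definition eigenvec :: "int \<Rightarrow> 'v \<Rightarrow> bool" where
  "eigenvec s u \<longleftrightarrow> \<sigma> u = scaleV (omega N powi s) u"

definition hom_modes :: "int \<Rightarrow> 'v \<Rightarrow> bool" where
  "hom_modes s u \<longleftrightarrow> (\<forall>p m. m mod int N \<noteq> s mod int N \<longrightarrow> modes N (YW u) p m = (\<lambda>w. 0))"

lemma field_YW: "M.fieldp (modes N (YW u) p)"
  by (rule M.field_modes[OF YWE])

lemma YW_zero: "YW 0 e p w = 0"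
  by (rule linear_dest(3)[OF YWlin])

lemma Y_zero: "Y 0 e p w = 0"
  by (rule linear_dest(3)[OF Y_linear])

lemma lin_Y: "Vector_Spaces.linear scaleV scaleV (Y u e p)"
  using Y_E[of u] by (simp add: E_space_def)

lemma vanishing_Y: "\<exists>K. \<forall>n\<ge>K. \<forall>p. Y u (- n - 1) p v = 0"
proof -
  obtain K where K: "\<And>e p. e < K \<Longrightarrow> Y u e p v = 0" using Y_E[of u] unfolding E_space_def by blast
  show ?thesis by (rule exI[of _ "- K"]) (simp add: K)
qed

lemma vanishing_wprod: "M.vanishing (wprod u p v q)"
proof -
  obtain K where "\<And>n. n \<ge> K \<Longrightarrow> Y u (- n - 1) p v = 0" using vanishing_Y[of u v] by blast
  then show ?thesis by (intro exI[of _ K]) (simp add: wprod_def modes_def YW_zero fun_eq_iff)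
qed

text \<open>On an eigenvector \<open>\<sigma>^j\<close> is a power of a root of unity, and the
  average over \<open>j\<close> becomes a character sum: 1 on one residue class, 0
  elsewhere.\<close>

lemma right_eigen:
  assumes u: "eigenvec s u"
  shows "jacobi_right N scaleW \<sigma> Y YW u v n b c p q w =
    (if (- b - int N) mod int N = s mod int N
     then M.R (wprod u p v (q - p)) n (- b - int N) (- c - int N) w else 0)"
proof -
  let ?m = "- b - int N" and ?l = "- c - int N"
  define x where "x i = scaleW (M.gb ?m i) (wprod u p v (q - p) (n + int i) (?m + ?l - int N * int i) w)" for i :: nat
  have fx: "fin1 x" unfolding x_def by (rule M.fin_R[OF vanishing_wprod])
  have j: "Sum_any (\<lambda>i::nat. let k = b + int N * int i in
       scaleW (omega N powi (int j * k) * binom_coeff (of_int k / of_nat N) i)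
         (YW (Y ((\<sigma> ^^ j) u) (- n - 1 - int i) p v) (c + k + int N) q w))
     = scaleW (omega N powi (int j * (s + b))) (fsum x)" for j
  proof -
    have om: "omega N powi (int j * (b + int N * int i)) = omega N powi (int j * b)" for i
      unfolding omega_eq_iff[OF per(1)]
      using mod_mult_self2[of "int j * b" "int N" "int j * int i"] by (simp add: algebra_simps)
    have uj: "(\<sigma> ^^ j) u = scaleV (omega N powi (int j * s)) u"
      using S.funpow_eigen[of u s j] u by (simp add: eigenvec_def)
    have "(let k = b + int N * int i in
       scaleW (omega N powi (int j * k) * binom_coeff (of_int k / of_nat N) i)
         (YW (Y ((\<sigma> ^^ j) u) (- n - 1 - int i) p v) (c + k + int N) q w))
      = scaleW (omega N powi (int j * (s + b))) (x i)" for i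
    proof -
      have idx: "- (?m + ?l - int N * int i) - int N = c + (b + int N * int i) + int N" by simp
      have "wprod u p v (q - p) (n + int i) (?m + ?l - int N * int i) w
        = YW (Y u (- n - 1 - int i) p v) (c + (b + int N * int i) + int N) q w"
        unfolding wprod_def modes_def idx by (simp add: algebra_simps)
      then show ?thesis
        unfolding Let_def om M.binom_gb uj x_def linear_dest(2)[OF Y_linear] linear_dest(2)[OF YWlin]
        by (simp add: distrib_left omega_add mult_ac)
    qed
    then show ?thesis unfolding M.scl_fsum[OF fx] by simp
  qed
  have "jacobi_right N scaleW \<sigma> Y YW u v n b c p q w
     = scaleW (1 / of_nat N) (\<Sum>j<N. scaleW (omega N powi (int j * (s + b))) (fsum x))"
    unfolding jacobi_right_def j ..
  also have "\<dots> = scaleW (1 / of_nat N * (if int N dvd s + b then of_nat N else 0)) (fsum x)"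
    unfolding omega_sum[OF per(1), symmetric] by (simp flip: W.scale_sum_left)
  also have "int N dvd s + b \<longleftrightarrow> ?m mod int N = s mod int N"
  proof -
    have "?m mod int N = s mod int N \<longleftrightarrow> int N dvd (- b - int N - s)" by (rule mod_eq_dvd_iff)
    also have "\<dots> \<longleftrightarrow> int N dvd (- (s + b))"
      using dvd_add_right_iff[of "int N" "- int N" "- (s + b)"] by (simp add: algebra_simps)
    finally show ?thesis by (simp only: dvd_minus_iff)
  qed
  finally show ?thesis unfolding x_def M.R_def using per(1) by simp
qed

text \<open>Both sides are linear in \<open>u\<close>, and eigenvectors span. Outside the residue
  class of an eigenvector both sides vanish.\<close>

lemma jacobi_from_eigen:
  assumes "\<And>s u. eigenvec s u \<Longrightarrow> hom_modes s u" "\<And>s u v. eigenvec s u \<Longrightarrow> wjac s u v"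
  shows "twisted_jacobi N scaleW \<sigma> Y YW"
  unfolding twisted_jacobi_def
proof (intro allI)
  fix u v n b c p q w
  let ?L = "\<lambda>u. jacobi_left1 N scaleW (YW u) (YW v) n b c p q w - jacobi_left2 N scaleW (YW u) (YW v) n b c p q w"
  let ?R = "\<lambda>u. jacobi_right N scaleW \<sigma> Y YW u v n b c p q w"
  have eig: "?L u = ?R u" if u: "eigenvec s u" for s u
  proof (cases "(- b - int N) mod int N = s mod int N")
    case True
    have "M.jac s (modes N (YW u) p) (modes N (YW v) (q - p)) (wprod u p v (q - p))"
      using assms(2)[OF u, of v] unfolding wjac_def by blast
    from M.jac_eq[OF this True] show ?thesis
      unfolding M.left_eq[OF YWE YWE] right_eigen[OF u] if_P[OF True] .
  next
    case False
    have "(- b - int N + int N * x) mod int N = (- b - int N) mod int N" for x by (rule mod_mult_self2)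
    then have "modes N (YW u) p (- b - int N + int N * x) = (\<lambda>w. 0)" for x
      using assms(1)[OF u] False unfolding hom_modes_def by simp
    then have "M.P (modes N (YW u) p) (modes N (YW v) (q - p)) n (- b - int N) (- c - int N) w = 0"
      by (simp add: M.P_def M.L1_def M.lin_0[OF M.field_lin[OF field_YW]])
    then show ?thesis unfolding M.left_eq[OF YWE YWE] right_eigen[OF u] using False by simp
  qed
  have ev: "eigenvec s (S.ep s u)" for s by (simp add: eigenvec_def S.ep_eigen)
  have L: "?L u = (\<Sum>k<N. ?L (S.ep (int k) u))"
  proof -
    have "modes N (YW u) p = (\<lambda>m w. \<Sum>k<N. modes N (YW (S.ep (int k) u)) p m w)"
      by (subst S.ep_sum[of u, symmetric]) (simp add: modes_def fun_eq_iff linear_dest(6)[OF YWlin])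
    then show ?thesis unfolding M.left_eq[OF YWE YWE] using M.P_left_sum[OF field_YW field_YW] by simp
  qed
  have R: "?R u = (\<Sum>k<N. ?R (S.ep (int k) u))"
  proof -
    have s: "(\<sigma> ^^ j) u = (\<Sum>k<N. (\<sigma> ^^ j) (S.ep (int k) u))" for j
      by (subst S.ep_sum[of u, symmetric]) (simp add: linear_dest(6)[OF linear_funpow[OF S.lin_f]])
    let ?t = "\<lambda>j i u. let k = b + int N * int i in
       scaleW (omega N powi (int j * k) * binom_coeff (of_int k / of_nat N) i)
         (YW (Y ((\<sigma> ^^ j) u) (- n - 1 - int i) p v) (c + k + int N) q w)"
    have t: "?t j i u = (\<Sum>k<N. ?t j i (S.ep (int k) u))" for j i
      unfolding s[of j] Let_def linear_dest(6)[OF Y_linear] linear_dest(6)[OF YWlin] by (simp add: W.scale_sum_right)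
    have f: "fin1 (\<lambda>i. ?t j i u')" for j u'
    proof -
      obtain K where K: "\<And>n p. n \<ge> K \<Longrightarrow> Y ((\<sigma> ^^ j) u') (- n - 1) p v = 0" using vanishing_Y by blast
      have "Y ((\<sigma> ^^ j) u') (- n - 1 - int i) p v = 0" if "nat (K - n) \<le> i" for i
        using K[of "n + int i" p] that by (simp add: nat_le_iff algebra_simps)
      then show ?thesis by (intro fin1I[of "nat (K - n)"]) (simp add: Let_def YW_zero)
    qed
    have "Sum_any (\<lambda>i. ?t j i u) = (\<Sum>k<N. Sum_any (\<lambda>i. ?t j i (S.ep (int k) u)))" for j
      unfolding t[of _ j] by (rule M.fsum_sum[OF f])
    then show ?thesis unfolding jacobi_right_def
      by (simp add: W.scale_sum_right) (subst sum.swap, rule refl)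
  qed
  show "?L u = ?R u" unfolding L R using eig[OF ev] by simp
qed

lemma wjac_from_jacobi:
  assumes J: "twisted_jacobi N scaleW \<sigma> Y YW" and u: "eigenvec s u"
  shows "wjac s u v"
  unfolding wjac_def M.jac_def
proof (intro allI conjI impI vanishing_wprod)
  fix p q n m l w assume m: "m mod int N = s mod int N"
  have "M.P (modes N (YW u) p) (modes N (YW v) (p + q - p)) n (- (- m - int N) - int N) (- (- l - int N) - int N) w
     = jacobi_right N scaleW \<sigma> Y YW u v n (- m - int N) (- l - int N) p (p + q) w"
    using J unfolding twisted_jacobi_def M.left_eq[OF YWE YWE, symmetric] by blast
  then show "M.P (modes N (YW u) p) (modes N (YW v) q) n m l w = M.R (wprod u p v q) n m l w"
    unfolding right_eigen[OF u] using m by simp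
qed

text \<open>Take the vacuum as second vector and \<open>n = -1\<close>. On the left only the mode
  \<open>m\<close> of \<open>u\<close> remains, since the identity has a single mode; outside the
  class the right-hand side is 0.\<close>

lemma hom_from_jacobi:
  assumes J: "twisted_jacobi N scaleW \<sigma> Y YW" and vac: "YW vac = id_series" and u: "eigenvec s u"
  shows "hom_modes s u"
  unfolding hom_modes_def
proof (intro allI impI)
  fix p m assume m: "m mod int N \<noteq> s mod int N"
  have i: "modes N (YW vac) 0 = M.idm"
    unfolding vac by (auto simp: modes_def id_series_def M.idm_def fun_eq_iff)
  show "modes N (YW u) p m = (\<lambda>w. 0)"
  proof
    fix w
    let ?A = "modes N (YW u) p"
    have "M.P ?A (modes N (YW vac) (p - p)) (- 1) (- (- (m + int N) - int N) - int N) (- 0 - int N) w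
       = jacobi_right N scaleW \<sigma> Y YW u vac (- 1) (- (m + int N) - int N) 0 p p w"
      using J unfolding twisted_jacobi_def M.left_eq[OF YWE YWE, symmetric] by blast
    also have "\<dots> = 0" unfolding right_eigen[OF u] using m by simp
    finally have P0: "M.P ?A M.idm (- 1) (m + int N) (- int N) w = 0" by (simp add: i add.commute)
    have 1: "M.L1 ?A M.idm (- 1) (m + int N) (- int N) w = ?A m w"
    proof -
      have "M.L1 ?A M.idm (- 1) (m + int N) (- int N) w
        = scaleW (be (- 1) 0) (?A (m + int N + int N * (- 1 - int 0)) (M.idm (- int N + int N * int 0) w))"
        unfolding M.L1_def
      proof (rule fsum_single)
        fix i :: nat assume "i \<noteq> 0"
        then have "- int N + int N * int i \<noteq> - int N" using per(1) by simp
        then show "scaleW (be (- 1) i) (?A (m + int N + int N * (- 1 - int i)) (M.idm (- int N + int N * int i) w)) = 0"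
          by (simp add: M.idm_def M.lin_0[OF M.field_lin[OF field_YW]])
      qed
      then show ?thesis by (simp add: M.idm_def binom_coeff_def)
    qed
    have 2: "M.L1 M.idm ?A (- 1) (- int N) (m + int N) w = 0"
      unfolding M.L1_def
    proof (rule fsum_zero)
      fix i
      have "int N * (1 + int i) > 0" using per(1) by simp
      then have "- int N + int N * (- 1 - int i) \<noteq> - int N" by (simp add: algebra_simps)
      then show "scaleW (be (- 1) i) (M.idm (- int N + int N * (- 1 - int i)) (?A (m + int N + int N * int i) w)) = 0"
        by (simp only: M.idm_def if_False W.scale_zero_right)
    qed
    show "?A m w = 0" using P0 unfolding M.P_def 1 2 by simp
  qed
qed

end

context tva_fields
begin

text \<open>The algebra is a module over itself for the identity map and \<open>N = 1\<close>, where
  every vector is an eigenvector. Its own Jacobi identity, pushed through the linear map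
  \<open>YW\<close>, is the hypothesis \<open>jacobi\<close> of \<open>jac_closure\<close>.\<close>

lemma wjac_closure:
  assumes J: "twisted_jacobi 1 scaleV id Y Y"
    and a: "\<And>v. wjac s a v" "hom_modes s a" and u: "\<And>v. wjac t u v" "hom_modes t u"
  shows "wjac (s + t) (Y a (- k - 1) pa u) v" "hom_modes (s + t) (Y a (- k - 1) pa u)"
proof -
  interpret V: tva_fields scaleV Y vac scaleV id 1 Y
    by (rule tva_fields.intro[OF toroidal_vertex_algebra_axioms vector_space_axioms], rule tva_fields_axioms.intro)
       (simp_all add: tva_automorphism_def linear_idf Y_linear Y_E)
  note fy = field_YW
  have jj: "M.jac s (modes N (YW a) p) (modes N (YW v) q) (wprod a p v q)" for p v q
    using a(1) unfolding wjac_def by blast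
  have ju: "M.jac t (modes N (YW u) p) (modes N (YW v) q) (wprod u p v q)" for p v q
    using u(1) unfolding wjac_def by blast
  have h: "\<And>m. m mod int N \<noteq> s mod int N \<Longrightarrow> modes N (YW a) p m = (\<lambda>w. 0)"
    "\<And>m. m mod int N \<noteq> t mod int N \<Longrightarrow> modes N (YW u) p m = (\<lambda>w. 0)" for p
    using a(2) u(2) unfolding hom_modes_def by auto
  have fw: "M.fieldp (wprod x p y q n)" for x p y q n
    unfolding wprod_def by (rule fy)
  show "wjac (s + t) (Y a (- k - 1) pa u) v"
    unfolding wjac_def
  proof (intro allI)
    fix p q
    \<comment> \<open>The torus exponent \<open>p\<close> of the product is shared between
      \<open>a\<close> and \<open>u\<close>.\<close>
    define pu where "pu = p - pa"
    have p: "pa + pu = p" by (simp add: pu_def)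
    define F where "F k n = modes N (YW (Y (Y a (- k - 1) pa u) (- n - 1) p v)) (p + q)" for k n
    obtain K where K: "M.local_from K (modes N (YW u) pu) (modes N (YW v) q)"
      using M.jac_local_from[OF fy fy ju h(2)] by blast
    obtain K' where K': "M.local_from K' (modes N (YW a) pa) (modes N (YW v) q)"
      using M.jac_local_from[OF fy fy jj h(1)] by blast
    obtain Kau where Kau: "\<And>n p. n \<ge> Kau \<Longrightarrow> Y a (- n - 1) p u = 0" using vanishing_Y[of a u] by blast
    have "M.jac (s + t) (wprod a pa u pu k) (modes N (YW v) q) (F k)"
    proof (rule M.jac_closure[OF fy fy fy fw fw fw jj ju jj _ _ K K'])
      show "M.jac s (modes N (YW a) pa) (wprod u pu v q r) (wprod a pa (Y u (- r - 1) pu v) (pu + q))" for r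
        using jj[of pa "Y u (- r - 1) pu v" "pu + q"] unfolding wprod_def[of u] .
      show "M.jac t (modes N (YW u) pu) (wprod a pa v q r) (wprod u pu (Y a (- r - 1) pa v) (pa + q))" for r
        using ju[of pu "Y a (- r - 1) pa v" "pa + q"] unfolding wprod_def[of a] .
      show "wprod a pa u pu k = (\<lambda>e w. 0)" if "Kau \<le> k" for k
        by (simp add: wprod_def modes_def Kau[OF that] YW_zero fun_eq_iff)
      show "F k = (\<lambda>n e w. 0)" if "Kau \<le> k" for k
        by (simp add: F_def modes_def Kau[OF that] Y_zero YW_zero fun_eq_iff)
      show "M.vanishing (F k)" for k
        using vanishing_wprod[of "Y a (- k - 1) pa u" p v q] unfolding wprod_def F_def .
    next
      fix k q' r e w
      let ?T = "\<lambda>x. modes N (YW x) (p + q) e w"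
      have T: "?T (x + y) = ?T x + ?T y" "?T 0 = 0" "?T (scaleV c x) = scaleW c (?T x)"
        "?T (x - y) = ?T x - ?T y" "?T (sum f A) = (\<Sum>i\<in>A. ?T (f i))" for x y c and f :: "nat \<Rightarrow> 'v" and A
        unfolding modes_def by (rule linear_dest[OF YWlin])+
      have e0: "V.eigenvec 0 a" unfolding V.eigenvec_def by simp
      have q1: "int q' mod int 1 = 0 mod int 1" by simp
      have "V.M.jac 0 (modes 1 (Y a) pa) (modes 1 (Y u) pu) (V.wprod a pa u pu)"
        using V.wjac_from_jacobi[OF J e0, of u] unfolding V.wjac_def by blast
      from V.M.jac_eq[OF this q1]
      have eq: "V.M.P (modes 1 (Y a) pa) (modes 1 (Y u) pu) k (int q') r v = V.M.R (V.wprod a pa u pu) k (int q') r v" .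
      have R: "V.M.R (V.wprod a pa u pu) k (int q') r v =
          (\<Sum>i\<le>q'. scaleV (of_nat (q' choose i)) (Y (Y a (- (k + int i) - 1) pa u) (- (int q' - int i + r) - 1) p v))"
      proof -
        have g: "V.M.gb (int q') i = of_nat (q' choose i)" for i
          unfolding V.M.gb_def by (simp add: binomial_gbinomial)
        have "V.M.R (V.wprod a pa u pu) k (int q') r v
          = (\<Sum>i<Suc q'. scaleV (V.M.gb (int q') i) (V.wprod a pa u pu (k + int i) (int q' + r - int 1 * int i) v))"
          unfolding V.M.R_def by (rule fsum_eq) (simp add: g binomial_eq_0 del: One_nat_def)
        then show ?thesis
          unfolding lessThan_Suc_atMost g V.wprod_def modes_def p by (simp add: algebra_simps)
      qed
      have f1: "fin1 (\<lambda>i. scaleV (be k i) (modes 1 (Y a) pa (int q' + int 1 * (k - int i)) (modes 1 (Y u) pu (r + int 1 * int i) v)))"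
        by (rule V.M.fin_L1[OF V.field_YW V.field_YW])
      have f2: "fin1 (\<lambda>i. scaleV (be k i) (modes 1 (Y u) pu (r + int 1 * (k - int i)) (modes 1 (Y a) pa (int q' + int 1 * int i) v)))"
        by (rule V.M.fin_L1[OF V.field_YW V.field_YW])
      have L1: "?T (V.M.L1 (modes 1 (Y a) pa) (modes 1 (Y u) pu) k (int q') r v)
        = fsum (\<lambda>i. scaleW (be k i) (wprod a pa (Y u (- (r + int i) - 1) pu v) (pu + q) (int q' + k - int i) e w))"
        unfolding V.M.L1_def fsum_hom[where T = ?T, OF f1 T(1,2)] T(3)
        unfolding wprod_def p[symmetric] by (simp add: modes_def algebra_simps)
      have L2: "?T (V.M.L1 (modes 1 (Y u) pu) (modes 1 (Y a) pa) k r (int q') v)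
        = fsum (\<lambda>i. scaleW (be k i) (wprod u pu (Y a (- (int q' + int i) - 1) pa v) (pa + q) (r + k - int i) e w))"
        unfolding V.M.L1_def fsum_hom[where T = ?T, OF f2 T(1,2)] T(3)
        unfolding wprod_def p[symmetric] by (simp add: modes_def algebra_simps)
      have "?T (V.M.R (V.wprod a pa u pu) k (int q') r v) = (\<Sum>i\<le>q'. scaleW (of_nat (q' choose i)) (F (k + int i) (int q' - int i + r) e w))"
        unfolding R T(3,5) F_def ..
      then show "(\<Sum>i\<le>q'. scaleW (of_nat (q' choose i)) (F (k + int i) (int q' - int i + r) e w))
        = fsum (\<lambda>i. scaleW (be k i) (wprod a pa (Y u (- (r + int i) - 1) pu v) (pu + q) (int q' + k - int i) e w))
        - scaleW (sg k) (fsum (\<lambda>i. scaleW (be k i) (wprod u pu (Y a (- (int q' + int i) - 1) pa v) (pa + q) (r + k - int i) e w)))"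
        unfolding eq[symmetric] V.M.P_def T(3,4) L1 L2 by simp
    qed
    then show "M.jac (s + t) (modes N (YW (Y a (- k - 1) pa u)) p) (modes N (YW v) q) (wprod (Y a (- k - 1) pa u) p v q)"
      unfolding F_def wprod_def p .
  qed
  show "hom_modes (s + t) (Y a (- k - 1) pa u)"
    unfolding hom_modes_def
  proof (intro allI impI)
    fix p m assume m: "m mod int N \<noteq> (s + t) mod int N"
    have "wprod a pa u (p - pa) k m = (\<lambda>w. 0)"
      by (rule M.jac_class[OF fy jj h(2) m])
    then show "modes N (YW (Y a (- k - 1) pa u)) p m = (\<lambda>w. 0)" by (simp add: wprod_def)
  qed
qed

end

section \<open>Induction on words and on elements of loop algebras\<close>

context induced_module
begin

lemma tens_span:
  assumes S: "V.subspace S" and t: "\<And>u m. u \<in> lists L \<Longrightarrow> tens u m \<in> S"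
  shows "v \<in> S"
proof -
  obtain f where f: "f \<in> words L" "V.lext ten f = v" using surj_words by blast
  show ?thesis unfolding f(2)[symmetric] V.lext_def
    by (intro V.subspace_sum[OF S] V.subspace_scale[OF S] t) (use f(1) in \<open>auto simp: words_def\<close>)
qed

end

lemma loop_monom_add: "loop_monom (a + b) n m = loop_monom a n m + loop_monom b n m"
  by (simp add: loop_monom_def single_add)

lemma loop_monom_zero: "loop_monom 0 n m = 0"
  by (simp add: loop_monom_def zero_prod_def)

lemma lookup_map_zero: "f 0 = 0 \<Longrightarrow> Poly_Mapping.lookup (Poly_Mapping.map f p) k = f (Poly_Mapping.lookup p k)"
  by (simp add: Poly_Mapping.map.rep_eq when_def)

lemma graded_loop_add:
  assumes "\<And>k x y. x \<in> E k \<Longrightarrow> y \<in> E k \<Longrightarrow> x + y \<in> E k" "X \<in> graded_loop E" "Z \<in> graded_loop E"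
  shows "X + Z \<in> graded_loop E"
  using assms by (auto simp: graded_loop_def lookup_add)

lemma loop_decomp:
  "X = (\<Sum>k\<in>Poly_Mapping.keys (fst X). loop_monom (Poly_Mapping.lookup (fst X) k) (fst k) (snd k)) + (0, snd X)"
proof (rule prod_eqI)
  have "fst X = (\<Sum>k\<in>Poly_Mapping.keys (fst X). Poly_Mapping.single k (Poly_Mapping.lookup (fst X) k))"
    by (rule poly_mapping_eqI) (auto simp: lookup_sum lookup_single when_def in_keys_iff)
  then show "fst X = fst ((\<Sum>k\<in>Poly_Mapping.keys (fst X). loop_monom (Poly_Mapping.lookup (fst X) k) (fst k) (snd k)) + (0, snd X))"
    by (simp add: fst_sum loop_monom_def)
qed (simp add: snd_sum loop_monom_def)

text \<open>\<open>D\<close> carries a restriction on the degrees in the support; in this way one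
  induction also treats the nonnegative part.\<close>

lemma loop_induct:
  assumes X: "X \<in> graded_loop E" and D: "\<And>k. k \<in> Poly_Mapping.keys (fst X) \<Longrightarrow> D k"
    and E0: "\<And>k. 0 \<in> E k" and Eadd: "\<And>k x y. x \<in> E k \<Longrightarrow> y \<in> E k \<Longrightarrow> x + y \<in> E k"
    and add: "\<And>X Z. X \<in> graded_loop E \<Longrightarrow> Z \<in> graded_loop E \<Longrightarrow> Q X \<Longrightarrow> Q Z \<Longrightarrow> Q (X + Z)"
    and cen: "\<And>c. Q (0, c)"
    and mon: "\<And>k a. D k \<Longrightarrow> a \<in> E k \<Longrightarrow> Q (loop_monom a (fst k) (snd k))"
  shows "Q X"
proof -
  have mem: "loop_monom a (fst k) (snd k) \<in> graded_loop E" if "a \<in> E k" for a k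
    using that E0 by (auto simp: loop_monom_def graded_loop_def lookup_single when_def)
  have c: "(0, c) \<in> graded_loop E" for c using E0 by (simp add: graded_loop_def)
  have "(\<Sum>k\<in>K. loop_monom (Poly_Mapping.lookup (fst X) k) (fst k) (snd k)) \<in> graded_loop E \<and>
      Q (\<Sum>k\<in>K. loop_monom (Poly_Mapping.lookup (fst X) k) (fst k) (snd k))"
    if "finite K" "K \<subseteq> Poly_Mapping.keys (fst X)" for K
    using that
  proof (induction K)
    case empty
    show ?case using cen[of 0] c[of 0] by (simp add: zero_prod_def)
  next
    case (insert k K)
    have k: "Poly_Mapping.lookup (fst X) k \<in> E k" using X unfolding graded_loop_def by blast
    have "D k" using insert D by auto
    then show ?case using insert mem[OF k] mon[OF _ k] by (auto intro: add graded_loop_add[OF Eadd])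
  qed
  from this[OF finite_keys subset_refl] show ?thesis
    by (subst loop_decomp) (auto intro: add cen c)
qed

subsection \<open>The Lie algebras and the algebra $V_L(l,0)$\<close>

locale toroidal_setting =
  fixes scaleG :: "complex \<Rightarrow> 'g::ab_group_add \<Rightarrow> 'g"
    and br :: "'g \<Rightarrow> 'g \<Rightarrow> 'g" and form :: "'g \<Rightarrow> 'g \<Rightarrow> complex"
    and \<sigma>0 :: "'g \<Rightarrow> 'g" and N0 :: nat
    and \<sigma> :: "'r::finite \<Rightarrow> 'g \<Rightarrow> 'g" and N :: "'r \<Rightarrow> nat"
    and level :: complex
    and scaleV :: "complex \<Rightarrow> 'v::ab_group_add \<Rightarrow> 'v"
    and tens :: "('g, 'r) loop list \<Rightarrow> 'g \<times> complex \<Rightarrow> 'v"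
    and actV :: "('g, 'r) loop \<Rightarrow> 'v \<Rightarrow> 'v"
    and Y :: "'v \<Rightarrow> ('r, 'v) fseries"
  assumes data: "toroidal_lie_data scaleG br form \<sigma>0 N0 \<sigma> N"
    and V: "is_V_L scaleG br form \<sigma> N level scaleV tens actV"
    and tva: "toroidal_vertex_algebra scaleV Y (V_vac tens)"
    and Y_gen: "\<And>a. Y (V_gen tens a) = current_series scaleG 1 (eigen_L scaleG \<sigma> N) actV a"
begin

lemma simple: "simple_fd_lie_algebra scaleG br"
  and autos: "lie_automorphism scaleG br \<sigma>0" "lie_automorphism scaleG br (\<sigma> i)"
  and orders: "has_order \<sigma>0 N0" "has_order (\<sigma> i) (N i)"
  and commute: "\<sigma>0 (\<sigma> i a) = \<sigma> i (\<sigma>0 a)" "\<sigma> i (\<sigma> j a) = \<sigma> j (\<sigma> i a)"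
  using data unfolding toroidal_lie_data_def by (auto simp: fun_eq_iff o_def)

sublocale G: complex_lie_algebra scaleG br
  using simple by (simp add: simple_fd_lie_algebra_def)

sublocale TV: toroidal_vertex_algebra scaleV Y "V_vac tens"
  by (rule tva)

text \<open>\<open>None\<close> stands for the index 0, so that all \<open>r + 1\<close>
  automorphisms form one commuting family.\<close>

abbreviation sT :: "'r option \<Rightarrow> 'g \<Rightarrow> 'g" where "sT \<equiv> case_option \<sigma>0 \<sigma>"
abbreviation NT :: "'r option \<Rightarrow> nat" where "NT \<equiv> case_option N0 N"

lemma periodic: "periodic_map scaleG (sT i) (NT i)"
  using autos orders
  by (cases i) (auto intro!: periodic_map.intro periodic_map_axioms.intro G.vector_space_axioms simp: lie_automorphism_def has_order_def)

sublocale Tf: commuting_family scaleG sT NT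
  by (rule commuting_family.intro[OF G.vector_space_axioms], rule commuting_family_axioms.intro[OF periodic])
     (auto simp: commute split: option.split)

sublocale Lf: commuting_family scaleG \<sigma> N
  by (rule commuting_family.intro[OF G.vector_space_axioms], rule commuting_family_axioms.intro)
     (use periodic[of "Some _"] in \<open>auto simp: commute\<close>)

lemma N0_pos: "N0 > 0"
  using Tf.M_pos[of None] by simp

definition tq :: "int \<times> (int ^ 'r) \<Rightarrow> 'r option \<Rightarrow> int" where
  "tq k = case_option (fst k) (\<lambda>i. snd k $ i)"

definition lq :: "int \<times> (int ^ 'r) \<Rightarrow> 'r \<Rightarrow> int" where
  "lq k = (\<lambda>i. snd k $ i)"

lemma surj_tq: "surj tq"
proof (rule surjI)
  show "tq (f None, \<chi> i. f (Some i)) = f" for f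
    by (auto simp: tq_def fun_eq_iff split: option.split)
qed

lemma surj_lq: "surj lq"
  by (rule surjI[of _ "\<lambda>f. (0, \<chi> i. f i)"]) (simp add: lq_def)

lemma eigen_L_eq: "eigen_L scaleG \<sigma> N = (\<lambda>k. Lf.jeig (lq k))"
  by (simp add: eigen_L_def Lf.jeig_def lq_def fun_eq_iff)

lemma eigen_tau_eq: "eigen_tau scaleG \<sigma>0 N0 \<sigma> N = (\<lambda>k. Tf.jeig (tq k))"
proof
  fix k
  show "eigen_tau scaleG \<sigma>0 N0 \<sigma> N k = Tf.jeig (tq k)"
    unfolding eigen_tau_def eigen_L_def Tf.jeig_def tq_def by (auto split: option.split_asm simp: split_option_all split: option.split)
qed

definition pT :: "int \<Rightarrow> int ^ 'r \<Rightarrow> 'g \<Rightarrow> 'g" where "pT n p = Tf.jproj (tq (n, p))"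
definition pL :: "int ^ 'r \<Rightarrow> 'g \<Rightarrow> 'g" where "pL p = Lf.jproj (lq (0, p))"

lemma eigen_part_tau: "eigen_part scaleG (eigen_tau scaleG \<sigma>0 N0 \<sigma> N) (n, p) a = pT n p a"
  unfolding eigen_tau_eq Tf.eigen_part_eq[OF surj_tq] pT_def ..

lemma eigen_part_L: "eigen_part scaleG (eigen_L scaleG \<sigma> N) (n, p) a = pL p a"
  unfolding eigen_L_eq Lf.eigen_part_eq[OF surj_lq] pL_def by (simp add: lq_def)

text \<open>Homogeneity for tau is used for L as well: such elements are homogeneous there too, and
  they span \<open>g\<close>.\<close>

definition hom :: "int \<Rightarrow> int ^ 'r \<Rightarrow> 'g \<Rightarrow> bool" where
  "hom s m a \<longleftrightarrow> a \<in> Tf.jeig (tq (s, m))"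

definition meq :: "int ^ 'r \<Rightarrow> int ^ 'r \<Rightarrow> bool" where
  "meq p m \<longleftrightarrow> (\<forall>i. p $ i mod int (N i) = m $ i mod int (N i))"

lemma meq_refl [simp]: "meq p p" by (simp add: meq_def)

lemma hom_iff: "hom s m a \<longleftrightarrow> \<sigma>0 a = scaleG (omega N0 powi s) a \<and> (\<forall>i. \<sigma> i a = scaleG (omega (N i) powi (m $ i)) a)"
  unfolding hom_def Tf.jeig_def tq_def by (auto simp: split_option_all)

lemma pT_hom: "hom s m a \<Longrightarrow> pT n p a = (if n mod int N0 = s mod int N0 \<and> meq p m then a else 0)"
proof -
  assume "hom s m a"
  then have a: "a \<in> Tf.jeig (tq (s, m))" by (simp add: hom_def)
  have e: "(\<forall>i. tq (n, p) i mod int (NT i) = tq (s, m) i mod int (NT i)) \<longleftrightarrow> n mod int N0 = s mod int N0 \<and> meq p m"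
    by (simp add: tq_def meq_def split_option_all)
  show ?thesis unfolding pT_def Tf.jproj_on[OF a] e ..
qed

lemma hom_L: "hom s m a \<Longrightarrow> a \<in> Lf.jeig (lq (n, m))"
  by (simp add: hom_iff Lf.jeig_def lq_def)

lemma pL_hom: "hom s m a \<Longrightarrow> pL p a = (if meq p m then a else 0)"
  unfolding pL_def using Lf.jproj_on[OF hom_L[of s m a 0], of "lq (0, p)"] by (simp add: lq_def meq_def)

lemma linear_pT: "Vector_Spaces.linear scaleG scaleG (pT n p)"
  unfolding pT_def by (rule Tf.linear_jproj)

lemma hom_mod: "hom s m a \<longleftrightarrow> hom (s mod int N0) m a"
  unfolding hom_iff using omega_eq_iff[OF N0_pos, of "s mod int N0" s] by simp

lemma hom_span:
  assumes S: "G.subspace S" and h: "\<And>s m a. 0 \<le> s \<Longrightarrow> s < int N0 \<Longrightarrow> hom s m a \<Longrightarrow> a \<in> S"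
  shows "a \<in> S"
proof -
  have "(\<Union>k. Tf.jeig k) \<subseteq> S"
  proof
    fix b assume "b \<in> (\<Union>k. Tf.jeig k)"
    then obtain k where b: "b \<in> Tf.jeig k" by blast
    obtain l where "k = tq l" using surj_tq by (metis surjD)
    then have "hom (fst l mod int N0) (snd l) b" using b hom_mod[of "fst l" "snd l" b] by (simp add: hom_def)
    then show "b \<in> S" using N0_pos by (intro h[of "fst l mod int N0" "snd l"]) simp_all
  qed
  then have "G.span (\<Union>k. Tf.jeig k) \<subseteq> S" using S by (rule G.span_minimal)
  then show ?thesis unfolding Tf.jeig_span by blast
qed

lemma hom_br:
  assumes "hom s m a" "hom t k b" shows "hom (s + t) (m + k) (br a b)"
proof -
  have h: "f (br a b) = br (f a) (f b)" if "lie_automorphism scaleG br f" for f a b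
    using that by (simp add: lie_automorphism_def)
  show ?thesis
    using assms unfolding hom_iff
    by (simp add: h[OF autos(1)] h[OF autos(2)] linear_dest(2)[OF G.br_linear_left] linear_dest(2)[OF G.br_linear_right]
        omega_add mult.commute)
qed

lemma form_props:
  "form (x + x') y = form x y + form x' y" "form (scaleG c x) y = c * form x y"
  "form x (y + y') = form x y + form x y'" "form x (scaleG c y) = c * form x y"
  and form_auto: "lie_automorphism scaleG br f \<Longrightarrow> form (f x) (f y) = form x y"
proof -
  obtain d where f: "form = (\<lambda>x y. d * killing scaleG br x y)"
    using data unfolding toroidal_lie_data_def normalized_killing_form_def by blast
  show "form (x + x') y = form x y + form x' y" "form (scaleG c x) y = c * form x y"
    "form x (y + y') = form x y + form x y'" "form x (scaleG c y) = c * form x y"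
    unfolding f by (simp_all add: killing_bilinear[OF simple] distrib_left)
  show "lie_automorphism scaleG br f \<Longrightarrow> form (f x) (f y) = form x y"
    unfolding f by (simp add: killing_automorphism[OF simple])
qed

lemma form_zero: "form 0 y = 0" "form x 0 = 0"
  using form_props(2)[of 0 0 y] form_props(4)[of x 0 0] by simp_all

text \<open>By invariance of the form a nonzero pairing forces the product of the two eigenvalues to
  be 1.\<close>

lemma form_hom:
  assumes a: "hom s m a" and b: "hom t k b" and n: "form a b \<noteq> 0"
  shows "(s + t) mod int N0 = 0" "meq (m + k) 0"
proof -
  have "form (\<sigma>0 a) (\<sigma>0 b) = form a b" by (rule form_auto[OF autos(1)])
  then have "omega N0 powi (s + t) = 1"
    using a b n by (simp add: hom_iff form_props omega_add mult.commute)
  then show "(s + t) mod int N0 = 0" using omega_one_iff[OF N0_pos] by auto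
  show "meq (m + k) 0"
    unfolding meq_def
  proof
    fix i
    have "form (\<sigma> i a) (\<sigma> i b) = form a b" by (rule form_auto[OF autos(2)])
    then have "omega (N i) powi (m $ i + k $ i) = 1"
      using a b n by (simp add: hom_iff form_props omega_add mult.commute)
    then show "(m + k) $ i mod int (N i) = 0 $ i mod int (N i)" using omega_one_iff[OF Lf.M_pos] by auto
  qed
qed

abbreviation LL :: "('g, 'r) loop set" where "LL \<equiv> graded_loop (eigen_L scaleG \<sigma> N)"
abbreviation Tau :: "('g, 'r) loop set" where "Tau \<equiv> graded_loop (eigen_tau scaleG \<sigma>0 N0 \<sigma> N)"

sublocale IM: induced_module "loop_scale scaleG" "loop_bracket 1 br form" LL "nonneg_part LL" "vac_scale scaleG"
  "vac_act scaleG br form level" scaleV tens actV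
  by (rule induced_module.intro) (use V in \<open>simp add: is_V_L_def Let_def\<close>)

lemma eigen_L_sub: "0 \<in> eigen_L scaleG \<sigma> N k" "x \<in> eigen_L scaleG \<sigma> N k \<Longrightarrow> y \<in> eigen_L scaleG \<sigma> N k \<Longrightarrow> x + y \<in> eigen_L scaleG \<sigma> N k"
    "x \<in> eigen_L scaleG \<sigma> N k \<Longrightarrow> scaleG c x \<in> eigen_L scaleG \<sigma> N k"
  unfolding eigen_L_eq using Lf.subspace_jeig by (auto simp: G.subspace_def)

lemma eigen_tau_sub: "0 \<in> eigen_tau scaleG \<sigma>0 N0 \<sigma> N k" "x \<in> eigen_tau scaleG \<sigma>0 N0 \<sigma> N k \<Longrightarrow> y \<in> eigen_tau scaleG \<sigma>0 N0 \<sigma> N k \<Longrightarrow> x + y \<in> eigen_tau scaleG \<sigma>0 N0 \<sigma> N k"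
    "x \<in> eigen_tau scaleG \<sigma>0 N0 \<sigma> N k \<Longrightarrow> scaleG c x \<in> eigen_tau scaleG \<sigma>0 N0 \<sigma> N k"
  unfolding eigen_tau_eq using Tf.subspace_jeig by (auto simp: G.subspace_def)

lemma eigen_L_decomp:
  assumes "a \<in> eigen_L scaleG \<sigma> N (n, m)"
  shows "hom s m (Tf.epi None s a)" "(\<Sum>s<N0. Tf.epi None (int s) a) = a"
proof -
  have a: "\<sigma> i a = scaleG (omega (N i) powi (m $ i)) a" for i using assms by (simp add: eigen_L_def)
  interpret P0: periodic_map scaleG \<sigma>0 N0 using periodic[of None] by simp
  have "\<sigma> i (P0.ep s a) = P0.ep s (\<sigma> i a)" for i
    by (rule P0.ep_commute) (use autos(2) in \<open>auto simp: lie_automorphism_def commute\<close>)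
  then show "hom s m (Tf.epi None s a)"
    unfolding hom_iff by (simp add: P0.ep_eigen a linear_dest(2)[OF P0.linear_ep])
  show "(\<Sum>s<N0. Tf.epi None (int s) a) = a" using P0.ep_sum by simp
qed

lemma L_monom: "a \<in> eigen_L scaleG \<sigma> N (n, m) \<Longrightarrow> loop_monom a n m \<in> LL"
  using eigen_L_sub(1) by (auto simp: loop_monom_def graded_loop_def lookup_single when_def)

lemma L_hom: "hom s m a \<Longrightarrow> loop_monom a n m \<in> LL"
  by (rule L_monom) (simp add: eigen_L_eq hom_L)

lemma L_cen: "(0, c) \<in> LL"
  using eigen_L_sub(1) by (simp add: graded_loop_def)

lemma L_add: "x \<in> LL \<Longrightarrow> y \<in> LL \<Longrightarrow> x + y \<in> LL"
  by (rule graded_loop_add[OF eigen_L_sub(2)])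

lemma loop_scale_monom: "loop_scale scaleG c (loop_monom a n m) = loop_monom (scaleG c a) n m"
  unfolding loop_scale_def loop_monom_def
  by (auto intro!: poly_mapping_eqI simp: lookup_map_zero lookup_single when_def)

text \<open>A coefficient of an element of L is an eigenvector of \<sigma>_1, ..., \<sigma>_r only;
  the projections for \<sigma>_0 split it further.\<close>

lemma L_induct_hom:
  assumes X: "X \<in> LL" and D: "\<And>k. k \<in> Poly_Mapping.keys (fst X) \<Longrightarrow> D (fst k)"
    and add: "\<And>X Z. X \<in> LL \<Longrightarrow> Z \<in> LL \<Longrightarrow> Q X \<Longrightarrow> Q Z \<Longrightarrow> Q (X + Z)"
    and cen: "\<And>c. Q (0, c)"
    and mon: "\<And>n s m a. D n \<Longrightarrow> 0 \<le> s \<Longrightarrow> s < int N0 \<Longrightarrow> hom s m a \<Longrightarrow> Q (loop_monom a n m)"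
  shows "Q X"
proof (rule loop_induct[OF X, of "\<lambda>k. D (fst k)"])
  fix k a assume k: "D (fst k)" and a: "a \<in> eigen_L scaleG \<sigma> N k"
  then have a': "a \<in> eigen_L scaleG \<sigma> N (fst k, snd k)" by simp
  note d = eigen_L_decomp[OF a']
  have "Q (loop_monom (\<Sum>s<j. Tf.epi None (int s) a) (fst k) (snd k)) \<and> loop_monom (\<Sum>s<j. Tf.epi None (int s) a) (fst k) (snd k) \<in> LL" if "j \<le> N0" for j
    using that
  proof (induction j)
    case 0
    then show ?case using cen[of 0] L_cen[of 0] by (simp add: loop_monom_zero zero_prod_def)
  next
    case (Suc j)
    then show ?case
      using mon[OF k _ _ d(1), of "int j"] L_hom[OF d(1), of "int j" "fst k"]
      by (auto simp: loop_monom_add intro: add L_add)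
  qed
  from this[of N0] show "Q (loop_monom a (fst k) (snd k))" using d(2) by simp
qed (use D eigen_L_sub add cen in auto)

text \<open>\<open>actV\<close> is prescribed on tensors only; there its additivity in the algebra
  element is the relation for sums of letters.\<close>

lemma actV_add: "x \<in> LL \<Longrightarrow> y \<in> LL \<Longrightarrow> actV (x + y) v = actV x v + actV y v"
proof -
  assume x: "x \<in> LL" and y: "y \<in> LL"
  note xy = L_add[OF x y]
  note l = linear_dest[OF IM.actV_linear[OF x]] linear_dest[OF IM.actV_linear[OF y]] linear_dest[OF IM.actV_linear[OF xy]]
  have "v \<in> {v. actV (x + y) v = actV x v + actV y v}"
  proof (rule IM.tens_span)
    show "TV.subspace {v. actV (x + y) v = actV x v + actV y v}"
      by (rule TV.subspaceI) (simp_all add: l TV.scale_right_distrib)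
    fix u m assume u: "u \<in> lists LL"
    show "tens u m \<in> {v. actV (x + y) v = actV x v + actV y v}"
      using IM.tens_relations(1)[OF _ u x y xy, of "[]" m] by (simp add: IM.actV_tens[OF _ u] x y xy)
  qed
  then show ?thesis by simp
qed

lemma actV_zero: "actV 0 v = 0"
  using actV_add[OF L_cen[of 0] L_cen[of 0], of v] by (simp add: zero_prod_def)

text \<open>The central element passes every letter because its brackets vanish, and at the end of
  the word \<open>(g + C)_l\<close> prescribes \<open>level\<close>.\<close>

lemma actV_central: "actV (0, c) v = scaleV (level * c) v"
proof -
  note l = linear_dest[OF IM.actV_linear[OF L_cen[of c]]]
  have t: "tens ((0, c) # u) m = scaleV (level * c) (tens u m)" if "u \<in> lists LL" for u m
    using that
  proof (induction u)
    case Nil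
    have "[(0, c)] \<in> lists (nonneg_part LL)" using L_cen[of c] by (simp add: nonneg_part_def)
    then have "tens [(0, c)] m = tens [] (foldr (vac_act scaleG br form level) [(0, c) :: ('g, 'r) loop] m)"
      using IM.tens_relations(6)[where u = "[]" and v = "[]" and w = "[(0, c)]" and m = m]
      by (auto simp: nonneg_part_def)
    also have "foldr (vac_act scaleG br form level) [(0, c) :: ('g, 'r) loop] m = vac_scale scaleG (level * c) m"
      by (simp add: vac_act_def vac_scale_def)
    finally show ?case using IM.tens_relations(5)[of "[]" "[]" "level * c" m] by simp
  next
    case (Cons x u)
    then have x: "x \<in> LL" and u: "u \<in> lists LL" by auto
    have b: "loop_bracket 1 br form (0, c) x = 0" by (simp add: loop_bracket_def zero_prod_def)
    have z: "(0::('g,'r) loop) \<in> LL" using L_cen[of 0] by (simp add: zero_prod_def)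
    have "tens ((0, c) # x # u) m = tens (x # (0, c) # u) m + tens (loop_bracket 1 br form (0, c) x # u) m"
      using IM.tens_relations(3)[of "[]" u "(0, c)" x m] u x L_cen[of c] z b by simp
    also have "tens (loop_bracket 1 br form (0, c) x # u) m = 0"
      unfolding b using actV_zero[of "tens u m"] IM.actV_tens[OF z u] by simp
    also have "tens (x # (0, c) # u) m = actV x (tens ((0, c) # u) m)"
      using IM.actV_tens[OF x, of "(0, c) # u"] u L_cen by simp
    also have "\<dots> = scaleV (level * c) (tens (x # u) m)"
      unfolding Cons.IH linear_dest(2)[OF IM.actV_linear[OF x]] IM.actV_tens[OF x u] ..
    finally show ?case by simp
  qed
  have "v \<in> {v. actV (0, c) v = scaleV (level * c) v}"
  proof (rule IM.tens_span)
    show "TV.subspace {v. actV (0, c) v = scaleV (level * c) v}"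
      by (rule TV.subspaceI) (simp_all add: l TV.scale_right_distrib mult.commute)
  qed (use t IM.actV_tens[OF L_cen] in simp)
  then show ?thesis by simp
qed

lemma Y_gen_act: "Y (V_gen tens a) e p v = actV (loop_monom (pL (- p) a) (- e - 1) (- p)) v"
  unfolding Y_gen current_series_def eigen_part_L by simp

lemma Y_gen_hom:
  "hom s m a \<Longrightarrow> Y (V_gen tens a) e p v = (if meq (- p) m then actV (loop_monom a (- e - 1) (- p)) v else 0)"
  unfolding Y_gen_act by (simp add: pL_hom loop_monom_zero actV_zero)

lemma V_gen_linear: "V_gen tens (a + b) = V_gen tens a + V_gen tens b" "V_gen tens (scaleG c a) = scaleV c (V_gen tens a)"
  using IM.tens_relations(4)[of "[]" "[]" "(a, 0)" "(b, 0)"] IM.tens_relations(5)[of "[]" "[]" c "(a, 0)"]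
  by (simp_all add: V_gen_def vac_scale_def)

lemma tens_Nil: "tens [] (b, y) = V_gen tens b + scaleV y (V_vac tens)"
  using IM.tens_relations(4)[of "[]" "[]" "(b, 0)" "(0, y)"] IM.tens_relations(5)[of "[]" "[]" y "(0, 1)"]
  by (simp add: V_gen_def V_vac_def vac_scale_def)

lemma V_gen_zero: "V_gen tens 0 = 0"
  using V_gen_linear(2)[of 0 0] by simp

text \<open>L acts through the modes of \<open>Y (V_gen tens a)\<close> and through scalars, so
  closure under these modes is closure under L.\<close>

lemma V_generation:
  assumes S: "TV.subspace S" and vac: "V_vac tens \<in> S" and gen: "\<And>b. V_gen tens b \<in> S"
    and act: "\<And>s m a e p v. 0 \<le> s \<Longrightarrow> s < int N0 \<Longrightarrow> hom s m a \<Longrightarrow> v \<in> S \<Longrightarrow> Y (V_gen tens a) e p v \<in> S"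
  shows "v \<in> S"
proof (rule IM.module_generation[OF S])
  fix m
  show "tens [] m \<in> S"
    using tens_Nil[of "fst m" "snd m"] TV.subspace_add[OF S gen TV.subspace_scale[OF S vac]] by simp
next
  fix x v assume x: "x \<in> LL" and v: "v \<in> S"
  show "actV x v \<in> S"
  proof (rule L_induct_hom[OF x, of "\<lambda>_. True"])
    show "actV (0, c) v \<in> S" for c unfolding actV_central by (rule TV.subspace_scale[OF S v])
    show "actV (X + Z) v \<in> S" if "X \<in> LL" "Z \<in> LL" "actV X v \<in> S" "actV Z v \<in> S" for X Z
      unfolding actV_add[OF that(1,2)] by (rule TV.subspace_add[OF S that(3,4)])
    show "actV (loop_monom a n m) v \<in> S" if "0 \<le> s" "s < int N0" "hom s m a" for n s m a
      using act[OF that v, of "- n - 1" "- m"] by (simp add: Y_gen_hom[OF that(3)])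
  qed simp
qed

lemma vac_act_monom:
  "vac_act scaleG br form level (loop_monom a n p :: ('g, 'r) loop) b =
    (if n = 0 then (br a (fst b), 0) else if n = 1 then (0, form a (fst b) * level) else (0, 0))"
\<comment> \<open>A monomial with coefficient 0 has no keys, hence the separate case.\<close>
proof (cases "a = 0")
  case True
  then show ?thesis
    by (simp add: vac_act_def loop_monom_zero form_zero linear_dest(3)[OF G.br_linear_left])
next
  case False
  then have k: "{k \<in> Poly_Mapping.keys (Poly_Mapping.single (n, p) a). fst k = j} = (if n = j then {(n, p)} else {})" for j
    by (auto simp: in_keys_iff lookup_single when_def)
  show ?thesis unfolding vac_act_def loop_monom_def Let_def fst_conv snd_conv k
    using False by auto
qed

text \<open>For \<open>n \<ge> 0\<close> the monomial lies in the nonnegative part, so it passes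
  through the tensor sign and acts on \<open>(g + C)_l\<close>.\<close>

lemma Y_gen_gen:
  assumes a: "hom s m a" and p: "meq (- p) m" and n: "0 \<le> n"
  shows "Y (V_gen tens a) (- n - 1) p (V_gen tens b) =
    (if n = 0 then V_gen tens (br a b) else if n = 1 then scaleV (form a b * level) (V_vac tens) else 0)"
proof -
  \<comment> \<open>The degree \<open>m\<close> may be replaced by \<open>- p\<close>, since only
    residues modulo the orders matter.\<close>
  have hp: "hom s (- p) a" using a p unfolding hom_iff meq_def using omega_eq_iff[OF Lf.M_pos] by metis
  let ?x = "loop_monom a n (- p) :: ('g, 'r) loop"
  have x: "?x \<in> LL" by (rule L_hom[OF hp])
  have xP: "[?x] \<in> lists (nonneg_part LL)"
    using x n by (auto simp: nonneg_part_def loop_monom_def in_keys_iff lookup_single when_def split: if_splits)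
  have "Y (V_gen tens a) (- n - 1) p (V_gen tens b) = actV ?x (tens [] (b, 0))"
    unfolding Y_gen_hom[OF a] using p by (simp add: V_gen_def)
  also have "\<dots> = tens [?x] (b, 0)" by (simp add: IM.actV_tens[OF x])
  also have "\<dots> = tens [] (foldr (vac_act scaleG br form level) [?x] (b, 0))"
    using IM.tens_relations(6)[where u = "[]" and v = "[]" and w = "[?x]" and m = "(b, 0)"] xP
    by (auto simp: nonneg_part_def)
  also have "foldr (vac_act scaleG br form level) [?x] (b, 0) = (if n = 0 then (br a b, 0) else if n = 1 then (0, form a b * level) else (0, 0))"
    by (simp add: vac_act_monom)
  finally show ?thesis
    using tens_Nil[of "br a b" 0] tens_Nil[of 0 "form a b * level"] tens_Nil[of 0 0] by (simp add: V_gen_zero)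
qed

end

section \<open>Linearity of the Jacobi identity, and homogeneous vectors\<close>

context mode_calculus
begin

lemma jac_left_add:
  assumes A: "fieldp A" and A': "fieldp A'" and B: "fieldp B" and "jac s A B C" "jac s A' B C'"
  shows "jac s (\<lambda>m w. A m w + A' m w) B (\<lambda>n e w. C n e w + C' n e w)"
proof -
  note v = jac_vanishing[OF assms(4)] jac_vanishing[OF assms(5)]
  have "vanishing (\<lambda>n e w. C n e w + C' n e w)"
  proof -
    obtain K L where "\<forall>n\<ge>K. C n = (\<lambda>e w. 0)" "\<forall>n\<ge>L. C' n = (\<lambda>e w. 0)" using v by blast
    then show ?thesis by (intro exI[of _ "max K L"]) auto
  qed
  moreover have "R (\<lambda>n e w. C n e w + C' n e w) n m l w = R C n m l w + R C' n m l w" for n m l w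
    unfolding R_def scale_right_distrib by (rule fsum_add[OF fin_R[OF v(1)] fin_R[OF v(2)]])
  ultimately show ?thesis
    unfolding jac_def P_left_add[OF A A' B] using jac_eq[OF assms(4)] jac_eq[OF assms(5)] by simp
qed

lemma vanishing_scl: "vanishing C \<Longrightarrow> vanishing (\<lambda>n e w. c \<odot> C n e w)"
proof -
  assume "vanishing C"
  then obtain K where "\<forall>n\<ge>K. C n = (\<lambda>e w. 0)" by blast
  then show ?thesis by (intro exI[of _ K]) auto
qed

lemma R_scl: "vanishing C \<Longrightarrow> R (\<lambda>n e w. c \<odot> C n e w) n m l w = c \<odot> R C n m l w"
  unfolding R_def scl_fsum[OF fin_R] by (simp add: mult.commute)

lemma jac_left_scl:
  assumes A: "fieldp A" and B: "fieldp B" and j: "jac s A B C"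
  shows "jac s (\<lambda>m w. c \<odot> A m w) B (\<lambda>n e w. c \<odot> C n e w)"
  unfolding jac_def P_left_scl[OF A B] R_scl[OF jac_vanishing[OF j]]
  using vanishing_scl[OF jac_vanishing[OF j]] jac_eq[OF j] by simp

lemma jac_right_scl:
  assumes A: "fieldp A" and B: "fieldp B" and j: "jac s A B C"
  shows "jac s A (\<lambda>m w. c \<odot> B m w) (\<lambda>n e w. c \<odot> C n e w)"
  unfolding jac_def P_right_scl[OF A B] R_scl[OF jac_vanishing[OF j]]
  using vanishing_scl[OF jac_vanishing[OF j]] jac_eq[OF j] by simp

lemma jac_zero: "fieldp B \<Longrightarrow> jac s (\<lambda>m w. 0) B (\<lambda>n e w. 0)"
  unfolding jac_def by (simp add: P_left_zero R_zero)

lemma jac_mod: "s mod int N = t mod int N \<Longrightarrow> jac s A B C \<longleftrightarrow> jac t A B C"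
  unfolding jac_def by simp

end

context tva_fields
begin

definition good :: "int \<Rightarrow> 'v \<Rightarrow> bool" where
  "good s u \<longleftrightarrow> hom_modes s u \<and> (\<forall>v. wjac s u v)"

lemma YW_add: "modes N (YW (x + y)) p m w = modes N (YW x) p m w + modes N (YW y) p m w"
  and YW_scale: "modes N (YW (scaleV c x)) p m w = scaleW c (modes N (YW x) p m w)"
  unfolding modes_def by (rule linear_dest[OF YWlin])+

lemma good_zero: "good s 0"
proof -
  have z: "modes N (YW 0) p = (\<lambda>m w. 0)" for p by (simp add: modes_def YW_zero fun_eq_iff)
  have "wprod 0 p v q = (\<lambda>n m w. 0)" for p v q
    by (simp add: wprod_def modes_def Y_zero YW_zero fun_eq_iff)
  then show ?thesis
    unfolding good_def hom_modes_def wjac_def z using M.jac_zero[OF field_YW] by simp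
qed

lemma good_add: "good s u \<Longrightarrow> good s u' \<Longrightarrow> good s (u + u')"
proof -
  assume u: "good s u" and u': "good s u'"
  have "hom_modes s (u + u')" using u u' unfolding good_def hom_modes_def by (simp add: fun_eq_iff YW_add)
  moreover have "wjac s (u + u') v" for v
    unfolding wjac_def
  proof (intro allI)
    fix p q
    have "M.jac s (modes N (YW u) p) (modes N (YW v) q) (wprod u p v q)" "M.jac s (modes N (YW u') p) (modes N (YW v) q) (wprod u' p v q)"
      using u u' unfolding good_def wjac_def by blast+
    note j = M.jac_left_add[OF field_YW field_YW field_YW this]
    have 1: "modes N (YW (u + u')) p = (\<lambda>m w. modes N (YW u) p m w + modes N (YW u') p m w)"
      by (simp add: fun_eq_iff YW_add)
    have 2: "wprod (u + u') p v q = (\<lambda>n m w. wprod u p v q n m w + wprod u' p v q n m w)"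
      by (simp add: fun_eq_iff wprod_def linear_dest(1)[OF Y_linear] YW_add)
    show "M.jac s (modes N (YW (u + u')) p) (modes N (YW v) q) (wprod (u + u') p v q)"
      unfolding 1 2 by (rule j)
  qed
  ultimately show ?thesis by (simp add: good_def)
qed

lemma good_scale: "good s u \<Longrightarrow> good s (scaleV c u)"
proof -
  assume u: "good s u"
  have "hom_modes s (scaleV c u)" using u unfolding good_def hom_modes_def by (simp add: fun_eq_iff YW_scale)
  moreover have "wjac s (scaleV c u) v" for v
    unfolding wjac_def
  proof (intro allI)
    fix p q
    have "M.jac s (modes N (YW u) p) (modes N (YW v) q) (wprod u p v q)"
      using u unfolding good_def wjac_def by blast
    note j = M.jac_left_scl[OF field_YW field_YW this, of c]
    have 1: "modes N (YW (scaleV c u)) p = (\<lambda>m w. scaleW c (modes N (YW u) p m w))"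
      by (simp add: fun_eq_iff YW_scale)
    have 2: "wprod (scaleV c u) p v q = (\<lambda>n m w. scaleW c (wprod u p v q n m w))"
      by (simp add: fun_eq_iff wprod_def linear_dest(2)[OF Y_linear] YW_scale)
    show "M.jac s (modes N (YW (scaleV c u)) p) (modes N (YW v) q) (wprod (scaleV c u) p v q)"
      unfolding 1 2 by (rule j)
  qed
  ultimately show ?thesis by (simp add: good_def)
qed

lemma good_mod: "s mod int N = t mod int N \<Longrightarrow> good s u \<longleftrightarrow> good t u"
proof -
  assume st: "s mod int N = t mod int N"
  show ?thesis unfolding good_def hom_modes_def wjac_def M.jac_mod[OF st] st ..
qed

lemma good_vac: "YW vac = id_series \<Longrightarrow> good 0 vac"
proof -
  assume v: "YW vac = id_series"
  have m: "modes N (YW vac) p = (if p = 0 then M.idm else (\<lambda>m w. 0))" for p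
    unfolding v by (auto simp: modes_def id_series_def M.idm_def fun_eq_iff)
  have "hom_modes 0 vac" unfolding hom_modes_def m by (auto simp: M.idm_def fun_eq_iff)
  moreover have "wjac 0 vac v" for v
    unfolding wjac_def
  proof (intro allI)
    fix p q
    have w: "wprod vac p v q = (\<lambda>n. if n = - 1 \<and> p = 0 then modes N (YW v) q else (\<lambda>e w. 0))"
      by (auto simp: fun_eq_iff wprod_def Y_vac id_series_def modes_def YW_zero)
    show "M.jac 0 (modes N (YW vac) p) (modes N (YW v) q) (wprod vac p v q)"
      unfolding m w using M.jac_idm[OF field_YW, of v q] M.jac_zero[OF field_YW] by (cases "p = 0") simp_all
  qed
  ultimately show ?thesis by (simp add: good_def)
qed

text \<open>The modes of an eigenvector multiply eigenvalues by \<open>omega N powi s0\<close>,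
  hence the projection moves through them with its index lowered by \<open>s0\<close>.\<close>

lemma ep_Y:
  assumes a: "\<sigma> a = scaleV (omega N powi s0) a"
  shows "S.ep s (Y a e p v) = Y a e p (S.ep (s - s0) v)"
proof -
  have aut': "\<sigma> (Y u e p v) = Y (\<sigma> u) e p (\<sigma> v)" for u v using aut by (simp add: tva_automorphism_def)
  have "(\<sigma> ^^ j) (Y a e p v) = scaleV (omega N powi (int j * s0)) (Y a e p ((\<sigma> ^^ j) v))" for j
  proof (induction j)
    case (Suc j)
    have "int (Suc j) * s0 = int j * s0 + s0" by (simp add: algebra_simps)
    then show ?case
      by (simp only: funpow.simps o_apply Suc linear_dest(2)[OF S.lin_f] aut' a linear_dest(2)[OF Y_linear] scale_scale omega_add)
  qed simp
  then have "S.ep s (Y a e p v) = scaleV (1 / of_nat N) (\<Sum>j<N. scaleV (omega N powi (- (int j * (s - s0)))) (Y a e p ((\<sigma> ^^ j) v)))"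
    unfolding S.ep_def by (simp add: right_diff_distrib flip: omega_add)
  moreover have "Y a e p (S.ep (s - s0) v) = scaleV (1 / of_nat N) (\<Sum>j<N. scaleV (omega N powi (- (int j * (s - s0)))) (Y a e p ((\<sigma> ^^ j) v)))"
    unfolding S.ep_def linear_dest(2,6)[OF lin_Y] by simp
  ultimately show ?thesis by simp
qed

lemma ep_good_step:
  assumes J: "twisted_jacobi 1 scaleV id Y Y" and a: "\<sigma> a = scaleV (omega N powi s0) a" "good s0 a"
    and v: "\<And>s. good s (S.ep s v)"
  shows "good s (S.ep s (Y a e p v))"
proof -
  have a': "\<And>v. wjac s0 a v" "hom_modes s0 a" using a(2) by (simp_all add: good_def)
  have v': "\<And>v'. wjac (s - s0) (S.ep (s - s0) v) v'" "hom_modes (s - s0) (S.ep (s - s0) v)"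
    using v[of "s - s0"] by (simp_all add: good_def)
  show ?thesis
    using wjac_closure[OF J a' v', where k = "- e - 1" and pa = p] unfolding ep_Y[OF a(1)] good_def by auto
qed

end

section \<open>Propagation from the generators to the whole algebra\<close>

locale toroidal_auto = toroidal_setting scaleG br form \<sigma>0 N0 \<sigma> N level scaleV tens actV Y
  for scaleG :: "complex \<Rightarrow> 'g::ab_group_add \<Rightarrow> 'g" and br form \<sigma>0 N0
    and \<sigma> :: "'r::finite \<Rightarrow> 'g \<Rightarrow> 'g" and N level
    and scaleV :: "complex \<Rightarrow> 'v::ab_group_add \<Rightarrow> 'v" and tens actV Y +
  fixes \<sigma>t0 :: "'v \<Rightarrow> 'v" and \<sigma>t :: "'r \<Rightarrow> 'v \<Rightarrow> 'v"
  assumes aut0: "tva_automorphism scaleV Y (V_vac tens) \<sigma>t0"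
    and ext0: "\<And>a. \<sigma>t0 (V_gen tens a) = V_gen tens (\<sigma>0 a)"
    and aut: "\<And>i. tva_automorphism scaleV Y (V_vac tens) (\<sigma>t i)"
    and ext: "\<And>i a. \<sigma>t i (V_gen tens a) = V_gen tens (\<sigma> i a)"
begin

lemma lin_t0: "Vector_Spaces.linear scaleV scaleV \<sigma>t0" and lin_t: "Vector_Spaces.linear scaleV scaleV (\<sigma>t i)"
  using aut0 aut[of i] by (simp_all add: tva_automorphism_def)

lemma eig0: "hom s m a \<Longrightarrow> \<sigma>t0 (V_gen tens a) = scaleV (omega N0 powi s) (V_gen tens a)"
  and eigi: "hom s m a \<Longrightarrow> \<sigma>t i (V_gen tens a) = scaleV (omega (N i) powi (m $ i)) (V_gen tens a)"
  unfolding hom_iff ext0 ext by (simp_all add: V_gen_linear)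

text \<open>The power and the identity are compatible with \<open>Y\<close> and agree on the vacuum
  and on \<open>g\<close>, which generate.\<close>

lemma period0: "\<sigma>t0 ^^ N0 = id"
proof
  fix v
  have l: "Vector_Spaces.linear scaleV scaleV (\<sigma>t0 ^^ j)" for j by (rule TV.linear_funpow[OF lin_t0])
  have vac: "(\<sigma>t0 ^^ j) (V_vac tens) = V_vac tens" for j
    using aut0 by (induction j) (simp_all add: tva_automorphism_def)
  have gen: "(\<sigma>t0 ^^ j) (V_gen tens b) = V_gen tens ((\<sigma>0 ^^ j) b)" for j b
    by (induction j) (simp_all add: ext0)
  have Y: "(\<sigma>t0 ^^ j) (Y u e p v) = Y ((\<sigma>t0 ^^ j) u) e p ((\<sigma>t0 ^^ j) v)" for j u e p v
    using aut0 by (induction j) (simp_all add: tva_automorphism_def)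
  have o: "\<sigma>0 ^^ N0 = id" using orders by (simp add: has_order_def)
  have "v \<in> {v. (\<sigma>t0 ^^ N0) v = v}"
  proof (rule V_generation)
    show "TV.subspace {v. (\<sigma>t0 ^^ N0) v = v}"
      by (rule TV.subspaceI) (simp_all add: linear_dest[OF l])
  qed (simp_all add: vac gen Y o)
  then show "(\<sigma>t0 ^^ N0) v = id v" by simp
qed

end

locale twisted_setting = toroidal_auto scaleG br form \<sigma>0 N0 \<sigma> N level scaleV tens actV Y \<sigma>t0 \<sigma>t + W: vector_space scaleW
  for scaleG :: "complex \<Rightarrow> 'g::ab_group_add \<Rightarrow> 'g" and br form \<sigma>0 N0
    and \<sigma> :: "'r::finite \<Rightarrow> 'g \<Rightarrow> 'g" and N level
    and scaleV :: "complex \<Rightarrow> 'v::ab_group_add \<Rightarrow> 'v" and tens actV Y \<sigma>t0 \<sigma>t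
    and scaleW :: "complex \<Rightarrow> 'w::ab_group_add \<Rightarrow> 'w" +
  fixes YW :: "'v \<Rightarrow> ('r, 'w) fseries"
  assumes YWlin: "\<And>e p w. Vector_Spaces.linear scaleV scaleW (\<lambda>v. YW v e p w)"
    and YWE: "\<And>v. YW v \<in> E_space scaleW"
    and YWvac: "YW (V_vac tens) = id_series"
begin

sublocale TF: tva_fields scaleV Y "V_vac tens" scaleW \<sigma>t0 N0 YW
  by (rule tva_fields.intro[OF tva W.vector_space_axioms], rule tva_fields_axioms.intro[OF aut0 N0_pos period0 YWlin YWE])

text \<open>\<open>good\<close> refers to one eigenvalue and does not survive sums across
  eigenspaces; the induction therefore runs on the linear property that all eigencomponents are
  good.\<close>

lemma jacobi_from_generators:
  assumes "\<And>s m a. hom s m a \<Longrightarrow> TF.good s (V_gen tens a)"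
  shows "twisted_jacobi N0 scaleW \<sigma>t0 Y YW"
proof -
  have all: "TF.good s (TF.S.ep s u)" for s u
  proof -
    have "u \<in> {u. \<forall>s. TF.good s (TF.S.ep s u)}"
    proof (rule V_generation)
      show "TV.subspace {u. \<forall>s. TF.good s (TF.S.ep s u)}"
        by (rule TV.subspaceI) (simp_all add: linear_dest[OF TF.S.linear_ep] TF.good_zero TF.good_add TF.good_scale)
      have v0: "\<sigma>t0 (V_vac tens) = scaleV (omega N0 powi 0) (V_vac tens)"
        using aut0 by (simp add: tva_automorphism_def)
      have "TF.good s (TF.S.ep s (V_vac tens))" for s
        unfolding TF.S.ep_on_eigen[OF v0]
        using TF.good_vac[OF YWvac] TF.good_mod[of s 0] TF.good_zero by simp
      then show "V_vac tens \<in> {u. \<forall>s. TF.good s (TF.S.ep s u)}" by simp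
    next
      fix b
      have "b \<in> {b. \<forall>s. TF.good s (TF.S.ep s (V_gen tens b))}"
      proof (rule hom_span)
        show "G.subspace {b. \<forall>s. TF.good s (TF.S.ep s (V_gen tens b))}"
          by (rule G.subspaceI)
            (simp_all add: V_gen_zero V_gen_linear linear_dest[OF TF.S.linear_ep] TF.good_zero TF.good_add TF.good_scale)
        fix t m a assume h: "hom t m a"
        have "TF.good s (TF.S.ep s (V_gen tens a))" for s
          unfolding TF.S.ep_on_eigen[OF eig0[OF h]]
          using assms[OF h] TF.good_mod[of s t] TF.good_zero by simp
        then show "a \<in> {b. \<forall>s. TF.good s (TF.S.ep s (V_gen tens b))}" by simp
      qed
      then show "V_gen tens b \<in> {u. \<forall>s. TF.good s (TF.S.ep s u)}" by simp
    next
      fix t m a e p v assume h: "hom t m a" and v: "v \<in> {u. \<forall>s. TF.good s (TF.S.ep s u)}"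
      then show "Y (V_gen tens a) e p v \<in> {u. \<forall>s. TF.good s (TF.S.ep s u)}"
        using TF.ep_good_step[OF TV.Y_jacobi eig0[OF h] assms[OF h]] by simp
    qed
    then show ?thesis by simp
  qed
  have "TF.good s u" if "TF.eigenvec s u" for s u
    using all[of s u] TF.S.ep_on_eigen[of u s s] that by (simp add: TF.eigenvec_def)
  then show ?thesis by (intro TF.jacobi_from_eigen) (auto simp: TF.good_def)
qed

lemma module_from_generators:
  assumes "\<And>s m a. hom s m a \<Longrightarrow> TF.good s (V_gen tens a)"
  shows "twisted_tva_module scaleV Y (V_vac tens) scaleW \<sigma>t0 N0 YW"
proof -
  have J: "twisted_jacobi N0 scaleW \<sigma>t0 Y YW" by (rule jacobi_from_generators) (rule assms)
  show ?thesis
    by (rule twisted_tva_module.intro[OF tva W.vector_space_axioms],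
        rule twisted_tva_module_axioms.intro[OF aut0 N0_pos period0 YWlin YWE YWvac J])
qed

text \<open>The factor for the exponent \<open>p'\<close> splits into those for \<open>p\<close> and
  \<open>p' - p\<close>. The first is the eigenvalue of the generator, by the support of its field.
  The second rescales the field of \<open>v\<close>, hence also the products, by uniqueness.\<close>

lemma star_from_generators:
  assumes good: "\<And>s m a. hom s m a \<Longrightarrow> TF.good s (V_gen tens a)"
    and supp: "\<And>s m a e p w. hom s m a \<Longrightarrow> \<not> meq (- p) m \<Longrightarrow> YW (V_gen tens a) e p w = 0"
  shows "YW (\<sigma>t i v) = subst_var scaleW i (inverse (omega (N i))) (YW v)"
proof -
  let ?c = "\<lambda>p::int ^ 'r. inverse (omega (N i)) powi (p $ i)"
  have c: "?c p = omega (N i) powi (m $ i)" if "meq (- p) m" for p m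
  proof -
    have "omega (N i) powi (- (p $ i)) = omega (N i) powi (m $ i)"
      unfolding omega_eq_iff[OF Lf.M_pos] using that by (simp add: meq_def)
    then show ?thesis by (simp add: power_int_inverse power_int_minus)
  qed
  let ?S = "{v. \<forall>e p w. YW (\<sigma>t i v) e p w = scaleW (?c p) (YW v e p w)}"
  have "v \<in> ?S"
  proof (rule V_generation)
    show "TV.subspace ?S"
      by (rule TV.subspaceI) (simp_all add: linear_dest[OF lin_t] linear_dest[OF YWlin] W.scale_right_distrib mult.commute)
    have "\<sigma>t i (V_vac tens) = V_vac tens" using aut by (simp add: tva_automorphism_def)
    then show "V_vac tens \<in> ?S" by (auto simp: YWvac id_series_def)
  next
    fix b
    have "b \<in> {b. V_gen tens b \<in> ?S}"
    proof (rule hom_span)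
      show "G.subspace {b. V_gen tens b \<in> ?S}"
        by (rule G.subspaceI) (simp_all add: V_gen_zero V_gen_linear linear_dest[OF lin_t] linear_dest[OF YWlin] W.scale_right_distrib mult.commute)
      fix s m a assume h: "hom s m a"
      show "a \<in> {b. V_gen tens b \<in> ?S}"
      proof (simp, intro allI)
        fix e p w
        show "YW (\<sigma>t i (V_gen tens a)) e p w = scaleW (?c p) (YW (V_gen tens a) e p w)"
          unfolding eigi[OF h] linear_dest(2)[OF YWlin]
          using c[of p m] supp[OF h, of p e w] by (cases "meq (- p) m") simp_all
      qed
    qed
    then show "V_gen tens b \<in> ?S" by simp
  next
    fix s m a e p v assume h: "hom s m a" and v: "v \<in> ?S"
    show "Y (V_gen tens a) e p v \<in> ?S"
    proof (cases "meq (- p) m")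
      case False
      then show ?thesis
        by (simp add: Y_gen_hom[OF h] linear_dest[OF lin_t] linear_dest[OF YWlin])
    next
      case True
      have s: "\<sigma>t i (Y (V_gen tens a) e p v) = scaleV (omega (N i) powi (m $ i)) (Y (V_gen tens a) e p (\<sigma>t i v))"
        using aut[of i] unfolding tva_automorphism_def by (simp add: eigi[OF h] linear_dest(2)[OF TV.Y_linear])
      have "YW (Y (V_gen tens a) e p (\<sigma>t i v)) e' p' w = scaleW (?c (p' - p)) (YW (Y (V_gen tens a) e p v) e' p' w)" for e' p' w
      proof -
        let ?q = "p' - p"
        have B: "modes N0 (YW (\<sigma>t i v)) ?q = (\<lambda>m w. scaleW (?c ?q) (modes N0 (YW v) ?q m w))"
          using v by (simp add: modes_def fun_eq_iff)
        have j: "TF.M.jac s (modes N0 (YW (V_gen tens a)) p) (modes N0 (YW v) ?q) (TF.wprod (V_gen tens a) p v ?q)" for v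
          using good[OF h] unfolding TF.good_def TF.wjac_def by blast
        have "TF.wprod (V_gen tens a) p (\<sigma>t i v) ?q = (\<lambda>n e w. scaleW (?c ?q) (TF.wprod (V_gen tens a) p v ?q n e w))"
          by (rule TF.M.jac_unique[OF j TF.M.jac_right_scl[OF TF.field_YW TF.field_YW j, of "?c ?q" v, folded B]])
        then have "TF.wprod (V_gen tens a) p (\<sigma>t i v) ?q (- e - 1) (- e' - int N0) w = scaleW (?c ?q) (TF.wprod (V_gen tens a) p v ?q (- e - 1) (- e' - int N0) w)"
          by simp
        then show ?thesis by (simp add: TF.wprod_def modes_def)
      qed
      moreover have "omega (N i) powi (m $ i) * ?c (p' - p) = ?c p'" for p'
        unfolding c[OF True, symmetric] by (simp add: power_int_add[symmetric])
      ultimately show ?thesis unfolding s by (simp add: s linear_dest(2)[OF YWlin])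
    qed
  qed
  then show ?thesis by (simp add: subst_var_def fun_eq_iff)
qed

end

lemma (in toroidal_auto) module_unique:
  assumes 1: "twisted_tva_module scaleV Y (V_vac tens) scaleW \<sigma>t0 N0 YW"
    and 2: "twisted_tva_module scaleV Y (V_vac tens) scaleW \<sigma>t0 N0 YW'"
    and gen: "\<And>a. YW (V_gen tens a) = YW' (V_gen tens a)"
  shows "YW = YW'"
proof -
  interpret A: twisted_tva_module scaleV Y "V_vac tens" scaleW \<sigma>t0 N0 YW by (rule 1)
  interpret B: twisted_tva_module scaleV Y "V_vac tens" scaleW \<sigma>t0 N0 YW' by (rule 2)
  interpret FA: tva_fields scaleV Y "V_vac tens" scaleW \<sigma>t0 N0 YW
    by (rule tva_fields.intro[OF tva A.W.vector_space_axioms], rule tva_fields_axioms.intro[OF aut0 N0_pos period0 A.YW_linear A.YW_E])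
  interpret FB: tva_fields scaleV Y "V_vac tens" scaleW \<sigma>t0 N0 YW'
    by (rule tva_fields.intro[OF tva A.W.vector_space_axioms], rule tva_fields_axioms.intro[OF aut0 N0_pos period0 B.YW_linear B.YW_E])
  have "v \<in> {v. YW v = YW' v}" for v
  proof (rule V_generation)
    show "TV.subspace {v. YW v = YW' v}"
      by (rule TV.subspaceI) (simp_all add: fun_eq_iff linear_dest[OF A.YW_linear] linear_dest[OF B.YW_linear])
    show "V_vac tens \<in> {v. YW v = YW' v}" by (simp add: A.YW_vac B.YW_vac)
    show "V_gen tens b \<in> {v. YW v = YW' v}" for b by (simp add: gen)
  next
    fix s m a e p v assume h: "hom s m a" and v: "v \<in> {v. YW v = YW' v}"
    have ea: "FA.eigenvec s (V_gen tens a)" unfolding FA.eigenvec_def by (rule eig0[OF h])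
    have eb: "FB.eigenvec s (V_gen tens a)" unfolding FB.eigenvec_def by (rule eig0[OF h])
    have "YW (Y (V_gen tens a) e p v) e' p' w = YW' (Y (V_gen tens a) e p v) e' p' w" for e' p' w
    proof -
      have ja: "FA.M.jac s (modes N0 (YW (V_gen tens a)) p) (modes N0 (YW v) (p' - p)) (FA.wprod (V_gen tens a) p v (p' - p))"
        using FA.wjac_from_jacobi[OF A.YW_jacobi ea, of v] unfolding FA.wjac_def by blast
      \<comment> \<open>Once the fields of \<open>a\<close> and \<open>v\<close> agree, the second
        module solves the system with the same two factors.\<close>
      have jb: "FA.M.jac s (modes N0 (YW (V_gen tens a)) p) (modes N0 (YW v) (p' - p)) (FB.wprod (V_gen tens a) p v (p' - p))"
        using FB.wjac_from_jacobi[OF B.YW_jacobi eb, of v] v unfolding FB.wjac_def by (simp add: gen)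
      have "FA.wprod (V_gen tens a) p v (p' - p) (- e - 1) (- e' - int N0) w = FB.wprod (V_gen tens a) p v (p' - p) (- e - 1) (- e' - int N0) w"
        using FA.M.jac_unique[OF ja jb] by simp
      then show ?thesis by (simp add: FA.wprod_def FB.wprod_def modes_def)
    qed
    then show "Y (V_gen tens a) e p v \<in> {v. YW v = YW' v}" by (simp add: fun_eq_iff)
  qed
  then show ?thesis by (simp add: fun_eq_iff)
qed

section \<open>Linearity of the products\<close>

context mode_calculus
begin

lemma jac_right_add:
  assumes A: "fieldp A" and B: "fieldp B" and B': "fieldp B'" and "jac s A B C" "jac s A B' C'"
  shows "jac s A (\<lambda>m w. B m w + B' m w) (\<lambda>n e w. C n e w + C' n e w)"
proof -
  note v = jac_vanishing[OF assms(4)] jac_vanishing[OF assms(5)]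
  have "vanishing (\<lambda>n e w. C n e w + C' n e w)"
  proof -
    obtain K L where "\<forall>n\<ge>K. C n = (\<lambda>e w. 0)" "\<forall>n\<ge>L. C' n = (\<lambda>e w. 0)" using v by blast
    then show ?thesis by (intro exI[of _ "max K L"]) auto
  qed
  moreover have "R (\<lambda>n e w. C n e w + C' n e w) n m l w = R C n m l w + R C' n m l w" for n m l w
    unfolding R_def scale_right_distrib by (rule fsum_add[OF fin_R[OF v(1)] fin_R[OF v(2)]])
  ultimately show ?thesis
    unfolding jac_def P_right_add[OF A B B'] using jac_eq[OF assms(4)] jac_eq[OF assms(5)] by simp
qed

lemma jac_tprod_local: "fieldp A \<Longrightarrow> fieldp B \<Longrightarrow> local_from K A B \<Longrightarrow> jac s A B (tprod s A B)"
  by (rule jac_tprod[of A B K]) (simp_all add: local_from_def)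

text \<open>Linearity of \<open>jac\<close> and uniqueness give linearity of the solution without
  touching the sums in \<open>tprod\<close>.\<close>

lemma tprod_left_add:
  assumes "fieldp A" "fieldp A'" "fieldp B" "local_from K A B" "local_from K' A' B"
  shows "tprod s (\<lambda>m w. A m w + A' m w) B n e w = tprod s A B n e w + tprod s A' B n e w"
proof -
  have "local_from (max K K') (\<lambda>m w. A m w + A' m w) B"
    using assms(4,5) by (simp add: local_from_def P_left_add[OF assms(1-3)])
  from jac_unique[OF jac_tprod_local[OF field_plus[OF assms(1,2)] assms(3) this]
      jac_left_add[OF assms(1-3) jac_tprod_local[OF assms(1,3,4)] jac_tprod_local[OF assms(2,3,5)]]]
  show ?thesis by metis
qed

lemma tprod_left_scl:
  assumes "fieldp A" "fieldp B" "local_from K A B"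
  shows "tprod s (\<lambda>m w. c \<odot> A m w) B n e w = c \<odot> tprod s A B n e w"
proof -
  have "local_from K (\<lambda>m w. c \<odot> A m w) B"
    using assms(3) by (simp add: local_from_def P_left_scl[OF assms(1,2)])
  from jac_unique[OF jac_tprod_local[OF field_scl[OF assms(1)] assms(2) this]
      jac_left_scl[OF assms(1,2) jac_tprod_local[OF assms]]]
  show ?thesis by metis
qed

lemma tprod_right_add:
  assumes "fieldp A" "fieldp B" "fieldp B'" "local_from K A B" "local_from K' A B'"
  shows "tprod s A (\<lambda>m w. B m w + B' m w) n e w = tprod s A B n e w + tprod s A B' n e w"
proof -
  have "local_from (max K K') A (\<lambda>m w. B m w + B' m w)"
    using assms(4,5) by (simp add: local_from_def P_right_add[OF assms(1-3)])
  from jac_unique[OF jac_tprod_local[OF assms(1) field_plus[OF assms(2,3)] this]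
      jac_right_add[OF assms(1-3) jac_tprod_local[OF assms(1,2,4)] jac_tprod_local[OF assms(1,3,5)]]]
  show ?thesis by metis
qed

lemma tprod_right_scl:
  assumes "fieldp A" "fieldp B" "local_from K A B"
  shows "tprod s A (\<lambda>m w. c \<odot> B m w) n e w = c \<odot> tprod s A B n e w"
proof -
  have "local_from K A (\<lambda>m w. c \<odot> B m w)"
    using assms(3) by (simp add: local_from_def P_right_scl[OF assms(1,2)])
  from jac_unique[OF jac_tprod_local[OF assms(1) field_scl[OF assms(2)] this]
      jac_right_scl[OF assms(1,2) jac_tprod_local[OF assms]]]
  show ?thesis by metis
qed

lemma tprod_left_zero: "fieldp B \<Longrightarrow> tprod s (\<lambda>m w. 0) B = (\<lambda>n e w. 0)"
  by (simp add: tprod_def[abs_def] P_left_zero fsum_zero)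

end

section \<open>Additivity of the loop bracket and its values on monomials\<close>

lemma sum_keys_superset:
  assumes "finite A" "Poly_Mapping.keys f \<subseteq> A" "\<And>k. h k 0 = 0"
  shows "(\<Sum>k\<in>Poly_Mapping.keys f. h k (Poly_Mapping.lookup f k)) = (\<Sum>k\<in>A. h k (Poly_Mapping.lookup f k))"
  by (rule sum.mono_neutral_left) (use assms in \<open>auto simp: in_keys_iff\<close>)

text \<open>The support of a sum can shrink by cancellation, so all three sums are extended to the
  union of the supports.\<close>

lemma sum_keys_add:
  assumes "\<And>k x y. h k (x + y) = h k x + h k (y :: 'a::ab_group_add)"
  shows "(\<Sum>k\<in>Poly_Mapping.keys (f + g). h k (Poly_Mapping.lookup (f + g) k) :: 'b::ab_group_add)
    = (\<Sum>k\<in>Poly_Mapping.keys f. h k (Poly_Mapping.lookup f k)) + (\<Sum>k\<in>Poly_Mapping.keys g. h k (Poly_Mapping.lookup g k))"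
proof -
  have 0: "h k 0 = 0" for k using assms[of k 0 0] by simp
  let ?A = "Poly_Mapping.keys f \<union> Poly_Mapping.keys g"
  have s: "Poly_Mapping.keys (f + g) \<subseteq> ?A" by (rule keys_add)
  show ?thesis
    unfolding sum_keys_superset[of ?A "f + g" h, OF _ s 0, simplified] sum_keys_superset[of ?A f h, OF _ _ 0, simplified]
      sum_keys_superset[of ?A g h, OF _ _ 0, simplified]
    by (simp add: lookup_add assms sum.distrib)
qed

lemma sum_keys_single:
  assumes "\<And>k. h k 0 = 0"
  shows "(\<Sum>k\<in>Poly_Mapping.keys (Poly_Mapping.single l a). h k (Poly_Mapping.lookup (Poly_Mapping.single l a) k)) = h l a"
  using sum_keys_superset[of "{l}" "Poly_Mapping.single l a" h] assms by simp

lemma loop_bracket_monom: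
  assumes "\<And>y. br 0 y = 0" "\<And>y. br y 0 = 0" "\<And>y. form 0 y = 0" "\<And>y. form y 0 = 0"
  shows "loop_bracket M br form (loop_monom a x u) (loop_monom b y v)
    = loop_monom (br a b) (x + y) (u + v) + (0, if y = - x \<and> v = - u then of_int x / of_nat M * form a b else 0)"
proof -
  have 1: "(\<Sum>k\<in>Poly_Mapping.keys (Poly_Mapping.single (x, u) a). \<Sum>l\<in>Poly_Mapping.keys (Poly_Mapping.single (y, v) b).
      Poly_Mapping.single (k + l) (br (Poly_Mapping.lookup (Poly_Mapping.single (x, u) a) k) (Poly_Mapping.lookup (Poly_Mapping.single (y, v) b) l)))
    = Poly_Mapping.single ((x, u) + (y, v)) (br a b)"
  proof -
    have "(\<Sum>l\<in>Poly_Mapping.keys (Poly_Mapping.single (y, v) b). Poly_Mapping.single (k + l) (br c (Poly_Mapping.lookup (Poly_Mapping.single (y, v) b) l)))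
      = Poly_Mapping.single (k + (y, v)) (br c b)" for k c
      by (rule sum_keys_single[of "\<lambda>l z. Poly_Mapping.single (k + l) (br c z)"]) (simp add: assms)
    then show ?thesis
      using sum_keys_single[of "\<lambda>k z. Poly_Mapping.single (k + (y, v)) (br z b)" "(x, u)" a] by (simp add: assms)
  qed
  have 2: "(\<Sum>k\<in>Poly_Mapping.keys (Poly_Mapping.single (x, u) a). of_int (fst k) / of_nat M * form (Poly_Mapping.lookup (Poly_Mapping.single (x, u) a) k) (Poly_Mapping.lookup (Poly_Mapping.single (y, v) b) (- k)))
    = of_int x / of_nat M * form a (Poly_Mapping.lookup (Poly_Mapping.single (y, v) b) (- (x, u)))"
    using sum_keys_single[of "\<lambda>k z. of_int (fst k) / of_nat M * form z (Poly_Mapping.lookup (Poly_Mapping.single (y, v) b) (- k))" "(x, u)" a]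
    by (simp add: assms)
  show ?thesis
    unfolding loop_bracket_def loop_monom_def fst_conv snd_conv 1 2
    by (auto simp: lookup_single when_def assms)
qed

lemma loop_bracket_add_left:
  assumes "\<And>x x' y. br (x + x') y = br x y + br x' (y::'g::ab_group_add)" "\<And>x x' y. form (x + x') y = form x y + form x' y"
  shows "loop_bracket M br form (X + X') Z = loop_bracket M br form X Z + loop_bracket M br form X' Z"
proof (rule prod_eqI)
  show "fst (loop_bracket M br form (X + X') Z) = fst (loop_bracket M br form X Z + loop_bracket M br form X' Z)"
    unfolding loop_bracket_def fst_conv fst_add
    by (rule sum_keys_add) (simp add: assms single_add sum.distrib)
  show "snd (loop_bracket M br form (X + X') Z) = snd (loop_bracket M br form X Z + loop_bracket M br form X' Z)"
    unfolding loop_bracket_def snd_conv snd_add fst_add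
    by (rule sum_keys_add) (simp add: assms distrib_left)
qed

lemma loop_bracket_add_right:
  assumes "\<And>x y y'. br x (y + y') = br x y + br x (y'::'g::ab_group_add)" "\<And>x y y'. form x (y + y') = form x y + form x y'"
  shows "loop_bracket M br form X (Z + Z') = loop_bracket M br form X Z + loop_bracket M br form X Z'"
proof (rule prod_eqI)
  have "(\<Sum>l\<in>Poly_Mapping.keys (fst Z + fst Z'). Poly_Mapping.single (k + l) (br x (Poly_Mapping.lookup (fst Z + fst Z') l)))
    = (\<Sum>l\<in>Poly_Mapping.keys (fst Z). Poly_Mapping.single (k + l) (br x (Poly_Mapping.lookup (fst Z) l)))
    + (\<Sum>l\<in>Poly_Mapping.keys (fst Z'). Poly_Mapping.single (k + l) (br x (Poly_Mapping.lookup (fst Z') l)))" for k x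
    by (rule sum_keys_add) (simp add: assms single_add)
  then show "fst (loop_bracket M br form X (Z + Z')) = fst (loop_bracket M br form X Z + loop_bracket M br form X Z')"
    unfolding loop_bracket_def fst_conv fst_add by (simp add: sum.distrib)
  show "snd (loop_bracket M br form X (Z + Z')) = snd (loop_bracket M br form X Z + loop_bracket M br form X Z')"
    unfolding loop_bracket_def snd_conv snd_add fst_add by (simp add: assms lookup_add distrib_left sum.distrib)
qed

lemma (in toroidal_setting) br_zero: "br 0 y = 0" "br y 0 = 0"
  using linear_dest(3)[OF G.br_linear_left] linear_dest(3)[OF G.br_linear_right] by simp_all

lemma (in toroidal_setting) bracket_monom:
  "loop_bracket M br form (loop_monom a x u) (loop_monom b y v)
    = loop_monom (br a b) (x + y) (u + v) + (0, if y = - x \<and> v = - u then of_int x / of_nat M * form a b else 0)"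
  by (rule loop_bracket_monom) (simp_all add: br_zero form_zero)

lemma (in toroidal_setting) bracket_add:
  "loop_bracket M br form (X + X') Z = loop_bracket M br form X Z + loop_bracket M br form X' Z"
  "loop_bracket M br form X (Z + Z') = loop_bracket M br form X Z + loop_bracket M br form X Z'"
  by (rule loop_bracket_add_left loop_bracket_add_right;
      simp add: linear_dest(1)[OF G.br_linear_left] linear_dest(1)[OF G.br_linear_right] form_props)+

lemma bracket_central: "loop_bracket M br form (0, c) Z = 0"
  by (simp add: loop_bracket_def zero_prod_def)

lemma (in toroidal_setting) bracket_central': "loop_bracket M br form Z (0, c) = 0"
  by (simp add: loop_bracket_def zero_prod_def form_zero)

subsection \<open>From restricted modules to twisted modules\<close>

locale tau_module = toroidal_auto scaleG br form \<sigma>0 N0 \<sigma> N level scaleV tens actV Y \<sigma>t0 \<sigma>t + W: vector_space scaleW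
  for scaleG :: "complex \<Rightarrow> 'g::ab_group_add \<Rightarrow> 'g" and br form \<sigma>0 N0
    and \<sigma> :: "'r::finite \<Rightarrow> 'g \<Rightarrow> 'g" and N level
    and scaleV :: "complex \<Rightarrow> 'v::ab_group_add \<Rightarrow> 'v" and tens actV Y \<sigma>t0 \<sigma>t
    and scaleW :: "complex \<Rightarrow> 'w::ab_group_add \<Rightarrow> 'w" +
  fixes act :: "('g, 'r) loop \<Rightarrow> 'w \<Rightarrow> 'w"
  assumes res: "restricted_tau_module scaleG br form \<sigma>0 N0 \<sigma> N level scaleW act"
begin

sublocale M: mode_calculus scaleW N0
  by unfold_locales (rule N0_pos)

abbreviation cur :: "'g \<Rightarrow> ('r, 'w) fseries" where
  "cur \<equiv> current_series scaleG N0 (eigen_tau scaleG \<sigma>0 N0 \<sigma> N) act"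

definition tau_mode :: "'g \<Rightarrow> int ^ 'r \<Rightarrow> int \<Rightarrow> 'w \<Rightarrow> 'w" where
  "tau_mode a p m = act (loop_monom (pT m (- p) a) m (- p))"

lemma modes_cur: "modes N0 (cur a) p = tau_mode a p"
  by (simp add: fun_eq_iff modes_def current_series_def eigen_part_tau tau_mode_def)

lemma cur_eq: "cur a e p = tau_mode a p (- e - int N0)"
  by (simp add: current_series_def eigen_part_tau tau_mode_def)

lemma act_add: "x \<in> Tau \<Longrightarrow> y \<in> Tau \<Longrightarrow> act (x + y) w = act x w + act y w"
  and act_scale: "x \<in> Tau \<Longrightarrow> act (loop_scale scaleG c x) w = scaleW c (act x w)"
  and act_bracket: "x \<in> Tau \<Longrightarrow> y \<in> Tau \<Longrightarrow> act (loop_bracket N0 br form x y) w = act x (act y w) - act y (act x w)"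
  and act_one: "act (0, 1) w = scaleW level w"
  and cur_E: "cur a \<in> E_space scaleW"
  using res unfolding restricted_tau_module_def lie_module_def by auto

lemma Tau_monom: "loop_monom (pT m p a) m p \<in> Tau"
proof -
  have "pT m p a \<in> eigen_tau scaleG \<sigma>0 N0 \<sigma> N (m, p)" unfolding eigen_tau_eq pT_def by (rule Tf.jproj_in)
  then show ?thesis using eigen_tau_sub(1) by (auto simp: loop_monom_def graded_loop_def lookup_single when_def)
qed

lemma Tau_cen: "(0, c) \<in> Tau"
  using eigen_tau_sub(1) by (simp add: graded_loop_def)

lemma act_zero: "act 0 w = 0"
  using act_add[OF Tau_cen[of 0] Tau_cen[of 0], of w] by (simp add: zero_prod_def)

lemma act_cen: "act (0, c) w = scaleW (c * level) w"
proof -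
  have e: "loop_scale scaleG c (0, 1) = ((0, c) :: ('g, 'r) loop)"
    by (auto simp: loop_scale_def intro!: poly_mapping_eqI simp: lookup_map_zero)
  show ?thesis using act_scale[OF Tau_cen[of 1], of c w] unfolding e act_one by simp
qed

lemma tau_mode_add: "tau_mode (a + b) p m w = tau_mode a p m w + tau_mode b p m w"
  unfolding tau_mode_def linear_dest(1)[OF linear_pT] loop_monom_add by (rule act_add[OF Tau_monom Tau_monom])

lemma tau_mode_scale: "tau_mode (scaleG c a) p m w = scaleW c (tau_mode a p m w)"
  unfolding tau_mode_def linear_dest(2)[OF linear_pT] loop_scale_monom[symmetric] by (rule act_scale[OF Tau_monom])

lemma tau_mode_zero: "tau_mode 0 p m w = 0"
  using tau_mode_scale[of 0 0 p m w] by simp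

lemma field_tau_mode: "M.fieldp (tau_mode a p)"
  using M.field_modes[OF cur_E, of a p] unfolding modes_cur .

lemma tau_mode_hom: "hom s m a \<Longrightarrow> tau_mode a p x = (if x mod int N0 = s mod int N0 \<and> meq (- p) m then act (loop_monom a x (- p)) else (\<lambda>w. 0))"
  unfolding tau_mode_def by (auto simp: pT_hom loop_monom_zero act_zero fun_eq_iff)

end

lemma mod_add_iff: "x mod n = s mod n \<Longrightarrow> (x + y) mod n = (s + t) mod n \<longleftrightarrow> y mod n = t mod n" for x :: int
proof -
  assume "x mod n = s mod n"
  then have "(x + y) mod n = (s + y) mod n" by (rule mod_add_cong) simp
  then have "(x + y) mod n = (s + t) mod n \<longleftrightarrow> (s + y) mod n = (s + t) mod n" by simp
  then show ?thesis by (simp only: mod_eq_dvd_iff add_diff_cancel_left)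
qed

lemma (in toroidal_setting) meq_add_iff: "meq p m \<Longrightarrow> meq (p + q) (m + k) \<longleftrightarrow> meq q k"
  by (simp add: meq_def mod_add_iff)

context tau_module
begin

definition central_term :: "'g \<Rightarrow> 'g \<Rightarrow> int ^ 'r \<Rightarrow> complex" where
  "central_term a b p = (if p = 0 then form a b * level else 0)"

text \<open>The shape is the one that \<open>P_P_affine\<close> asks for. Only \<open>a\<close> has
  to match its degree: if \<open>b\<close> does not, its mode is 0 and so is the right-hand side,
  because the projection of \<open>[a, b]\<close> vanishes and a nonzero form would force the
  degrees to match.\<close>

lemma tau_mode_comm:
  assumes a: "hom s m a" and b: "hom t k b" and p: "meq (- p) m" and x: "x mod int N0 = s mod int N0"
  shows "M.P (tau_mode a p) (tau_mode b q) 0 x y w =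
    tau_mode (br a b) (p + q) (x + y) w + scaleW (of_int x / of_nat N0) (scaleW (central_term a b (p + q)) (M.idm (x + y - int N0) w))"
proof -
  let ?b = "pT y (- q) b"
  have aT: "pT x (- p) a = a" using pT_hom[OF a] p x by simp
  have mx: "(x + y) mod int N0 = (s + t) mod int N0 \<longleftrightarrow> y mod int N0 = t mod int N0" by (rule mod_add_iff[OF x])
  have mp: "meq (- p + - q) (m + k) \<longleftrightarrow> meq (- q) k" by (rule meq_add_iff[OF p])
  have br: "br a ?b = pT (x + y) (- p + - q) (br a b)"
    unfolding pT_hom[OF b] pT_hom[OF hom_br[OF a b]] mx mp by (simp add: br_zero)
  have sc: "scaleW ((if y = - x \<and> - q = - (- p) then of_int x / of_nat N0 * form a ?b else 0) * level) w
     = scaleW (of_int x / of_nat N0) (scaleW (central_term a b (p + q)) (M.idm (x + y - int N0) w))"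
  proof (cases "y = - x \<and> q = - p")
    case True
    have "form a ?b = form a b"
    proof (cases "y mod int N0 = t mod int N0 \<and> meq (- q) k")
      case True
      then show ?thesis by (simp add: pT_hom[OF b])
    next
      case False
      have "form a b = 0"
      proof (rule ccontr)
        assume f: "form a b \<noteq> 0"
        have "y mod int N0 = t mod int N0" using mx form_hom(1)[OF a b f] True by simp
        moreover have "meq (- q) k" using mp form_hom(2)[OF a b f] True by (simp add: meq_def)
        ultimately show False using False by simp
      qed
      moreover have "?b = 0" unfolding pT_hom[OF b] if_not_P[OF False] ..
      ultimately show ?thesis by (simp add: form_zero)
    qed
    then show ?thesis using True by (simp add: central_term_def M.idm_def mult.assoc)
  next
    case False
    then have "\<not> (y = - x \<and> - q = - (- p))" by (metis minus_minus)
    moreover have "scaleW (central_term a b (p + q)) (M.idm (x + y - int N0) w) = 0"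
      using False by (auto simp: central_term_def M.idm_def eq_neg_iff_add_eq_0 add.commute)
    ultimately show ?thesis by (simp only: if_False mult_zero_left W.scale_zero_left W.scale_zero_right)
  qed
  have "M.P (tau_mode a p) (tau_mode b q) 0 x y w = act (loop_bracket N0 br form (loop_monom a x (- p)) (loop_monom ?b y (- q))) w"
    unfolding M.P_0 tau_mode_def aT using act_bracket[OF Tau_monom[of x "- p" a] Tau_monom[of y "- q" b]] aT by simp
  also have "\<dots> = act (loop_monom (br a ?b) (x + y) (- p + - q) + (0, if y = - x \<and> - q = - (- p) then of_int x / of_nat N0 * form a ?b else 0)) w"
    unfolding bracket_monom ..
  also have "\<dots> = act (loop_monom (pT (x + y) (- p + - q) (br a b)) (x + y) (- p + - q) + (0, if y = - x \<and> - q = - (- p) then of_int x / of_nat N0 * form a ?b else 0)) w"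
    unfolding br ..
  also have "\<dots> = tau_mode (br a b) (p + q) (x + y) w + scaleW ((if y = - x \<and> - q = - (- p) then of_int x / of_nat N0 * form a ?b else 0) * level) w"
    unfolding act_add[OF Tau_monom Tau_cen] act_cen tau_mode_def by (simp add: add.commute)
  finally show ?thesis unfolding sc .
qed

lemma P_tau_mode_unmatched:
  assumes "hom s m a" "M.fieldp B" "\<not> (meq (- p) m \<and> x mod int N0 = s mod int N0)"
  shows "M.P (tau_mode a p) B n x y w = 0"
proof -
  have "(x + int N0 * j) mod int N0 = x mod int N0" for j by (rule mod_mult_self2)
  then have "tau_mode a p (x + int N0 * j) = (\<lambda>w. 0)" for j
    using assms(3) unfolding tau_mode_hom[OF assms(1)] by auto
  then show ?thesis by (simp add: M.P_def M.L1_def M.lin_0[OF M.field_lin[OF assms(2)]])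
qed

text \<open>The first difference cancels the bracket term and leaves the slope of the central term,
  \<open>(x + N0)/N0 - x/N0 = 1\<close>.\<close>

lemma tau_mode_P1:
  assumes a: "hom s m a" and b: "hom t k b" and p: "meq (- p) m" and x: "x mod int N0 = s mod int N0"
  shows "M.P (tau_mode a p) (tau_mode b q) 1 x y w = scaleW (central_term a b (p + q)) (M.idm (x + y) w)"
proof -
  let ?z = "scaleW (central_term a b (p + q)) (M.idm (x + y) w)"
  have x': "(x + int N0) mod int N0 = s mod int N0" using x by simp
  have H: "M.P (tau_mode a p) (tau_mode b q) (0 + 1) x y w = M.P (tau_mode a p) (tau_mode b q) 0 (x + int N0) y w - M.P (tau_mode a p) (tau_mode b q) 0 x (y + int N0) w"
    by (rule M.P_rec[OF field_tau_mode field_tau_mode])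
  have N: "of_int (x + int N0) / of_nat N0 = of_int x / of_nat N0 + (1::complex)" using N0_pos by (simp add: field_simps)
  have i: "x + int N0 + y - int N0 = x + y" "x + (y + int N0) - int N0 = x + y" "x + (y + int N0) = x + int N0 + y" by simp_all
  from H have "M.P (tau_mode a p) (tau_mode b q) (0 + 1) x y w =
      (tau_mode (br a b) (p + q) (x + int N0 + y) w + (scaleW (of_int x / of_nat N0) ?z + scaleW 1 ?z))
      - (tau_mode (br a b) (p + q) (x + int N0 + y) w + scaleW (of_int x / of_nat N0) ?z)"
    unfolding tau_mode_comm[OF a b p x] tau_mode_comm[OF a b p x'] N i W.scale_left_distrib .
  also have "\<dots> = ?z" by simp
  finally show ?thesis by simp
qed

text \<open>A second difference removes the central term as well, since it depends on
  \<open>x + y\<close> only; hence the order 2.\<close>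

lemma tau_mode_local: "hom s m a \<Longrightarrow> M.local_from 2 (tau_mode a p) (tau_mode b q)"
proof -
  assume a: "hom s m a"
  have P2: "M.P (tau_mode a p) (tau_mode b q) 2 x y w = 0" for x y w
  proof -
    have "b \<in> {b. M.P (tau_mode a p) (tau_mode b q) 2 x y w = 0}"
    proof (rule hom_span)
      have e: "tau_mode (b + c) q = (\<lambda>m w. tau_mode b q m w + tau_mode c q m w)" "tau_mode (scaleG d b) q = (\<lambda>m w. scaleW d (tau_mode b q m w))" "tau_mode 0 q = (\<lambda>m w. 0)" for b c d
        by (simp_all add: fun_eq_iff tau_mode_add tau_mode_scale tau_mode_zero)
      show "G.subspace {b. M.P (tau_mode a p) (tau_mode b q) 2 x y w = 0}"
        by (rule G.subspaceI) (simp_all add: e M.P_right_add M.P_right_scl M.P_right_zero field_tau_mode)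
      fix t k b assume b: "hom t k b"
      have "M.P (tau_mode a p) (tau_mode b q) (1 + 1) x y w = 0"
      proof (cases "meq (- p) m \<and> x mod int N0 = s mod int N0")
        case True
        then have p: "meq (- p) m" and x: "x mod int N0 = s mod int N0" by auto
        have x': "(x + int N0) mod int N0 = s mod int N0" using x by simp
        show ?thesis
          unfolding M.P_rec[OF field_tau_mode field_tau_mode] tau_mode_P1[OF a b p x] tau_mode_P1[OF a b p x'] by (simp add: add_ac)
      qed (rule P_tau_mode_unmatched[OF a field_tau_mode])
      then show "b \<in> {b. M.P (tau_mode a p) (tau_mode b q) 2 x y w = 0}" by simp
    qed
    then show ?thesis by simp
  qed
  show ?thesis unfolding M.local_from_def
    by (intro allI impI) (rule M.P_zero_up[OF field_tau_mode field_tau_mode P2])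
qed

text \<open>By locality only the indices 0 and 1 survive. In the equation for \<open>n = 0\<close>
  the term \<open>s/N0\<close> times the first product matches the central term of the commutator,
  which leaves the current of \<open>[a, b]\<close> as the zeroth product.\<close>

lemma tprod_gen:
  assumes a: "hom s m a" and b: "hom t k b" and p: "meq (- p) m" and n: "0 \<le> n"
  shows "M.tprod s (tau_mode a p) (tau_mode b q) n e w =
    (if n = 0 then tau_mode (br a b) (p + q) e w else if n = 1 then scaleW (central_term a b (p + q)) (M.idm e w) else 0)"
proof -
  let ?C = "M.tprod s (tau_mode a p) (tau_mode b q)"
  have j: "M.jac s (tau_mode a p) (tau_mode b q) ?C" by (rule M.jac_tprod_local[OF field_tau_mode field_tau_mode tau_mode_local[OF a]])
  have z: "?C n = (\<lambda>e w. 0)" if "2 \<le> n" for n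
    by (rule M.tprod_zero[of 2]) (use tau_mode_local[OF a] that in \<open>auto simp: M.local_from_def\<close>)
  have r: "M.P (tau_mode a p) (tau_mode b q) n s (e - s) w = M.R ?C n s (e - s) w" for n e
    by (rule M.jac_eq[OF j refl])
  have one: "?C 1 e w = scaleW (central_term a b (p + q)) (M.idm e w)" for e
  proof -
    have "M.R ?C 1 s (e - s) w = scaleW (M.gb s 0) (?C (1 + int 0) (s + (e - s) - int N0 * int 0) w)"
      unfolding M.R_def by (rule fsum_single) (simp add: z)
    then show ?thesis using r[of 1 e] tau_mode_P1[OF a b p refl, of q "e - s" w] by simp
  qed
  have 0: "?C 0 e w = tau_mode (br a b) (p + q) e w"
  proof -
    have f: "fin1 (\<lambda>i. scaleW (M.gb s i) (?C (0 + int i) (s + (e - s) - int N0 * int i) w))"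
      by (rule fin1I[of 2]) (simp add: z)
    have "M.R ?C 0 s (e - s) w = (\<Sum>i<2. scaleW (M.gb s i) (?C (0 + int i) (s + (e - s) - int N0 * int i) w))"
      unfolding M.R_def by (rule fsum_eq) (simp add: z)
    also have "\<dots> = ?C 0 e w + scaleW (of_int s / of_nat N0) (?C 1 (e - int N0) w)"
      by (simp add: numeral_2_eq_2 M.gb_def)
    finally show ?thesis using r[of 0 e] tau_mode_comm[OF a b p refl, of q "e - s" w] one by simp
  qed
  consider "n = 0" | "n = 1" | "2 \<le> n" using n by linarith
  then show ?thesis
  proof cases
    case 1 then show ?thesis using 0 by simp
  next
    case 2 then show ?thesis using one[of e] by simp
  next
    case 3 then show ?thesis using z[OF 3] by simp
  qed
qed

end

section \<open>Local fields and their products with currents\<close>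

context tau_module
begin

text \<open>
  The bound \<open>K\<close> does not depend on the exponent \<open>q\<close> of the torus variables; otherwise products could
  leave \<open>E_space\<close>.
\<close>

definition local_fields :: "('r, 'w) fseries set" where
  "local_fields = {F \<in> E_space scaleW. \<forall>a p. \<exists>K. \<forall>q. M.local_from K (tau_mode a p) (modes N0 F q)}"

definition scaleF :: "complex \<Rightarrow> ('r, 'w) fseries \<Rightarrow> ('r, 'w) fseries" where
  "scaleF c F = (\<lambda>e p w. scaleW c (F e p w))"

lemma E_space_trunc: "F \<in> E_space scaleW \<Longrightarrow> \<exists>K. \<forall>q. \<forall>l\<ge>K. modes N0 F q l w = 0"
proof -
  assume "F \<in> E_space scaleW"
  then obtain K where K: "\<And>e p. e < K \<Longrightarrow> F e p w = 0" unfolding E_space_def by blast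
  show ?thesis by (intro exI[of _ "1 - K - int N0"]) (simp add: modes_def K)
qed

lemma E_spaceI:
  assumes "\<And>e p. Vector_Spaces.linear scaleW scaleW (F e p)" "\<And>w. \<exists>K. \<forall>q. \<forall>l\<ge>K. modes N0 F q l w = 0"
  shows "F \<in> E_space scaleW"
  unfolding E_space_def
proof (intro CollectI conjI allI)
  fix w
  obtain K where K: "\<And>q l. K \<le> l \<Longrightarrow> modes N0 F q l w = 0" using assms(2) by blast
  have "F e p w = 0" if "e < 1 - K - int N0" for e p
    using K[of "- e - int N0" p] that by (simp add: modes_def)
  then show "\<exists>K. \<forall>e<K. \<forall>p. F e p w = 0" by blast
qed (rule assms(1))

lemma local_fields_E: "F \<in> local_fields \<Longrightarrow> F \<in> E_space scaleW"
  by (simp add: local_fields_def)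

lemma field_local_fields: "F \<in> local_fields \<Longrightarrow> M.fieldp (modes N0 F q)"
  by (rule M.field_modes[OF local_fields_E])

lemma local_fields_local: "F \<in> local_fields \<Longrightarrow> \<exists>K. \<forall>q. M.local_from K (tau_mode a p) (modes N0 F q)"
  by (simp add: local_fields_def)

lemma tau_mode_fun:
  "tau_mode (a + b) p = (\<lambda>m w. tau_mode a p m w + tau_mode b p m w)" "tau_mode (scaleG c a) p = (\<lambda>m w. scaleW c (tau_mode a p m w))" "tau_mode 0 p = (\<lambda>m w. 0)"
  by (simp_all add: fun_eq_iff tau_mode_add tau_mode_scale tau_mode_zero)

lemma local_fields_I:
  assumes F: "F \<in> E_space scaleW"
    and l: "\<And>s m a p. hom s m a \<Longrightarrow> \<exists>K. \<forall>q. M.local_from K (tau_mode a p) (modes N0 F q)"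
  shows "F \<in> local_fields"
  unfolding local_fields_def
proof (intro CollectI conjI allI F)
  fix a p
  note fF = M.field_modes[OF F]
  have "a \<in> {a. \<exists>K. \<forall>q. M.local_from K (tau_mode a p) (modes N0 F q)}"
  proof (rule hom_span)
    show "G.subspace {a. \<exists>K. \<forall>q. M.local_from K (tau_mode a p) (modes N0 F q)}"
    proof (rule G.subspaceI; unfold mem_Collect_eq)
      show "\<exists>K. \<forall>q. M.local_from K (tau_mode 0 p) (modes N0 F q)"
        by (rule exI[of _ 0]) (simp add: M.local_from_def tau_mode_fun M.P_left_zero[OF fF])
    next
      fix a b
      assume a: "\<exists>K. \<forall>q. M.local_from K (tau_mode a p) (modes N0 F q)" and b: "\<exists>K. \<forall>q. M.local_from K (tau_mode b p) (modes N0 F q)"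
      obtain K where K: "\<And>q. M.local_from K (tau_mode a p) (modes N0 F q)" using a by blast
      obtain L where L: "\<And>q. M.local_from L (tau_mode b p) (modes N0 F q)" using b by blast
      show "\<exists>K. \<forall>q. M.local_from K (tau_mode (a + b) p) (modes N0 F q)"
        by (rule exI[of _ "max K L"])
          (use K L in \<open>simp add: M.local_from_def tau_mode_fun M.P_left_add[OF field_tau_mode field_tau_mode fF]\<close>)
    next
      fix c a
      assume a: "\<exists>K. \<forall>q. M.local_from K (tau_mode a p) (modes N0 F q)"
      obtain K where K: "\<And>q. M.local_from K (tau_mode a p) (modes N0 F q)" using a by blast
      show "\<exists>K. \<forall>q. M.local_from K (tau_mode (scaleG c a) p) (modes N0 F q)"
        by (rule exI[of _ K]) (use K in \<open>simp add: M.local_from_def tau_mode_fun M.P_left_scl[OF field_tau_mode fF]\<close>)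
    qed
  qed (use l in blast)
  then show "\<exists>K. \<forall>q. M.local_from K (tau_mode a p) (modes N0 F q)" by simp
qed

lemma modes_plus: "modes N0 (F + G) q = (\<lambda>m w. modes N0 F q m w + modes N0 G q m w)"
  by (simp add: modes_def fun_eq_iff)

lemma modes_scaleF: "modes N0 (scaleF c F) q = (\<lambda>m w. scaleW c (modes N0 F q m w))"
  by (simp add: modes_def scaleF_def fun_eq_iff)

lemma local_fields_add:
  assumes F: "F \<in> local_fields" and G: "G \<in> local_fields" shows "F + G \<in> local_fields"
proof -
  have "F + G \<in> E_space scaleW"
  proof (rule E_spaceI)
    show "Vector_Spaces.linear scaleW scaleW ((F + G) e p)" for e p
      using M.lin_plus[of "F e p" "G e p"] local_fields_E[OF F] local_fields_E[OF G] by (simp add: E_space_def plus_fun_def)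
    fix w
    obtain K L where "\<And>q l. l \<ge> K \<Longrightarrow> modes N0 F q l w = 0" "\<And>q l. l \<ge> L \<Longrightarrow> modes N0 G q l w = 0"
      using E_space_trunc[OF local_fields_E[OF F]] E_space_trunc[OF local_fields_E[OF G]] by metis
    then show "\<exists>K. \<forall>q. \<forall>l\<ge>K. modes N0 (F + G) q l w = 0"
      unfolding modes_plus by (intro exI[of _ "max K L"]) simp
  qed
  moreover have "\<exists>K. \<forall>q. M.local_from K (tau_mode a p) (modes N0 (F + G) q)" for a p
  proof -
    obtain K where K: "\<And>q. M.local_from K (tau_mode a p) (modes N0 F q)" using local_fields_local[OF F] by blast
    obtain L where L: "\<And>q. M.local_from L (tau_mode a p) (modes N0 G q)" using local_fields_local[OF G] by blast
    show ?thesis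
      by (rule exI[of _ "max K L"])
        (use K L in \<open>simp add: M.local_from_def modes_plus M.P_right_add[OF field_tau_mode field_local_fields[OF F] field_local_fields[OF G]]\<close>)
  qed
  ultimately show ?thesis by (simp add: local_fields_def)
qed

lemma local_fields_scale:
  assumes F: "F \<in> local_fields" shows "scaleF c F \<in> local_fields"
proof -
  have "scaleF c F \<in> E_space scaleW"
  proof (rule E_spaceI)
    show "Vector_Spaces.linear scaleW scaleW (scaleF c F e p)" for e p
      using M.lin_scl[of "F e p" c] local_fields_E[OF F] by (simp add: E_space_def scaleF_def)
    fix w
    obtain K where "\<And>q l. l \<ge> K \<Longrightarrow> modes N0 F q l w = 0"
      using E_space_trunc[OF local_fields_E[OF F]] by metis
    then show "\<exists>K. \<forall>q. \<forall>l\<ge>K. modes N0 (scaleF c F) q l w = 0"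
      unfolding modes_scaleF by (intro exI[of _ K]) simp
  qed
  moreover have "\<exists>K. \<forall>q. M.local_from K (tau_mode a p) (modes N0 (scaleF c F) q)" for a p
  proof -
    obtain K where K: "\<And>q. M.local_from K (tau_mode a p) (modes N0 F q)" using local_fields_local[OF F] by blast
    show ?thesis
      by (rule exI[of _ K])
        (use K in \<open>simp add: M.local_from_def modes_scaleF M.P_right_scl[OF field_tau_mode field_local_fields[OF F]]\<close>)
  qed
  ultimately show ?thesis by (simp add: local_fields_def)
qed

lemma local_fields_zero: "0 \<in> local_fields"
proof (rule local_fields_I)
  have z: "modes N0 (0 :: ('r, 'w) fseries) q = (\<lambda>m w. 0)" for q by (simp add: modes_def fun_eq_iff)
  show "(0 :: ('r, 'w) fseries) \<in> E_space scaleW"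
  proof (rule E_spaceI)
    show "Vector_Spaces.linear scaleW scaleW ((0 :: ('r, 'w) fseries) e p)" for e p
      using M.lin_zero by (simp add: zero_fun_def)
  qed (simp add: z)
  show "\<exists>K. \<forall>q. M.local_from K (tau_mode a p) (modes N0 (0 :: ('r, 'w) fseries) q)" for a p
    unfolding z by (simp add: M.local_from_def M.P_right_zero[OF field_tau_mode])
qed

lemma local_fields_cur: "cur b \<in> local_fields"
proof (rule local_fields_I[OF cur_E])
  show "\<exists>K. \<forall>q. M.local_from K (tau_mode a p) (modes N0 (cur b) q)" if "hom s m a" for s m a p
    unfolding modes_cur using tau_mode_local[OF that] by blast
qed

lemma modes_id: "modes N0 id_series p = (if p = 0 then M.idm else (\<lambda>m w. 0))"
  by (auto simp: modes_def id_series_def M.idm_def fun_eq_iff)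

lemma local_fields_id: "id_series \<in> local_fields"
proof (rule local_fields_I)
  show "(id_series :: ('r, 'w) fseries) \<in> E_space scaleW"
  proof (rule E_spaceI)
    show "Vector_Spaces.linear scaleW scaleW (id_series e p)" for e :: int and p :: "int ^ 'r"
      by (rule M.linI) (simp_all add: id_series_def)
    show "\<exists>K. \<forall>q. \<forall>l\<ge>K. modes N0 (id_series :: ('r, 'w) fseries) q l w = 0" for w
      using N0_pos by (intro exI[of _ 0]) (simp add: modes_def id_series_def)
  qed
  show "\<exists>K. \<forall>q. M.local_from K (tau_mode a p) (modes N0 (id_series :: ('r, 'w) fseries) q)" for a p
    unfolding modes_id
    by (intro exI[of _ 0]) (simp add: M.local_from_def M.P_right_zero[OF field_tau_mode] M.P_idm_right[OF field_tau_mode])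
qed

text \<open>The sum runs over the eigencomponents of \<open>a\<close>, since \<open>tprod\<close> depends on the residue class of the modes.\<close>

definition gen_product :: "'g \<Rightarrow> int \<Rightarrow> int ^ 'r \<Rightarrow> ('r, 'w) fseries \<Rightarrow> ('r, 'w) fseries" where
  "gen_product a n p F = (\<lambda>e q w. \<Sum>s<N0. M.tprod (int s) (tau_mode (Tf.epi None (int s) a) p) (modes N0 F (q - p)) n (- e - int N0) w)"

sublocale P0: periodic_map scaleG \<sigma>0 N0
  using periodic[of None] by simp

lemma tprod_mod:
  assumes "s mod int N0 = t mod int N0" "M.fieldp X" "M.fieldp Z" "M.local_from K X Z"
  shows "M.tprod s X Z = M.tprod t X Z"
proof (rule M.jac_unique)
  show "M.jac s X Z (M.tprod s X Z)" by (rule M.jac_tprod_local[OF assms(2-4)])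
  show "M.jac s X Z (M.tprod t X Z)" unfolding M.jac_mod[OF assms(1)] by (rule M.jac_tprod_local[OF assms(2-4)])
qed

text \<open>Only the summand indexed by the residue of \<open>s\<close> is nonzero, and
  \<open>tprod_mod\<close> replaces that residue by \<open>s\<close>.\<close>

lemma gen_product_hom:
  assumes a: "hom s m a" and F: "F \<in> local_fields"
  shows "gen_product a n p F e q w = M.tprod s (tau_mode a p) (modes N0 F (q - p)) n (- e - int N0) w"
proof -
  obtain K where K: "\<And>q. M.local_from K (tau_mode a p) (modes N0 F q)" using local_fields_local[OF F] by blast
  have ev: "\<sigma>0 a = scaleG (omega N0 powi s) a" using a by (simp add: hom_iff)
  let ?s = "nat (s mod int N0)"
  have s: "?s \<in> {..<N0}" "int ?s = s mod int N0"
  proof -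
    have "0 \<le> s mod int N0" "s mod int N0 < int N0" by (rule pos_mod_sign pos_mod_bound; use N0_pos in simp)+
    then show "?s \<in> {..<N0}" "int ?s = s mod int N0" by (simp_all only: lessThan_iff nat_less_iff nat_0_le)
  qed
  have "gen_product a n p F e q w = (\<Sum>t<N0. if t = ?s then M.tprod (int ?s) (tau_mode a p) (modes N0 F (q - p)) n (- e - int N0) w else 0)"
    unfolding gen_product_def
  proof (rule sum.cong[OF refl])
    fix t assume "t \<in> {..<N0}"
    then have t: "int t mod int N0 = s mod int N0 \<longleftrightarrow> t = ?s" using s(2) by auto
    show "M.tprod (int t) (tau_mode (Tf.epi None (int t) a) p) (modes N0 F (q - p)) n (- e - int N0) w
      = (if t = ?s then M.tprod (int ?s) (tau_mode a p) (modes N0 F (q - p)) n (- e - int N0) w else 0)"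
    proof (cases "t = ?s")
      case True
      then have "P0.ep (int t) a = a" using P0.ep_on_eigen[OF ev, of "int t"] t by simp
      then show ?thesis using True by simp
    next
      case False
      then have "P0.ep (int t) a = 0" using P0.ep_on_eigen[OF ev, of "int t"] t by simp
      then show ?thesis using False by (simp add: tau_mode_fun M.tprod_left_zero[OF field_local_fields[OF F]])
    qed
  qed
  also have "\<dots> = M.tprod (int ?s) (tau_mode a p) (modes N0 F (q - p)) n (- e - int N0) w" using s(1) by simp
  also have "M.tprod (int ?s) (tau_mode a p) (modes N0 F (q - p)) = M.tprod s (tau_mode a p) (modes N0 F (q - p))"
    by (rule tprod_mod[OF _ field_tau_mode field_local_fields[OF F] K]) (simp only: s(2) mod_mod_trivial)
  finally show ?thesis .
qed

lemma modes_gen_product_hom: "hom s m a \<Longrightarrow> F \<in> local_fields \<Longrightarrow> modes N0 (gen_product a n p F) q = M.tprod s (tau_mode a p) (modes N0 F (q - p)) n"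
  by (simp add: fun_eq_iff modes_def[of N0 "gen_product a n p F"] gen_product_hom)

lemma gen_product_add:
  assumes F: "F \<in> local_fields" shows "gen_product (a + b) n p F = gen_product a n p F + gen_product b n p F"
proof -
  have "M.tprod s (tau_mode (P0.ep s (a + b)) p) (modes N0 F q) n e w =
    M.tprod s (tau_mode (P0.ep s a) p) (modes N0 F q) n e w + M.tprod s (tau_mode (P0.ep s b) p) (modes N0 F q) n e w" for s q e w
  proof -
    obtain K where K: "\<And>q. M.local_from K (tau_mode (P0.ep s a) p) (modes N0 F q)" using local_fields_local[OF F] by blast
    obtain L where L: "\<And>q. M.local_from L (tau_mode (P0.ep s b) p) (modes N0 F q)" using local_fields_local[OF F] by blast
    show ?thesis unfolding linear_dest(1)[OF P0.linear_ep] tau_mode_fun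
      by (rule M.tprod_left_add[OF field_tau_mode field_tau_mode field_local_fields[OF F] K L])
  qed
  then show ?thesis by (simp add: gen_product_def fun_eq_iff sum.distrib)
qed

lemma gen_product_scale:
  assumes F: "F \<in> local_fields" shows "gen_product (scaleG c a) n p F = scaleF c (gen_product a n p F)"
proof -
  have "M.tprod s (tau_mode (P0.ep s (scaleG c a)) p) (modes N0 F q) n e w =
    scaleW c (M.tprod s (tau_mode (P0.ep s a) p) (modes N0 F q) n e w)" for s q e w
  proof -
    obtain K where K: "\<And>q. M.local_from K (tau_mode (P0.ep s a) p) (modes N0 F q)" using local_fields_local[OF F] by blast
    show ?thesis unfolding linear_dest(2)[OF P0.linear_ep] tau_mode_fun
      by (rule M.tprod_left_scl[OF field_tau_mode field_local_fields[OF F] K])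
  qed
  then show ?thesis by (simp add: gen_product_def scaleF_def fun_eq_iff W.scale_sum_right)
qed

lemma gen_product_plus:
  assumes F: "F \<in> local_fields" and F': "F' \<in> local_fields" shows "gen_product a n p (F + F') = gen_product a n p F + gen_product a n p F'"
proof -
  have "M.tprod s (tau_mode b p) (modes N0 (F + F') q) n e w =
    M.tprod s (tau_mode b p) (modes N0 F q) n e w + M.tprod s (tau_mode b p) (modes N0 F' q) n e w" for b s q e w
  proof -
    obtain K where K: "\<And>q. M.local_from K (tau_mode b p) (modes N0 F q)" using local_fields_local[OF F] by blast
    obtain L where L: "\<And>q. M.local_from L (tau_mode b p) (modes N0 F' q)" using local_fields_local[OF F'] by blast
    show ?thesis unfolding modes_plus
      by (rule M.tprod_right_add[OF field_tau_mode field_local_fields[OF F] field_local_fields[OF F'] K L])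
  qed
  then show ?thesis by (simp add: gen_product_def fun_eq_iff sum.distrib)
qed

lemma gen_product_scaleF:
  assumes F: "F \<in> local_fields" shows "gen_product a n p (scaleF c F) = scaleF c (gen_product a n p F)"
proof -
  have "M.tprod s (tau_mode b p) (modes N0 (scaleF c F) q) n e w = scaleW c (M.tprod s (tau_mode b p) (modes N0 F q) n e w)" for b s q e w
  proof -
    obtain K where K: "\<And>q. M.local_from K (tau_mode b p) (modes N0 F q)" using local_fields_local[OF F] by blast
    show ?thesis unfolding modes_scaleF
      by (rule M.tprod_right_scl[OF field_tau_mode field_local_fields[OF F] K])
  qed
  then show ?thesis by (simp add: gen_product_def scaleF_def fun_eq_iff W.scale_sum_right)
qed

text \<open>Locality is Dong's lemma; its order \<open>2 + nat L + nat (K - n)\<close> is free of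
  \<open>q\<close> because \<open>K\<close> and \<open>L\<close> are.\<close>

lemma gen_product_hom_local_fields:
  assumes a: "hom s m a" and F: "F \<in> local_fields" shows "gen_product a n p F \<in> local_fields"
proof (rule local_fields_I)
  obtain K where K: "\<And>q. M.local_from K (tau_mode a p) (modes N0 F q)" using local_fields_local[OF F] by blast
  have PK: "\<And>q n m l w. K \<le> n \<Longrightarrow> M.P (tau_mode a p) (modes N0 F q) n m l w = 0" using K by (simp add: M.local_from_def)
  show "gen_product a n p F \<in> E_space scaleW"
  proof (rule E_spaceI)
    show "Vector_Spaces.linear scaleW scaleW (gen_product a n p F e q)" for e q
      using M.lin_tprod[OF field_tau_mode field_local_fields[OF F] PK] unfolding gen_product_hom[OF a F, abs_def] .
    fix w
    have "\<exists>L. \<forall>q. \<forall>e\<ge>L. M.tprod s (tau_mode a p) (modes N0 F q) n e w = 0"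
      by (rule M.tprod_trunc[OF field_tau_mode E_space_trunc[OF local_fields_E[OF F]] _ PK])
        (simp add: M.lin_0[OF M.field_lin[OF field_local_fields[OF F]]])
    then show "\<exists>L. \<forall>q. \<forall>e\<ge>L. modes N0 (gen_product a n p F) q e w = 0"
      unfolding modes_gen_product_hom[OF a F] by blast
  qed
  fix t k b r assume b: "hom t k b"
  obtain L where L: "\<And>q. M.local_from L (tau_mode b r) (modes N0 F q)" using local_fields_local[OF F] by blast
  have 1: "M.P (tau_mode b r) (tau_mode a p) (int 2) x y w = 0" for x y w
    using tau_mode_local[OF b] by (simp add: M.local_from_def)
  have 2: "M.P (tau_mode b r) (modes N0 F q) (int (nat L)) x y w = 0" for q x y w
    using L[of q] by (simp add: M.local_from_def)
  have "M.local_from (int (2 + nat L + nat (K - n))) (tau_mode b r) (modes N0 (gen_product a n p F) q)" for q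
    unfolding M.local_from_def modes_gen_product_hom[OF a F]
  proof (intro allI impI)
    fix n' x y w assume n': "int (2 + nat L + nat (K - n)) \<le> n'"
    show "M.P (tau_mode b r) (M.tprod s (tau_mode a p) (modes N0 F (q - p)) n) n' x y w = 0"
      by (rule M.dong[OF field_tau_mode field_tau_mode field_local_fields[OF F] 1 2 PK n'])
  qed
  then show "\<exists>K. \<forall>q. M.local_from K (tau_mode b r) (modes N0 (gen_product a n p F) q)" by blast
qed

end

section \<open>The action of L on local fields\<close>

lemma sum_keys_filter_add:
  assumes "\<And>x y. h (x + y) = h x + h (y :: 'a::ab_group_add)"
  shows "(\<Sum>k\<in>{k \<in> Poly_Mapping.keys (f + g). Q k}. h (Poly_Mapping.lookup (f + g) k) :: 'b::ab_group_add)
    = (\<Sum>k\<in>{k \<in> Poly_Mapping.keys f. Q k}. h (Poly_Mapping.lookup f k)) + (\<Sum>k\<in>{k \<in> Poly_Mapping.keys g. Q k}. h (Poly_Mapping.lookup g k))"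
  unfolding sum.inter_filter[OF finite_keys]
  by (rule sum_keys_add[of "\<lambda>k x. if Q k then h x else 0"]) (simp add: assms)

lemma vac_act_add:
  assumes "\<And>x x' y. br (x + x') y = br x y + br x' y" "\<And>x x' y. form (x + x') y = form x y + form x' y"
    "\<And>c d x. scl (c + d) x = scl c x + scl d x"
  shows "vac_act scl br form level (X + Z) b = vac_act scl br form level X b + vac_act scl br form level Z b"
  unfolding vac_act_def Let_def fst_add snd_add
  by (subst sum_keys_filter_add[of "\<lambda>x. br x (fst b)"], simp add: assms,
      subst sum_keys_filter_add[of "\<lambda>x. form x (fst b) * level"], simp add: assms distrib_right)
    (simp add: assms distrib_left distrib_right)

lemma loop_scale_add:
  assumes "\<And>x y. scl c (x + y) = scl c x + scl c (y :: 'g::ab_group_add)"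
  shows "loop_scale scl c (X + Z) = loop_scale scl c X + loop_scale scl c (Z :: ('g, 'r::finite) loop)"
proof -
  have 0: "scl c 0 = 0" using assms[of 0 0] by simp
  show ?thesis
    unfolding loop_scale_def
    by (rule prod_eqI) (auto intro!: poly_mapping_eqI simp: lookup_map_zero[of "scl c", OF 0] lookup_add assms distrib_left)
qed

context toroidal_setting
begin

lemma vac_act_plus:
  "vac_act scaleG br form level (X + Z :: ('g, 'r) loop) b = vac_act scaleG br form level X b + vac_act scaleG br form level Z b"
  by (rule vac_act_add) (simp_all add: linear_dest(1)[OF G.br_linear_left] form_props G.scale_left_distrib)

lemma vac_act_cen: "vac_act scaleG br form level ((0, c) :: ('g, 'r) loop) b = (scaleG (level * c) (fst b), level * c * snd b)"
  by (simp add: vac_act_def)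

end

context tau_module
begin

lemma scaleF_simps:
  "scaleF c (F + G) = scaleF c F + scaleF c G" "scaleF (c + d) F = scaleF c F + scaleF d F"
  "scaleF c (scaleF d F) = scaleF (c * d) F" "scaleF 1 F = F" "scaleF c 0 = 0" "scaleF 0 F = 0"
  "scaleF c (F - G) = scaleF c F - scaleF c G"
  by (simp_all add: scaleF_def fun_eq_iff W.scale_right_distrib W.scale_left_distrib W.scale_right_diff_distrib)

lemma vector_space_scaleF: "vector_space scaleF"
  by unfold_locales (simp_all add: scaleF_simps)

lemma gen_product_zero: "F \<in> local_fields \<Longrightarrow> gen_product 0 n p F = 0"
  using gen_product_add[of F 0 0 n p] by simp

text \<open>A coefficient of \<open>t_0^n t^m\<close> acts as an n-th product with integral
  \<open>n\<close>, although its current may have fractional powers of \<open>x_0\<close>;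
  \<open>t^m\<close> belongs to the torus exponent \<open>- m\<close>.\<close>

definition loop_op :: "('g, 'r) loop \<Rightarrow> ('r, 'w) fseries \<Rightarrow> ('r, 'w) fseries" where
  "loop_op X F = (\<Sum>k\<in>Poly_Mapping.keys (fst X). gen_product (Poly_Mapping.lookup (fst X) k) (fst k) (- snd k) F) + scaleF (snd X * level) F"

lemma loop_op_add: "F \<in> local_fields \<Longrightarrow> loop_op (X + Z) F = loop_op X F + loop_op Z F"
  unfolding loop_op_def fst_add snd_add
  by (subst sum_keys_add[of "\<lambda>k x. gen_product x (fst k) (- snd k) F"]) (simp_all add: gen_product_add distrib_right scaleF_simps)

lemma loop_op_monom: "F \<in> local_fields \<Longrightarrow> loop_op (loop_monom a n m) F = gen_product a n (- m) F"
  unfolding loop_op_def loop_monom_def fst_conv snd_conv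
  by (subst sum_keys_single[of "\<lambda>k x. gen_product x (fst k) (- snd k) F"]) (simp_all add: gen_product_zero scaleF_simps)

lemma loop_op_cen: "loop_op (0, c) F = scaleF (c * level) F"
  by (simp add: loop_op_def)

lemma loop_op_local_fields: "X \<in> LL \<Longrightarrow> F \<in> local_fields \<Longrightarrow> loop_op X F \<in> local_fields"
  by (rule L_induct_hom[of X "\<lambda>_. True" "\<lambda>X. loop_op X F \<in> local_fields"]) (simp_all add: loop_op_add local_fields_add loop_op_cen local_fields_scale loop_op_monom gen_product_hom_local_fields)

lemma loop_op_scale: "X \<in> LL \<Longrightarrow> F \<in> local_fields \<Longrightarrow> loop_op (loop_scale scaleG c X) F = scaleF c (loop_op X F)"
proof (rule L_induct_hom[of X "\<lambda>_. True" "\<lambda>X. loop_op (loop_scale scaleG c X) F = scaleF c (loop_op X F)"])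
  assume F: "F \<in> local_fields"
  show "loop_op (loop_scale scaleG c (X + Z)) F = scaleF c (loop_op (X + Z) F)"
    if "loop_op (loop_scale scaleG c X) F = scaleF c (loop_op X F)" "loop_op (loop_scale scaleG c Z) F = scaleF c (loop_op Z F)" for X Z
    unfolding loop_scale_add[of scaleG, OF G.scale_right_distrib] loop_op_add[OF F] scaleF_simps that ..
  have "loop_scale scaleG c ((0, d) :: ('g, 'r) loop) = (0, c * d)" for d
    by (auto simp: loop_scale_def intro!: poly_mapping_eqI simp: lookup_map_zero)
  then show "loop_op (loop_scale scaleG c (0, d)) F = scaleF c (loop_op (0, d) F)" for d
    by (simp add: loop_op_cen scaleF_simps mult.assoc)
  show "loop_op (loop_scale scaleG c (loop_monom a n m)) F = scaleF c (loop_op (loop_monom a n m) F)" for a n m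
    unfolding loop_scale_monom loop_op_monom[OF F] by (rule gen_product_scale[OF F])
qed simp_all

lemma loop_op_plus: "X \<in> LL \<Longrightarrow> F \<in> local_fields \<Longrightarrow> G \<in> local_fields \<Longrightarrow> loop_op X (F + G) = loop_op X F + loop_op X G"
  by (rule L_induct_hom[of X "\<lambda>_. True" "\<lambda>X. loop_op X (F + G) = loop_op X F + loop_op X G"]) (simp_all add: loop_op_add local_fields_add loop_op_cen loop_op_monom gen_product_plus scaleF_simps)

lemma loop_op_scaleF: "X \<in> LL \<Longrightarrow> F \<in> local_fields \<Longrightarrow> loop_op X (scaleF c F) = scaleF c (loop_op X F)"
  by (rule L_induct_hom[of X "\<lambda>_. True" "\<lambda>X. loop_op X (scaleF c F) = scaleF c (loop_op X F)"]) (simp_all add: loop_op_add local_fields_scale loop_op_cen loop_op_monom gen_product_scaleF scaleF_simps mult.commute)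

text \<open>\<open>jac_commutator\<close> in each torus exponent: the iterated products at
  \<open>q\<close> involve \<open>F\<close> at \<open>q + m + k\<close>. The constant
  \<open>\<kappa>\<close> carries the condition \<open>m + k = 0\<close>, and
  \<open>jac_commutator\<close> supplies \<open>n + n' = 0\<close>.\<close>

lemma loop_op_bracket_monom:
  assumes a: "hom s m a" and b: "hom t k b" and F: "F \<in> local_fields"
  shows "loop_op (loop_bracket 1 br form (loop_monom a n m) (loop_monom b n' k)) F =
    loop_op (loop_monom a n m) (loop_op (loop_monom b n' k) F) - loop_op (loop_monom b n' k) (loop_op (loop_monom a n m) F)"
proof -
  let ?Ga = "gen_product a n (- m) F" and ?Gb = "gen_product b n' (- k) F"
  define \<kappa> where "\<kappa> = central_term a b (- m + - k)"
  note Ga = gen_product_hom_local_fields[OF a F, of n "- m"] and Gb = gen_product_hom_local_fields[OF b F, of n' "- k"]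
  have "gen_product a n (- m) ?Gb e q w - gen_product b n' (- k) ?Ga e q w =
      gen_product (br a b) (n + n') (- (m + k)) F e q w + (if n + n' = 0 then scaleW (of_int n * \<kappa>) (F e (q + m + k) w) else 0)" for e q w
  proof -
    let ?B = "modes N0 F (q + m + k)"
    have lab: "q - - m = q + m" "q - - k = q + k" "- (m + k) = - m + - k" "q - (- m + - k) = q + m + k" by simp_all
    obtain Ka Kb Ke where K: "\<And>q. M.local_from Ka (tau_mode a (- m)) (modes N0 F q)" "\<And>q. M.local_from Kb (tau_mode b (- k)) (modes N0 F q)"
      "\<And>q. M.local_from Ke (tau_mode (br a b) (- m + - k)) (modes N0 F q)"
      using local_fields_local[OF F] by metis
    have eb: "modes N0 (gen_product b j (- k) F) (q + m) = M.tprod t (tau_mode b (- k)) ?B j" for j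
      unfolding modes_gen_product_hom[OF b F] by simp
    have ea: "modes N0 (gen_product a j (- m) F) (q + k) = M.tprod s (tau_mode a (- m)) ?B j" for j
      unfolding modes_gen_product_hom[OF a F] by (simp add: add.commute add.left_commute)
    have "M.tprod s (tau_mode a (- m)) (modes N0 (gen_product b n' (- k) F) (q + m)) n (- e - int N0) w
      - M.tprod t (tau_mode b (- k)) (modes N0 (gen_product a n (- m) F) (q + k)) n' (- e - int N0) w
      = M.tprod (s + t) (tau_mode (br a b) (- m + - k)) ?B (n + n') (- e - int N0) w
      + (if n + n' = 0 then scaleW (of_int n * \<kappa>) (?B (- e - int N0) w) else 0)"
    proof (rule M.jac_commutator[where a = "tau_mode a (- m)" and b = "tau_mode b (- k)" and B = ?B and E = "tau_mode (br a b) (- m + - k)"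
        and s = s and t = t and Ca = "M.tprod s (tau_mode a (- m)) ?B" and Cb = "M.tprod t (tau_mode b (- k)) ?B"
        and CE = "M.tprod (s + t) (tau_mode (br a b) (- m + - k)) ?B"
        and Cab = "\<lambda>j. M.tprod s (tau_mode a (- m)) (modes N0 (gen_product b j (- k) F) (q + m))"
        and Cba = "\<lambda>j. M.tprod t (tau_mode b (- k)) (modes N0 (gen_product a j (- m) F) (q + k))"])
      show "M.fieldp (tau_mode a (- m))" "M.fieldp (tau_mode b (- k))" "M.fieldp (tau_mode (br a b) (- m + - k))" by (rule field_tau_mode)+
      show "M.fieldp ?B" by (rule field_local_fields[OF F])
      show "M.fieldp (M.tprod s (tau_mode a (- m)) ?B j)" for j
        unfolding ea[symmetric] by (rule field_local_fields[OF gen_product_hom_local_fields[OF a F]])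
      show "M.fieldp (M.tprod t (tau_mode b (- k)) ?B j)" for j
        unfolding eb[symmetric] by (rule field_local_fields[OF gen_product_hom_local_fields[OF b F]])
      show "M.jac s (tau_mode a (- m)) ?B (M.tprod s (tau_mode a (- m)) ?B)" by (rule M.jac_tprod_local[OF field_tau_mode field_local_fields[OF F] K(1)])
      show "M.jac t (tau_mode b (- k)) ?B (M.tprod t (tau_mode b (- k)) ?B)" by (rule M.jac_tprod_local[OF field_tau_mode field_local_fields[OF F] K(2)])
      show "M.jac (s + t) (tau_mode (br a b) (- m + - k)) ?B (M.tprod (s + t) (tau_mode (br a b) (- m + - k)) ?B)"
        by (rule M.jac_tprod_local[OF field_tau_mode field_local_fields[OF F] K(3)])
      show "M.jac s (tau_mode a (- m)) (M.tprod t (tau_mode b (- k)) ?B j) (M.tprod s (tau_mode a (- m)) (modes N0 (gen_product b j (- k) F) (q + m)))" for j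
      proof -
        obtain K where K: "\<And>q. M.local_from K (tau_mode a (- m)) (modes N0 (gen_product b j (- k) F) q)" using local_fields_local[OF gen_product_hom_local_fields[OF b F]] by blast
        show ?thesis unfolding eb[symmetric] by (rule M.jac_tprod_local[OF field_tau_mode field_local_fields[OF gen_product_hom_local_fields[OF b F]] K])
      qed
      show "M.jac t (tau_mode b (- k)) (M.tprod s (tau_mode a (- m)) ?B j) (M.tprod t (tau_mode b (- k)) (modes N0 (gen_product a j (- m) F) (q + k)))" for j
      proof -
        obtain K where K: "\<And>q. M.local_from K (tau_mode b (- k)) (modes N0 (gen_product a j (- m) F) q)" using local_fields_local[OF gen_product_hom_local_fields[OF a F]] by blast
        show ?thesis unfolding ea[symmetric] by (rule M.jac_tprod_local[OF field_tau_mode field_local_fields[OF gen_product_hom_local_fields[OF a F]] K])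
      qed
      show "M.P (tau_mode a (- m)) (tau_mode b (- k)) 0 x y w = tau_mode (br a b) (- m + - k) (x + y) w
          + scaleW (of_int x / of_nat N0) (scaleW \<kappa> (M.idm (x + y - int N0) w))"
        if "x mod int N0 = s mod int N0" for x y w
        unfolding \<kappa>_def by (rule tau_mode_comm[OF a b _ that]) simp
      show "(s + t) mod int N0 = 0" if "\<kappa> \<noteq> 0"
        using that form_hom(1)[OF a b] by (auto simp: \<kappa>_def central_term_def split: if_splits)
    qed
    then show ?thesis
      unfolding gen_product_hom[OF a Gb] gen_product_hom[OF b Ga] gen_product_hom[OF hom_br[OF a b] F] lab by (simp add: modes_def)
  qed
  moreover have "(if n + n' = 0 then scaleW (of_int n * \<kappa>) (F e (q + m + k) w) else 0)
     = scaleW ((if n' = - n \<and> k = - m then of_int n / of_nat 1 * form a b else 0) * level) (F e q w)" for e q w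
  proof (cases "n + n' = 0 \<and> m + k = 0")
    case True
    then have "n' = - n" "k = - m" by (simp_all add: eq_neg_iff_add_eq_0 add.commute)
    then show ?thesis by (simp add: \<kappa>_def central_term_def mult.assoc)
  next
    case False
    then have "\<not> (n' = - n \<and> k = - m)" by auto
    moreover have "\<kappa> = 0" if "n + n' = 0"
    proof -
      have "- m + - k \<noteq> 0" using False that by (metis add_diff_cancel_left' diff_minus_eq_add neg_equal_0_iff_equal uminus_add_conv_diff minus_add_distrib)
      then show ?thesis by (simp add: \<kappa>_def central_term_def)
    qed
    ultimately show ?thesis by auto
  qed
  ultimately have "gen_product a n (- m) ?Gb - gen_product b n' (- k) ?Ga = gen_product (br a b) (n + n') (- (m + k)) F
      + scaleF ((if n' = - n \<and> k = - m then of_int n / of_nat 1 * form a b else 0) * level) F"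
    by (simp add: fun_eq_iff scaleF_def)
  then show ?thesis
    unfolding bracket_monom loop_op_add[OF F] loop_op_monom[OF F] loop_op_monom[OF Ga] loop_op_monom[OF Gb] loop_op_cen by simp
qed

lemma loop_op_bracket:
  assumes X: "X \<in> LL" and Z: "Z \<in> LL" and F: "F \<in> local_fields"
  shows "loop_op (loop_bracket 1 br form X Z) F = loop_op X (loop_op Z F) - loop_op Z (loop_op X F)"
proof (rule L_induct_hom[OF X, of "\<lambda>_. True" "\<lambda>X. loop_op (loop_bracket 1 br form X Z) F = loop_op X (loop_op Z F) - loop_op Z (loop_op X F)"])
  fix X X' :: "('g, 'r) loop" assume "X \<in> LL" "X' \<in> LL"
    and "loop_op (loop_bracket 1 br form X Z) F = loop_op X (loop_op Z F) - loop_op Z (loop_op X F)"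
    and "loop_op (loop_bracket 1 br form X' Z) F = loop_op X' (loop_op Z F) - loop_op Z (loop_op X' F)"
  then show "loop_op (loop_bracket 1 br form (X + X') Z) F = loop_op (X + X') (loop_op Z F) - loop_op Z (loop_op (X + X') F)"
    by (simp add: bracket_add loop_op_add[OF F] loop_op_add[OF loop_op_local_fields[OF Z F]] loop_op_plus[OF Z loop_op_local_fields[OF _ F] loop_op_local_fields[OF _ F]])
next
  show "loop_op (loop_bracket 1 br form (0, c) Z) F = loop_op (0, c) (loop_op Z F) - loop_op Z (loop_op (0, c) F)" for c
    using loop_op_cen[of 0 F] by (simp add: bracket_central loop_op_cen loop_op_scaleF[OF Z F] zero_prod_def scaleF_simps)
next
  fix n s m a assume a: "hom s m a"
  let ?x = "loop_monom a n m"
  have x: "?x \<in> LL" by (rule L_hom[OF a])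
  show "loop_op (loop_bracket 1 br form ?x Z) F = loop_op ?x (loop_op Z F) - loop_op Z (loop_op ?x F)"
  proof (rule L_induct_hom[OF Z, of "\<lambda>_. True" "\<lambda>Z. loop_op (loop_bracket 1 br form ?x Z) F = loop_op ?x (loop_op Z F) - loop_op Z (loop_op ?x F)"])
    fix Z Z' :: "('g, 'r) loop" assume "Z \<in> LL" "Z' \<in> LL"
      and "loop_op (loop_bracket 1 br form ?x Z) F = loop_op ?x (loop_op Z F) - loop_op Z (loop_op ?x F)"
      and "loop_op (loop_bracket 1 br form ?x Z') F = loop_op ?x (loop_op Z' F) - loop_op Z' (loop_op ?x F)"
    then show "loop_op (loop_bracket 1 br form ?x (Z + Z')) F = loop_op ?x (loop_op (Z + Z') F) - loop_op (Z + Z') (loop_op ?x F)"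
      by (simp add: bracket_add loop_op_add[OF F] loop_op_add[OF loop_op_local_fields[OF x F]] loop_op_plus[OF x loop_op_local_fields[OF _ F] loop_op_local_fields[OF _ F]])
  next
    show "loop_op (loop_bracket 1 br form ?x (0, c)) F = loop_op ?x (loop_op (0, c) F) - loop_op (0, c) (loop_op ?x F)" for c
      using loop_op_cen[of 0 F] by (simp add: bracket_central' loop_op_cen loop_op_scaleF[OF x F] zero_prod_def scaleF_simps)
  qed (use loop_op_bracket_monom[OF a _ F] in auto)
qed simp

lemma gen_product_cur:
  assumes a: "hom s m a" and n: "0 \<le> n"
  shows "gen_product a n (- m) (cur b) = (if n = 0 then cur (br a b) else if n = 1 then scaleF (form a b * level) id_series else 0)"
proof -
  define R where "R b = (if n = 0 then cur (br a b) else if n = 1 then scaleF (form a b * level) id_series else 0)" for b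
  have cur: "cur (x + y) = cur x + cur y" "cur (scaleG c x) = scaleF c (cur x)" for x y c
    by (simp_all add: fun_eq_iff cur_eq tau_mode_add tau_mode_scale scaleF_def)
  have cur0: "cur 0 = 0" by (simp add: fun_eq_iff cur_eq tau_mode_zero)
  define S where "S = {b. gen_product a n (- m) (cur b) = R b}"
  have "b \<in> S"
  proof (rule hom_span)
    show "G.subspace S"
    proof (rule G.subspaceI; unfold S_def mem_Collect_eq)
      show "gen_product a n (- m) (cur 0) = R 0"
        using gen_product_plus[OF local_fields_zero local_fields_zero, of a n "- m"] by (simp add: R_def br_zero form_zero cur0 scaleF_simps)
      show "gen_product a n (- m) (cur (x + y)) = R (x + y)" if "gen_product a n (- m) (cur x) = R x" "gen_product a n (- m) (cur y) = R y" for x y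
        using that by (simp add: R_def cur gen_product_plus[OF local_fields_cur local_fields_cur] linear_dest(1)[OF G.br_linear_right] form_props distrib_right scaleF_simps)
      show "gen_product a n (- m) (cur (scaleG c x)) = R (scaleG c x)" if "gen_product a n (- m) (cur x) = R x" for c x
        using that by (simp add: R_def cur gen_product_scaleF[OF local_fields_cur] linear_dest(2)[OF G.br_linear_right] form_props mult.assoc scaleF_simps)
    qed
    fix t k b assume b: "hom t k b"
    have "gen_product a n (- m) (cur b) e q w = R b e q w" for e q w
    proof -
      have mm: "meq (- (- m)) m" by simp
      have "gen_product a n (- m) (cur b) e q w = M.tprod s (tau_mode a (- m)) (tau_mode b (q + m)) n (- e - int N0) w"
        unfolding gen_product_hom[OF a local_fields_cur] modes_cur by simp
      also have "\<dots> = (if n = 0 then tau_mode (br a b) q (- e - int N0) w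
          else if n = 1 then scaleW (central_term a b q) (M.idm (- e - int N0) w) else 0)"
        unfolding tprod_gen[OF a b mm n] by simp
      also have "\<dots> = R b e q w"
        by (auto simp: R_def cur_eq scaleF_def id_series_def central_term_def M.idm_def)
      finally show ?thesis .
    qed
    then show "b \<in> S" unfolding S_def by (simp add: fun_eq_iff)
  qed
  then show ?thesis by (simp add: S_def R_def)
qed

lemma gen_product_id: "hom s m a \<Longrightarrow> 0 \<le> n \<Longrightarrow> gen_product a n p id_series = 0"
proof -
  assume a: "hom s m a" and n: "0 \<le> n"
  have "M.tprod s (tau_mode a p) (modes N0 id_series q) n = (\<lambda>e w. 0)" for q
    by (rule M.tprod_zero[OF _ n]) (simp add: modes_id M.P_right_zero[OF field_tau_mode] M.P_idm_right[OF field_tau_mode])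
  then have "gen_product a n p id_series e q w = 0" for e q w unfolding gen_product_hom[OF a local_fields_id] by metis
  then show "gen_product a n p id_series = 0" by (simp add: fun_eq_iff)
qed

definition init :: "'g \<times> complex \<Rightarrow> ('r, 'w) fseries" where
  "init b = cur (fst b) + scaleF (snd b) id_series"

lemma init_local_fields: "init b \<in> local_fields"
  unfolding init_def by (rule local_fields_add[OF local_fields_cur local_fields_scale[OF local_fields_id]])

lemma init_add: "init (b + b') = init b + init b'"
  by (simp add: init_def fun_eq_iff cur_eq tau_mode_add scaleF_def W.scale_left_distrib)

lemma init_scale: "init (vac_scale scaleG c b) = scaleF c (init b)"
  by (simp add: init_def vac_scale_def fun_eq_iff cur_eq tau_mode_scale scaleF_def W.scale_right_distrib)

text \<open>The products of nonnegative index with currents (\<open>gen_product_cur\<close>) and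
  with the identity (\<open>gen_product_id\<close>) reproduce the action that defines
  \<open>(g + C)_l\<close>.\<close>

lemma init_act:
  assumes X: "X \<in> nonneg_part LL"
  shows "init (vac_act scaleG br form level X b) = loop_op X (init b)"
proof (rule L_induct_hom[of X "\<lambda>n. 0 \<le> n" "\<lambda>X. init (vac_act scaleG br form level X b) = loop_op X (init b)"])
  show "X \<in> LL" "\<And>k. k \<in> Poly_Mapping.keys (fst X) \<Longrightarrow> 0 \<le> fst k" using X by (auto simp: nonneg_part_def)
  show "init (vac_act scaleG br form level ((0, c) :: ('g, 'r) loop) b) = loop_op (0, c) (init b)" for c
    using init_scale[of "level * c" b] unfolding vac_act_cen loop_op_cen vac_scale_def mult.commute[of c level] .
  show "init (vac_act scaleG br form level (X + Z) b) = loop_op (X + Z) (init b)"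
    if "init (vac_act scaleG br form level X b) = loop_op X (init b)" "init (vac_act scaleG br form level Z b) = loop_op Z (init b)" for X Z
    unfolding vac_act_plus init_add that loop_op_add[OF init_local_fields] ..
  fix n s m a assume n: "(0::int) \<le> n" and a: "hom s m a"
  have c0: "cur 0 = 0" by (simp add: fun_eq_iff cur_eq tau_mode_zero)
  have "loop_op (loop_monom a n m) (init b) = gen_product a n (- m) (cur (fst b))"
    unfolding loop_op_monom[OF init_local_fields] unfolding init_def gen_product_plus[OF local_fields_cur local_fields_scale[OF local_fields_id]] gen_product_scaleF[OF local_fields_id] gen_product_id[OF a n]
    by (simp add: scaleF_simps)
  then show "init (vac_act scaleG br form level (loop_monom a n m) b) = loop_op (loop_monom a n m) (init b)"
    unfolding gen_product_cur[OF a n] vac_act_monom by (simp add: init_def c0 scaleF_simps)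
qed

lemma field_map_exists:
  "\<exists>YW. Vector_Spaces.linear scaleV scaleF YW \<and> (\<forall>v. YW v \<in> local_fields) \<and> (\<forall>b. YW (tens [] b) = init b) \<and>
    (\<forall>x\<in>LL. \<forall>v. YW (actV x v) = loop_op x (YW v))"
proof (rule IM.universal[OF vector_space_scaleF, where T = local_fields and act = loop_op and init = init])
  interpret VF: vector_space scaleF by (rule vector_space_scaleF)
  show "VF.subspace local_fields" by (rule VF.subspaceI) (simp_all add: local_fields_zero local_fields_add local_fields_scale)
  show "nonneg_part LL \<subseteq> LL" by (auto simp: nonneg_part_def)
qed (simp_all add: loop_op_bracket[unfolded One_nat_def] loop_op_local_fields loop_op_plus loop_op_scaleF loop_op_add loop_op_scale loop_op_bracket init_local_fields init_add init_scale init_act)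

end

section \<open>Existence of the twisted module\<close>

context tau_module
begin

theorem twisted_module_exists:
  "\<exists>YW. twisted_tva_module scaleV Y (V_vac tens) scaleW \<sigma>t0 N0 YW \<and> (\<forall>a. YW (V_gen tens a) = cur a) \<and>
    (\<forall>i v. YW (\<sigma>t i v) = subst_var scaleW i (inverse (omega (N i))) (YW v))"
proof -
  obtain YW where lin: "Vector_Spaces.linear scaleV scaleF YW" and local_fields: "\<And>v. YW v \<in> local_fields"
    and YWi: "\<And>b. YW (tens [] b) = init b" and YWa: "\<And>x v. x \<in> LL \<Longrightarrow> YW (actV x v) = loop_op x (YW v)"
    using field_map_exists by blast
  have cur0: "cur 0 = 0" by (simp add: fun_eq_iff cur_eq tau_mode_zero)
  interpret TS: twisted_setting scaleG br form \<sigma>0 N0 \<sigma> N level scaleV tens actV Y \<sigma>t0 \<sigma>t scaleW YW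
  proof unfold_locales
    show "YW (x + y) e p w = YW x e p w + YW y e p w" "YW (scaleV c x) e p w = scaleW c (YW x e p w)" for x y c e p w
      by (simp_all add: linear_dest(1,2)[OF lin] scaleF_def)
    show "YW v \<in> E_space scaleW" for v by (rule local_fields_E[OF local_fields])
    show "YW (V_vac tens) = id_series" by (simp add: V_vac_def YWi init_def cur0 scaleF_simps)
  qed
  have gen: "YW (V_gen tens a) = cur a" for a
    by (simp add: V_gen_def YWi init_def scaleF_simps)
  have good: "TS.TF.good s (V_gen tens a)" if a: "hom s m a" for s m a
    unfolding TS.TF.good_def TS.TF.hom_modes_def TS.TF.wjac_def gen modes_cur
  proof (intro conjI allI impI)
    show "tau_mode a p x = (\<lambda>w. 0)" if "x mod int N0 \<noteq> s mod int N0" for p x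
      using that by (simp add: tau_mode_hom[OF a])
    fix v p q
    show "M.jac s (tau_mode a p) (modes N0 (YW v) q) (TS.TF.wprod (V_gen tens a) p v q)"
    \<comment> \<open>If \<open>- p\<close> is in the class of \<open>m\<close>, the monomial of
      degree \<open>- p\<close> lies in L and \<open>YW\<close> sends its action to a product.
      Otherwise the current and all products vanish at this exponent.\<close>
    proof (cases "meq (- p) m")
      case True
      then have p: "hom s (- p) a"
        using a omega_eq_iff[OF Lf.M_pos] unfolding hom_iff meq_def by metis
      obtain K where K: "\<And>q. M.local_from K (tau_mode a p) (modes N0 (YW v) q)" using local_fields_local[OF local_fields] by blast
      have "TS.TF.wprod (V_gen tens a) p v q = M.tprod s (tau_mode a p) (modes N0 (YW v) q)"
        by (rule HOL.ext)
          (use True in \<open>simp add: TS.TF.wprod_def Y_gen_hom[OF a] YWa[OF L_hom[OF p]] loop_op_monom[OF local_fields] modes_gen_product_hom[OF a local_fields]\<close>)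
      then show ?thesis using M.jac_tprod_local[OF field_tau_mode field_local_fields[OF local_fields] K] by simp
    next
      case False
      then have "tau_mode a p = (\<lambda>m w. 0)" by (simp add: fun_eq_iff tau_mode_hom[OF a])
      moreover have "TS.TF.wprod (V_gen tens a) p v q = (\<lambda>n m w. 0)"
        using False by (simp add: fun_eq_iff TS.TF.wprod_def Y_gen_hom[OF a] modes_def TS.TF.YW_zero)
      ultimately show ?thesis using M.jac_zero[OF field_local_fields[OF local_fields]] by simp
    qed
  qed
  have supp: "YW (V_gen tens a) e p w = 0" if "hom s m a" "\<not> meq (- p) m" for s m a e p w
    using that unfolding gen cur_eq by (simp add: tau_mode_hom)
  show ?thesis
    using TS.module_from_generators[OF good] TS.star_from_generators[OF good supp] gen
    by (intro exI[of _ YW] conjI allI) auto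
qed

end

subsection \<open>From twisted modules to restricted modules\<close>

locale star_module = twisted_setting scaleG br form \<sigma>0 N0 \<sigma> N level scaleV tens actV Y \<sigma>t0 \<sigma>t scaleW YW
  for scaleG :: "complex \<Rightarrow> 'g::ab_group_add \<Rightarrow> 'g" and br form \<sigma>0 N0
    and \<sigma> :: "'r::finite \<Rightarrow> 'g \<Rightarrow> 'g" and N level
    and scaleV :: "complex \<Rightarrow> 'v::ab_group_add \<Rightarrow> 'v" and tens actV Y \<sigma>t0 \<sigma>t
    and scaleW :: "complex \<Rightarrow> 'w::ab_group_add \<Rightarrow> 'w" and YW +
  assumes J: "twisted_jacobi N0 scaleW \<sigma>t0 Y YW"
    and star: "\<And>i v. YW (\<sigma>t i v) = subst_var scaleW i (inverse (omega (N i))) (YW v)"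
begin

definition gen_mode :: "'g \<Rightarrow> int ^ 'r \<Rightarrow> int \<Rightarrow> 'w \<Rightarrow> 'w" where
  "gen_mode a p = modes N0 (YW (V_gen tens a)) p"

lemma gen_mode_eq: "YW (V_gen tens a) e p w = gen_mode a p (- e - int N0) w"
  by (simp add: gen_mode_def modes_def)

lemma gen_mode_add: "gen_mode (a + b) p m w = gen_mode a p m w + gen_mode b p m w"
  by (simp add: gen_mode_def V_gen_linear TF.YW_add)

lemma gen_mode_scale: "gen_mode (scaleG c a) p m w = scaleW c (gen_mode a p m w)"
  by (simp add: gen_mode_def V_gen_linear TF.YW_scale)

lemma gen_mode_zero: "gen_mode 0 p m w = 0"
  using gen_mode_scale[of 0 0 p m w] by simp

lemma lin_gen_mode: "Vector_Spaces.linear scaleW scaleW (gen_mode a p m)"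
  unfolding gen_mode_def by (rule TF.M.field_lin[OF TF.field_YW])

lemma eigenvec_gen: "hom s m a \<Longrightarrow> TF.eigenvec s (V_gen tens a)"
  by (simp add: TF.eigenvec_def eig0)

text \<open>For a torus exponent, the mode is multiplied by the eigenvalue of
  \<open>\<sigma>_i\<close> on one side of the equivariance and by the factor of the substitution on
  the other; if the two numbers differ, the mode is 0.\<close>

lemma gen_mode_unmatched:
  assumes a: "hom s m a" and n: "\<not> (x mod int N0 = s mod int N0 \<and> meq (- p) m)"
  shows "gen_mode a p x w = 0"
proof (cases "x mod int N0 = s mod int N0")
  case False
  then show ?thesis
    using TF.hom_from_jacobi[OF J YWvac eigenvec_gen[OF a]] unfolding TF.hom_modes_def gen_mode_def by (simp add: fun_eq_iff)
next
  case True
  then obtain i where i: "(- p) $ i mod int (N i) \<noteq> m $ i mod int (N i)" using n by (auto simp: meq_def)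
  let ?y = "gen_mode a p x w"
  have "omega (N i) powi (- (p $ i)) = inverse (omega (N i)) powi (p $ i)"
    by (simp add: power_int_inverse power_int_minus)
  moreover have "scaleW (omega (N i) powi (m $ i)) ?y = scaleW (inverse (omega (N i)) powi (p $ i)) ?y"
    using fun_cong[OF fun_cong[OF fun_cong[OF star[of i "V_gen tens a"]]], of "- x - int N0" p w]
    unfolding eigi[OF a] linear_dest(2)[OF YWlin] subst_var_def by (simp add: gen_mode_def modes_def)
  moreover have "omega (N i) powi (- (p $ i)) \<noteq> omega (N i) powi (m $ i)"
    unfolding omega_eq_iff[OF Lf.M_pos] using i by simp
  ultimately show ?thesis by (simp add: W.scale_cancel_right)
qed

text \<open>\<open>current_series\<close> projects \<open>a\<close> before acting; the projection
  removes only components whose mode vanishes at this degree.\<close>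

lemma gen_mode_part: "gen_mode (pT x (- p) a) p x w = gen_mode a p x w"
proof -
  define S where "S = {a. gen_mode (pT x (- p) a) p x w = gen_mode a p x w}"
  have "a \<in> S"
  proof (rule hom_span)
    show "G.subspace S"
      unfolding S_def by (rule G.subspaceI) (simp_all add: linear_dest[OF linear_pT] gen_mode_add gen_mode_scale gen_mode_zero)
    show "a \<in> S" if "hom s m a" for s m a
      using gen_mode_unmatched[OF that, of x p w] by (auto simp: S_def pT_hom[OF that] gen_mode_zero)
  qed
  then show ?thesis by (simp add: S_def)
qed

text \<open>The formula makes sense on all loops, which makes additivity immediate; compatibility
  with the bracket is shown on tau.\<close>

definition act :: "('g, 'r) loop \<Rightarrow> 'w \<Rightarrow> 'w" where
  "act X w = (\<Sum>k\<in>Poly_Mapping.keys (fst X). gen_mode (Poly_Mapping.lookup (fst X) k) (- snd k) (fst k) w) + scaleW (snd X * level) w"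

lemma act_add: "act (X + Z) w = act X w + act Z w"
  unfolding act_def fst_add snd_add
  by (subst sum_keys_add[of "\<lambda>k x. gen_mode x (- snd k) (fst k) w"]) (simp_all add: gen_mode_add distrib_right W.scale_left_distrib)

lemma act_monom: "act (loop_monom a n m) w = gen_mode a (- m) n w"
  unfolding act_def loop_monom_def fst_conv snd_conv
  by (subst sum_keys_single[of "\<lambda>k x. gen_mode x (- snd k) (fst k) w"]) (simp_all add: gen_mode_zero)

lemma act_cen: "act (0, c) w = scaleW (c * level) w"
  by (simp add: act_def)

lemma lin_act: "Vector_Spaces.linear scaleW scaleW (act X)"
  by (rule TF.M.linI)
    (simp_all add: act_def linear_dest[OF lin_gen_mode] sum.distrib W.scale_right_distrib W.scale_sum_right mult.commute)

lemma tau_induct: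
  assumes X: "X \<in> Tau"
    and "\<And>X Z. X \<in> Tau \<Longrightarrow> Z \<in> Tau \<Longrightarrow> Q X \<Longrightarrow> Q Z \<Longrightarrow> Q (X + Z)" "\<And>c. Q (0, c)"
    and mon: "\<And>n m a. hom n m a \<Longrightarrow> Q (loop_monom a n m)"
  shows "Q X"
proof (rule loop_induct[OF X, of "\<lambda>_. True" Q])
  show "Q (loop_monom a (fst k) (snd k))" if "a \<in> eigen_tau scaleG \<sigma>0 N0 \<sigma> N k" for k a
    by (rule mon) (use that in \<open>simp add: hom_def eigen_tau_eq\<close>)
qed (use assms eigen_tau_sub in auto)

lemma act_scale: "X \<in> Tau \<Longrightarrow> act (loop_scale scaleG c X) w = scaleW c (act X w)"
proof (rule tau_induct[of X "\<lambda>X. act (loop_scale scaleG c X) w = scaleW c (act X w)"])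
  show "act (loop_scale scaleG c (X + Z)) w = scaleW c (act (X + Z) w)"
    if "act (loop_scale scaleG c X) w = scaleW c (act X w)" "act (loop_scale scaleG c Z) w = scaleW c (act Z w)" for X Z
    unfolding loop_scale_add[of scaleG, OF G.scale_right_distrib] act_add W.scale_right_distrib that ..
  have "loop_scale scaleG c ((0, d) :: ('g, 'r) loop) = (0, c * d)" for d
    by (auto simp: loop_scale_def intro!: poly_mapping_eqI simp: lookup_map_zero)
  then show "act (loop_scale scaleG c (0, d)) w = scaleW c (act (0, d) w)" for d
    by (simp add: act_cen mult.assoc)
  show "act (loop_scale scaleG c (loop_monom a n m)) w = scaleW c (act (loop_monom a n m) w)" for a n m
    unfolding loop_scale_monom act_monom by (rule gen_mode_scale)
qed

text \<open>By \<open>Y_gen_gen\<close> the expansion stops after \<open>i = 1\<close>, and its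
  coefficient \<open>C(n/N0, 1) = n/N0\<close> is the factor of the central term in tau.\<close>

lemma act_bracket_monom:
  assumes a: "hom n m a" and b: "hom n' k b"
  shows "act (loop_bracket N0 br form (loop_monom a n m) (loop_monom b n' k)) w =
    act (loop_monom a n m) (act (loop_monom b n' k) w) - act (loop_monom b n' k) (act (loop_monom a n m) w)"
proof -
  let ?C = "TF.wprod (V_gen tens a) (- m) (V_gen tens b) (- k)"
  have p: "meq (- (- m)) m" by (simp add: meq_def)
  have gen: "?C j = (if j = 0 then gen_mode (br a b) (- m + - k) else
      if j = 1 then (\<lambda>x w. if - m + - k = 0 then scaleW (form a b * level) (TF.M.idm x w) else 0) else (\<lambda>x w. 0))" if "0 \<le> j" for j
    unfolding TF.wprod_def Y_gen_gen[OF a p that] gen_mode_def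
    by (auto simp: fun_eq_iff modes_def linear_dest(2,3)[OF YWlin] YWvac id_series_def TF.M.idm_def)
  have j: "TF.M.jac n (gen_mode a (- m)) (gen_mode b (- k)) ?C"
    using TF.wjac_from_jacobi[OF J eigenvec_gen[OF a]] unfolding TF.wjac_def gen_mode_def by blast
  have "gen_mode a (- m) n (gen_mode b (- k) n' w) - gen_mode b (- k) n' (gen_mode a (- m) n w) = TF.M.R ?C 0 n n' w"
    unfolding TF.M.P_0[symmetric] by (rule TF.M.jac_eq[OF j refl])
  also have "\<dots> = (\<Sum>i<2. scaleW (TF.M.gb n i) (?C (0 + int i) (n + n' - int N0 * int i) w))"
    unfolding TF.M.R_def by (rule fsum_eq) (simp add: gen)
  also have "\<dots> = ?C 0 (n + n') w + scaleW (of_int n / of_nat N0) (?C 1 (n + n' - int N0) w)"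
    by (simp add: numeral_2_eq_2 TF.M.gb_def)
  also have "\<dots> = gen_mode (br a b) (- (m + k)) (n + n') w
      + scaleW ((if n' = - n \<and> k = - m then of_int n / of_nat N0 * form a b else 0) * level) w"
  proof -
    have "n + n' = 0 \<longleftrightarrow> n' = - n" "- m + - k = 0 \<longleftrightarrow> k = - m"
      using eq_neg_iff_add_eq_0[of k m] neg_eq_iff_add_eq_0[of "m + k" 0] by (auto simp: add.commute)
    then show ?thesis using gen[of 0] gen[of 1] by (simp add: TF.M.idm_def mult.assoc)
  qed
  finally show ?thesis unfolding bracket_monom act_add act_monom act_cen by simp
qed

lemma act_bracket:
  assumes X: "X \<in> Tau" and Z: "Z \<in> Tau"
  shows "act (loop_bracket N0 br form X Z) w = act X (act Z w) - act Z (act X w)"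
proof (rule tau_induct[OF X, of "\<lambda>X. act (loop_bracket N0 br form X Z) w = act X (act Z w) - act Z (act X w)"])
  note l = linear_dest[OF lin_act]
  show "act (loop_bracket N0 br form (X + X') Z) w = act (X + X') (act Z w) - act Z (act (X + X') w)"
    if "act (loop_bracket N0 br form X Z) w = act X (act Z w) - act Z (act X w)"
      "act (loop_bracket N0 br form X' Z) w = act X' (act Z w) - act Z (act X' w)" for X X'
    using that by (simp add: bracket_add act_add l)
  show "act (loop_bracket N0 br form (0, c) Z) w = act (0, c) (act Z w) - act Z (act (0, c) w)" for c
    using act_cen[of 0 w] by (simp add: bracket_central act_cen zero_prod_def l)
  fix n m a assume a: "hom n m a"
  let ?x = "loop_monom a n m"
  show "act (loop_bracket N0 br form ?x Z) w = act ?x (act Z w) - act Z (act ?x w)"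
  proof (rule tau_induct[OF Z, of "\<lambda>Z. act (loop_bracket N0 br form ?x Z) w = act ?x (act Z w) - act Z (act ?x w)"])
    show "act (loop_bracket N0 br form ?x (Z + Z')) w = act ?x (act (Z + Z') w) - act (Z + Z') (act ?x w)"
      if "act (loop_bracket N0 br form ?x Z) w = act ?x (act Z w) - act Z (act ?x w)"
        "act (loop_bracket N0 br form ?x Z') w = act ?x (act Z' w) - act Z' (act ?x w)" for Z Z'
      using that by (simp add: bracket_add act_add l)
    show "act (loop_bracket N0 br form ?x (0, c)) w = act ?x (act (0, c) w) - act (0, c) (act ?x w)" for c
      using act_cen[of 0 w] by (simp add: bracket_central' act_cen zero_prod_def l)
  qed (rule act_bracket_monom[OF a])
qed

lemma current_act: "current_series scaleG N0 (eigen_tau scaleG \<sigma>0 N0 \<sigma> N) act a = YW (V_gen tens a)"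
  by (simp add: fun_eq_iff current_series_def eigen_part_tau act_monom gen_mode_part gen_mode_eq)

theorem restricted_module_exists: "restricted_tau_module scaleG br form \<sigma>0 N0 \<sigma> N level scaleW act"
  unfolding restricted_tau_module_def lie_module_def current_act
  using W.vector_space_axioms lin_act act_add act_scale act_bracket act_cen[of 1] YWE by auto

end

theorem theorem4p7:
  fixes scaleG :: "complex \<Rightarrow> 'g::ab_group_add \<Rightarrow> 'g"
    and br :: "'g \<Rightarrow> 'g \<Rightarrow> 'g" and form :: "'g \<Rightarrow> 'g \<Rightarrow> complex"
    and \<sigma>0 :: "'g \<Rightarrow> 'g" and N0 :: nat
    and \<sigma> :: "'r::finite \<Rightarrow> 'g \<Rightarrow> 'g" and N :: "'r \<Rightarrow> nat"
    and level :: complex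
    and scaleV :: "complex \<Rightarrow> 'v::ab_group_add \<Rightarrow> 'v"
    and tens :: "('g, 'r) loop list \<Rightarrow> 'g \<times> complex \<Rightarrow> 'v"
    and actV :: "('g, 'r) loop \<Rightarrow> 'v \<Rightarrow> 'v"
    and Y :: "'v \<Rightarrow> ('r, 'v) fseries"
    and \<sigma>t0 :: "'v \<Rightarrow> 'v" and \<sigma>t :: "'r \<Rightarrow> 'v \<Rightarrow> 'v"
    and scaleW :: "complex \<Rightarrow> 'w::ab_group_add \<Rightarrow> 'w"
  assumes data: "toroidal_lie_data scaleG br form \<sigma>0 N0 \<sigma> N"
    and V: "is_V_L scaleG br form \<sigma> N level scaleV tens actV"
    and tva: "toroidal_vertex_algebra scaleV Y (V_vac tens)"
    and Y_gen: "\<And>a. Y (V_gen tens a) = current_series scaleG 1 (eigen_L scaleG \<sigma> N) actV a"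
    and aut0: "tva_automorphism scaleV Y (V_vac tens) \<sigma>t0"
    and ext0: "\<And>a. \<sigma>t0 (V_gen tens a) = V_gen tens (\<sigma>0 a)"
    and aut: "\<And>i. tva_automorphism scaleV Y (V_vac tens) (\<sigma>t i)"
    and ext: "\<And>i a. \<sigma>t i (V_gen tens a) = V_gen tens (\<sigma> i a)"
    and W: "vector_space scaleW"
  shows "(\<forall>act. restricted_tau_module scaleG br form \<sigma>0 N0 \<sigma> N level scaleW act \<longrightarrow>
            (\<exists>YW. twisted_tva_module scaleV Y (V_vac tens) scaleW \<sigma>t0 N0 YW \<and>
                  (\<forall>a. YW (V_gen tens a) =
                       current_series scaleG N0 (eigen_tau scaleG \<sigma>0 N0 \<sigma> N) act a) \<and>
                  (\<forall>i v. YW (\<sigma>t i v) = subst_var scaleW i (inverse (omega (N i))) (YW v)) \<and>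
                  (\<forall>YW'. twisted_tva_module scaleV Y (V_vac tens) scaleW \<sigma>t0 N0 YW' \<and>
                         (\<forall>a. YW' (V_gen tens a) =
                              current_series scaleG N0 (eigen_tau scaleG \<sigma>0 N0 \<sigma> N) act a)
                         \<longrightarrow> YW' = YW))) \<and>
         (\<forall>YW. twisted_tva_module scaleV Y (V_vac tens) scaleW \<sigma>t0 N0 YW \<and>
               (\<forall>i v. YW (\<sigma>t i v) = subst_var scaleW i (inverse (omega (N i))) (YW v)) \<longrightarrow>
            (\<exists>act. restricted_tau_module scaleG br form \<sigma>0 N0 \<sigma> N level scaleW act \<and>
                   (\<forall>a. current_series scaleG N0 (eigen_tau scaleG \<sigma>0 N0 \<sigma> N) act a =
                        YW (V_gen tens a))))"
proof (intro conjI allI impI)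
  have TS: "toroidal_setting scaleG br form \<sigma>0 N0 \<sigma> N level scaleV tens actV Y"
    by (rule toroidal_setting.intro[OF data V tva Y_gen])
  interpret TA: toroidal_auto scaleG br form \<sigma>0 N0 \<sigma> N level scaleV tens actV Y \<sigma>t0 \<sigma>t
    by (rule toroidal_auto.intro[OF TS], rule toroidal_auto_axioms.intro[OF aut0 ext0 aut ext])
  {
    fix act assume res: "restricted_tau_module scaleG br form \<sigma>0 N0 \<sigma> N level scaleW act"
    interpret TM: tau_module scaleG br form \<sigma>0 N0 \<sigma> N level scaleV tens actV Y \<sigma>t0 \<sigma>t scaleW act
      by (rule tau_module.intro[OF TA.toroidal_auto_axioms W], rule tau_module_axioms.intro[OF res])
    obtain YW where YW: "twisted_tva_module scaleV Y (V_vac tens) scaleW \<sigma>t0 N0 YW"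
      "\<And>a. YW (V_gen tens a) = current_series scaleG N0 (eigen_tau scaleG \<sigma>0 N0 \<sigma> N) act a"
      "\<And>i v. YW (\<sigma>t i v) = subst_var scaleW i (inverse (omega (N i))) (YW v)"
      using TM.twisted_module_exists by auto
    have "YW' = YW" if "twisted_tva_module scaleV Y (V_vac tens) scaleW \<sigma>t0 N0 YW'"
      "\<forall>a. YW' (V_gen tens a) = current_series scaleG N0 (eigen_tau scaleG \<sigma>0 N0 \<sigma> N) act a" for YW'
      by (rule TA.module_unique[OF that(1) YW(1)]) (simp add: that(2) YW(2))
    then show "\<exists>YW. twisted_tva_module scaleV Y (V_vac tens) scaleW \<sigma>t0 N0 YW \<and>
                  (\<forall>a. YW (V_gen tens a) =
                       current_series scaleG N0 (eigen_tau scaleG \<sigma>0 N0 \<sigma> N) act a) \<and>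
                  (\<forall>i v. YW (\<sigma>t i v) = subst_var scaleW i (inverse (omega (N i))) (YW v)) \<and>
                  (\<forall>YW'. twisted_tva_module scaleV Y (V_vac tens) scaleW \<sigma>t0 N0 YW' \<and>
                         (\<forall>a. YW' (V_gen tens a) =
                              current_series scaleG N0 (eigen_tau scaleG \<sigma>0 N0 \<sigma> N) act a)
                         \<longrightarrow> YW' = YW)"
      using YW by blast
  }
  fix YW :: "'v \<Rightarrow> ('r, 'w) fseries"
  assume A: "twisted_tva_module scaleV Y (V_vac tens) scaleW \<sigma>t0 N0 YW \<and>
    (\<forall>i v. YW (\<sigma>t i v) = subst_var scaleW i (inverse (omega (N i))) (YW v))"
  then interpret TW: twisted_tva_module scaleV Y "V_vac tens" scaleW \<sigma>t0 N0 YW by blast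
  interpret SM: star_module scaleG br form \<sigma>0 N0 \<sigma> N level scaleV tens actV Y \<sigma>t0 \<sigma>t scaleW YW
    by (rule star_module.intro[OF twisted_setting.intro[OF TA.toroidal_auto_axioms W
            twisted_setting_axioms.intro[OF TW.YW_linear TW.YW_E TW.YW_vac]]],
        rule star_module_axioms.intro[OF TW.YW_jacobi]) (use A in blast)
  show "\<exists>act. restricted_tau_module scaleG br form \<sigma>0 N0 \<sigma> N level scaleW act \<and>
      (\<forall>a. current_series scaleG N0 (eigen_tau scaleG \<sigma>0 N0 \<sigma> N) act a = YW (V_gen tens a))"
    using SM.restricted_module_exists SM.current_act by blast
qed

end
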